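(* If a fully cancellative bi-parameter CZO $T$ on $\mathbb{R}^{n_1}\times\mathbb{R}^{n_2}$ satisfies the product weak compactness property, then $T$ is compact on $L^2(\mathbb{R}^{n_1}\times\mathbb{R}^{n_2})$.
   Context: CZ kernels and CZOs. For a Banach space $B$, $\delta\in(0,1]$, a $B$-valued $\delta$-CZ kernel on $\mathbb{R}^n$ is $K:\{x\ne y\}\to B$ with $\|K(x,y)\|_B\le C|x-y|^{-n}$ and $\|K(x,y)-K(x,y')\|_B,\|K(y,x)-K(y',x)\|_B\le C|y-y'|^\delta|x-y|^{-n-\delta}$ for $|y-y'|\le\frac12|x-y|$. A $\delta$-CZO on $\mathbb{R}^n$ is a continuous $T:\mathcal{D}(\mathbb{R}^n)\to\mathcal{D}(\mathbb{R}^n)'$ bounded on $L^2$ with $\langle Tf,g\rangle=\iint K(x,y)f(y)g(x)dxdy$ for a scalar $\delta$-CZ kernel when $f,g$ have disjoint supports; $\delta\mathrm{CZO}(\mathbb{R}^n)$ is the Banach space of these. A bi-parameter CZO is a continuous $T:\mathcal{D}(\mathbb{R}^{n_1})\otimes\mathcal{D}(\mathbb{R}^{n_2})\to(\mathcal{D}(\mathbb{R}^{n_1})\otimes\mathcal{D}(\mathbb{R}^{n_2}))'$ such that, for some $\delta\in(0,1]$ and $\{i,j\}=\{1,2\}$, there is a $\delta\mathrm{CZO}(\mathbb{R}^{n_j})$-valued $\delta$-CZ kernel $K_i$ on $\mathbb{R}^{n_i}$ with $\langle T(f_1\otimes f_2),g_1\otimes g_2\rangle=\iint f_i(y)g_i(x)\langle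 K_i(x,y)f_j,g_j\rangle dxdy$ when $f_i,g_i$ have disjoint supports, and such that $T$ and its partial transpose $T_t$ (defined by $\langle T(f_1\otimes f_2),g_1\otimes g_2\rangle=\langle T_t(g_1\otimes f_2),f_1\otimes g_2\rangle$) are bounded on $L^2(\mathbb{R}^{n_1}\times\mathbb{R}^{n_2})$. Fully cancellative: for all mean-zero $f_i,g_i\in\mathcal{D}(\mathbb{R}^{n_i})$, $\langle T(1\otimes1),g_1\otimes g_2\rangle=\langle T(1\otimes f_2),g_1\otimes1\rangle=\langle T(f_1\otimes1),1\otimes g_2\rangle=\langle T(f_1\otimes f_2),1\otimes1\rangle=0$ and $\langle T(1\otimes f_2),g_1\otimes g_2\rangle=\langle T(f_1\otimes1),g_1\otimes g_2\rangle=\langle T(f_1\otimes f_2),1\otimes g_2\rangle=\langle T(f_1\otimes f_2),g_1\otimes1\rangle=0$. Wavelets: $\mathbb{R}^{n+1}_+$ is the $ax+b$ group with hyperbolic metric from $ds^2=(dx^2+dt^2)/t^2$ and balls $D(z,R)$; $f_{(x,t)}=t^{-n/2}f((\cdot-x)/t)$; fixed real $\psi\in\mathcal{D}(\mathbb{R}^n)$ with support in $B(0,1)$, $\int\psi=0$, $\int_0^\infty|\widehat\psi(t\xi)|^2dt/t=1$ ($\xi\ne0$); $\psi_z=\psi_{z_1}\otimes\psi_{z_2}$ for $z=(z_1,z_2)\in\mathbb{R}^{n_1+1}_+\times\mathbb{R}^{n_2+1}_+$; $z\to\infty$ means $z$ leaves $D((0,1),R)\times D((0,1),R)$ for every $R$.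 Product weak compactness property: for every $R>0$, $\lim_{z\to\infty}\sup_{w\in D(z_1,R)\times D(z_2,R)}|\langle T\psi_z,\psi_w\rangle|=0$. *)

theory Defs
  imports "HOL-Analysis.Analysis"
begin

coinductive smooth_fun :: "('a::euclidean_space \<Rightarrow> complex) \<Rightarrow> bool" where
  "(\<forall>x. f differentiable (at x)) \<Longrightarrow>
   (\<forall>v. smooth_fun (\<lambda>x. frechet_derivative f (at x) v)) \<Longrightarrow> smooth_fun f"

definition tsupp :: "('a::euclidean_space \<Rightarrow> complex) \<Rightarrow> 'a set" where
  "tsupp f = closure {x. f x \<noteq> 0}"

definition test_fun :: "('a::euclidean_space \<Rightarrow> complex) \<Rightarrow> bool" where
  "test_fun f \<longleftrightarrow> smooth_fun f \<and> compact (tsupp f)"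

definition mean_zero_test :: "('a::euclidean_space \<Rightarrow> complex) \<Rightarrow> bool" where
  "mean_zero_test f \<longleftrightarrow> test_fun f \<and> integral\<^sup>L lborel f = 0"

text \<open>Cut-off functions used to give meaning to pairings involving the constant function 1.\<close>
definition cutoff :: "('a::euclidean_space \<Rightarrow> complex) \<Rightarrow> bool" where
  "cutoff chi \<longleftrightarrow> test_fun chi \<and> (\<forall>x. norm x \<le> 1 \<longrightarrow> chi x = 1)"

definition dil :: "('a::euclidean_space \<Rightarrow> complex) \<Rightarrow> nat \<Rightarrow> 'a \<Rightarrow> complex" where
  "dil chi k = (\<lambda>x. chi (x /\<^sub>R real k))"

definition tensor :: "('a \<Rightarrow> complex) \<Rightarrow> ('b \<Rightarrow> complex) \<Rightarrow> ('a \<times> 'b \<Rightarrow> complex)" where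
  "tensor f g = (\<lambda>(x, y). f x * g y)"

definition sq_int :: "('a::euclidean_space \<Rightarrow> complex) \<Rightarrow> bool" where
  "sq_int f \<longleftrightarrow> f \<in> borel_measurable lborel \<and> integrable lborel (\<lambda>x. (cmod (f x))\<^sup>2)"

definition l2norm :: "('a::euclidean_space \<Rightarrow> complex) \<Rightarrow> real" where
  "l2norm f = sqrt (integral\<^sup>L lborel (\<lambda>x. (cmod (f x))\<^sup>2))"

definition pair :: "('a::euclidean_space \<Rightarrow> complex) \<Rightarrow> ('a \<Rightarrow> complex) \<Rightarrow> complex" where
  "pair u v = integral\<^sup>L lborel (\<lambda>x. u x * v x)"

definition bounded_L2_op :: "(('a::euclidean_space \<Rightarrow> complex) \<Rightarrow> ('a \<Rightarrow> complex)) \<Rightarrow> bool" where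
  "bounded_L2_op T \<longleftrightarrow>
     (\<forall>f g a b. sq_int f \<longrightarrow> sq_int g \<longrightarrow>
        T (\<lambda>x. a * f x + b * g x) = (\<lambda>x. a * T f x + b * T g x)) \<and>
     (\<forall>f. sq_int f \<longrightarrow> sq_int (T f)) \<and>
     (\<exists>C. \<forall>f. sq_int f \<longrightarrow> l2norm (T f) \<le> C * l2norm f)"

text \<open>Compactness on L^2: the image of every bounded sequence has an L^2-Cauchy
  (equivalently, by completeness, L^2-convergent) subsequence.\<close>
definition compact_L2_op :: "(('a::euclidean_space \<Rightarrow> complex) \<Rightarrow> ('a \<Rightarrow> complex)) \<Rightarrow> bool" where
  "compact_L2_op T \<longleftrightarrow>
     (\<forall>fs :: nat \<Rightarrow> 'a \<Rightarrow> complex. (\<forall>k. sq_int (fs k) \<and> l2norm (fs k) \<le> 1) \<longrightarrow>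
        (\<exists>r. strict_mono r \<and>
           (\<forall>e>0. \<exists>N::nat. \<forall>m\<ge>N. \<forall>n\<ge>N. l2norm (\<lambda>x. T (fs (r m)) x - T (fs (r n)) x) < e)))"

definition cz_kernel :: "real \<Rightarrow> real \<Rightarrow> ('a::euclidean_space \<Rightarrow> 'a \<Rightarrow> complex) \<Rightarrow> bool" where
  "cz_kernel \<delta> C K \<longleftrightarrow>
     (\<forall>x y. x \<noteq> y \<longrightarrow> cmod (K x y) \<le> C / dist x y ^ DIM('a)) \<and>
     (\<forall>x y y'. x \<noteq> y \<longrightarrow> dist y y' \<le> dist x y / 2 \<longrightarrow>
        cmod (K x y - K x y') \<le> C * dist y y' powr \<delta> / dist x y powr (real DIM('a) + \<delta>) \<and>
        cmod (K y x - K y' x) \<le> C * dist y y' powr \<delta> / dist x y powr (real DIM('a) + \<delta>))"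

text \<open>A (scalar) operator D(R^m) -> D(R^m)' is represented by its bilinear form
  S f g = <S f, g>.\<close>
definition bilinear_on_test :: "(('a::euclidean_space \<Rightarrow> complex) \<Rightarrow> ('a \<Rightarrow> complex) \<Rightarrow> complex) \<Rightarrow> bool" where
  "bilinear_on_test S \<longleftrightarrow>
     (\<forall>f1 f2 g a b. test_fun f1 \<longrightarrow> test_fun f2 \<longrightarrow> test_fun g \<longrightarrow>
        S (\<lambda>x. a * f1 x + b * f2 x) g = a * S f1 g + b * S f2 g) \<and>
     (\<forall>f g1 g2 a b. test_fun f \<longrightarrow> test_fun g1 \<longrightarrow> test_fun g2 \<longrightarrow>
        S f (\<lambda>x. a * g1 x + b * g2 x) = a * S f g1 + b * S f g2)"

definition L2_bound_form :: "real \<Rightarrow> (('a::euclidean_space \<Rightarrow> complex) \<Rightarrow> ('a \<Rightarrow> complex) \<Rightarrow> complex) \<Rightarrow> bool" where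
  "L2_bound_form A S \<longleftrightarrow> (\<forall>f g. test_fun f \<longrightarrow> test_fun g \<longrightarrow> cmod (S f g) \<le> A * l2norm f * l2norm g)"

definition kernel_rep :: "('a::euclidean_space \<Rightarrow> 'a \<Rightarrow> complex) \<Rightarrow> (('a \<Rightarrow> complex) \<Rightarrow> ('a \<Rightarrow> complex) \<Rightarrow> complex) \<Rightarrow> bool" where
  "kernel_rep K S \<longleftrightarrow>
     (\<forall>f g. test_fun f \<longrightarrow> test_fun g \<longrightarrow> tsupp f \<inter> tsupp g = {} \<longrightarrow>
        S f g = integral\<^sup>L lborel (\<lambda>(x, y). K x y * f y * g x))"

definition is_czo :: "real \<Rightarrow> (('a::euclidean_space \<Rightarrow> complex) \<Rightarrow> ('a \<Rightarrow> complex) \<Rightarrow> complex) \<Rightarrow> bool" where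
  "is_czo \<delta> S \<longleftrightarrow> bilinear_on_test S \<and> (\<exists>A. L2_bound_form A S) \<and>
     (\<exists>C K. cz_kernel \<delta> C K \<and> kernel_rep K S)"

definition czo_norm :: "real \<Rightarrow> (('a::euclidean_space \<Rightarrow> complex) \<Rightarrow> ('a \<Rightarrow> complex) \<Rightarrow> complex) \<Rightarrow> real" where
  "czo_norm \<delta> S = Inf {A. A \<ge> 0 \<and> L2_bound_form A S} + Inf {C. \<exists>K. cz_kernel \<delta> C K \<and> kernel_rep K S}"

definition czo_valued_kernel :: "real \<Rightarrow> real \<Rightarrow>
    ('a::euclidean_space \<Rightarrow> 'a \<Rightarrow> (('b::euclidean_space \<Rightarrow> complex) \<Rightarrow> ('b \<Rightarrow> complex) \<Rightarrow> complex)) \<Rightarrow> bool" where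
  "czo_valued_kernel \<delta> C K \<longleftrightarrow>
     (\<forall>x y. x \<noteq> y \<longrightarrow> is_czo \<delta> (K x y) \<and> czo_norm \<delta> (K x y) \<le> C / dist x y ^ DIM('a)) \<and>
     (\<forall>x y y'. x \<noteq> y \<longrightarrow> dist y y' \<le> dist x y / 2 \<longrightarrow>
        czo_norm \<delta> (\<lambda>f g. K x y f g - K x y' f g) \<le> C * dist y y' powr \<delta> / dist x y powr (real DIM('a) + \<delta>) \<and>
        czo_norm \<delta> (\<lambda>f g. K y x f g - K y' x f g) \<le> C * dist y y' powr \<delta> / dist x y powr (real DIM('a) + \<delta>))"

text \<open>T is given by its (unique) bounded extension to L^2(R^n1 x R^n2); the pairing
  <T(f1 (x) f2), g1 (x) g2> is pair (T (tensor f1 f2)) (tensor g1 g2).\<close>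
definition biparam_czo :: "((('a::euclidean_space \<times> 'b::euclidean_space) \<Rightarrow> complex) \<Rightarrow> ('a \<times> 'b \<Rightarrow> complex)) \<Rightarrow> bool" where
  "biparam_czo T \<longleftrightarrow>
     bounded_L2_op T \<and>
     (\<exists>Tt. bounded_L2_op Tt \<and>
        (\<forall>f1 f2 g1 g2. test_fun f1 \<longrightarrow> test_fun f2 \<longrightarrow> test_fun g1 \<longrightarrow> test_fun g2 \<longrightarrow>
           pair (T (tensor f1 f2)) (tensor g1 g2) = pair (Tt (tensor g1 f2)) (tensor f1 g2))) \<and>
     (\<exists>\<delta> C1 C2 K1 K2. 0 < \<delta> \<and> \<delta> \<le> 1 \<and>
        czo_valued_kernel \<delta> C1 (K1 :: 'a \<Rightarrow> 'a \<Rightarrow> (('b \<Rightarrow> complex) \<Rightarrow> ('b \<Rightarrow> complex) \<Rightarrow> complex)) \<and>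
        czo_valued_kernel \<delta> C2 (K2 :: 'b \<Rightarrow> 'b \<Rightarrow> (('a \<Rightarrow> complex) \<Rightarrow> ('a \<Rightarrow> complex) \<Rightarrow> complex)) \<and>
        (\<forall>f1 f2 g1 g2. test_fun f1 \<longrightarrow> test_fun f2 \<longrightarrow> test_fun g1 \<longrightarrow> test_fun g2 \<longrightarrow>
           tsupp f1 \<inter> tsupp g1 = {} \<longrightarrow>
           pair (T (tensor f1 f2)) (tensor g1 g2) =
             integral\<^sup>L lborel (\<lambda>(x, y). f1 y * g1 x * K1 x y f2 g2)) \<and>
        (\<forall>f1 f2 g1 g2. test_fun f1 \<longrightarrow> test_fun f2 \<longrightarrow> test_fun g1 \<longrightarrow> test_fun g2 \<longrightarrow>
           tsupp f2 \<inter> tsupp g2 = {} \<longrightarrow>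
           pair (T (tensor f1 f2)) (tensor g1 g2) =
             integral\<^sup>L lborel (\<lambda>(x, y). f2 y * g2 x * K2 x y f1 g1)))"

text \<open>Full cancellation; a slot "1" is realised as the limit of dilated cut-offs.\<close>
definition fully_cancellative :: "((('a::euclidean_space \<times> 'b::euclidean_space) \<Rightarrow> complex) \<Rightarrow> ('a \<times> 'b \<Rightarrow> complex)) \<Rightarrow> bool" where
  "fully_cancellative T \<longleftrightarrow>
    (\<forall>(chi1::'a \<Rightarrow> complex) (chi2::'b \<Rightarrow> complex) f1 f2 g1 g2.
       cutoff chi1 \<longrightarrow> cutoff chi2 \<longrightarrow> mean_zero_test f1 \<longrightarrow> mean_zero_test f2 \<longrightarrow>
       mean_zero_test g1 \<longrightarrow> mean_zero_test g2 \<longrightarrow>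
       ((\<lambda>k. pair (T (tensor (dil chi1 k) (dil chi2 k))) (tensor g1 g2)) \<longlonglongrightarrow> 0) \<and>
       ((\<lambda>k. pair (T (tensor (dil chi1 k) f2)) (tensor g1 (dil chi2 k))) \<longlonglongrightarrow> 0) \<and>
       ((\<lambda>k. pair (T (tensor f1 (dil chi2 k))) (tensor (dil chi1 k) g2)) \<longlonglongrightarrow> 0) \<and>
       ((\<lambda>k. pair (T (tensor f1 f2)) (tensor (dil chi1 k) (dil chi2 k))) \<longlonglongrightarrow> 0) \<and>
       ((\<lambda>k. pair (T (tensor (dil chi1 k) f2)) (tensor g1 g2)) \<longlonglongrightarrow> 0) \<and>
       ((\<lambda>k. pair (T (tensor f1 (dil chi2 k))) (tensor g1 g2)) \<longlonglongrightarrow> 0) \<and>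
       ((\<lambda>k. pair (T (tensor f1 f2)) (tensor (dil chi1 k) g2)) \<longlonglongrightarrow> 0) \<and>
       ((\<lambda>k. pair (T (tensor f1 f2)) (tensor g1 (dil chi2 k))) \<longlonglongrightarrow> 0))"

text \<open>Points (x,t) of R^{n+1}_+ are pairs with t > 0; hyperbolic distance for
  ds^2 = (dx^2 + dt^2)/t^2.\<close>
definition hdist :: "('a::euclidean_space \<times> real) \<Rightarrow> ('a \<times> real) \<Rightarrow> real" where
  "hdist z w = arcosh (1 + ((dist (fst z) (fst w))\<^sup>2 + (snd z - snd w)\<^sup>2) / (2 * snd z * snd w))"

definition hball :: "('a::euclidean_space \<times> real) \<Rightarrow> real \<Rightarrow> ('a \<times> real) set" where
  "hball z R = {w. snd w > 0 \<and> hdist z w < R}"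

definition fourier :: "('a::euclidean_space \<Rightarrow> real) \<Rightarrow> 'a \<Rightarrow> complex" where
  "fourier \<psi> \<xi> = integral\<^sup>L lborel (\<lambda>x. complex_of_real (\<psi> x) * cis (- 2 * pi * (x \<bullet> \<xi>)))"

definition wavelet :: "('a::euclidean_space \<Rightarrow> real) \<Rightarrow> bool" where
  "wavelet \<psi> \<longleftrightarrow> test_fun (\<lambda>x. complex_of_real (\<psi> x)) \<and>
     closure {x. \<psi> x \<noteq> 0} \<subseteq> ball 0 1 \<and>
     integral\<^sup>L lborel \<psi> = 0 \<and>
     (\<forall>\<xi>. \<xi> \<noteq> 0 \<longrightarrow> ((\<lambda>t. (cmod (fourier \<psi> (t *\<^sub>R \<xi>)))\<^sup>2 / t) has_integral 1) {0<..})"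

definition wav :: "('a::euclidean_space \<Rightarrow> real) \<Rightarrow> ('a \<times> real) \<Rightarrow> 'a \<Rightarrow> complex" where
  "wav \<psi> z = (\<lambda>y. complex_of_real (snd z powr (- real DIM('a) / 2) * \<psi> ((y - fst z) /\<^sub>R snd z)))"

definition product_weak_compact ::
  "('a::euclidean_space \<Rightarrow> real) \<Rightarrow> ('b::euclidean_space \<Rightarrow> real) \<Rightarrow>
   ((('a \<times> 'b) \<Rightarrow> complex) \<Rightarrow> ('a \<times> 'b \<Rightarrow> complex)) \<Rightarrow> bool" where
  "product_weak_compact \<psi>1 \<psi>2 T \<longleftrightarrow>
     (\<forall>R>0. \<forall>e>0. \<exists>R0. \<forall>z1 z2. snd z1 > 0 \<longrightarrow> snd z2 > 0 \<longrightarrow>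
        (z1 \<notin> hball (0, 1) R0 \<or> z2 \<notin> hball (0, 1) R0) \<longrightarrow>
        (\<forall>w1\<in>hball z1 R. \<forall>w2\<in>hball z2 R.
           cmod (pair (T (tensor (wav \<psi>1 z1) (wav \<psi>2 z2))) (tensor (wav \<psi>1 w1) (wav \<psi>2 w2))) \<le> e))"

end

theory Submission
  imports Defs "HOL-Probability.Characteristic_Functions" "HOL-Complex_Analysis.Great_Picard"
begin

text \<open>
  Let $W f(z) = \langle f, \psi_z\rangle$ be the product wavelet transform; by Calderon's formula it is an isometry
  from $L^2$ into $L^2(\mu)$, where $\mu$ is the product of the invariant measures $dx\,dt/t^{n+1}$.
  In each parameter, subtracting the right multiple of a large cut-off from the wider of two wavelets leaves a pair
  that splits into a local part, estimated by the $L^2$ bound, and a part with disjoint supports, estimated by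
  the regularity of the kernel; full cancellation says exactly that the subtraction is free in the limit.
  Hence $|\langle T\psi_z, \psi_w\rangle|$ is dominated by a product of two almost-diagonal kernels, and the product weak
  compactness property makes the constant arbitrarily small once $z$ leaves a compact set $E$. Schur's test then gives
  $\|T g\|^2 \le C \int_E |W g|^2 d\mu + \eta \|g\|^2$. For a bounded sequence, $W f_k$ converges
  everywhere along a subsequence, so $\int_E |W (f_j - f_k)|^2 d\mu$ tends to $0$ and the images are Cauchy.
\<close>

section \<open>Smooth functions and cut-offs\<close>

text \<open>The kernel in one variable is accessible only through \<open>czo_norm\<close> of an
  operator in the other variable, an infimum over all bounds and all representing kernels. A pair of
  functions is therefore estimated against all bilinear forms and all kernels at once. Inserting a
  good pair in one variable turns the operator-valued kernel into a scalar kernel whose constant has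
  gained a factor, and to this kernel the good pair in the other variable is applied. Kernel
  regularity \<delta> yields decay \<epsilon> = \<delta>/2: the corrected wide wavelet may grow like
  |u - y|^(\<delta>/2), and the other half of \<delta> makes the tail integral converge. The
  exponent is halved once more to gain smallness. At hyperbolic distance at least R half of the
  decay is traded for cosh(R)^(-\<epsilon>/4); at smaller distance the almost-diagonal kernels are
  bounded below, so a sufficiently small bound from weak compactness can be absorbed. The expansion
  of T g into wavelets is used only through the scalar functionals g -> <T g, \<psi>_w>, so that no
  vector-valued integral occurs.\<close>

primrec ck :: "nat \<Rightarrow> ('a::euclidean_space \<Rightarrow> complex) \<Rightarrow> bool" where
  "ck 0 f = True"
| "ck (Suc n) f = ((\<forall>x. f differentiable (at x)) \<and> (\<forall>v. ck n (\<lambda>x. frechet_derivative f (at x) v)))"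

text \<open>\<open>ck\<close> unfolds the coinductive predicate finitely often, so that closure
  properties can be proved by induction on the order; a direct coinduction would first have to be
  closed up under sums of products of derivatives. Conversely, \<open>\<forall>n. ck n f\<close> is
  inherited by directional derivatives and is thus a post-fixed point.\<close>

lemma smooth_fun_iff_ck: "smooth_fun f \<longleftrightarrow> (\<forall>n. ck n f)"
proof
  show "\<forall>n. ck n f" if "smooth_fun f"
  proof
    show "ck n f" for n using that
    proof (induction n arbitrary: f)
      case (Suc n)
      show ?case using Suc.prems by (cases rule: smooth_fun.cases) (auto intro: Suc.IH)
    qed simp
  qed
  show "smooth_fun f" if "\<forall>n. ck n f"
    using that
  proof (coinduction arbitrary: f)
    case smooth_fun
    have d: "f differentiable (at x)" for x using spec[OF smooth_fun, of 1] by simp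
    have "ck n (\<lambda>x. frechet_derivative f (at x) v)" for n v
      using spec[OF smooth_fun, of "Suc n"] by simp
    then show ?case using d by blast
  qed
qed

lemma ck_Suc_imp: "ck (Suc n) f \<Longrightarrow> ck n f"
  by (induction n arbitrary: f) auto

lemma frechet_derivative_eqI: "(f has_derivative f') (at x) \<Longrightarrow> frechet_derivative f (at x) = f'"
  using frechet_derivative_at by metis

lemma ck_add: "ck n f \<Longrightarrow> ck n g \<Longrightarrow> ck n (\<lambda>x. f x + g x)"
proof (induction n arbitrary: f g)
  case (Suc n)
  have "frechet_derivative (\<lambda>x. f x + g x) (at x) v = frechet_derivative f (at x) v + frechet_derivative g (at x) v" for x v
    using Suc.prems by (subst frechet_derivative_eqI[OF has_derivative_add]) (auto simp: frechet_derivative_works[symmetric])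
  then show ?case using Suc by auto
qed simp

lemma ck_mult: "ck n f \<Longrightarrow> ck n g \<Longrightarrow> ck n (\<lambda>x. f x * g x)"
proof (induction n arbitrary: f g)
  case (Suc n)
  have "frechet_derivative (\<lambda>x. f x * g x) (at x) v = f x * frechet_derivative g (at x) v + frechet_derivative f (at x) v * g x" for x v
    using Suc.prems by (subst frechet_derivative_eqI[OF has_derivative_mult]) (auto simp: frechet_derivative_works[symmetric])
  \<comment> \<open>The product rule contains the factors themselves next to their derivatives, so
    the hypotheses are also used one order lower.\<close>
  then show ?case using Suc ck_Suc_imp[OF Suc.prems(1)] ck_Suc_imp[OF Suc.prems(2)] by (auto intro!: ck_add)
qed simp

lemma ck_const: "ck n (\<lambda>x. c)"
proof (induction n arbitrary: c)
  case (Suc n) then show ?case by (simp add: frechet_derivative_eqI[OF has_derivative_const])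
qed simp

lemma ck_affine: "ck n f \<Longrightarrow> ck n (\<lambda>x. f ((x - a) /\<^sub>R t))"
proof (induction n arbitrary: f)
  case (Suc n)
  have *: "((\<lambda>x. f ((x - a) /\<^sub>R t)) has_derivative (\<lambda>v. frechet_derivative f (at ((x - a) /\<^sub>R t)) (v /\<^sub>R t))) (at x)" for x
  proof -
    have 1: "((\<lambda>x. (x - a) /\<^sub>R t) has_derivative (\<lambda>v. v /\<^sub>R t)) (at x)"
      by (auto intro!: derivative_eq_intros)
    have 2: "(f has_derivative frechet_derivative f (at ((x - a) /\<^sub>R t))) (at ((x - a) /\<^sub>R t))"
      using Suc.prems by (auto simp: frechet_derivative_works[symmetric])
    show ?thesis using has_derivative_compose[OF 1 2] .
  qed
  have "frechet_derivative (\<lambda>x. f ((x - a) /\<^sub>R t)) (at x) v = frechet_derivative f (at ((x - a) /\<^sub>R t)) (v /\<^sub>R t)" for x v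
    using frechet_derivative_eqI[OF *] by simp
  moreover have "(\<lambda>x. f ((x - a) /\<^sub>R t)) differentiable (at x)" for x using * by (auto simp: differentiable_def)
  \<comment> \<open>The chain rule rescales the direction: the induction hypothesis is applied to
    the derivative of f in direction v / t.\<close>
  moreover have "ck n (\<lambda>x. frechet_derivative f (at ((x - a) /\<^sub>R t)) (v /\<^sub>R t))" for v
    using Suc.IH[of "\<lambda>x. frechet_derivative f (at x) (v /\<^sub>R t)"] Suc.prems by simp
  ultimately show ?case by simp
qed simp

lemma smooth_fun_differentiable: "smooth_fun f \<Longrightarrow> f differentiable (at x)"
  by (cases rule: smooth_fun.cases) auto

lemma smooth_fun_deriv: "smooth_fun f \<Longrightarrow> smooth_fun (\<lambda>x. frechet_derivative f (at x) v)"
  by (cases rule: smooth_fun.cases) auto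

lemma smooth_fun_continuous: "smooth_fun f \<Longrightarrow> continuous_on S f"
  by (meson smooth_fun_differentiable continuous_at_imp_continuous_on differentiable_imp_continuous_within)

section \<open>Supports and test functions\<close>

lemma compact_tsuppI: "bounded {x. f x \<noteq> 0} \<Longrightarrow> compact (tsupp f)"
  unfolding tsupp_def by (simp add: compact_closure)

lemma tsupp_outside: "x \<notin> tsupp f \<Longrightarrow> f x = 0"
  unfolding tsupp_def using closure_subset[of "{x. f x \<noteq> 0}"] by auto

lemma tsupp_subset: "closed S \<Longrightarrow> (\<And>x. x \<notin> S \<Longrightarrow> f x = 0) \<Longrightarrow> tsupp f \<subseteq> S"
  unfolding tsupp_def by (intro closure_minimal) auto

lemma test_funI: "smooth_fun f \<Longrightarrow> bounded {x. f x \<noteq> 0} \<Longrightarrow> test_fun f"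
  by (simp add: test_fun_def compact_tsuppI)

lemma test_fun_bounded_support: "test_fun f \<Longrightarrow> bounded {x. f x \<noteq> 0}"
  unfolding test_fun_def tsupp_def by (metis bounded_subset closure_subset compact_imp_bounded)

lemma test_fun_lincomb: 
  assumes "test_fun f" "test_fun g" shows "test_fun (\<lambda>x. a * f x + b * g x)"
proof (rule test_funI)
  show "smooth_fun (\<lambda>x. a * f x + b * g x)" using assms
    by (auto simp: test_fun_def smooth_fun_iff_ck intro!: ck_add ck_mult ck_const)
  show "bounded {x. a * f x + b * g x \<noteq> 0}"
    by (rule bounded_subset[OF bounded_Un[THEN iffD2, OF conjI, OF assms[THEN test_fun_bounded_support]]]) auto
qed

lemma test_fun_zero: "test_fun (\<lambda>x. 0)"
  by (rule test_funI) (auto simp: smooth_fun_iff_ck intro!: ck_const)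

lemma test_fun_cmult: "test_fun f \<Longrightarrow> test_fun (\<lambda>x. a * f x)"
  using test_fun_lincomb[of f f a 0] by simp

lemma test_fun_diff_cmult: "test_fun f \<Longrightarrow> test_fun g \<Longrightarrow> test_fun (\<lambda>x. f x - a * g x)"
  using test_fun_lincomb[of f g 1 "-a"] by simp

lemma test_fun_diff: "test_fun f \<Longrightarrow> test_fun g \<Longrightarrow> test_fun (\<lambda>x. f x - g x)"
  using test_fun_lincomb[of f g 1 "-1"] by simp

lemma test_fun_mult:
  assumes "test_fun f" "test_fun g" shows "test_fun (\<lambda>x. f x * g x)"
proof (rule test_funI)
  show "smooth_fun (\<lambda>x. f x * g x)" using assms
    by (auto simp: test_fun_def smooth_fun_iff_ck intro!: ck_mult)
  show "bounded {x. f x * g x \<noteq> 0}"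
    by (rule bounded_subset[OF test_fun_bounded_support[OF assms(1)]]) auto
qed

lemma test_fun_affine:
  assumes "test_fun f" "t \<noteq> 0" shows "test_fun (\<lambda>x. f ((x - a) /\<^sub>R t))"
proof (rule test_funI)
  show "smooth_fun (\<lambda>x. f ((x - a) /\<^sub>R t))" using assms
    by (auto simp: test_fun_def smooth_fun_iff_ck intro!: ck_affine)
  have "{x. f ((x - a) /\<^sub>R t) \<noteq> 0} \<subseteq> (\<lambda>u. a + t *\<^sub>R u) ` {x. f x \<noteq> 0}"
  proof
    fix x assume "x \<in> {x. f ((x - a) /\<^sub>R t) \<noteq> 0}"
    moreover have "x = a + t *\<^sub>R ((x - a) /\<^sub>R t)" using assms by simp
    ultimately show "x \<in> (\<lambda>u. a + t *\<^sub>R u) ` {x. f x \<noteq> 0}" by blast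
  qed
  moreover have "bounded ((\<lambda>u. a + t *\<^sub>R u) ` {x. f x \<noteq> 0})"
    using test_fun_bounded_support[OF assms(1)] by (metis bounded_scaling bounded_translation image_image)
  ultimately show "bounded {x. f ((x - a) /\<^sub>R t) \<noteq> 0}" by (rule bounded_subset[rotated])
qed

lemma test_fun_dil: "test_fun f \<Longrightarrow> k > 0 \<Longrightarrow> test_fun (dil f k)"
  using test_fun_affine[of f "real k" 0] by (simp add: dil_def)

lemma test_fun_continuous: "test_fun f \<Longrightarrow> continuous_on S f"
  by (simp add: smooth_fun_continuous test_fun_def)

lemma test_fun_measurable [measurable_dest]: "test_fun f \<Longrightarrow> f \<in> borel_measurable borel"
  by (simp add: borel_measurable_continuous_onI test_fun_continuous)

lemma test_fun_bounded:
  assumes "test_fun f" obtains B where "B > 0" "\<And>x. cmod (f x) \<le> B"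
proof -
  have "compact (f ` tsupp f)" using assms test_fun_continuous 
    by (intro compact_continuous_image) (auto simp: test_fun_def)
  then obtain B where B: "B > 0" "\<And>y. y \<in> f ` tsupp f \<Longrightarrow> cmod y \<le> B"
    using compact_imp_bounded bounded_pos by metis
  have "cmod (f x) \<le> B" for x
    using B tsupp_outside[of x f] by (cases "x \<in> tsupp f") auto
  then show thesis using B that by blast
qed

lemma test_fun_deriv:
  assumes "test_fun f" shows "test_fun (\<lambda>x. frechet_derivative f (at x) v)"
proof -
  have "frechet_derivative f (at x) v = 0" if "x \<notin> tsupp f" for x
  proof -
    \<comment> \<open>The complement of the support is open and f vanishes on it, so near x the
      function agrees with 0.\<close>
    have "(f has_derivative (\<lambda>_. 0)) (at x)"
      by (rule has_derivative_transform_within_open[of "\<lambda>_. 0" _ _ _ "- tsupp f"])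
         (use that tsupp_outside in \<open>auto simp: tsupp_def\<close>)
    then show ?thesis using frechet_derivative_eqI by fastforce
  qed
  then have "{x. frechet_derivative f (at x) v \<noteq> 0} \<subseteq> tsupp f" by blast
  then show ?thesis using assms 
    by (intro test_funI) (auto simp: test_fun_def smooth_fun_deriv intro: bounded_subset compact_imp_bounded)
qed

text \<open>Derivatives in the basis directions are again test functions, hence bounded. The sum of
  these bounds controls the operator norm of the derivative at every point, and the mean value
  inequality applies on the whole space.\<close>

lemma test_fun_lipschitz:
  fixes f :: "'a::euclidean_space \<Rightarrow> complex"
  assumes "test_fun f" obtains L where "L > 0" "\<And>x y. cmod (f x - f y) \<le> L * dist x y"
proof -
  have "\<forall>b::'a. \<exists>B>0. \<forall>x. cmod (frechet_derivative f (at x) b) \<le> B"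
    using test_fun_bounded[OF test_fun_deriv[OF assms]] by metis
  then obtain B where B: "\<And>b::'a. B b > 0" "\<And>b x. cmod (frechet_derivative f (at x) b) \<le> B b" by metis
  define L where "L = (\<Sum>b\<in>Basis. B b)"
  have L: "L > 0" unfolding L_def using B(1) by (intro sum_pos) auto
  have df: "(f has_derivative frechet_derivative f (at x)) (at x)" for x
    using assms smooth_fun_differentiable by (auto simp: frechet_derivative_works[symmetric] test_fun_def)
  have on: "onorm (frechet_derivative f (at x)) \<le> L" for x
  proof (rule onorm_le)
    fix v :: 'a
    interpret bounded_linear "frechet_derivative f (at x)" using df has_derivative_bounded_linear by blast
    have "frechet_derivative f (at x) v = (\<Sum>b\<in>Basis. (v \<bullet> b) *\<^sub>R frechet_derivative f (at x) b)"
      by (subst euclidean_representation[of v, symmetric]) (simp add: sum scale)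
    also have "cmod \<dots> \<le> (\<Sum>b\<in>Basis. \<bar>v \<bullet> b\<bar> * cmod (frechet_derivative f (at x) b))"
      by (rule sum_norm_le) simp
    also have "\<dots> \<le> (\<Sum>b\<in>Basis. norm v * B b)" 
      using B by (intro sum_mono mult_mono) (auto simp: Basis_le_norm)
    also have "\<dots> = L * norm v" by (simp add: L_def sum_distrib_left mult.commute)
    finally show "cmod (frechet_derivative f (at x) v) \<le> L * norm v" .
  qed
  have "cmod (f x - f y) \<le> L * dist x y" for x y
    using differentiable_bound[of UNIV f "\<lambda>x. frechet_derivative f (at x)" L x y] df on
    by (auto simp: dist_norm)
  then show thesis using L that by blast
qed

lemma test_fun_integrable: 
  fixes f :: "'a::euclidean_space \<Rightarrow> complex"
  assumes "test_fun f" shows "integrable lborel f"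
proof -
  have "integrable lborel (\<lambda>x. indicator (tsupp f) x *\<^sub>R f x)"
    using assms by (intro borel_integrable_compact test_fun_continuous) (auto simp: test_fun_def)
  moreover have "(\<lambda>x. indicator (tsupp f) x *\<^sub>R f x) = f" by (auto simp: indicator_def tsupp_outside)
  ultimately show ?thesis by simp
qed

lemma test_fun_sq_int: 
  fixes f :: "'a::euclidean_space \<Rightarrow> complex"
  assumes "test_fun f" shows "sq_int f"
proof -
  have "integrable lborel (\<lambda>x. indicator (tsupp f) x *\<^sub>R (cmod (f x))\<^sup>2)"
    using assms by (intro borel_integrable_compact) (auto simp: test_fun_def intro!: continuous_intros smooth_fun_continuous)
  moreover have "(\<lambda>x. indicator (tsupp f) x *\<^sub>R (cmod (f x))\<^sup>2) = (\<lambda>x. (cmod (f x))\<^sup>2)" by (rule ext) (auto simp: indicator_def tsupp_outside)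
  ultimately show ?thesis using assms by (auto simp: sq_int_def test_fun_measurable)
qed

section \<open>Affine changes of variables for Lebesgue measure\<close>

lemma nn_integral_lborel_affine:
  fixes f :: "'a::euclidean_space \<Rightarrow> ennreal"
  assumes [measurable]: "f \<in> borel_measurable borel" and c: "c \<noteq> 0"
  shows "(\<integral>\<^sup>+x. f x \<partial>lborel) = ennreal (\<bar>c\<bar> ^ DIM('a)) * (\<integral>\<^sup>+x. f (t + c *\<^sub>R x) \<partial>lborel)"
  by (subst lborel_affine[OF c, of t]) (simp add: nn_integral_density nn_integral_distr nn_integral_cmult ennreal_power)

lemma lborel_integrable_affine:
  fixes f :: "'a::euclidean_space \<Rightarrow> 'b::{banach, second_countable_topology}"
  assumes f: "integrable lborel f" and c: "c \<noteq> 0"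
  shows "integrable lborel (\<lambda>x. f (t + c *\<^sub>R x))"
proof -
  have [measurable]: "f \<in> borel_measurable borel" using f by auto
  have "(\<integral>\<^sup>+x. norm (f x) \<partial>lborel) < \<infinity>" using f by (auto simp: integrable_iff_bounded)
  then have "ennreal (\<bar>c\<bar> ^ DIM('a)) * (\<integral>\<^sup>+x. norm (f (t + c *\<^sub>R x)) \<partial>lborel) < \<infinity>"
    by (subst (asm) nn_integral_lborel_affine[OF _ c, of _ t]) auto
  then show ?thesis using c by (auto simp: integrable_iff_bounded ennreal_mult_less_top)
qed

lemma lborel_integral_affine:
  fixes f :: "'a::euclidean_space \<Rightarrow> 'b::{banach, second_countable_topology}"
  assumes [measurable]: "f \<in> borel_measurable borel" and c: "c \<noteq> 0"
  shows "integral\<^sup>L lborel f = \<bar>c\<bar> ^ DIM('a) *\<^sub>R (\<integral>x. f (t + c *\<^sub>R x) \<partial>lborel)"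
  by (subst lborel_affine[OF c, of t]) (simp add: integral_density integral_distr)

text \<open>A cube instead of a ball, because Leibniz' rule is available for integrals over boxes.\<close>

definition cube_conv :: "('a::euclidean_space \<Rightarrow> complex) \<Rightarrow> 'a \<Rightarrow> complex" where
  "cube_conv \<phi> x = integral (cbox (- (2 *\<^sub>R One)) (2 *\<^sub>R One)) (\<lambda>y. \<phi> (x - y))"

text \<open>The derivative falls on the smooth factor, so it is again \<open>cube_conv\<close> of a
  test function; this closes the induction in \<open>ck_cube_conv\<close>. \<open>Blinfun\<close>
  appears because Leibniz' rule asks for a continuous family of bounded linear maps.\<close>

lemma has_derivative_cube_conv:
  fixes \<phi> :: "'a::euclidean_space \<Rightarrow> complex"
  assumes \<phi>: "test_fun \<phi>"
  shows "(cube_conv \<phi> has_derivative (\<lambda>v. cube_conv (\<lambda>u. frechet_derivative \<phi> (at u) v) x)) (at x)"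
proof -
  define Q :: "'a set" where "Q = cbox (- (2 *\<^sub>R One)) (2 *\<^sub>R One)"
  define fx where "fx = (\<lambda>x t. Blinfun (frechet_derivative \<phi> (at (x - t))))"
  have df: "(\<phi> has_derivative frechet_derivative \<phi> (at u)) (at u)" for u
    using \<phi> smooth_fun_differentiable by (auto simp: frechet_derivative_works[symmetric] test_fun_def)
  have app: "blinfun_apply (fx x t) = frechet_derivative \<phi> (at (x - t))" for x t
    unfolding fx_def using df has_derivative_bounded_linear by (blast intro: bounded_linear_Blinfun_apply)
  have c1: "continuous_on UNIV (\<lambda>u. frechet_derivative \<phi> (at u) v)" for v
    using test_fun_deriv[OF \<phi>] test_fun_continuous by blast
  \<comment> \<open>In finite dimension a family of linear maps is continuous as soon as its values
    on each vector are.\<close>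
  have cont: "continuous_on (UNIV \<times> Q) (\<lambda>(x, t). fx x t)"
    by (intro continuous_on_blinfun_componentwise)
       (auto simp: app split_beta intro!: continuous_intros continuous_on_compose2[OF c1])
  have cont2: "continuous_on Q (fx x)" 
    by (intro continuous_on_blinfun_componentwise) (auto simp: app intro!: continuous_intros continuous_on_compose2[OF c1])
  have "((\<lambda>x. integral Q (\<lambda>y. \<phi> (x - y))) has_derivative blinfun_apply (integral Q (fx x))) (at x within UNIV)"
    unfolding Q_def
  proof (rule leibniz_rule)
    show "((\<lambda>x. \<phi> (x - t)) has_derivative blinfun_apply (fx x t)) (at x within UNIV)" for x t
    proof -
      have "((\<lambda>x. x - t) has_derivative (\<lambda>x. x)) (at x)" by (auto intro!: derivative_eq_intros)
      from has_derivative_compose[OF this df] show ?thesis unfolding app by simp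
    qed
    show "(\<lambda>y. \<phi> (x - y)) integrable_on cbox (- (2 *\<^sub>R One)) (2 *\<^sub>R One)" for x
      by (intro integrable_continuous continuous_intros continuous_on_compose2[OF test_fun_continuous[OF \<phi>]]) auto
  qed (use cont Q_def in auto)
  moreover have "blinfun_apply (integral Q (fx x)) v = integral Q (\<lambda>y. frechet_derivative \<phi> (at (x - y)) v)" for v
  proof -
    have "integral Q ((\<lambda>b. blinfun_apply b v) \<circ> fx x) = blinfun_apply (integral Q (fx x)) v"
      by (intro integral_linear blinfun.bounded_linear_left) (use cont2 Q_def integrable_continuous in auto)
    then show ?thesis by (simp add: o_def app)
  qed
  then have "blinfun_apply (integral Q (fx x)) = (\<lambda>v. integral Q (\<lambda>y. frechet_derivative \<phi> (at (x - y)) v))" by blast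
  ultimately show ?thesis unfolding cube_conv_def[abs_def] Q_def by simp
qed

lemma ck_cube_conv: "test_fun \<phi> \<Longrightarrow> ck n (cube_conv \<phi>)"
proof (induction n arbitrary: \<phi>)
  case (Suc n)
  have "cube_conv \<phi> differentiable (at x)" for x
    using has_derivative_cube_conv[OF Suc.prems] unfolding differentiable_def by blast
  moreover have "frechet_derivative (cube_conv \<phi>) (at x) v = cube_conv (\<lambda>u. frechet_derivative \<phi> (at u) v) x" for x v
    using frechet_derivative_eqI[OF has_derivative_cube_conv[OF Suc.prems]] by simp
  ultimately show ?case using Suc.IH[OF test_fun_deriv[OF Suc.prems]] by simp
qed simp

text \<open>Convolution of a bump of mass 1 with the indicator of the cube [-2,2]^n. If |x| <= 1 and
  \<phi>(x - y) is not 0, then |y| <= 2 and y lies in the cube, so the integral sees the full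
  mass.\<close>

lemma cutoff_cube_conv:
  fixes \<phi> :: "'a::euclidean_space \<Rightarrow> complex"
  assumes \<phi>: "test_fun \<phi>" and supp: "\<And>x. norm x \<ge> 1 \<Longrightarrow> \<phi> x = 0" and int: "integral\<^sup>L lborel \<phi> = 1"
  shows "cutoff (cube_conv \<phi>)"
proof -
  define Q :: "'a set" where "Q = cbox (- (2 *\<^sub>R One)) (2 *\<^sub>R One)"
  obtain R where R: "\<And>y. y \<in> Q \<Longrightarrow> norm y \<le> R" using bounded_cbox bounded_iff Q_def by metis
  have "cube_conv \<phi> x = 0" if "norm x > R + 1" for x
  proof -
    have "\<phi> (x - y) = 0" if "y \<in> Q" for y
    proof (rule supp)
      show "1 \<le> norm (x - y)" using R[OF that] \<open>norm x > R + 1\<close> norm_triangle_ineq2[of x y] by linarith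
    qed
    then have "cube_conv \<phi> x = integral Q (\<lambda>y. 0)" unfolding cube_conv_def Q_def by (intro integral_cong) auto
    then show ?thesis by simp
  qed
  then have "{x. cube_conv \<phi> x \<noteq> 0} \<subseteq> cball 0 (R + 1)" by force
  then have t: "test_fun (cube_conv \<phi>)"
    by (intro test_funI) (auto simp: smooth_fun_iff_ck ck_cube_conv \<phi> intro: bounded_subset)
  have "cube_conv \<phi> x = 1" if x: "norm x \<le> 1" for x
  proof -
    have yQ: "y \<in> Q" if "\<phi> (x - y) \<noteq> 0" for y
    proof -
      have "norm (x - y) < 1" using that supp by force
      then have "norm y \<le> 2" using x norm_triangle_ineq2[of y x] by (simp add: norm_minus_commute)
      then have "-2 \<le> y \<bullet> b \<and> y \<bullet> b \<le> 2" if "b \<in> Basis" for b using Basis_le_norm[OF that, of y] by linarith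
      then show ?thesis unfolding Q_def mem_box by auto
    qed
    have "integrable lborel (\<lambda>y. \<phi> (x + (-1) *\<^sub>R y))"
      by (rule lborel_integrable_affine) (auto simp: test_fun_integrable \<phi>)
    then have i: "integrable lborel (\<lambda>y. \<phi> (x - y))" by simp
    have "((\<lambda>y. \<phi> (x - y)) has_integral integral\<^sup>L lborel (\<lambda>y. \<phi> (x - y))) UNIV"
      by (rule has_integral_integral_lborel[OF i])
    moreover have "integral\<^sup>L lborel (\<lambda>y. \<phi> (x - y)) = 1"
      using lborel_integral_affine[of \<phi> "-1" x] test_fun_measurable[OF \<phi>] int by simp
    ultimately have "((\<lambda>y. \<phi> (x - y)) has_integral 1) UNIV" by simp
    then have "((\<lambda>y. \<phi> (x - y)) has_integral 1) Q"
    proof -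
      have e: "(\<lambda>y. \<phi> (x - y)) = (\<lambda>y. if y \<in> Q then \<phi> (x - y) else 0)" using yQ by (intro ext) auto
      show ?thesis using has_integral_restrict_UNIV[of Q "\<lambda>y. \<phi> (x - y)" 1] \<open>((\<lambda>y. \<phi> (x - y)) has_integral 1) UNIV\<close>
        unfolding e[symmetric] by blast
    qed
    then show ?thesis unfolding cube_conv_def Q_def by (rule integral_unique)
  qed
  then show ?thesis using t by (simp add: cutoff_def)
qed

section \<open>A cut-off obtained from the wavelet\<close>

lemma wavelet_test_fun: "wavelet \<psi> \<Longrightarrow> test_fun (\<lambda>x. complex_of_real (\<psi> x))"
  by (simp add: wavelet_def)

lemma wavelet_measurable: assumes "wavelet \<psi>" shows "\<psi> \<in> borel_measurable borel"
proof -
  have "(\<lambda>x. Re (complex_of_real (\<psi> x))) \<in> borel_measurable borel"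
    using test_fun_measurable[OF wavelet_test_fun[OF assms]] by measurable
  then show ?thesis by simp
qed

lemma wavelet_supp: "wavelet \<psi> \<Longrightarrow> norm x \<ge> 1 \<Longrightarrow> \<psi> x = 0"
  unfolding wavelet_def using closure_subset[of "{x. \<psi> x \<noteq> 0}"] by fastforce

text \<open>The bump is supplied by the wavelet itself: \<psi>^2 is a nonnegative test function. Its
  mass is not 0, for otherwise \<psi> would vanish almost everywhere and its Fourier transform
  everywhere, against the normalisation of the integral over dt/t.\<close>

lemma ex_cutoff:
  assumes w: "wavelet (\<psi> :: 'a::euclidean_space \<Rightarrow> real)" shows "\<exists>chi :: 'a \<Rightarrow> complex. cutoff chi"
proof -
  define g where "g = (\<lambda>x. complex_of_real (\<psi> x) * complex_of_real (\<psi> x))"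
  have g: "test_fun g" unfolding g_def by (intro test_fun_mult wavelet_test_fun w)
  have nz: "integral\<^sup>L lborel g \<noteq> 0"
  proof
    assume "integral\<^sup>L lborel g = 0"
    have ge: "g = (\<lambda>x. complex_of_real ((\<psi> x)\<^sup>2))" by (simp add: g_def power2_eq_square)
    have i: "integrable lborel (\<lambda>x. (\<psi> x)\<^sup>2)" using integrable_Re[OF test_fun_integrable[OF g]] unfolding ge by simp
    have "integral\<^sup>L lborel (\<lambda>x. (\<psi> x)\<^sup>2) = 0" using \<open>integral\<^sup>L lborel g = 0\<close> unfolding ge
      by (metis integral_complex_of_real of_real_eq_0_iff)
    then have "AE x in lborel. (\<psi> x)\<^sup>2 = 0" using integral_nonneg_eq_0_iff_AE[OF i] by simp
    then have ae: "AE x in lborel. \<psi> x = 0" by simp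
    have "fourier \<psi> \<xi> = 0" for \<xi>
    proof -
      have "fourier \<psi> \<xi> = integral\<^sup>L lborel (\<lambda>x::'a. 0::complex)"
        unfolding fourier_def
      proof (rule integral_cong_AE)
        show "(\<lambda>x. complex_of_real (\<psi> x) * cis (- 2 * pi * (x \<bullet> \<xi>))) \<in> borel_measurable lborel"
          using test_fun_measurable[OF wavelet_test_fun[OF w]]
          by (auto simp: cis_conv_exp intro!: borel_measurable_times borel_measurable_continuous_onI continuous_intros)
      qed (use ae in auto)
      then show ?thesis by simp
    qed
    moreover obtain \<xi> :: 'a where "\<xi> \<noteq> 0" using nonzero_Basis nonempty_Basis by blast
    ultimately have "((\<lambda>t::real. 0) has_integral (1::real)) {0<..}"
      using w unfolding wavelet_def by auto
    then show False using has_integral_unique[OF _ has_integral_0] by fastforce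
  qed
  define \<phi> where "\<phi> = (\<lambda>x. (1 / integral\<^sup>L lborel g) * g x)"
  have "cutoff (cube_conv \<phi>)"
  proof (rule cutoff_cube_conv)
    show "test_fun \<phi>" unfolding \<phi>_def by (intro test_fun_cmult g)
    show "\<phi> x = 0" if "norm x \<ge> 1" for x using wavelet_supp[OF w that] by (simp add: \<phi>_def g_def)
    show "integral\<^sup>L lborel \<phi> = 1" unfolding \<phi>_def using nz by simp
  qed
  then show ?thesis by blast
qed

lemma cutoff_bounded_support:
  assumes "cutoff chi" obtains \<rho> where "\<rho> \<ge> 1" "\<And>x. norm x > \<rho> \<Longrightarrow> chi x = 0"
proof -
  obtain B where "B>0" and "\<And>x. chi x \<noteq> 0 \<Longrightarrow> norm x \<le> B"
    using test_fun_bounded_support[of chi] assms unfolding cutoff_def bounded_pos by auto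
  then show thesis using that[of "max 1 B"] by (metis less_max_iff_disj linorder_not_le max.cobounded1 max.strict_boundedE)
qed

section \<open>Square-integrable functions\<close>

text \<open>Stated for an arbitrary measure, because it serves Euclidean space as well as wavelet
  coefficients on the product of two half-spaces.\<close>

lemma integrable_mult_L2:
  fixes f g :: "'a \<Rightarrow> complex"
  assumes [measurable]: "f \<in> borel_measurable M" "g \<in> borel_measurable M"
    and f: "integrable M (\<lambda>x. (cmod (f x))\<^sup>2)" and g: "integrable M (\<lambda>x. (cmod (g x))\<^sup>2)"
  shows "integrable M (\<lambda>x. f x * g x)"
proof (rule Bochner_Integration.integrable_bound)
  show "integrable M (\<lambda>x. (cmod (f x))\<^sup>2 + (cmod (g x))\<^sup>2)" using f g by simp
  have "cmod (f x) * cmod (g x) \<le> (cmod (f x))\<^sup>2 + (cmod (g x))\<^sup>2" for x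
  proof -
    have "0 \<le> cmod (f x) * cmod (g x)" by simp
    then show ?thesis using sum_squares_bound[of "cmod (f x)" "cmod (g x)"] by linarith
  qed
  then show "AE x in M. norm (f x * g x) \<le> norm ((cmod (f x))\<^sup>2 + (cmod (g x))\<^sup>2)"
    by (auto simp: norm_mult)
qed auto

lemma Cauchy_Schwarz_integral:
  fixes f g :: "'a \<Rightarrow> complex"
  assumes m[measurable]: "f \<in> borel_measurable M" "g \<in> borel_measurable M"
    and f: "integrable M (\<lambda>x. (cmod (f x))\<^sup>2)" and g: "integrable M (\<lambda>x. (cmod (g x))\<^sup>2)"
  shows "(\<integral>x. cmod (f x * g x) \<partial>M) \<le> sqrt (\<integral>x. (cmod (f x))\<^sup>2 \<partial>M) * sqrt (\<integral>x. (cmod (g x))\<^sup>2 \<partial>M)"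
proof -
  have i: "integrable M (\<lambda>x. cmod (f x * g x))" using integrable_mult_L2[OF m f g] by (rule integrable_norm)
  have "(\<integral>\<^sup>+x. ennreal (cmod (f x)) * ennreal (cmod (g x)) \<partial>M)\<^sup>2 \<le> (\<integral>\<^sup>+x. (ennreal (cmod (f x)))\<^sup>2 \<partial>M) * (\<integral>\<^sup>+x. (ennreal (cmod (g x)))\<^sup>2 \<partial>M)"
    by (rule Cauchy_Schwarz_nn_integral) auto
  moreover have "(\<integral>\<^sup>+x. ennreal (cmod (f x)) * ennreal (cmod (g x)) \<partial>M) = ennreal (\<integral>x. cmod (f x * g x) \<partial>M)"
    by (subst nn_integral_eq_integral[symmetric, OF i]) (auto simp: norm_mult ennreal_mult)
  moreover have "(\<integral>\<^sup>+x. (ennreal (cmod (f x)))\<^sup>2 \<partial>M) = ennreal (\<integral>x. (cmod (f x))\<^sup>2 \<partial>M)"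
    by (subst nn_integral_eq_integral[symmetric, OF f]) (auto simp: ennreal_power)
  moreover have "(\<integral>\<^sup>+x. (ennreal (cmod (g x)))\<^sup>2 \<partial>M) = ennreal (\<integral>x. (cmod (g x))\<^sup>2 \<partial>M)"
    by (subst nn_integral_eq_integral[symmetric, OF g]) (auto simp: ennreal_power)
  ultimately have "ennreal ((\<integral>x. cmod (f x * g x) \<partial>M)\<^sup>2) \<le> ennreal ((\<integral>x. (cmod (f x))\<^sup>2 \<partial>M) * (\<integral>x. (cmod (g x))\<^sup>2 \<partial>M))"
    by (simp add: ennreal_power ennreal_mult)
  then have "(\<integral>x. cmod (f x * g x) \<partial>M)\<^sup>2 \<le> (\<integral>x. (cmod (f x))\<^sup>2 \<partial>M) * (\<integral>x. (cmod (g x))\<^sup>2 \<partial>M)"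
    by (subst (asm) ennreal_le_iff) (auto intro!: mult_nonneg_nonneg)
  then show ?thesis unfolding real_sqrt_mult[symmetric] by (rule real_le_rsqrt)
qed

lemma sq_int_mult_integrable: "sq_int f \<Longrightarrow> sq_int g \<Longrightarrow> integrable lborel (\<lambda>x. f x * g x)"
  unfolding sq_int_def by (intro integrable_mult_L2) auto

lemma integral_cmod_mult_le:
  assumes "sq_int f" "sq_int g" shows "(\<integral>x. cmod (f x * g x) \<partial>lborel) \<le> l2norm f * l2norm g"
  using assms Cauchy_Schwarz_integral[of f lborel g] unfolding sq_int_def l2norm_def by auto

lemma cmod_pair_le:
  assumes "sq_int f" "sq_int g" shows "cmod (pair f g) \<le> l2norm f * l2norm g"
  unfolding pair_def using integral_norm_bound[of lborel "\<lambda>x. f x * g x"] integral_cmod_mult_le[OF assms] by linarith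

lemma l2norm_nonneg: "l2norm f \<ge> 0" by (simp add: l2norm_def)

lemma l2norm_sq: "(l2norm f)\<^sup>2 = (\<integral>x. (cmod (f x))\<^sup>2 \<partial>lborel)" by (simp add: l2norm_def)

lemma nn_integral_l2norm: "sq_int f \<Longrightarrow> (\<integral>\<^sup>+x. ennreal ((cmod (f x))\<^sup>2) \<partial>lborel) = ennreal ((l2norm f)\<^sup>2)"
  unfolding l2norm_sq sq_int_def by (subst nn_integral_eq_integral) auto

lemma sq_int_nnI:
  assumes [measurable]: "f \<in> borel_measurable borel" and "(\<integral>\<^sup>+x. ennreal ((cmod (f x))\<^sup>2) \<partial>lborel) < \<infinity>"
  shows "sq_int f"
  unfolding sq_int_def using assms by (auto simp: integrable_iff_bounded)

lemma cmod_lincomb_sq: "(cmod (a * x + b * y))\<^sup>2 \<le> 2 * (cmod a)\<^sup>2 * (cmod x)\<^sup>2 + 2 * (cmod b)\<^sup>2 * (cmod y)\<^sup>2"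
proof -
  have "(cmod (a * x + b * y))\<^sup>2 \<le> (cmod a * cmod x + cmod b * cmod y)\<^sup>2"
    using norm_triangle_ineq[of "a * x" "b * y"] by (intro power_mono) (auto simp: norm_mult)
  also have "\<dots> \<le> 2 * (cmod a * cmod x)\<^sup>2 + 2 * (cmod b * cmod y)\<^sup>2"
    using sum_squares_bound[of "cmod a * cmod x" "cmod b * cmod y"] by (simp add: power2_sum)
  finally show ?thesis by (simp add: power_mult_distrib)
qed

lemma sq_int_lincomb:
  assumes "sq_int f" "sq_int g" shows "sq_int (\<lambda>x. a * f x + b * g x)"
proof -
  have [measurable]: "f \<in> borel_measurable borel" "g \<in> borel_measurable borel" 
    and i: "integrable lborel (\<lambda>x. (cmod (f x))\<^sup>2)" "integrable lborel (\<lambda>x. (cmod (g x))\<^sup>2)"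
    using assms by (auto simp: sq_int_def)
  have "integrable lborel (\<lambda>x. (cmod (a * f x + b * g x))\<^sup>2)"
    by (rule Bochner_Integration.integrable_bound[of _ "\<lambda>x. 2 * (cmod a)\<^sup>2 * (cmod (f x))\<^sup>2 + 2 * (cmod b)\<^sup>2 * (cmod (g x))\<^sup>2"])
       (use i cmod_lincomb_sq in auto)
  then show ?thesis by (simp add: sq_int_def)
qed

lemma sq_int_cmult: "sq_int f \<Longrightarrow> sq_int (\<lambda>x. a * f x)"
  using sq_int_lincomb[of f f a 0] by simp

lemma sq_int_diff: "sq_int f \<Longrightarrow> sq_int g \<Longrightarrow> sq_int (\<lambda>x. f x - g x)"
  using sq_int_lincomb[of f g 1 "-1"] by simp

lemma l2norm_cmult: "l2norm (\<lambda>x. a * f x) = cmod a * l2norm f"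
  by (simp add: l2norm_def norm_mult power_mult_distrib real_sqrt_mult)

lemma pair_lincomb_left:
  assumes "sq_int f" "sq_int g" "sq_int h"
  shows "pair (\<lambda>x. a * f x + b * g x) h = a * pair f h + b * pair g h"
proof -
  have "pair (\<lambda>x. a * f x + b * g x) h = (\<integral>x. a * (f x * h x) + b * (g x * h x) \<partial>lborel)"
    unfolding pair_def by (simp add: algebra_simps)
  also have "\<dots> = a * pair f h + b * pair g h"
    unfolding pair_def using assms sq_int_mult_integrable by (subst Bochner_Integration.integral_add) (auto intro!: integrable_mult_right)
  finally show ?thesis .
qed

lemma pair_commute: "pair f g = pair g f" by (simp add: pair_def mult.commute)

lemma pair_lincomb_right:
  assumes "sq_int f" "sq_int g" "sq_int h"
  shows "pair h (\<lambda>x. a * f x + b * g x) = a * pair h f + b * pair h g"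
  using pair_lincomb_left[OF assms] by (simp add: pair_commute)

lemma tensor_l2:
  fixes f :: "'a::euclidean_space \<Rightarrow> complex" and g :: "'b::euclidean_space \<Rightarrow> complex"
  assumes f: "sq_int f" and g: "sq_int g"
  shows "sq_int (tensor f g)" "l2norm (tensor f g) = l2norm f * l2norm g"
proof -
  have [measurable]: "f \<in> borel_measurable borel" "g \<in> borel_measurable borel" using f g by (auto simp: sq_int_def)
  have m: "tensor f g \<in> borel_measurable borel"
    unfolding tensor_def borel_prod[symmetric] by measurable
  have "(\<integral>\<^sup>+x. ennreal ((cmod (tensor f g x))\<^sup>2) \<partial>lborel) = (\<integral>\<^sup>+x. \<integral>\<^sup>+y. ennreal ((cmod (tensor f g (x, y)))\<^sup>2) \<partial>lborel \<partial>lborel)"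
    unfolding lborel_prod[symmetric]
    by (subst lborel.nn_integral_fst[symmetric]) (use m in \<open>auto simp: borel_prod[symmetric]\<close>)
  also have "\<dots> = (\<integral>\<^sup>+x. ennreal ((cmod (f x))\<^sup>2) * (\<integral>\<^sup>+y. ennreal ((cmod (g y))\<^sup>2) \<partial>lborel) \<partial>lborel)"
    by (auto simp: tensor_def norm_mult power_mult_distrib ennreal_mult nn_integral_cmult)
  also have "\<dots> = ennreal ((l2norm f)\<^sup>2) * ennreal ((l2norm g)\<^sup>2)"
    by (subst nn_integral_multc) (auto simp: nn_integral_l2norm f g)
  finally have e: "(\<integral>\<^sup>+x. ennreal ((cmod (tensor f g x))\<^sup>2) \<partial>lborel) = ennreal ((l2norm f * l2norm g)\<^sup>2)"
    by (simp add: ennreal_mult power_mult_distrib)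
  show s: "sq_int (tensor f g)" by (rule sq_int_nnI) (use m e in auto)
  have "(l2norm (tensor f g))\<^sup>2 = (l2norm f * l2norm g)\<^sup>2"
    using nn_integral_l2norm[OF s] e by simp
  then show "l2norm (tensor f g) = l2norm f * l2norm g"
    using l2norm_nonneg[of f] l2norm_nonneg[of g] l2norm_nonneg[of "tensor f g"] by (simp add: power2_eq_iff_nonneg)
qed

lemma tensor_lincomb_left: "tensor (\<lambda>x. a * f x + b * g x) h = (\<lambda>p. a * tensor f h p + b * tensor g h p)"
  by (auto simp: tensor_def algebra_simps)

lemma tensor_lincomb_right: "tensor h (\<lambda>x. a * f x + b * g x) = (\<lambda>p. a * tensor h f p + b * tensor h g p)"
  by (auto simp: tensor_def algebra_simps)

lemma bounded_L2_op_lincomb: "bounded_L2_op T \<Longrightarrow> sq_int f \<Longrightarrow> sq_int g \<Longrightarrow> T (\<lambda>x. a * f x + b * g x) = (\<lambda>x. a * T f x + b * T g x)"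
  unfolding bounded_L2_op_def by blast

lemma bounded_L2_op_sq_int: "bounded_L2_op T \<Longrightarrow> sq_int f \<Longrightarrow> sq_int (T f)"
  unfolding bounded_L2_op_def by blast

lemma bounded_L2_op_bound:
  assumes "bounded_L2_op T" obtains C where "C > 0" "\<And>f. sq_int f \<Longrightarrow> l2norm (T f) \<le> C * l2norm f"
proof -
  obtain C where C: "\<And>f. sq_int f \<Longrightarrow> l2norm (T f) \<le> C * l2norm f" using assms unfolding bounded_L2_op_def by blast
  have "l2norm (T f) \<le> (\<bar>C\<bar> + 1) * l2norm f" if "sq_int f" for f
    using C[OF that] mult_right_mono[OF _ l2norm_nonneg, of C "\<bar>C\<bar> + 1" f] by linarith
  then show thesis using that[of "\<bar>C\<bar> + 1"] by simp
qed

section \<open>Calderon-Zygmund kernels and operators\<close>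

text \<open>At two points of distance 1 the size condition bounds a modulus by N itself.\<close>

lemma cz_kernel_nonneg:
  fixes k :: "'a::euclidean_space \<Rightarrow> 'a \<Rightarrow> complex"
  assumes "cz_kernel \<delta> N k" shows "N \<ge> 0"
proof -
  obtain b :: 'a where b: "b \<in> Basis" using nonempty_Basis by blast
  then have "cmod (k b 0) \<le> N / dist b 0 ^ DIM('a)" using assms nonzero_Basis unfolding cz_kernel_def by blast
  then have "cmod (k b 0) \<le> N" using b by simp
  then show ?thesis using norm_ge_zero[of "k b 0"] by linarith
qed

lemma cz_kernelD:
  fixes k :: "'a::euclidean_space \<Rightarrow> 'a \<Rightarrow> complex"
  assumes "cz_kernel \<delta> N k" "x \<noteq> y"
  shows "cmod (k x y) \<le> N / dist x y ^ DIM('a)"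
    "dist y y' \<le> dist x y / 2 \<Longrightarrow> cmod (k x y - k x y') \<le> N * dist y y' powr \<delta> / dist x y powr (real DIM('a) + \<delta>)"
    "dist y y' \<le> dist x y / 2 \<Longrightarrow> cmod (k y x - k y' x) \<le> N * dist y y' powr \<delta> / dist x y powr (real DIM('a) + \<delta>)"
  using assms unfolding cz_kernel_def by blast+

text \<open>Both regularity conditions are applied, one variable at a time, through the intermediate
  point (x, y0); this gives a Hoelder bound near every off-diagonal point. Continuity provides the
  measurability of the integrand in the kernel representation, which is not part of
  \<open>cz_kernel\<close>.\<close>

lemma cz_kernel_continuous:
  fixes k :: "'a::euclidean_space \<Rightarrow> 'a \<Rightarrow> complex"
  assumes k: "cz_kernel \<delta> N k" and \<delta>: "\<delta> > 0"
  shows "continuous_on {p. fst p \<noteq> snd p} (\<lambda>p. k (fst p) (snd p))"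
proof (rule continuous_at_imp_continuous_on, safe)
  fix x0 y0 :: 'a assume ne: "fst (x0, y0) \<noteq> snd (x0, y0)"
  define r where "r = dist x0 y0"
  have r: "r > 0" using ne by (simp add: r_def)
  have N: "N \<ge> 0" by (rule cz_kernel_nonneg[OF k])
  define c where "c = N / (r / 2) powr (real DIM('a) + \<delta>)"
  have c: "c \<ge> 0" unfolding c_def using N by simp
  define bd where "bd = (\<lambda>p. c * dist (snd p) y0 powr \<delta> + c * dist (fst p) x0 powr \<delta>)"
  have est: "cmod (k x y - k x0 y0) \<le> bd (x, y)" if "dist x x0 < r / 4" "dist y y0 < r / 4" for x y
  proof -
    \<comment> \<open>Displacements below r/4 keep x at distance at least r/2 from y0, so that they
      stay within half of the distance, as the regularity conditions require.\<close>
    have d: "dist x y0 \<ge> r / 2" 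
    proof -
      have "r \<le> dist x x0 + dist x y0" unfolding r_def using dist_triangle[of x0 y0 x] by (simp add: dist_commute)
      then show ?thesis using that r by linarith
    qed
    have xy: "x \<noteq> y0" using d r by auto
    have "cmod (k x y0 - k x y) \<le> N * dist y0 y powr \<delta> / dist x y0 powr (real DIM('a) + \<delta>)"
      using d that r by (intro cz_kernelD(2)[OF k xy]) (auto simp: dist_commute)
    also have "\<dots> \<le> N * dist y0 y powr \<delta> / (r / 2) powr (real DIM('a) + \<delta>)"
      using d r \<delta> N by (intro divide_left_mono powr_mono2 mult_pos_pos) auto
    finally have 1: "cmod (k x y0 - k x y) \<le> c * dist y y0 powr \<delta>" unfolding c_def by (simp add: dist_commute)
    have "cmod (k x0 y0 - k x y0) \<le> N * dist x0 x powr \<delta> / dist y0 x0 powr (real DIM('a) + \<delta>)"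
      
    proof (rule cz_kernelD(3)[OF k])
      show "dist x0 x \<le> dist y0 x0 / 2"
        using that(1) r unfolding dist_commute[of x0 x] dist_commute[of y0 x0] r_def[symmetric] by linarith
    qed (use ne in auto)
    also have "\<dots> \<le> N * dist x0 x powr \<delta> / (r / 2) powr (real DIM('a) + \<delta>)"
      using r \<delta> N by (intro divide_left_mono powr_mono2 mult_pos_pos) (auto simp: r_def dist_commute)
    finally have 2: "cmod (k x0 y0 - k x y0) \<le> c * dist x x0 powr \<delta>" unfolding c_def by (simp add: dist_commute)
    have "cmod (k x y - k x0 y0) = cmod ((k x0 y0 - k x y0) + (k x y0 - k x y))" 
      by (subst norm_minus_commute) (simp add: algebra_simps)
    also have "\<dots> \<le> cmod (k x0 y0 - k x y0) + cmod (k x y0 - k x y)" by (rule norm_triangle_ineq)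
    finally show ?thesis unfolding bd_def using 1 2 by simp
  qed
  have bd0: "(bd \<longlongrightarrow> 0) (at (x0, y0))"
  proof -
    have "isCont bd (x0, y0)" unfolding bd_def using \<delta>
      by (intro continuous_intros) (auto intro!: continuous_at_imp_continuous_at_within tendsto_zero_powrI simp: continuous_within)
    then show ?thesis unfolding bd_def by (simp add: isCont_def)
  qed
  have ev: "\<forall>\<^sub>F p in at (x0, y0). cmod (k (fst p) (snd p) - k x0 y0) \<le> bd p"
  proof -
    have t: "((\<lambda>p. dist (fst p) x0) \<longlongrightarrow> 0) (at (x0, y0))" "((\<lambda>p. dist (snd p) y0) \<longlongrightarrow> 0) (at (x0, y0))"
      by (auto intro!: tendsto_eq_intros)
    then have "\<forall>\<^sub>F p in at (x0, y0). dist (fst p) x0 < r / 4" "\<forall>\<^sub>F p in at (x0, y0). dist (snd p) y0 < r / 4"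
      using r order_tendstoD(2)[OF t(1), of "r / 4"] order_tendstoD(2)[OF t(2), of "r / 4"] by auto
    then show ?thesis by eventually_elim (metis est prod.collapse)
  qed
  have "((\<lambda>p. k (fst p) (snd p) - k x0 y0) \<longlongrightarrow> 0) (at (x0, y0))"
    by (rule Lim_null_comparison[OF ev bd0])
  then show "isCont (\<lambda>p. k (fst p) (snd p)) (x0, y0)" 
    by (simp add: isCont_def LIM_zero_iff)
qed

text \<open>The product of the two supports is compact and misses the diagonal: the integrand is
  continuous there and 0 elsewhere.\<close>

lemma cz_kernel_integrable:
  fixes k :: "'a::euclidean_space \<Rightarrow> 'a \<Rightarrow> complex"
  assumes k: "cz_kernel \<delta> N k" and \<delta>: "\<delta> > 0" and f: "test_fun f" and g: "test_fun g" and d: "tsupp f \<inter> tsupp g = {}"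
  shows "integrable lborel (\<lambda>(x, y). k x y * f y * g x)"
proof -
  define S where "S = tsupp g \<times> tsupp f"
  have S: "compact S" unfolding S_def using f g by (intro compact_Times) (auto simp: test_fun_def)
  have sub: "S \<subseteq> {p. fst p \<noteq> snd p}" using d by (auto simp: S_def)
  have "integrable lborel (\<lambda>p. indicator S p *\<^sub>R (k (fst p) (snd p) * f (snd p) * g (fst p)))"
    by (intro borel_integrable_compact S continuous_intros continuous_on_subset[OF cz_kernel_continuous[OF k \<delta>] sub]
        continuous_on_compose2[OF test_fun_continuous[OF f]] continuous_on_compose2[OF test_fun_continuous[OF g]]) auto
  moreover have "(\<lambda>p. indicator S p *\<^sub>R (k (fst p) (snd p) * f (snd p) * g (fst p))) = (\<lambda>(x, y). k x y * f y * g x)"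
    by (auto simp: S_def indicator_def tsupp_outside fun_eq_iff)
  ultimately show ?thesis by simp
qed

text \<open>The off-diagonal part of a pair of test functions is controlled by the kernel alone, the local part
  by the $L^2$ bound. The resulting notion of a good pair serves scalar operators and, applied to one variable at a
  time, the bi-parameter operator: if the pair in one variable is good, the kernel in the other variable is scalar.\<close>

definition kgood :: "real \<Rightarrow> real \<Rightarrow> ('a::euclidean_space \<Rightarrow> complex) \<Rightarrow> ('a \<Rightarrow> complex) \<Rightarrow> bool" where
  "kgood \<delta> lam f g \<longleftrightarrow> tsupp f \<inter> tsupp g = {} \<and>
     (\<forall>k N. cz_kernel \<delta> N k \<longrightarrow> cmod (integral\<^sup>L lborel (\<lambda>(x, y). k x y * f y * g x)) \<le> lam * N)"

definition good :: "real \<Rightarrow> real \<Rightarrow> ('a::euclidean_space \<Rightarrow> complex) \<Rightarrow> ('a \<Rightarrow> complex) \<Rightarrow> bool" where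
  "good \<delta> lam f g \<longleftrightarrow> (\<exists>fa ga fb gb. test_fun fa \<and> test_fun ga \<and> test_fun fb \<and> test_fun gb \<and>
     (\<forall>S. bilinear_on_test S \<longrightarrow> S f g = S fa ga + S fb gb) \<and>
     l2norm fa * l2norm ga \<le> lam \<and> kgood \<delta> lam fb gb)"

lemma kgoodD: "kgood \<delta> lam f g \<Longrightarrow> cz_kernel \<delta> N k \<Longrightarrow> cmod (integral\<^sup>L lborel (\<lambda>(x, y). k x y * f y * g x)) \<le> lam * N"
  by (simp add: kgood_def)

lemma cz_kernel_swap:
  fixes k :: "'a::euclidean_space \<Rightarrow> 'a \<Rightarrow> complex"
  assumes k: "cz_kernel \<delta> N k" shows "cz_kernel \<delta> N (\<lambda>x y. k y x)"
  unfolding cz_kernel_def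
proof (intro conjI allI impI)
  show "cmod (k y x) \<le> N / dist x y ^ DIM('a)" if "x \<noteq> y" for x y
    using cz_kernelD(1)[OF k, of y x] that by (simp add: dist_commute)
qed (use cz_kernelD(2,3)[OF k] in blast)+

lemma lborel_swap_integral:
  fixes F :: "'a::euclidean_space \<times> 'a \<Rightarrow> complex"
  assumes "F \<in> borel_measurable borel"
  shows "integral\<^sup>L lborel (\<lambda>(x, y). F (y, x)) = integral\<^sup>L lborel F"
  using lborel_pair.integral_product_swap[of F] assms unfolding lborel_prod by (simp add: lborel_prod)

lemma kgood_sym:
  fixes f g :: "'a::euclidean_space \<Rightarrow> complex"
  assumes "kgood \<delta> lam f g" "\<delta> > 0" "test_fun f" "test_fun g" shows "kgood \<delta> lam g f"
  unfolding kgood_def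
proof (intro conjI allI impI)
  show d: "tsupp g \<inter> tsupp f = {}" using assms by (auto simp: kgood_def)
  fix k :: "'a \<Rightarrow> 'a \<Rightarrow> complex" and N assume k: "cz_kernel \<delta> N k"
  have m: "(\<lambda>(x, y). k x y * g y * f x) \<in> borel_measurable borel"
    using cz_kernel_integrable[OF k assms(2,4,3) d] by auto
  have "integral\<^sup>L lborel (\<lambda>(x, y). k x y * g y * f x) = integral\<^sup>L lborel (\<lambda>(x, y). (\<lambda>(x, y). k x y * g y * f x) (y, x))"
    by (rule lborel_swap_integral[OF m, symmetric])
  also have "\<dots> = integral\<^sup>L lborel (\<lambda>(x, y). k y x * f y * g x)" 
    by (simp add: mult_ac)
  finally show "cmod (integral\<^sup>L lborel (\<lambda>(x, y). k x y * g y * f x)) \<le> lam * N"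
    using kgoodD[OF assms(1) cz_kernel_swap[OF k]] by simp
qed

lemma bilinear_on_test_swap: "bilinear_on_test S \<Longrightarrow> bilinear_on_test (\<lambda>f g. S g f)"
  unfolding bilinear_on_test_def by blast

text \<open>Transposed kernels and transposed forms are of the same kind, with the same constants.
  Hence only pairs whose second wavelet is the narrower one have to be treated.\<close>

lemma good_sym:
  assumes "good \<delta> lam f g" "\<delta> > 0" shows "good \<delta> lam g f"
proof -
  obtain fa ga fb gb where *: "test_fun fa" "test_fun ga" "test_fun fb" "test_fun gb"
     "\<And>S. bilinear_on_test S \<Longrightarrow> S f g = S fa ga + S fb gb"
     "l2norm fa * l2norm ga \<le> lam" "kgood \<delta> lam fb gb" using assms unfolding good_def by blast
  have "S g f = S ga fa + S gb fb" if "bilinear_on_test S" for S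
    using *(5)[OF bilinear_on_test_swap[OF that]] .
  then show ?thesis unfolding good_def using * kgood_sym[OF *(7) assms(2) *(3,4)] by (metis mult.commute)
qed

lemma good_mono:
  assumes "good \<delta> lam f g" "lam \<le> lam'" shows "good \<delta> lam' f g"
proof -
  have "kgood \<delta> lam' fb gb" if "kgood \<delta> lam fb gb" for fb gb :: "'a \<Rightarrow> complex"
    unfolding kgood_def
  proof (intro conjI allI impI)
    show "tsupp fb \<inter> tsupp gb = {}" using that by (simp add: kgood_def)
    fix k :: "'a \<Rightarrow> 'a \<Rightarrow> complex" and N assume k: "cz_kernel \<delta> N k"
    have "cmod (integral\<^sup>L lborel (\<lambda>(x, y). k x y * fb y * gb x)) \<le> lam * N" using that k by (simp add: kgood_def)
    also have "\<dots> \<le> lam' * N" using assms(2) cz_kernel_nonneg[OF k] by (rule mult_right_mono)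
    finally show "cmod (integral\<^sup>L lborel (\<lambda>(x, y). k x y * fb y * gb x)) \<le> lam' * N" .
  qed
  then show ?thesis using assms unfolding good_def by (meson order_trans)
qed

lemma good_nonneg: "good \<delta> lam f g \<Longrightarrow> lam \<ge> 0"
  unfolding good_def using l2norm_nonneg by (metis mult_nonneg_nonneg order_trans)

lemma l2norm_zero: "l2norm (\<lambda>x. 0) = 0" by (simp add: l2norm_def)

lemma kgood_imp_good:
  assumes "kgood \<delta> lam f g" "test_fun f" "test_fun g" "lam \<ge> 0" shows "good \<delta> lam f g"
proof -
  have "S f g = S (\<lambda>x. 0) (\<lambda>x. 0) + S f g" if "bilinear_on_test S" for S
  proof -
    \<comment> \<open>Linearity with both coefficients 0 gives S 0 0 = 0, so the zero pair may serve
      as the local part.\<close>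
    have "S (\<lambda>x. 0 * f x + 0 * f x) (\<lambda>x. 0) = 0 * S f (\<lambda>x. 0) + 0 * S f (\<lambda>x. 0)"
      using that assms(2) test_fun_zero unfolding bilinear_on_test_def by blast
    then show ?thesis by simp
  qed
  then show ?thesis unfolding good_def using assms test_fun_zero
    by (intro exI[of _ "\<lambda>x. 0"] exI[of _ f] exI[of _ g]) (auto simp: l2norm_zero)
qed

text \<open>The local pair is bounded by every admissible L2 constant and the off-diagonal pair by
  every admissible kernel constant. Taking the infimum in each yields the two summands of
  \<open>czo_norm\<close>. The given A, C and K make the two sets nonempty, without which
  \<open>Inf\<close> says nothing.\<close>

lemma good_czo_norm:
  fixes S :: "('a::euclidean_space \<Rightarrow> complex) \<Rightarrow> ('a \<Rightarrow> complex) \<Rightarrow> complex"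
  assumes S: "bilinear_on_test S" and A: "L2_bound_form A S" and K: "cz_kernel \<delta> C K" "kernel_rep K S"
    and g: "good \<delta> lam f g"
  shows "cmod (S f g) \<le> lam * czo_norm \<delta> S"
proof -
  obtain fa ga fb gb where *: "test_fun fa" "test_fun ga" "test_fun fb" "test_fun gb"
     "\<And>S. bilinear_on_test S \<Longrightarrow> S f g = S fa ga + S fb gb"
     "l2norm fa * l2norm ga \<le> lam" "kgood \<delta> lam fb gb" using g unfolding good_def by blast
  have lam: "lam \<ge> 0" by (rule good_nonneg[OF g])
  have 1: "cmod (S fa ga) \<le> lam * B" if "B \<ge> 0" "L2_bound_form B S" for B
  proof -
    have "cmod (S fa ga) \<le> B * (l2norm fa * l2norm ga)"
      using that * unfolding L2_bound_form_def by (simp add: mult.assoc)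
    also have "\<dots> \<le> B * lam" using that * by (intro mult_left_mono)
    finally show ?thesis by (simp add: mult.commute)
  qed
  have 2: "cmod (S fb gb) \<le> lam * D" if "cz_kernel \<delta> D k" "kernel_rep k S" for D k
    using that * unfolding kgood_def kernel_rep_def by auto
  \<comment> \<open>Division by \<open>lam\<close> carries the bound to the infimum; if
    \<open>lam\<close> is 0, a single member of X already forces c = 0.\<close>
  have inf: "c \<le> lam * Inf X" if ne: "X \<noteq> {}" and le: "\<And>B. B \<in> X \<Longrightarrow> c \<le> lam * B" and c: "c \<ge> 0" for c :: real and X
  proof (cases "lam = 0")
    case True then show ?thesis using ne le c by force
  next
    case False
    then have "lam > 0" using lam by simp
    then have "c / lam \<le> Inf X" using ne le by (intro cInf_greatest) (auto simp: divide_le_eq mult.commute)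
    then show ?thesis using \<open>lam > 0\<close> by (simp add: divide_le_eq mult.commute)
  qed
  \<comment> \<open>Only nonnegative constants belong to the set whose infimum enters the
    norm.\<close>
  have A': "L2_bound_form \<bar>A\<bar> S"
    unfolding L2_bound_form_def
  proof (intro allI impI)
    fix f g :: "'a \<Rightarrow> complex" assume "test_fun f" "test_fun g"
    then have "cmod (S f g) \<le> A * (l2norm f * l2norm g)" using A by (simp add: L2_bound_form_def mult.assoc)
    also have "\<dots> \<le> \<bar>A\<bar> * (l2norm f * l2norm g)" by (intro mult_right_mono mult_nonneg_nonneg l2norm_nonneg) auto
    finally show "cmod (S f g) \<le> \<bar>A\<bar> * l2norm f * l2norm g" by (simp add: mult.assoc)
  qed
  have "cmod (S f g) \<le> cmod (S fa ga) + cmod (S fb gb)" using *(5)[OF S] norm_triangle_ineq by metis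
  also have "\<dots> \<le> lam * Inf {A. A \<ge> 0 \<and> L2_bound_form A S} + lam * Inf {C. \<exists>K. cz_kernel \<delta> C K \<and> kernel_rep K S}"
    using A' K by (intro add_mono inf) (auto intro: 1 2 abs_ge_zero)
  finally show ?thesis by (simp add: czo_norm_def distrib_left)
qed

lemma good_is_czo: "is_czo \<delta> S \<Longrightarrow> good \<delta> lam f g \<Longrightarrow> cmod (S f g) \<le> lam * czo_norm \<delta> S"
  unfolding is_czo_def using good_czo_norm by blast

text \<open>A bound on \<open>czo_norm\<close> of a difference carries information only if the two
  infima run over nonempty sets. Members are produced from the two operators: the sum of their L2
  constants, and the difference of their kernels with the sum of the kernel constants.\<close>

lemma good_czo_diff:
  fixes S S' :: "('a::euclidean_space \<Rightarrow> complex) \<Rightarrow> ('a \<Rightarrow> complex) \<Rightarrow> complex"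
  assumes S: "is_czo \<delta> S" and S': "is_czo \<delta> S'" and \<delta>: "\<delta> > 0" and g: "good \<delta> lam f g"
  shows "cmod (S f g - S' f g) \<le> lam * czo_norm \<delta> (\<lambda>f g. S f g - S' f g)"
proof -
  obtain A C K where 1: "bilinear_on_test S" "L2_bound_form A S" "cz_kernel \<delta> C K" "kernel_rep K S" using S unfolding is_czo_def by blast
  obtain A' C' K' where 2: "bilinear_on_test S'" "L2_bound_form A' S'" "cz_kernel \<delta> C' K'" "kernel_rep K' S'" using S' unfolding is_czo_def by blast
  have b: "bilinear_on_test (\<lambda>f g. S f g - S' f g)" using 1(1) 2(1) unfolding bilinear_on_test_def by (simp add: algebra_simps)
  have l: "L2_bound_form (A + A') (\<lambda>f g. S f g - S' f g)"
    unfolding L2_bound_form_def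
  proof (intro allI impI)
    fix f g :: "'a \<Rightarrow> complex" assume "test_fun f" "test_fun g"
    then have "cmod (S f g) \<le> A * l2norm f * l2norm g" "cmod (S' f g) \<le> A' * l2norm f * l2norm g" using 1 2 by (auto simp: L2_bound_form_def)
    then show "cmod (S f g - S' f g) \<le> (A + A') * l2norm f * l2norm g" 
      using norm_triangle_ineq4[of "S f g" "S' f g"] by (simp add: algebra_simps)
  qed
  have c: "cz_kernel \<delta> (C + C') (\<lambda>x y. K x y - K' x y)"
    unfolding cz_kernel_def
  proof (intro conjI allI impI)
    fix x y :: 'a assume "x \<noteq> y"
    then have "cmod (K x y) \<le> C / dist x y ^ DIM('a)" "cmod (K' x y) \<le> C' / dist x y ^ DIM('a)" using 1 2 by (auto simp: cz_kernel_def)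
    then show "cmod (K x y - K' x y) \<le> (C + C') / dist x y ^ DIM('a)" 
      using norm_triangle_ineq4[of "K x y" "K' x y"] by (simp add: add_divide_distrib)
  next
    fix x y y' :: 'a assume "x \<noteq> y" "dist y y' \<le> dist x y / 2"
    then have *: "cmod (K x y - K x y') \<le> C * dist y y' powr \<delta> / dist x y powr (real DIM('a) + \<delta>)" "cmod (K' x y - K' x y') \<le> C' * dist y y' powr \<delta> / dist x y powr (real DIM('a) + \<delta>)"
      "cmod (K y x - K y' x) \<le> C * dist y y' powr \<delta> / dist x y powr (real DIM('a) + \<delta>)" "cmod (K' y x - K' y' x) \<le> C' * dist y y' powr \<delta> / dist x y powr (real DIM('a) + \<delta>)"
      using 1 2 by (auto simp: cz_kernel_def)
    have e: "(C + C') * dist y y' powr \<delta> / dist x y powr (real DIM('a) + \<delta>) = C * dist y y' powr \<delta> / dist x y powr (real DIM('a) + \<delta>) + C' * dist y y' powr \<delta> / dist x y powr (real DIM('a) + \<delta>)"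
      by (simp add: add_divide_distrib algebra_simps)
    show "cmod (K x y - K' x y - (K x y' - K' x y')) \<le> (C + C') * dist y y' powr \<delta> / dist x y powr (real DIM('a) + \<delta>)"
      using * norm_triangle_ineq4[of "K x y - K x y'" "K' x y - K' x y'"] unfolding e by (simp add: algebra_simps)
    show "cmod (K y x - K' y x - (K y' x - K' y' x)) \<le> (C + C') * dist y y' powr \<delta> / dist x y powr (real DIM('a) + \<delta>)"
      using * norm_triangle_ineq4[of "K y x - K y' x" "K' y x - K' y' x"] unfolding e by (simp add: algebra_simps)
  qed
  have r: "kernel_rep (\<lambda>x y. K x y - K' x y) (\<lambda>f g. S f g - S' f g)"
    unfolding kernel_rep_def
  proof (intro allI impI)
    fix f g :: "'a \<Rightarrow> complex" assume f: "test_fun f" and g: "test_fun g" and d: "tsupp f \<inter> tsupp g = {}"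
    have "S f g - S' f g = integral\<^sup>L lborel (\<lambda>(x, y). K x y * f y * g x) - integral\<^sup>L lborel (\<lambda>(x, y). K' x y * f y * g x)"
      using 1(4) 2(4) f g d unfolding kernel_rep_def by simp
    \<comment> \<open>Splitting the integral requires integrability of both terms, hence disjoint
      supports and \<delta> > 0.\<close>
    also have "\<dots> = integral\<^sup>L lborel (\<lambda>p. (\<lambda>(x, y). K x y * f y * g x) p - (\<lambda>(x, y). K' x y * f y * g x) p)"
      by (rule Bochner_Integration.integral_diff[symmetric, OF cz_kernel_integrable[OF 1(3) \<delta> f g d] cz_kernel_integrable[OF 2(3) \<delta> f g d]])
    also have "(\<lambda>p. (\<lambda>(x, y). K x y * f y * g x) p - (\<lambda>(x, y). K' x y * f y * g x) p) = (\<lambda>(x, y). (K x y - K' x y) * f y * g x)"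
      by (auto simp: algebra_simps)
    finally show "S f g - S' f g = integral\<^sup>L lborel (\<lambda>(x, y). (K x y - K' x y) * f y * g x)" .
  qed
  show ?thesis using good_czo_norm[OF b l c r g] .
qed

lemma czo_valued_kernelD:
  fixes K :: "'a::euclidean_space \<Rightarrow> 'a \<Rightarrow> ('b::euclidean_space \<Rightarrow> complex) \<Rightarrow> ('b \<Rightarrow> complex) \<Rightarrow> complex"
  assumes K: "czo_valued_kernel \<delta> C K" and "x \<noteq> y"
  shows "is_czo \<delta> (K x y)" "czo_norm \<delta> (K x y) \<le> C / dist x y ^ DIM('a)"
    "dist y y' \<le> dist x y / 2 \<Longrightarrow> czo_norm \<delta> (\<lambda>f g. K x y f g - K x y' f g) \<le> C * dist y y' powr \<delta> / dist x y powr (real DIM('a) + \<delta>)"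
    "dist y y' \<le> dist x y / 2 \<Longrightarrow> czo_norm \<delta> (\<lambda>f g. K y x f g - K y' x f g) \<le> C * dist y y' powr \<delta> / dist x y powr (real DIM('a) + \<delta>)"
  using assms unfolding czo_valued_kernel_def by simp_all

text \<open>The passage from operator-valued to scalar kernels: testing on a good pair costs the
  factor \<open>lam\<close>, in the size condition and in both regularity conditions.\<close>

lemma good_cz_kernel:
  fixes K :: "'a::euclidean_space \<Rightarrow> 'a \<Rightarrow> ('b::euclidean_space \<Rightarrow> complex) \<Rightarrow> ('b \<Rightarrow> complex) \<Rightarrow> complex"
  assumes K: "czo_valued_kernel \<delta> C K" and g: "good \<delta> lam f g" and \<delta>: "\<delta> > 0"
  shows "cz_kernel \<delta> (lam * C) (\<lambda>x y. K x y f g)"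
  unfolding cz_kernel_def
proof (intro conjI allI impI)
  have lam: "lam \<ge> 0" by (rule good_nonneg[OF g])
  {
    fix x y :: 'a assume ne: "x \<noteq> y"
    then have "cmod (K x y f g) \<le> lam * czo_norm \<delta> (K x y)" using good_is_czo[OF czo_valued_kernelD(1)[OF K] g] by blast
    also have "\<dots> \<le> lam * (C / dist x y ^ DIM('a))" by (rule mult_left_mono[OF czo_valued_kernelD(2)[OF K ne] lam])
    finally show "cmod (K x y f g) \<le> lam * C / dist x y ^ DIM('a)" by simp
  }
  {
    fix x y y' :: 'a assume ne: "x \<noteq> y" and d: "dist y y' \<le> dist x y / 2"
    \<comment> \<open>The values of K are known to be CZOs only off the diagonal; the half-distance
      condition keeps y' away from x.\<close>
    have ne': "x \<noteq> y'" 
    proof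
      assume "x = y'"
      then have "dist x y \<le> dist x y / 2" using d by (simp add: dist_commute)
      then show False using ne by simp
    qed
    have czo: "is_czo \<delta> (K x y)" "is_czo \<delta> (K x y')" "is_czo \<delta> (K y x)" "is_czo \<delta> (K y' x)" 
      using ne ne' by (auto intro!: czo_valued_kernelD(1)[OF K])
    have "cmod (K x y f g - K x y' f g) \<le> lam * czo_norm \<delta> (\<lambda>f g. K x y f g - K x y' f g)" by (rule good_czo_diff[OF czo(1,2) \<delta> g])
    also have "\<dots> \<le> lam * (C * dist y y' powr \<delta> / dist x y powr (real DIM('a) + \<delta>))" by (rule mult_left_mono[OF czo_valued_kernelD(3)[OF K ne d] lam])
    finally show "cmod (K x y f g - K x y' f g) \<le> lam * C * dist y y' powr \<delta> / dist x y powr (real DIM('a) + \<delta>)" by (simp add: mult.assoc)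
    have "cmod (K y x f g - K y' x f g) \<le> lam * czo_norm \<delta> (\<lambda>f g. K y x f g - K y' x f g)" by (rule good_czo_diff[OF czo(3,4) \<delta> g])
    also have "\<dots> \<le> lam * (C * dist y y' powr \<delta> / dist x y powr (real DIM('a) + \<delta>))" by (rule mult_left_mono[OF czo_valued_kernelD(4)[OF K ne d] lam])
    finally show "cmod (K y x f g - K y' x f g) \<le> lam * C * dist y y' powr \<delta> / dist x y powr (real DIM('a) + \<delta>)" by (simp add: mult.assoc)
  }
qed

text \<open>The off-diagonal pair is zero. In \<open>biparam_good_bound\<close> this makes the local
  pair of the first variable usable as a good pair against the kernel in the second
  variable.\<close>

lemma good_local:
  assumes "test_fun f" "test_fun g" shows "good \<delta> (l2norm f * l2norm g) f g"
proof -
  have "S f g = S f g + S (\<lambda>x. 0) (\<lambda>x. 0)" if "bilinear_on_test S" for S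
  proof -
    have "S (\<lambda>x. 0 * f x + 0 * f x) (\<lambda>x. 0) = 0 * S f (\<lambda>x. 0) + 0 * S f (\<lambda>x. 0)"
      using that assms test_fun_zero unfolding bilinear_on_test_def by blast
    then show ?thesis by simp
  qed
  moreover have "kgood \<delta> (l2norm f * l2norm g) (\<lambda>x. 0) (\<lambda>x. 0)"
    unfolding kgood_def tsupp_def using cz_kernel_nonneg by (auto intro!: mult_nonneg_nonneg l2norm_nonneg simp: case_prod_unfold)
  ultimately show ?thesis unfolding good_def using assms test_fun_zero by blast
qed

text \<open>Three terms arise. The off-diagonal pair in the first variable meets the whole pair in
  the second (K1); the local pair in the first meets the off-diagonal pair in the second (K2); the
  two local pairs meet the L2 bound of T. Each term gains lam1 * lam2.\<close>

lemma biparam_good_bound: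
  fixes T :: "('a::euclidean_space \<times> 'b::euclidean_space \<Rightarrow> complex) \<Rightarrow> 'a \<times> 'b \<Rightarrow> complex"
    and K1 :: "'a \<Rightarrow> 'a \<Rightarrow> ('b \<Rightarrow> complex) \<Rightarrow> ('b \<Rightarrow> complex) \<Rightarrow> complex" and K2 :: "'b \<Rightarrow> 'b \<Rightarrow> ('a \<Rightarrow> complex) \<Rightarrow> ('a \<Rightarrow> complex) \<Rightarrow> complex"
  assumes T: "bounded_L2_op T" and C: "\<And>f. sq_int f \<Longrightarrow> l2norm (T f) \<le> C * l2norm f" "C \<ge> 0" and \<delta>: "\<delta> > 0"
    and K1: "czo_valued_kernel \<delta> C1 K1" and K2: "czo_valued_kernel \<delta> C2 K2"
    and r1: "\<And>f1 f2 g1 g2. test_fun f1 \<Longrightarrow> test_fun f2 \<Longrightarrow> test_fun g1 \<Longrightarrow> test_fun g2 \<Longrightarrow> tsupp f1 \<inter> tsupp g1 = {} \<Longrightarrow>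
           pair (T (tensor f1 f2)) (tensor g1 g2) = integral\<^sup>L lborel (\<lambda>(x, y). f1 y * g1 x * K1 x y f2 g2)"
    and r2: "\<And>f1 f2 g1 g2. test_fun f1 \<Longrightarrow> test_fun f2 \<Longrightarrow> test_fun g1 \<Longrightarrow> test_fun g2 \<Longrightarrow> tsupp f2 \<inter> tsupp g2 = {} \<Longrightarrow>
           pair (T (tensor f1 f2)) (tensor g1 g2) = integral\<^sup>L lborel (\<lambda>(x, y). f2 y * g2 x * K2 x y f1 g1)"
    and t: "test_fun f2" "test_fun g2" "test_fun f1" "test_fun g1"
    and g1: "good \<delta> lam1 f1 g1" and g2: "good \<delta> lam2 f2 g2"
  shows "cmod (pair (T (tensor f1 f2)) (tensor g1 g2)) \<le> lam1 * lam2 * (C + C1 + C2)"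
proof -
  let ?P = "\<lambda>f1 f2 g1 g2. pair (T (tensor f1 f2)) (tensor g1 g2)"
  note sq = test_fun_sq_int
  have lam: "lam1 \<ge> 0" "lam2 \<ge> 0" using g1 g2 good_nonneg by auto
  have b1: "bilinear_on_test (\<lambda>f g. ?P f f2 g g2)" if "test_fun f2" "test_fun g2" for f2 g2
    unfolding bilinear_on_test_def using that
    by (auto simp: tensor_lincomb_left bounded_L2_op_lincomb[OF T] pair_lincomb_left pair_lincomb_right sq tensor_l2 bounded_L2_op_sq_int[OF T])
  have b2: "bilinear_on_test (\<lambda>f g. ?P f1 f g1 g)" if "test_fun f1" "test_fun g1" for f1 g1
    unfolding bilinear_on_test_def using that
    by (auto simp: tensor_lincomb_right bounded_L2_op_lincomb[OF T] pair_lincomb_left pair_lincomb_right sq tensor_l2 bounded_L2_op_sq_int[OF T])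
  obtain fa ga fb gb where 1: "test_fun fa" "test_fun ga" "test_fun fb" "test_fun gb"
     "\<And>S. bilinear_on_test S \<Longrightarrow> S f1 g1 = S fa ga + S fb gb"
     "l2norm fa * l2norm ga \<le> lam1" "kgood \<delta> lam1 fb gb" using g1 unfolding good_def by blast
  obtain fa2 ga2 fb2 gb2 where 2: "test_fun fa2" "test_fun ga2" "test_fun fb2" "test_fun gb2"
     "\<And>S. bilinear_on_test S \<Longrightarrow> S f2 g2 = S fa2 ga2 + S fb2 gb2"
     "l2norm fa2 * l2norm ga2 \<le> lam2" "kgood \<delta> lam2 fb2 gb2" using g2 unfolding good_def by blast
  have "?P fb f2 gb g2 = integral\<^sup>L lborel (\<lambda>(x, y). K1 x y f2 g2 * fb y * gb x)"
    using r1[OF 1(3) t(1) 1(4) t(2)] 1(7) by (simp add: kgood_def mult_ac)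
  then have e1: "cmod (?P fb f2 gb g2) \<le> lam1 * (lam2 * C1)"
    using kgoodD[OF 1(7) good_cz_kernel[OF K1 g2 \<delta>]] by simp
  have "?P fa fb2 ga gb2 = integral\<^sup>L lborel (\<lambda>(x, y). K2 x y fa ga * fb2 y * gb2 x)"
    using r2[OF 1(1) 2(3) 1(2) 2(4)] 2(7) by (simp add: kgood_def mult_ac)
  then have e2: "cmod (?P fa fb2 ga gb2) \<le> lam2 * (lam1 * C2)"
    using kgoodD[OF 2(7) good_cz_kernel[OF K2 good_mono[OF good_local[OF 1(1,2)] 1(6)] \<delta>]] by simp
  have "cmod (?P fa fa2 ga ga2) \<le> l2norm (T (tensor fa fa2)) * l2norm (tensor ga ga2)"
    using 1 2 by (intro cmod_pair_le bounded_L2_op_sq_int[OF T] tensor_l2 sq)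
  also have "\<dots> \<le> (C * l2norm (tensor fa fa2)) * l2norm (tensor ga ga2)"
    using 1 2 by (intro mult_right_mono C l2norm_nonneg tensor_l2 sq)
  also have "\<dots> = C * ((l2norm fa * l2norm ga) * (l2norm fa2 * l2norm ga2))" 
    using tensor_l2(2)[OF sq[OF 1(1)] sq[OF 2(1)]] tensor_l2(2)[OF sq[OF 1(2)] sq[OF 2(2)]] by (simp only: mult_ac)
  also have "\<dots> \<le> C * (lam1 * lam2)" using 1 2 C lam by (intro mult_left_mono mult_mono mult_nonneg_nonneg l2norm_nonneg)
  finally have e3: "cmod (?P fa fa2 ga ga2) \<le> C * (lam1 * lam2)" .
  have "?P f1 f2 g1 g2 = ?P fa f2 ga g2 + ?P fb f2 gb g2" using 1(5)[OF b1[OF t(1,2)]] .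
  also have "?P fa f2 ga g2 = ?P fa fa2 ga ga2 + ?P fa fb2 ga gb2" using 2(5)[OF b2[OF 1(1,2)]] .
  finally have "cmod (?P f1 f2 g1 g2) \<le> cmod (?P fa fa2 ga ga2) + cmod (?P fa fb2 ga gb2) + cmod (?P fb f2 gb g2)"
    by (smt (verit) norm_triangle_ineq)
  then show ?thesis using e1 e2 e3 by (simp add: algebra_simps)
qed

text \<open>Since g has mean zero, k(x, y) may be replaced by k(x, y) - k(c, y), where c is the
  centre of g. For x within s of c and y at least 2s from c, regularity bounds this by N s^\<delta>
  / |y - c|^(n+\<delta>); D majorises what then remains of f.\<close>

lemma kgoodI:
  fixes f g :: "'a::euclidean_space \<Rightarrow> complex"
  assumes \<delta>: "\<delta> > 0" and f: "test_fun f" and g: "test_fun g" and g0: "integral\<^sup>L lborel g = 0" and s: "s > 0"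
    and gs: "\<And>v. g v \<noteq> 0 \<Longrightarrow> dist v c \<le> s" and fs: "\<And>u. f u \<noteq> 0 \<Longrightarrow> 2 * s \<le> dist u c" and disj: "tsupp f \<inter> tsupp g = {}"
    and D: "integrable lborel D" "\<And>u. 2 * s \<le> dist u c \<Longrightarrow> cmod (f u) / dist u c powr (real DIM('a) + \<delta>) \<le> D u" "\<And>u. D u \<ge> 0"
  shows "kgood \<delta> (s powr \<delta> * (\<integral>v. cmod (g v) \<partial>lborel) * integral\<^sup>L lborel D) f g"
  unfolding kgood_def
proof (intro conjI allI impI disj)
  fix k :: "'a \<Rightarrow> 'a \<Rightarrow> complex" and N assume k: "cz_kernel \<delta> N k"
  have N: "N \<ge> 0" by (rule cz_kernel_nonneg[OF k])
  define G where "G = (\<integral>v. cmod (g v) \<partial>lborel)"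
  have gi: "integrable lborel g" by (rule test_fun_integrable[OF g])
  have int: "integrable (lborel \<Otimes>\<^sub>M lborel) (\<lambda>(x, y). k x y * f y * g x)"
    using cz_kernel_integrable[OF k \<delta> f g disj] by (simp add: lborel_prod)
  have eq: "integral\<^sup>L lborel (\<lambda>(x, y). k x y * f y * g x) = (\<integral>y. (\<integral>x. k x y * f y * g x \<partial>lborel) \<partial>lborel)"
    using lborel_pair.integral_snd[OF int] by (simp add: lborel_prod)
  have inner: "cmod (\<integral>x. k x y * f y * g x \<partial>lborel) \<le> s powr \<delta> * G * N * D y" for y
  \<comment> \<open>A non-integrable inner integrand has integral 0 by convention, and then the
    bound is trivial.\<close>
  proof (cases "f y \<noteq> 0 \<and> integrable lborel (\<lambda>x. k x y * f y * g x)")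
    case True
    then have fy: "2 * s \<le> dist y c" using fs by blast
    have "(\<integral>x. k x y * f y * g x \<partial>lborel) = (\<integral>x. k x y * f y * g x \<partial>lborel) - (\<integral>x. (k c y * f y) * g x \<partial>lborel)"
      using g0 by simp
    also have "\<dots> = (\<integral>x. k x y * f y * g x - (k c y * f y) * g x \<partial>lborel)"
      using True gi by (intro Bochner_Integration.integral_diff[symmetric]) auto
    also have "cmod \<dots> \<le> (\<integral>x. (cmod (f y) * N * s powr \<delta> / dist y c powr (real DIM('a) + \<delta>)) * cmod (g x) \<partial>lborel)"
    proof (rule Bochner_Integration.integral_norm_bound_integral)
      show "integrable lborel (\<lambda>x. k x y * f y * g x - (k c y * f y) * g x)" using True gi by auto
      show "integrable lborel (\<lambda>x. (cmod (f y) * N * s powr \<delta> / dist y c powr (real DIM('a) + \<delta>)) * cmod (g x))" using gi by auto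
      fix x
      show "cmod (k x y * f y * g x - (k c y * f y) * g x) \<le> (cmod (f y) * N * s powr \<delta> / dist y c powr (real DIM('a) + \<delta>)) * cmod (g x)"
      proof (cases "g x = 0")
        case False
        then have xs: "dist c x \<le> s" using gs[of x] by (simp add: dist_commute)
        have "y \<noteq> c" using fy s by auto
        then have "cmod (k c y - k x y) \<le> N * dist c x powr \<delta> / dist y c powr (real DIM('a) + \<delta>)"
          using xs fy by (intro cz_kernelD(3)[OF k]) auto
        also have "\<dots> \<le> N * s powr \<delta> / dist y c powr (real DIM('a) + \<delta>)"
          using xs N \<delta> by (intro divide_right_mono mult_left_mono powr_mono2) auto
        finally have *: "cmod (k x y - k c y) \<le> N * s powr \<delta> / dist y c powr (real DIM('a) + \<delta>)" by (simp add: norm_minus_commute)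
        have "cmod (k x y * f y * g x - (k c y * f y) * g x) = cmod (k x y - k c y) * (cmod (f y) * cmod (g x))"
          by (simp add: norm_mult[symmetric] algebra_simps)
        also have "\<dots> \<le> (N * s powr \<delta> / dist y c powr (real DIM('a) + \<delta>)) * (cmod (f y) * cmod (g x))"
          using * by (intro mult_right_mono) auto
        finally show ?thesis by (simp add: mult_ac)
      qed simp
    qed
    also have "\<dots> = s powr \<delta> * G * N * (cmod (f y) / dist y c powr (real DIM('a) + \<delta>))" by (simp add: G_def)
    also have "\<dots> \<le> s powr \<delta> * G * N * D y" using D(2)[OF fy] N by (intro mult_left_mono) (auto simp: G_def)
    finally show ?thesis .
  next
    case False
    then have "(\<integral>x. k x y * f y * g x \<partial>lborel) = 0" using not_integrable_integral_eq by fastforce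
    then show ?thesis using N D(3)[of y] by (simp add: G_def)
  qed
  have "cmod (\<integral>y. (\<integral>x. k x y * f y * g x \<partial>lborel) \<partial>lborel) \<le> (\<integral>y. s powr \<delta> * G * N * D y \<partial>lborel)"
    by (rule Bochner_Integration.integral_norm_bound_integral) (use lborel_pair.integrable_snd[OF int] D inner in auto)
  then show "cmod (integral\<^sup>L lborel (\<lambda>(x, y). k x y * f y * g x)) \<le> s powr \<delta> * (\<integral>v. cmod (g v) \<partial>lborel) * integral\<^sup>L lborel D * N"
    unfolding eq by (simp add: G_def mult_ac)
qed

section \<open>Almost-diagonal kernels on the upper half-space\<close>

lemma nn_integral_has_integral_on:
  fixes f :: "'a::euclidean_space \<Rightarrow> real"
  assumes [measurable]: "f \<in> borel_measurable borel" "S \<in> sets borel" and nn: "\<And>x. x \<in> S \<Longrightarrow> 0 \<le> f x" and I: "(f has_integral I) S"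
  shows "(\<integral>\<^sup>+x. ennreal (f x) * indicator S x \<partial>lborel) = ennreal I"
proof -
  have "((\<lambda>x. f x * indicator S x) has_integral I) UNIV"

  proof -
    have e: "(\<lambda>x. f x * indicator S x) = (\<lambda>x. if x \<in> S then f x else 0)" by (auto simp: indicator_def)
    show ?thesis unfolding e has_integral_restrict_UNIV by (rule I)
  qed
  then have "(\<integral>\<^sup>+x. ennreal (f x * indicator S x) \<partial>lborel) = ennreal I"
    by (rule nn_integral_has_integral_lborel[rotated 2]) (auto simp: indicator_def nn)
  moreover have "ennreal (f x * indicator S x) = ennreal (f x) * indicator S x" for x by (simp add: indicator_def)
  ultimately show ?thesis by simp
qed

text \<open>Dyadic shells: where 1 + |u| lies between 2^j and 2^(j+1), the integrand is at most
  2^(-(n+\<epsilon>)j), and the shell sits in a ball of volume proportional to 2^(nj). The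
  contributions form a geometric series of ratio 2^(-\<epsilon>).\<close>

lemma decay_integral_finite:
  fixes \<epsilon> :: real
  assumes \<epsilon>: "\<epsilon> > 0"
  shows "(\<integral>\<^sup>+(u::'a::euclidean_space). ennreal ((1 + norm u) powr - (real DIM('a) + \<epsilon>)) \<partial>lborel) < \<infinity>"
proof -
  let ?n = "real DIM('a)"
  define c where "c = (\<lambda>j::nat. 2 powr (- (?n + \<epsilon>) * real j))"
  define v where "v = unit_ball_vol ?n"
  have v: "v \<ge> 0" unfolding v_def by (simp add: unit_ball_vol_nonneg)
  have le: "ennreal ((1 + norm u) powr - (?n + \<epsilon>)) \<le> (\<Sum>j. ennreal (c j) * indicator (cball 0 (2 ^ (j + 1))) u)" for u :: 'a
  proof -
    define l where "l = log 2 (1 + norm u)"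
    have l: "l \<ge> 0" "1 + norm u = 2 powr l" unfolding l_def by (simp_all add: add_pos_nonneg)
    \<comment> \<open>The index of a dyadic shell containing u.\<close>
    define j where "j = nat \<lfloor>l\<rfloor>"
    have j: "real j \<le> l" "l \<le> real j + 1" using l(1) unfolding j_def by (auto simp: le_floor_iff)
    have "2 powr l \<le> 2 powr (real j + 1)" using j by (intro powr_mono) auto
    also have "\<dots> = 2 ^ (j + 1)" by (simp add: powr_add powr_realpow)
    finally have u: "u \<in> cball 0 (2 ^ (j + 1))" using l(2) by auto
    have "(1 + norm u) powr - (?n + \<epsilon>) = 2 powr (- (?n + \<epsilon>) * l)" unfolding l(2) by (simp add: powr_powr mult.commute)
    also have "\<dots> \<le> c j" unfolding c_def using j \<epsilon> by (intro powr_mono mult_left_mono_neg) auto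
    finally have "ennreal ((1 + norm u) powr - (?n + \<epsilon>)) \<le> ennreal (c j) * indicator (cball 0 (2 ^ (j + 1))) u"
      using u by (simp add: ennreal_leI)
    \<comment> \<open>One term of a nonnegative series is enough, so overlapping balls may replace
      the disjoint shells.\<close>
    also have "\<dots> \<le> (\<Sum>j. ennreal (c j) * indicator (cball 0 (2 ^ (j + 1))) u)"

    proof -
      define g where "g = (\<lambda>j. ennreal (c j) * indicator (cball 0 (2 ^ (j + 1))) u)"
      have "g j \<le> suminf g" using sum_le_suminf[of g "{j}"] by simp
      then show ?thesis by (simp add: g_def)
    qed
    finally show ?thesis .
  qed
  have "(\<integral>\<^sup>+(u::'a). ennreal ((1 + norm u) powr - (?n + \<epsilon>)) \<partial>lborel) \<le> (\<integral>\<^sup>+(u::'a). (\<Sum>j. ennreal (c j) * indicator (cball 0 (2 ^ (j + 1))) u) \<partial>lborel)"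
    by (intro nn_integral_mono le)
  also have "\<dots> = (\<Sum>j. \<integral>\<^sup>+(u::'a). ennreal (c j) * indicator (cball 0 (2 ^ (j + 1))) u \<partial>lborel)"

  proof (rule nn_integral_suminf)
    have [measurable]: "cball (0::'a) r \<in> sets borel" for r by (rule borel_closed) simp
    show "(\<lambda>u::'a. ennreal (c j) * indicator (cball 0 (2 ^ (j + 1))) u) \<in> borel_measurable lborel" for j by measurable
  qed
  also have "\<dots> = (\<Sum>j. ennreal (v * 2 ^ DIM('a) * (2 powr - \<epsilon>) ^ j))"
  proof (rule suminf_cong)
    fix j
    have "(\<integral>\<^sup>+(u::'a). ennreal (c j) * indicator (cball 0 (2 ^ (j + 1))) u \<partial>lborel) = ennreal (c j) * ennreal (v * (2 ^ (j + 1)) ^ DIM('a))"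
      by (subst nn_integral_cmult_indicator) (auto simp: emeasure_cball v_def)
    also have "\<dots> = ennreal (c j * (v * (2 ^ (j + 1)) ^ DIM('a)))" using v by (simp add: ennreal_mult c_def)
    also have "c j * (v * (2 ^ (j + 1)) ^ DIM('a)) = v * 2 ^ DIM('a) * (2 powr - \<epsilon>) ^ j"
    proof -
      have "(2 powr - \<epsilon>) ^ j = 2 powr (- \<epsilon> * real j)" by (simp add: powr_realpow[symmetric] powr_powr)
      moreover have "((2::real) ^ j) ^ DIM('a) = 2 powr (?n * real j)" by (simp add: powr_realpow[symmetric] powr_powr power_mult[symmetric] mult.commute)
      moreover have "c j = 2 powr (- \<epsilon> * real j) * 2 powr (- (?n * real j))" unfolding c_def by (simp add: powr_add[symmetric] algebra_simps)
      moreover have "(2::real) powr (- (?n * real j)) * 2 powr (?n * real j) = 1" by (simp add: powr_add[symmetric])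
      ultimately show ?thesis by (simp add: power_mult_distrib algebra_simps)
    qed
    finally show "(\<integral>\<^sup>+(u::'a). ennreal (c j) * indicator (cball 0 (2 ^ (j + 1))) u \<partial>lborel) = ennreal (v * 2 ^ DIM('a) * (2 powr - \<epsilon>) ^ j)" .
  qed
  also have "\<dots> < \<infinity>"
  proof -
    have "2 powr - \<epsilon> < (2::real) powr 0" using \<epsilon> by (intro powr_less_mono) auto
    then have "summable (\<lambda>j. v * 2 ^ DIM('a) * (2 powr - \<epsilon>) ^ j)" by (intro summable_mult summable_geometric) auto
    then show ?thesis using v by (simp add: ennreal_suminf_neq_top less_top[symmetric])
  qed
  finally show ?thesis .
qed

text \<open>The substitution u -> c + r u contributes r^n against r^(-n-\<epsilon>). The constant is
  raised by 1 to make it positive.\<close>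

lemma decay_integral:
  fixes \<epsilon> :: real
  assumes \<epsilon>: "\<epsilon> > 0"
  obtains C where "C > 0" "\<And>r (c::'a::euclidean_space). r > 0 \<Longrightarrow>
    (\<integral>\<^sup>+u. ennreal ((r + dist u c) powr - (real DIM('a) + \<epsilon>)) \<partial>lborel) \<le> ennreal (C * r powr - \<epsilon>)"
proof -
  let ?n = "real DIM('a)"
  define C where "C = enn2real (\<integral>\<^sup>+(u::'a). ennreal ((1 + norm u) powr - (?n + \<epsilon>)) \<partial>lborel)"
  have C: "(\<integral>\<^sup>+(u::'a). ennreal ((1 + norm u) powr - (?n + \<epsilon>)) \<partial>lborel) = ennreal C" "C \<ge> 0"
    unfolding C_def using decay_integral_finite[OF \<epsilon>, where ?'a='a] by (auto simp: less_top)
  have "(\<integral>\<^sup>+u. ennreal ((r + dist u c) powr - (?n + \<epsilon>)) \<partial>lborel) \<le> ennreal ((C + 1) * r powr - \<epsilon>)" if r: "r > 0" for r and c :: 'a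
  proof -
    have "(\<integral>\<^sup>+u. ennreal ((r + dist u c) powr - (?n + \<epsilon>)) \<partial>lborel) =
      ennreal (\<bar>r\<bar> ^ DIM('a)) * (\<integral>\<^sup>+u. ennreal ((r + dist (c + r *\<^sub>R u) c) powr - (?n + \<epsilon>)) \<partial>lborel)"
      using r by (subst nn_integral_lborel_affine[where c=r and t=c]) auto
    also have "(\<integral>\<^sup>+u. ennreal ((r + dist (c + r *\<^sub>R u) c) powr - (?n + \<epsilon>)) \<partial>lborel) = 
      (\<integral>\<^sup>+(u::'a). ennreal (r powr - (?n + \<epsilon>)) * ennreal ((1 + norm u) powr - (?n + \<epsilon>)) \<partial>lborel)"
    proof (intro nn_integral_cong)
      fix u :: 'a
      have "r + dist (c + r *\<^sub>R u) c = r * (1 + norm u)" using r by (simp add: dist_norm algebra_simps)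
      then show "ennreal ((r + dist (c + r *\<^sub>R u) c) powr - (?n + \<epsilon>)) = ennreal (r powr - (?n + \<epsilon>)) * ennreal ((1 + norm u) powr - (?n + \<epsilon>))"
        using r by (simp add: powr_mult ennreal_mult[symmetric])
    qed
    also have "\<dots> = ennreal (r powr - (?n + \<epsilon>)) * ennreal C" unfolding C(1)[symmetric] by (rule nn_integral_cmult) auto
    also have "ennreal (\<bar>r\<bar> ^ DIM('a)) * (ennreal (r powr - (?n + \<epsilon>)) * ennreal C) = ennreal (C * r powr - \<epsilon>)"
    proof -
      have "\<bar>r\<bar> ^ DIM('a) * (r powr - (?n + \<epsilon>) * C) = C * r powr - \<epsilon>"
        using r by (simp add: powr_realpow[symmetric] powr_add[symmetric] mult_ac)
      then show ?thesis using C r by (simp add: ennreal_mult[symmetric])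
    qed
    also have "\<dots> \<le> ennreal ((C + 1) * r powr - \<epsilon>)" by (intro ennreal_leI mult_right_mono) auto
    finally show ?thesis .
  qed
  then show thesis using that[of "C + 1"] C by auto
qed

text \<open>With m and M the smaller and the larger scale and d the distance of the base points,
  this is m^(n/2+\<epsilon>) M^(n/2) / (M+d)^(n+\<epsilon>), the usual almost-diagonal bound. It is
  invariant under simultaneous translation and dilation of both points.\<close>

definition hker :: "real \<Rightarrow> ('a::euclidean_space \<times> real) \<Rightarrow> ('a \<times> real) \<Rightarrow> real" where
  "hker \<epsilon> z w = min (snd z) (snd w) powr (real DIM('a) / 2 + \<epsilon>) * max (snd z) (snd w) powr (real DIM('a) / 2) *
     (max (snd z) (snd w) + dist (fst z) (fst w)) powr - (real DIM('a) + \<epsilon>)"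

text \<open>The type contains all real scales. The density is set to 0 for t <= 0, so that facts
  about wavelets, which need t > 0, hold almost everywhere by \<open>AE_hmeas\<close>.\<close>

definition hmeas :: "('a::euclidean_space \<times> real) measure" where
  "hmeas = density lborel (\<lambda>z. ennreal (indicator {0<..} (snd z) * snd z powr - (real DIM('a) + 1)))"

lemma hker_nonneg: "hker \<epsilon> z w \<ge> 0" by (simp add: hker_def)

lemma hker_sym: "hker \<epsilon> z w = hker \<epsilon> w z"
  by (simp add: hker_def dist_commute min.commute max.commute)

lemma sets_hmeas [measurable_cong]: "sets hmeas = sets borel" by (simp add: hmeas_def)

lemma borel_measurable_fst_snd [measurable]:
  "fst \<in> borel_measurable (borel :: ('a::second_countable_topology \<times> 'b::second_countable_topology) measure)"
  "snd \<in> borel_measurable (borel :: ('a::second_countable_topology \<times> 'b::second_countable_topology) measure)"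
  unfolding borel_prod[symmetric] by measurable

lemma hker_measurable [measurable]: "(\<lambda>p. hker \<epsilon> (fst p) (snd p)) \<in> borel_measurable (borel \<Otimes>\<^sub>M borel)"
  unfolding hker_def borel_prod by measurable

lemma sigma_finite_hmeas: "sigma_finite_measure (hmeas :: ('a::euclidean_space \<times> real) measure)"
  unfolding hmeas_def
  by (subst sigma_finite_measure.sigma_finite_iff_density_finite[OF lborel.sigma_finite_measure_axioms]) auto

lemma AE_hmeas: "AE z in hmeas. snd z > 0"
  unfolding hmeas_def by (subst AE_density) (auto simp: indicator_def)

text \<open>The weight s^(n/2) is there because for \<epsilon> <= n/2 the unweighted integral
  diverges at small scales. Integration in space leaves a multiple of t^(n/2-\<epsilon>)
  s^(\<epsilon>-1) for s <= t and of t^(n/2+\<epsilon>) s^(-\<epsilon>-1) for s >= t; each of these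
  integrates to t^(n/2) / \<epsilon>.\<close>

lemma hker_schur:
  assumes \<epsilon>: "\<epsilon> > 0"
  obtains C where "C > 0" "\<And>z::'a::euclidean_space \<times> real. snd z > 0 \<Longrightarrow>
    (\<integral>\<^sup>+w. ennreal (hker \<epsilon> z w * snd w powr (real DIM('a) / 2)) \<partial>hmeas) \<le> ennreal (C * snd z powr (real DIM('a) / 2))"
proof -
  let ?n = "real DIM('a)"
  obtain C where C: "C > 0" "\<And>r (c::'a). r > 0 \<Longrightarrow> (\<integral>\<^sup>+u. ennreal ((r + dist u c) powr - (?n + \<epsilon>)) \<partial>lborel) \<le> ennreal (C * r powr - \<epsilon>)"
    using decay_integral[OF \<epsilon>] by metis
  have "(\<integral>\<^sup>+w. ennreal (hker \<epsilon> z w * snd w powr (?n / 2)) \<partial>hmeas) \<le> ennreal ((2 * C / \<epsilon>) * snd z powr (?n / 2))" if t: "snd z > 0" for z :: "'a \<times> real"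
  proof -
    obtain x t where z: "z = (x, t)" "t > 0" using t by (cases z) auto
    \<comment> \<open>All factors that depend on the scales alone, with the weight and the density
      of the measure included.\<close>
    define A where "A = (\<lambda>s. min t s powr (?n / 2 + \<epsilon>) * max t s powr (?n / 2) * s powr (?n / 2) * s powr - (?n + 1))"
    have "(\<integral>\<^sup>+w. ennreal (hker \<epsilon> z w * snd w powr (?n / 2)) \<partial>hmeas)
       = (\<integral>\<^sup>+w. ennreal (indicator {0<..} (snd w) * A (snd w)) * ennreal ((max t (snd w) + dist (fst w) x) powr - (?n + \<epsilon>)) \<partial>lborel)"
      unfolding hmeas_def
      by (subst nn_integral_density) (auto simp: hker_def z A_def ennreal_mult[symmetric] dist_commute mult_ac intro!: nn_integral_cong)
    also have "\<dots> = (\<integral>\<^sup>+s. \<integral>\<^sup>+y. ennreal (indicator {0<..} s * A s) * ennreal ((max t s + dist y x) powr - (?n + \<epsilon>)) \<partial>lborel \<partial>lborel)"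
      unfolding lborel_prod[symmetric] A_def
      by (subst lborel_pair.nn_integral_snd[symmetric]) (auto simp: split_beta')
    also have "\<dots> \<le> (\<integral>\<^sup>+s. ennreal (indicator {0<..} s * A s) * ennreal (C * max t s powr - \<epsilon>) \<partial>lborel)"
    proof (intro nn_integral_mono)
      fix s
      have "(\<integral>\<^sup>+y. ennreal (indicator {0<..} s * A s) * ennreal ((max t s + dist y x) powr - (?n + \<epsilon>)) \<partial>lborel) = 
         ennreal (indicator {0<..} s * A s) * (\<integral>\<^sup>+y. ennreal ((max t s + dist y x) powr - (?n + \<epsilon>)) \<partial>lborel)"
        by (rule nn_integral_cmult) auto
      also have "\<dots> \<le> ennreal (indicator {0<..} s * A s) * ennreal (C * max t s powr - \<epsilon>)"
        using z(2) by (intro mult_left_mono C) auto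
      finally show "(\<integral>\<^sup>+y. ennreal (indicator {0<..} s * A s) * ennreal ((max t s + dist y x) powr - (?n + \<epsilon>)) \<partial>lborel) \<le>
          ennreal (indicator {0<..} s * A s) * ennreal (C * max t s powr - \<epsilon>)" .
    qed
    also have "\<dots> \<le> (\<integral>\<^sup>+s. ennreal (C * t powr (?n / 2 - \<epsilon>)) * (ennreal (s powr (\<epsilon> - 1)) * indicator {0..t} s) +
         ennreal (C * t powr (?n / 2 + \<epsilon>)) * (ennreal (s powr (- \<epsilon> - 1)) * indicator {t..} s) \<partial>lborel)"
    proof (intro nn_integral_mono)
      fix s :: real
      consider "s \<le> 0" | "0 < s" "s \<le> t" | "t < s" by linarith
      then show "ennreal (indicator {0<..} s * A s) * ennreal (C * max t s powr - \<epsilon>) \<le> ennreal (C * t powr (?n / 2 - \<epsilon>)) * (ennreal (s powr (\<epsilon> - 1)) * indicator {0..t} s) +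
         ennreal (C * t powr (?n / 2 + \<epsilon>)) * (ennreal (s powr (- \<epsilon> - 1)) * indicator {t..} s)"
      proof cases
        case 1 then show ?thesis by simp
      next
        case 2
        have e1: "s powr (?n / 2 + \<epsilon>) * s powr (?n / 2) * s powr - (?n + 1) = s powr (\<epsilon> - 1)"
          unfolding powr_add[symmetric] by (rule arg_cong[where f="\<lambda>e. s powr e"]) simp
        have e2: "t powr (?n / 2) * t powr - \<epsilon> = t powr (?n / 2 - \<epsilon>)" using 2 by (simp add: powr_add[symmetric])
        have "A s * (C * max t s powr - \<epsilon>) = C * (t powr (?n / 2) * t powr - \<epsilon>) * (s powr (?n / 2 + \<epsilon>) * s powr (?n / 2) * s powr - (?n + 1))"
          using 2 by (simp add: A_def min_absorb2 max_absorb1 mult_ac)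
        also have "\<dots> = C * t powr (?n / 2 - \<epsilon>) * s powr (\<epsilon> - 1)" unfolding e1 e2 ..
        finally have "ennreal (indicator {0<..} s * A s) * ennreal (C * max t s powr - \<epsilon>) = ennreal (C * t powr (?n / 2 - \<epsilon>)) * (ennreal (s powr (\<epsilon> - 1)) * indicator {0..t} s)"
          using 2 C(1) by (simp add: ennreal_mult[symmetric] A_def)
        then show ?thesis by simp
      next
        case 3
        then have s: "s > 0" using z by simp
        have e1: "s powr (?n / 2) * s powr (?n / 2) * s powr - (?n + 1) * s powr - \<epsilon> = s powr (- \<epsilon> - 1)"
          unfolding powr_add[symmetric] by (rule arg_cong[where f="\<lambda>e. s powr e"]) simp
        have "A s * (C * max t s powr - \<epsilon>) = C * t powr (?n / 2 + \<epsilon>) * (s powr (?n / 2) * s powr (?n / 2) * s powr - (?n + 1) * s powr - \<epsilon>)"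
          using 3 by (simp add: A_def min_absorb1 max_absorb2 mult_ac)
        also have "\<dots> = C * t powr (?n / 2 + \<epsilon>) * s powr (- \<epsilon> - 1)" unfolding e1 ..
        finally have "ennreal (indicator {0<..} s * A s) * ennreal (C * max t s powr - \<epsilon>) = ennreal (C * t powr (?n / 2 + \<epsilon>)) * (ennreal (s powr (- \<epsilon> - 1)) * indicator {t..} s)"
          using 3 s C(1) by (simp add: ennreal_mult[symmetric] A_def)
        then show ?thesis by simp
      qed
    qed
    also have "\<dots> = ennreal (C * t powr (?n / 2 - \<epsilon>)) * (\<integral>\<^sup>+s. ennreal (s powr (\<epsilon> - 1)) * indicator {0..t} s \<partial>lborel) +
         ennreal (C * t powr (?n / 2 + \<epsilon>)) * (\<integral>\<^sup>+s. ennreal (s powr (- \<epsilon> - 1)) * indicator {t..} s \<partial>lborel)"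
      by (simp add: nn_integral_add nn_integral_cmult)
    also have "(\<integral>\<^sup>+s. ennreal (s powr (\<epsilon> - 1)) * indicator {0..t} s \<partial>lborel) = ennreal (t powr \<epsilon> / \<epsilon>)"
      using has_integral_powr_from_0[of "\<epsilon> - 1" t] z \<epsilon> by (intro nn_integral_has_integral_on) auto
    also have "(\<integral>\<^sup>+s. ennreal (s powr (- \<epsilon> - 1)) * indicator {t..} s \<partial>lborel) = ennreal (t powr - \<epsilon> / \<epsilon>)"
      using has_integral_powr_to_inf[of "- \<epsilon> - 1" t] z \<epsilon> by (intro nn_integral_has_integral_on) auto
    also have "ennreal (C * t powr (?n / 2 - \<epsilon>)) * ennreal (t powr \<epsilon> / \<epsilon>) + ennreal (C * t powr (?n / 2 + \<epsilon>)) * ennreal (t powr - \<epsilon> / \<epsilon>)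
       = ennreal ((2 * C / \<epsilon>) * snd z powr (?n / 2))"
    proof -
      have e: "C * t powr (?n / 2 - \<epsilon>) * (t powr \<epsilon> / \<epsilon>) = C / \<epsilon> * t powr (?n / 2)" "C * t powr (?n / 2 + \<epsilon>) * (t powr - \<epsilon> / \<epsilon>) = C / \<epsilon> * t powr (?n / 2)"
        using z(2) by (simp_all add: powr_add[symmetric])
      have "ennreal (C * t powr (?n / 2 - \<epsilon>)) * ennreal (t powr \<epsilon> / \<epsilon>) = ennreal (C / \<epsilon> * t powr (?n / 2))"
        using C \<epsilon> by (subst ennreal_mult[symmetric]) (auto simp only: e, auto)
      moreover have "ennreal (C * t powr (?n / 2 + \<epsilon>)) * ennreal (t powr - \<epsilon> / \<epsilon>) = ennreal (C / \<epsilon> * t powr (?n / 2))"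
        using C \<epsilon> by (subst ennreal_mult[symmetric]) (auto simp only: e, auto)
      moreover have "C / \<epsilon> * t powr (?n / 2) + C / \<epsilon> * t powr (?n / 2) = (2 * C / \<epsilon>) * snd z powr (?n / 2)" by (simp add: z)
      ultimately show ?thesis using C \<epsilon> by (simp add: ennreal_plus[symmetric] del: ennreal_plus)
    qed
    finally show ?thesis .
  qed
  then show thesis using that[of "2 * C / \<epsilon>"] C \<epsilon> by auto
qed

text \<open>Cauchy-Schwarz for k = sqrt(k h) sqrt(k / h), followed by Tonelli. By symmetry of k, the
  single hypothesis S serves both for the first factor and for the integration in the other
  variable.\<close>

lemma schur_test:
  fixes k :: "'a \<Rightarrow> 'a \<Rightarrow> real" and h :: "'a \<Rightarrow> real" and F :: "'a \<Rightarrow> ennreal"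
  assumes M: "sigma_finite_measure M" 
    and [measurable]: "(\<lambda>(x, y). k x y) \<in> borel_measurable (M \<Otimes>\<^sub>M M)" "h \<in> borel_measurable M" "F \<in> borel_measurable M"
    and k: "\<And>x y. k x y \<ge> 0" and sym: "\<And>x y. k x y = k y x" and h: "AE x in M. h x > 0" and C: "C \<ge> 0"
    and S: "AE z in M. (\<integral>\<^sup>+w. ennreal (k z w * h w) \<partial>M) \<le> ennreal (C * h z)"
  shows "(\<integral>\<^sup>+w. (\<integral>\<^sup>+z. ennreal (k z w) * F z \<partial>M)\<^sup>2 \<partial>M) \<le> ennreal (C\<^sup>2) * (\<integral>\<^sup>+z. (F z)\<^sup>2 \<partial>M)"
proof -
  interpret sigma_finite_measure M by fact
  interpret P: pair_sigma_finite M M ..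
  \<comment> \<open>F^2 / h, with the value 0 on the null set where h is not positive.\<close>
  define q where "q = (\<lambda>z. (if h z > 0 then (F z)\<^sup>2 * ennreal (1 / h z) else 0))"
  have [measurable]: "q \<in> borel_measurable M" unfolding q_def by measurable
  have "AE w in M. (\<integral>\<^sup>+z. ennreal (k z w) * F z \<partial>M)\<^sup>2 \<le> ennreal (C * h w) * (\<integral>\<^sup>+z. ennreal (k z w) * q z \<partial>M)"
    using S AE_space
  proof eventually_elim
    case (elim w)
    show ?case
    proof -
      have [measurable]: "(\<lambda>z. k z w) \<in> borel_measurable M" using elim by measurable
      have "(\<integral>\<^sup>+z. ennreal (k z w) * F z \<partial>M) = (\<integral>\<^sup>+z. ennreal (sqrt (k z w * max 0 (h z))) * ((if h z > 0 then ennreal (sqrt (k z w / h z)) else 0) * F z) \<partial>M)"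
      proof (rule nn_integral_cong_AE, use h in eventually_elim)
        case (elim z)
        have "ennreal (sqrt (k z w * h z)) * ennreal (sqrt (k z w / h z)) = ennreal (k z w)"
          using elim k[of z w] by (simp add: ennreal_mult[symmetric] real_sqrt_mult[symmetric])
        then show ?case using elim by (simp add: mult.assoc[symmetric])
      qed
      also have "\<dots>\<^sup>2 \<le> (\<integral>\<^sup>+z. (ennreal (sqrt (k z w * max 0 (h z))))\<^sup>2 \<partial>M) * (\<integral>\<^sup>+z. ((if h z > 0 then ennreal (sqrt (k z w / h z)) else 0) * F z)\<^sup>2 \<partial>M)"
        by (rule Cauchy_Schwarz_nn_integral) auto
      also have "(\<integral>\<^sup>+z. (ennreal (sqrt (k z w * max 0 (h z))))\<^sup>2 \<partial>M) = (\<integral>\<^sup>+z. ennreal (k w z * h z) \<partial>M)"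
      proof (rule nn_integral_cong_AE, use h in eventually_elim)
        case (elim z)
        then show ?case using k[of z w] by (simp add: ennreal_power sym[of w z])
      qed
      also have "(\<integral>\<^sup>+z. ((if h z > 0 then ennreal (sqrt (k z w / h z)) else 0) * F z)\<^sup>2 \<partial>M) = (\<integral>\<^sup>+z. ennreal (k z w) * q z \<partial>M)"
      proof (rule nn_integral_cong)
        fix z
        have "(ennreal (sqrt (k z w / h z)) * F z)\<^sup>2 = ennreal (k z w) * ((F z)\<^sup>2 * ennreal (1 / h z))" if "h z > 0"

        proof -
          have "(ennreal (sqrt (k z w / h z)))\<^sup>2 = ennreal (k z w / h z)" using that k[of z w] by (simp add: ennreal_power)
          also have "\<dots> = ennreal (k z w) * ennreal (1 / h z)" using that k[of z w] by (simp add: ennreal_mult[symmetric])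
          finally show ?thesis by (simp add: power_mult_distrib mult_ac)
        qed
        then show "((if h z > 0 then ennreal (sqrt (k z w / h z)) else 0) * F z)\<^sup>2 = ennreal (k z w) * q z"
          by (simp add: q_def)
      qed
      also have "(\<integral>\<^sup>+z. ennreal (k w z * h z) \<partial>M) * (\<integral>\<^sup>+z. ennreal (k z w) * q z \<partial>M) \<le> ennreal (C * h w) * (\<integral>\<^sup>+z. ennreal (k z w) * q z \<partial>M)"
        using elim(1) by (rule mult_right_mono) simp
      finally show ?thesis .
    qed
  qed
  then have "(\<integral>\<^sup>+w. (\<integral>\<^sup>+z. ennreal (k z w) * F z \<partial>M)\<^sup>2 \<partial>M) \<le> (\<integral>\<^sup>+w. ennreal (C * h w) * (\<integral>\<^sup>+z. ennreal (k z w) * q z \<partial>M) \<partial>M)"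
    by (rule nn_integral_mono_AE)
  also have "\<dots> = (\<integral>\<^sup>+w. \<integral>\<^sup>+z. ennreal (C * h w) * (ennreal (k z w) * q z) \<partial>M \<partial>M)"
    by (intro nn_integral_cong nn_integral_cmult[symmetric]) auto
  also have "\<dots> = (\<integral>\<^sup>+z. \<integral>\<^sup>+w. ennreal (C * h w) * (ennreal (k z w) * q z) \<partial>M \<partial>M)"
    by (rule P.Fubini') auto
  also have "\<dots> \<le> (\<integral>\<^sup>+z. ennreal (C\<^sup>2) * (F z)\<^sup>2 \<partial>M)"
  proof (rule nn_integral_mono_AE, use S h AE_space in eventually_elim)
    case (elim z)
    have [measurable]: "(\<lambda>w. k z w) \<in> borel_measurable M" using elim by measurable
    have "(\<integral>\<^sup>+w. ennreal (C * h w) * (ennreal (k z w) * q z) \<partial>M) = (\<integral>\<^sup>+w. (ennreal C * q z) * ennreal (k z w * h w) \<partial>M)"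
      using C k by (intro nn_integral_cong_AE, use h in eventually_elim) (simp add: ennreal_mult mult_ac)
    also have "\<dots> = (ennreal C * q z) * (\<integral>\<^sup>+w. ennreal (k z w * h w) \<partial>M)" by (rule nn_integral_cmult) auto
    also have "\<dots> \<le> (ennreal C * q z) * ennreal (C * h z)" using elim by (intro mult_left_mono) auto
    also have "\<dots> = ennreal (C\<^sup>2) * (F z)\<^sup>2"
    proof -
      have "ennreal (1 / h z) * ennreal (h z) = 1" using elim by (simp add: ennreal_mult[symmetric])
      then show ?thesis using elim C by (simp add: q_def ennreal_mult power2_eq_square mult_ac)
    qed
    finally show ?case .
  qed
  also have "\<dots> = ennreal (C\<^sup>2) * (\<integral>\<^sup>+z. (F z)\<^sup>2 \<partial>M)" by (rule nn_integral_cmult) auto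
  finally show ?thesis .
qed

section \<open>Single-parameter wavelet estimates\<close>

lemma test_fun_wav: "wavelet \<psi> \<Longrightarrow> snd z > 0 \<Longrightarrow> test_fun (wav \<psi> z)"
  unfolding wav_def of_real_mult by (intro test_fun_cmult test_fun_affine[of "\<lambda>x. complex_of_real (\<psi> x)"] wavelet_test_fun) auto

lemma wav_integral:
  fixes \<psi> :: "'a::euclidean_space \<Rightarrow> real"
  assumes w: "wavelet \<psi>" and t: "snd z > 0"
  shows "integral\<^sup>L lborel (wav \<psi> z) = 0"
    and "(\<integral>v. cmod (wav \<psi> z v) \<partial>lborel) = snd z powr (real DIM('a) / 2) * (\<integral>v. \<bar>\<psi> v\<bar> \<partial>lborel)"
    and "l2norm (wav \<psi> z) = l2norm (\<lambda>v. complex_of_real (\<psi> v))"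
proof -
  let ?n = "real DIM('a)"
  obtain x s where z: "z = (x, s)" by (cases z)
  have s: "s > 0" using t z by simp
  have sn: "s ^ DIM('a) = s powr ?n" using s by (simp add: powr_realpow)
  have m[measurable]: "wav \<psi> z \<in> borel_measurable borel" using test_fun_measurable[OF test_fun_wav[OF w t]] .
  have [measurable]: "\<psi> \<in> borel_measurable borel" by (rule wavelet_measurable[OF w])
  have e: "wav \<psi> z (x + s *\<^sub>R u) = complex_of_real (s powr (- ?n / 2) * \<psi> u)" for u
    using s by (simp add: wav_def z)
  have "integral\<^sup>L lborel (\<lambda>u. complex_of_real (\<psi> u)) = 0" using w by (simp add: wavelet_def)
  then show "integral\<^sup>L lborel (wav \<psi> z) = 0"
    using s by (subst lborel_integral_affine[where c=s and t=x]) (auto simp: e)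
  have "(\<integral>v. cmod (wav \<psi> z v) \<partial>lborel) = s powr ?n * (\<integral>u. s powr (- ?n / 2) * \<bar>\<psi> u\<bar> \<partial>lborel)"
    using s by (subst lborel_integral_affine[where c=s and t=x]) (auto simp: e sn norm_mult abs_mult)
  also have "\<dots> = (s powr ?n * s powr (- ?n / 2)) * (\<integral>u. \<bar>\<psi> u\<bar> \<partial>lborel)" by simp
  also have "s powr ?n * s powr (- ?n / 2) = s powr (?n / 2)" by (simp add: powr_add[symmetric])
  finally show "(\<integral>v. cmod (wav \<psi> z v) \<partial>lborel) = snd z powr (?n / 2) * (\<integral>v. \<bar>\<psi> v\<bar> \<partial>lborel)" by (simp add: z)
  have "(\<integral>v. (cmod (wav \<psi> z v))\<^sup>2 \<partial>lborel) = s powr ?n * (\<integral>u. (s powr (- ?n / 2))\<^sup>2 * (cmod (complex_of_real (\<psi> u)))\<^sup>2 \<partial>lborel)"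
    using s by (subst lborel_integral_affine[where c=s and t=x]) (auto simp: e sn power_mult_distrib norm_mult)
  also have "\<dots> = (s powr ?n * (s powr (- ?n / 2))\<^sup>2) * (\<integral>u. (cmod (complex_of_real (\<psi> u)))\<^sup>2 \<partial>lborel)" by simp
  also have "s powr ?n * (s powr (- ?n / 2))\<^sup>2 = 1" using s by (simp add: power2_eq_square powr_add[symmetric])
  finally show "l2norm (wav \<psi> z) = l2norm (\<lambda>v. complex_of_real (\<psi> v))" by (simp add: l2norm_def)
qed

lemma norm_div_dist: "t > 0 \<Longrightarrow> norm ((u - x) /\<^sub>R t) = dist u x / t"
  by (simp add: dist_norm divide_inverse mult.commute)

lemma wav_supp:
  assumes w: "wavelet \<psi>" and t: "t > 0" and "wav \<psi> (x, t) u \<noteq> 0" shows "dist u x < t"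
proof (rule ccontr)
  assume "\<not> dist u x < t"
  then have "norm ((u - x) /\<^sub>R t) \<ge> 1" using t by (simp add: norm_div_dist del: norm_scaleR)
  then show False using wavelet_supp[OF w] assms(3) by (simp add: wav_def)
qed

text \<open>The closed support has to be located, not just the set where the wavelet is nonzero,
  since disjointness in the kernel representation refers to closures.\<close>

lemma wav_tsupp:
  assumes w: "wavelet \<psi>" and t: "t > 0" shows "tsupp (wav \<psi> (x, t)) \<subseteq> ball x t"
proof -
  define S where "S = (\<lambda>u. (u - x) /\<^sub>R t) -` closure {x. \<psi> x \<noteq> 0}"
  have "closed S" unfolding S_def by (intro continuous_closed_vimage closed_closure continuous_intros)
  then have "tsupp (wav \<psi> (x, t)) \<subseteq> S"
    by (rule tsupp_subset) (use closure_subset[of "{x. \<psi> x \<noteq> 0}"] in \<open>auto simp: S_def wav_def\<close>)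
  also have "S \<subseteq> ball x t"
  proof
    fix u assume "u \<in> S"
    then have "(u - x) /\<^sub>R t \<in> ball 0 1" using w unfolding wavelet_def S_def by blast
    then have "norm ((u - x) /\<^sub>R t) < 1" unfolding mem_ball dist_norm diff_0 norm_minus_cancel .
    then show "u \<in> ball x t" using t unfolding norm_div_dist[OF t] by (simp add: dist_commute)
  qed
  finally show ?thesis .
qed

lemma wav_bounds:
  fixes \<psi> :: "'a::euclidean_space \<Rightarrow> real"
  assumes w: "wavelet \<psi>"
  obtains A L where "A > 0" "L > 0"
    "\<And>x t u. t > 0 \<Longrightarrow> cmod (wav \<psi> (x, t) u) \<le> A * t powr (- real DIM('a) / 2)"
    "\<And>x t u v. t > 0 \<Longrightarrow> cmod (wav \<psi> (x, t) u - wav \<psi> (x, t) v) \<le> L * t powr (- real DIM('a) / 2) * (dist u v / t)"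
proof -
  obtain A where A: "A > 0" "\<And>x. cmod (complex_of_real (\<psi> x)) \<le> A" using test_fun_bounded[OF wavelet_test_fun[OF w]] by blast
  obtain L where L: "L > 0" "\<And>x y. cmod (complex_of_real (\<psi> x) - complex_of_real (\<psi> y)) \<le> L * dist x y" using test_fun_lipschitz[OF wavelet_test_fun[OF w]] by blast
  have 1: "cmod (wav \<psi> (x, t) u) \<le> A * t powr (- real DIM('a) / 2)" for x t u
    using mult_left_mono[OF A(2)[of "(u - x) /\<^sub>R t"], of "t powr (- real DIM('a) / 2)"] by (simp add: wav_def norm_mult mult.commute abs_mult)
  have 2: "cmod (wav \<psi> (x, t) u - wav \<psi> (x, t) v) \<le> L * t powr (- real DIM('a) / 2) * (dist u v / t)" if "t > 0" for x t u v
  proof -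
    let ?u = "(u - x) /\<^sub>R t" and ?v = "(v - x) /\<^sub>R t"
    have d: "dist ?u ?v = dist u v / t" using that by (simp add: dist_norm scaleR_diff_right[symmetric] divide_inverse)
    have "wav \<psi> (x, t) u - wav \<psi> (x, t) v = complex_of_real (t powr (- real DIM('a) / 2)) * (complex_of_real (\<psi> ?u) - complex_of_real (\<psi> ?v))"
      by (simp add: wav_def algebra_simps)
    then have "cmod (wav \<psi> (x, t) u - wav \<psi> (x, t) v) = t powr (- real DIM('a) / 2) * cmod (complex_of_real (\<psi> ?u) - complex_of_real (\<psi> ?v))"
      by (simp add: norm_mult)
    also have "\<dots> \<le> t powr (- real DIM('a) / 2) * (L * dist ?u ?v)" by (intro mult_left_mono L) auto
    finally show ?thesis unfolding d by (simp add: mult_ac)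
  qed
  show thesis using that[OF A(1) L(1)] 1 2 by blast
qed

lemma l2norm_le_cball:
  fixes f :: "'a::euclidean_space \<Rightarrow> complex"
  assumes f: "f \<in> borel_measurable borel" and c: "c \<ge> 0" and r: "r \<ge> 0"
    and b: "\<And>u. dist u y \<le> r \<Longrightarrow> cmod (f u) \<le> c" and z: "\<And>u. dist u y > r \<Longrightarrow> f u = 0"
  shows "l2norm f \<le> c * sqrt (unit_ball_vol (real DIM('a)) * r ^ DIM('a))"
proof -
  have i: "integrable lborel (\<lambda>u. c\<^sup>2 * indicat_real (cball y r) u)" by (intro integrable_mult_right integrable_real_indicator) (auto simp: emeasure_cball r)
  have "(\<integral>u. (cmod (f u))\<^sup>2 \<partial>lborel) \<le> (\<integral>u. c\<^sup>2 * indicat_real (cball y r) u \<partial>lborel)"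
  proof (rule integral_mono_AE')
    show "AE u in lborel. (cmod (f u))\<^sup>2 \<le> c\<^sup>2 * indicat_real (cball y r) u"
      using b z by (intro AE_I2) (auto simp: indicator_def dist_commute not_le intro!: power_mono)
  qed (use i in auto)
  also have "\<dots> = c\<^sup>2 * (unit_ball_vol (real DIM('a)) * r ^ DIM('a))" using r by (simp add: content_cball)
  finally have "l2norm f \<le> sqrt (c\<^sup>2 * (unit_ball_vol (real DIM('a)) * r ^ DIM('a)))" unfolding l2norm_def by simp
  then show ?thesis using c by (simp add: real_sqrt_mult)
qed

text \<open>No correction is made here: the supports are disjoint and the mean of the narrower
  wavelet suffices. On the support of the wider one |u - y| >= d - t >= 2d/3. The result s^\<delta>
  (st)^(n/2) d^(-n-\<delta>) exceeds the decay of \<open>hker\<close> with exponent \<delta>/2 by a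
  factor comparable to (s/(t+d))^(\<delta>/2), which is at most a constant.\<close>

lemma wavelet_pair_far:
  fixes \<psi> :: "'a::euclidean_space \<Rightarrow> real"
  assumes w: "wavelet \<psi>" and \<delta>: "0 < \<delta>" and s: "0 < s" "s \<le> t" and far: "3 * t \<le> dist x y"
  shows "good \<delta> ((\<integral>v. \<bar>\<psi> v\<bar> \<partial>lborel)\<^sup>2 * 2 powr (real DIM('a) + \<delta>) * hker (\<delta> / 2) (x, t) (y, s)) (wav \<psi> (x, t)) (wav \<psi> (y, s))"
proof -
  let ?n = "real DIM('a)" 
  define d where "d = dist x y"
  define A1 where "A1 = (\<integral>v. \<bar>\<psi> v\<bar> \<partial>lborel)"
  have A1: "A1 \<ge> 0" by (simp add: A1_def)
  have t: "t > 0" using s by simp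
  have d: "d > 0" "3 * t \<le> d" using far t by (auto simp: d_def)
  have tf: "test_fun (wav \<psi> (x, t))" "test_fun (wav \<psi> (y, s))" using test_fun_wav[OF w] s t by auto
  define D where "D = (\<lambda>u. cmod (wav \<psi> (x, t) u) * (2 / 3 * d) powr - (?n + \<delta>))"
  have far_u: "2 / 3 * d \<le> dist u y" "2 * s \<le> dist u y" if "wav \<psi> (x, t) u \<noteq> 0" for u
  proof -
    have "dist u x < t" using wav_supp[OF w t that] .
    moreover have "d \<le> dist u x + dist u y" unfolding d_def using dist_triangle[of x y u] by (simp add: dist_commute)
    ultimately show "2 / 3 * d \<le> dist u y" "2 * s \<le> dist u y" using d s by linarith+
  qed
  have "kgood \<delta> (s powr \<delta> * (\<integral>v. cmod (wav \<psi> (y, s) v) \<partial>lborel) * integral\<^sup>L lborel D) (wav \<psi> (x, t)) (wav \<psi> (y, s))"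
  proof (rule kgoodI[where c=y])
    show "integral\<^sup>L lborel (wav \<psi> (y, s)) = 0" using wav_integral(1)[OF w, of "(y, s)"] s by simp
    show "dist v y \<le> s" if "wav \<psi> (y, s) v \<noteq> 0" for v using wav_supp[OF w s(1) that] by simp
    show "tsupp (wav \<psi> (x, t)) \<inter> tsupp (wav \<psi> (y, s)) = {}"
    proof -
      have "ball x t \<inter> ball y s = {}"
      proof (rule ccontr)
        assume "ball x t \<inter> ball y s \<noteq> {}"
        then obtain u where "dist x u < t" "dist y u < s" by auto
        then show False using dist_triangle[of x y u] far s t by (simp add: dist_commute)
      qed
      then show ?thesis using wav_tsupp[OF w t, of x] wav_tsupp[OF w s(1), of y] by blast
    qed
    show "integrable lborel D" unfolding D_def using test_fun_integrable[OF tf(1)] by simp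
    show "cmod (wav \<psi> (x, t) u) / dist u y powr (?n + \<delta>) \<le> D u" if "2 * s \<le> dist u y" for u
    proof (cases "wav \<psi> (x, t) u = 0")
      case False
      have "dist u y powr - (?n + \<delta>) \<le> (2 / 3 * d) powr - (?n + \<delta>)"
        using far_u[OF False] d \<delta> by (intro powr_mono2') auto
      then have "cmod (wav \<psi> (x, t) u) * dist u y powr - (?n + \<delta>) \<le> D u" unfolding D_def by (rule mult_left_mono) simp
      then show ?thesis by (simp only: powr_minus divide_inverse)
    qed (simp add: D_def)
    show "D u \<ge> 0" for u by (simp add: D_def)
  qed (use tf \<delta> s far_u in auto)
  moreover have "s powr \<delta> * (\<integral>v. cmod (wav \<psi> (y, s) v) \<partial>lborel) * integral\<^sup>L lborel D \<le> A1\<^sup>2 * 2 powr (?n + \<delta>) * hker (\<delta> / 2) (x, t) (y, s)"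
  proof -
    have i1: "(\<integral>v. cmod (wav \<psi> (y, s) v) \<partial>lborel) = s powr (?n / 2) * A1" using wav_integral(2)[OF w, of "(y, s)"] s by (simp add: A1_def)
    have i2: "integral\<^sup>L lborel D = t powr (?n / 2) * A1 * (2 / 3 * d) powr - (?n + \<delta>)" using wav_integral(2)[OF w, of "(x, t)"] t by (simp add: A1_def D_def)
    \<comment> \<open>Since t <= d/3, the number (t + d)/2 is at most 2d/3.\<close>
    have a1: "(2 / 3 * d) powr - (?n + \<delta>) \<le> ((t + d) / 2) powr - (?n + \<delta>)" using d t \<delta> by (intro powr_mono2') auto
    have a2: "((t + d) / 2) powr - (?n + \<delta>) = 2 powr (?n + \<delta>) * ((t + d) powr - (?n + \<delta> / 2) * (t + d) powr - (\<delta> / 2))"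
    proof -
      have "((t + d) / 2) powr - (?n + \<delta>) = (t + d) powr - (?n + \<delta>) / 2 powr - (?n + \<delta>)" using d t by (simp add: powr_divide)
      also have "\<dots> = 2 powr (?n + \<delta>) * (t + d) powr - (?n + \<delta>)" by (simp only: powr_minus divide_inverse inverse_inverse_eq mult.commute)
      also have "(t + d) powr - (?n + \<delta>) = (t + d) powr - (?n + \<delta> / 2) * (t + d) powr - (\<delta> / 2)" unfolding powr_add[symmetric] by (rule arg_cong[where f="\<lambda>e. (t + d) powr e"]) simp
      finally show ?thesis .
    qed
    have a3: "s powr \<delta> * (t + d) powr - (\<delta> / 2) \<le> s powr (\<delta> / 2)"
    proof -
      have "(t + d) powr - (\<delta> / 2) \<le> s powr - (\<delta> / 2)" using s d t \<delta> by (intro powr_mono2') auto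
      then have "s powr \<delta> * (t + d) powr - (\<delta> / 2) \<le> s powr \<delta> * s powr - (\<delta> / 2)" by (intro mult_left_mono) auto
      also have "\<dots> = s powr (\<delta> / 2)" unfolding powr_add[symmetric] by (rule arg_cong[where f="\<lambda>e. s powr e"]) simp
      finally show ?thesis .
    qed
    have "s powr \<delta> * (\<integral>v. cmod (wav \<psi> (y, s) v) \<partial>lborel) * integral\<^sup>L lborel D = (A1\<^sup>2 * s powr (?n / 2) * t powr (?n / 2) * s powr \<delta>) * (2 / 3 * d) powr - (?n + \<delta>)"
      unfolding i1 i2 by (simp add: power2_eq_square mult_ac)
    also have "\<dots> \<le> (A1\<^sup>2 * s powr (?n / 2) * t powr (?n / 2) * s powr \<delta>) * ((t + d) / 2) powr - (?n + \<delta>)" by (intro mult_left_mono a1) auto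
    also have "\<dots> = (A1\<^sup>2 * 2 powr (?n + \<delta>) * s powr (?n / 2) * t powr (?n / 2) * (t + d) powr - (?n + \<delta> / 2)) * (s powr \<delta> * (t + d) powr - (\<delta> / 2))" unfolding a2 by (simp only: mult_ac)
    also have "\<dots> \<le> (A1\<^sup>2 * 2 powr (?n + \<delta>) * s powr (?n / 2) * t powr (?n / 2) * (t + d) powr - (?n + \<delta> / 2)) * s powr (\<delta> / 2)" by (intro mult_left_mono a3) auto
    also have "\<dots> = A1\<^sup>2 * 2 powr (?n + \<delta>) * ((s powr (?n / 2) * s powr (\<delta> / 2)) * t powr (?n / 2) * (t + d) powr - (?n + \<delta> / 2))" by (simp only: mult_ac)
    also have "\<dots> = A1\<^sup>2 * 2 powr (?n + \<delta>) * hker (\<delta> / 2) (x, t) (y, s)"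
      using s unfolding hker_def d_def powr_add[symmetric] by (simp add: min_absorb2 max_absorb1)
    finally show ?thesis .
  qed
  moreover have "s powr \<delta> * (\<integral>v. cmod (wav \<psi> (y, s) v) \<partial>lborel) * integral\<^sup>L lborel D \<ge> 0" by (intro mult_nonneg_nonneg) (auto simp: D_def)
  ultimately show ?thesis unfolding A1_def using kgood_imp_good[OF _ tf] good_mono by blast
qed

text \<open>The sum t + dist x y is below 4t, so (4t)^(-n-\<epsilon>) is a lower bound for the last
  factor of \<open>hker\<close>.\<close>

lemma hker_near:
  fixes x y :: "'a::euclidean_space"
  assumes "0 < s" "s \<le> t" "dist x y < 3 * t" "\<epsilon> > 0"
  shows "s powr (real DIM('a) / 2 + \<epsilon>) * t powr - (real DIM('a) / 2 + \<epsilon>) \<le> 4 powr (real DIM('a) + \<epsilon>) * hker \<epsilon> (x, t) (y, s)"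
proof -
  let ?n = "real DIM('a)"
  have t: "t > 0" using assms by simp
  have "(4 * t) powr - (?n + \<epsilon>) \<le> (t + dist x y) powr - (?n + \<epsilon>)" using assms t by (intro powr_mono2') (auto simp: add_pos_nonneg)
  then have "4 powr (?n + \<epsilon>) * (s powr (?n / 2 + \<epsilon>) * t powr (?n / 2) * (4 * t) powr - (?n + \<epsilon>)) \<le> 4 powr (?n + \<epsilon>) * (s powr (?n / 2 + \<epsilon>) * t powr (?n / 2) * (t + dist x y) powr - (?n + \<epsilon>))"
    by (intro mult_left_mono) auto
  moreover have "4 powr (?n + \<epsilon>) * (s powr (?n / 2 + \<epsilon>) * t powr (?n / 2) * (4 * t) powr - (?n + \<epsilon>)) = s powr (?n / 2 + \<epsilon>) * t powr - (?n / 2 + \<epsilon>)"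
  proof -
    have e1: "(4 * t) powr - (?n + \<epsilon>) = 4 powr - (?n + \<epsilon>) * t powr - (?n + \<epsilon>)" using t by (simp add: powr_mult)
    have e2: "4 powr (?n + \<epsilon>) * 4 powr - (?n + \<epsilon>) = (1::real)" by (simp add: powr_add[symmetric])
    have e3: "t powr (?n / 2) * t powr - (?n + \<epsilon>) = t powr - (?n / 2 + \<epsilon>)" unfolding powr_add[symmetric] by (rule arg_cong[where f="\<lambda>e. t powr e"]) simp
    have "4 powr (?n + \<epsilon>) * (s powr (?n / 2 + \<epsilon>) * t powr (?n / 2) * (4 * t) powr - (?n + \<epsilon>)) =
        (4 powr (?n + \<epsilon>) * 4 powr - (?n + \<epsilon>)) * s powr (?n / 2 + \<epsilon>) * (t powr (?n / 2) * t powr - (?n + \<epsilon>))"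
      unfolding e1 by (simp only: mult_ac)
    then show ?thesis unfolding e2 e3 by simp
  qed
  moreover have hk: "hker \<epsilon> (x, t) (y, s) = s powr (?n / 2 + \<epsilon>) * t powr (?n / 2) * (t + dist x y) powr - (?n + \<epsilon>)"
    using assms by (simp add: hker_def min_absorb2 max_absorb1)
  ultimately show ?thesis unfolding hk by linarith
qed

text \<open>The function $h = \psi_{(x,t)} - \psi_{(x,t)}(y) \chi_k$ vanishes at $y$ and is Lipschitz at scale $t$, so
  $|h(u)| \le C t^{-n/2} (|u-y|/t)^{\delta/2}$; it is split by a bump of width comparable to $s$ around $y$.\<close>

lemma wavelet_pair_near:
  fixes \<psi> :: "'a::euclidean_space \<Rightarrow> real"
  assumes w: "wavelet \<psi>" and chi: "cutoff chi" and \<delta>: "0 < \<delta>" "\<delta> \<le> 1"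
  obtains C where "C > 0" "\<And>x y t s. 0 < s \<Longrightarrow> s \<le> t \<Longrightarrow> dist x y < 3 * t \<Longrightarrow>
     \<exists>k0. \<forall>k\<ge>k0. good \<delta> (C * hker (\<delta> / 2) (x, t) (y, s)) (\<lambda>u. wav \<psi> (x, t) u - wav \<psi> (x, t) y * dil chi k u) (wav \<psi> (y, s))"
proof -
  let ?n = "real DIM('a)" 
  define \<epsilon> where "\<epsilon> = \<delta> / 2"
  have \<epsilon>: "0 < \<epsilon>" "\<epsilon> \<le> 1" "\<delta> = \<epsilon> + \<epsilon>" using \<delta> by (auto simp: \<epsilon>_def)
  have tc: "test_fun chi" and chi1: "\<And>x. norm x \<le> 1 \<Longrightarrow> chi x = 1" using chi by (auto simp: cutoff_def)
  obtain A L where A: "A > 0" "L > 0" "\<And>x t u. t > 0 \<Longrightarrow> cmod (wav \<psi> (x, t) u) \<le> A * t powr (- ?n / 2)"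
    "\<And>x t u v. t > 0 \<Longrightarrow> cmod (wav \<psi> (x, t) u - wav \<psi> (x, t) v) \<le> L * t powr (- ?n / 2) * (dist u v / t)"
    using wav_bounds[OF w] by metis
  obtain B where B: "B > 0" "\<And>x. cmod (chi x) \<le> B" using test_fun_bounded[OF tc] by blast
  obtain M where M: "M > 0" "\<And>x y. cmod (chi x - chi y) \<le> M * dist x y" using test_fun_lipschitz[OF tc] by blast
  obtain \<rho> where \<rho>: "\<rho> \<ge> 1" "\<And>x. norm x > \<rho> \<Longrightarrow> chi x = 0" using cutoff_bounded_support[OF chi] by blast
  obtain Cd where Cd: "Cd > 0" "\<And>r (c::'a). r > 0 \<Longrightarrow> (\<integral>\<^sup>+u. ennreal ((r + dist u c) powr - (?n + \<epsilon>)) \<partial>lborel) \<le> ennreal (Cd * r powr - \<epsilon>)"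
    using decay_integral[OF \<epsilon>(1)] by metis
  define A1 where "A1 = (\<integral>v. \<bar>\<psi> v\<bar> \<partial>lborel)"
  define A2 where "A2 = l2norm (\<lambda>v. complex_of_real (\<psi> v))"
  define v where "v = unit_ball_vol ?n"
  have nn: "A1 \<ge> 0" "A2 \<ge> 0" "v \<ge> 0" by (auto simp: A1_def A2_def l2norm_nonneg v_def unit_ball_vol_nonneg)
  \<comment> \<open>A (1 + B) bounds h uniformly; L + A M bounds it through the Lipschitz constants
    of the wavelet and of the cut-off.\<close>
  define C0 where "C0 = A * (1 + B) + L + A * M"
  have C0: "C0 > 0" "A * (1 + B) \<le> C0" "L + A * M \<le> C0" using A B M unfolding C0_def by (auto intro!: add_pos_pos mult_pos_pos)
  \<comment> \<open>\<open>Ca\<close> arises from the local part and \<open>Cb\<close> from the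
    off-diagonal part; both are computed at the end of \<open>loc\<close> and \<open>far\<close>
    below.\<close>
  define Ca where "Ca = B * C0 * A2 * sqrt v * (2 * \<rho>) powr (?n / 2 + \<epsilon>)"
  define Cb where "Cb = A1 * (1 + B) * C0 * 2 powr (?n + \<epsilon>) * Cd"
  have nn': "Ca \<ge> 0" "Cb \<ge> 0" unfolding Ca_def Cb_def using nn B C0 Cd by auto
  define C where "C = (Ca + Cb + 1) * 4 powr (?n + \<epsilon>)"
  have C: "C > 0" unfolding C_def using nn' by (intro mult_pos_pos) auto
  have "\<exists>k0. \<forall>k\<ge>k0. good \<delta> (C * hker \<epsilon> (x, t) (y, s)) (\<lambda>u. wav \<psi> (x, t) u - wav \<psi> (x, t) y * dil chi k u) (wav \<psi> (y, s))"
    if s: "0 < s" "s \<le> t" and near: "dist x y < 3 * t" for x y :: 'a and t s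
  proof -
    have t: "t > 0" using s by simp
    \<comment> \<open>(s/t)^(n/2+\<epsilon>), the quantity compared with \<open>hker\<close> in
      \<open>hker_near\<close>.\<close>
    define Q where "Q = s powr (?n / 2 + \<epsilon>) * t powr - (?n / 2 + \<epsilon>)"
    have Q: "(Ca + Cb + 1) * Q \<le> C * hker \<epsilon> (x, t) (y, s)" "Q \<ge> 0"
    proof -
      have "(Ca + Cb + 1) * Q \<le> (Ca + Cb + 1) * (4 powr (?n + \<epsilon>) * hker \<epsilon> (x, t) (y, s))"
        unfolding Q_def using nn' by (intro mult_left_mono hker_near s near \<epsilon>) auto
      then show "(Ca + Cb + 1) * Q \<le> C * hker \<epsilon> (x, t) (y, s)" by (simp add: C_def mult_ac)
      show "Q \<ge> 0" by (simp add: Q_def)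
    qed
    have "good \<delta> ((Ca + Cb + 1) * Q) (\<lambda>u. wav \<psi> (x, t) u - wav \<psi> (x, t) y * dil chi k u) (wav \<psi> (y, s))"
      if k: "k \<ge> nat \<lceil>max 1 (max t (norm y))\<rceil>" for k
    proof -
      \<comment> \<open>k >= |y| puts y where the dilated cut-off equals 1, so that h vanishes at y;
        k >= t gives the dilated cut-off a Lipschitz constant of at most M / t.\<close>
      have k': "real k \<ge> 1" "real k \<ge> t" "real k \<ge> norm y" using k by linarith+
      define al where "al = wav \<psi> (x, t) y"
      define g where "g = wav \<psi> (y, s)"
      define h where "h = (\<lambda>u. wav \<psi> (x, t) u - al * dil chi k u)"
      \<comment> \<open>At width 2s the bump is 1 up to distance 2s from y, so the remainder
        \<open>fb\<close> begins exactly where \<open>kgoodI\<close> wants it; the bump ends at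
        distance 2s\<rho>.\<close>
      define \<eta> where "\<eta> = (\<lambda>u. chi ((u - y) /\<^sub>R (2 * s)))"
      define fa where "fa = (\<lambda>u. h u * \<eta> u)"
      define fb where "fb = (\<lambda>u. h u - fa u)"
      have tg: "test_fun g" unfolding g_def using test_fun_wav[OF w] s by auto
      have th: "test_fun h" unfolding h_def using test_fun_wav[OF w, of "(x, t)"] t k' by (intro test_fun_diff_cmult test_fun_dil tc) auto
      have t\<eta>: "test_fun \<eta>" unfolding \<eta>_def using s by (intro test_fun_affine tc) auto
      have tfa: "test_fun fa" unfolding fa_def by (intro test_fun_mult th t\<eta>)
      have tfb: "test_fun fb" unfolding fb_def by (intro test_fun_diff th tfa)
      have alA: "cmod al \<le> A * t powr (- ?n / 2)" unfolding al_def using A t by blast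
      have dil_y: "dil chi k y = 1" unfolding dil_def using k' by (intro chi1) (simp add: field_simps)
      have h1: "cmod (h u) \<le> C0 * t powr (- ?n / 2)" for u
      proof -
        have "cmod (h u) \<le> cmod (wav \<psi> (x, t) u) + cmod al * cmod (dil chi k u)" unfolding h_def using norm_triangle_ineq4 by (metis norm_mult)
        also have "\<dots> \<le> A * t powr (- ?n / 2) + (A * t powr (- ?n / 2)) * B" using A(1) B alA t by (intro add_mono mult_mono A) (auto simp: dil_def)
        also have "\<dots> = A * (1 + B) * t powr (- ?n / 2)" by (simp add: algebra_simps)
        also have "\<dots> \<le> C0 * t powr (- ?n / 2)" by (intro mult_right_mono C0) auto
        finally show ?thesis .
      qed
      have h2: "cmod (h u) \<le> C0 * t powr (- ?n / 2) * (dist u y / t)" for u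
      proof -
        have "h u = (wav \<psi> (x, t) u - wav \<psi> (x, t) y) - al * (dil chi k u - dil chi k y)" unfolding h_def dil_y by (simp add: al_def algebra_simps)
        then have "cmod (h u) \<le> cmod (wav \<psi> (x, t) u - wav \<psi> (x, t) y) + cmod al * cmod (dil chi k u - dil chi k y)" using norm_triangle_ineq4 by (metis norm_mult)
        also have "\<dots> \<le> L * t powr (- ?n / 2) * (dist u y / t) + (A * t powr (- ?n / 2)) * (M * (dist u y / t))"
        proof (intro add_mono mult_mono A t alA)
          have "cmod (dil chi k u - dil chi k y) \<le> M * dist (u /\<^sub>R real k) (y /\<^sub>R real k)" unfolding dil_def by (rule M)
          also have "dist (u /\<^sub>R real k) (y /\<^sub>R real k) = dist u y / real k" by (simp add: dist_norm scaleR_diff_right[symmetric] divide_inverse)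
          also have "M * (dist u y / real k) \<le> M * (dist u y / t)" using M t k' by (intro mult_left_mono divide_left_mono) auto
          finally show "cmod (dil chi k u - dil chi k y) \<le> M * (dist u y / t)" .
        qed (use A in auto)
        also have "\<dots> = (L + A * M) * (t powr (- ?n / 2) * (dist u y / t))" by (simp add: algebra_simps add_divide_distrib)
        also have "\<dots> \<le> C0 * (t powr (- ?n / 2) * (dist u y / t))" using t by (intro mult_right_mono C0) auto
        finally show ?thesis by (simp add: mult_ac)
      qed
      \<comment> \<open>Interpolation between \<open>h1\<close> and \<open>h2\<close>: min 1 a <=
        a^\<epsilon> for a >= 0 and 0 < \<epsilon> <= 1.\<close>
      have h3: "cmod (h u) \<le> C0 * t powr - (?n / 2 + \<epsilon>) * dist u y powr \<epsilon>" for u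
      proof -
        have "cmod (h u) \<le> C0 * t powr (- ?n / 2) * (dist u y / t) powr \<epsilon>"
        proof (cases "dist u y \<le> t")
          case True
          have "dist u y / t \<le> (dist u y / t) powr \<epsilon>"
          proof (cases "u = y")
            case False
            then have "(dist u y / t) powr 1 \<le> (dist u y / t) powr \<epsilon>" using True t \<epsilon> by (intro powr_mono') auto
            then show ?thesis using t by simp
          qed simp
          then have "C0 * t powr (- ?n / 2) * (dist u y / t) \<le> C0 * t powr (- ?n / 2) * (dist u y / t) powr \<epsilon>" using C0 by (intro mult_left_mono) auto
          then show ?thesis using h2[of u] by linarith
        next
          case False
          then have "1 \<le> (dist u y / t) powr \<epsilon>" using t \<epsilon> by (intro ge_one_powr_ge_zero) auto
          then have "C0 * t powr (- ?n / 2) * 1 \<le> C0 * t powr (- ?n / 2) * (dist u y / t) powr \<epsilon>" using C0 by (intro mult_left_mono) auto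
          then show ?thesis using h1[of u] by linarith
        qed
        also have "(dist u y / t) powr \<epsilon> = dist u y powr \<epsilon> * t powr - \<epsilon>" using t by (simp add: powr_divide) (simp add: powr_minus divide_inverse)
        also have "C0 * t powr (- ?n / 2) * (dist u y powr \<epsilon> * t powr - \<epsilon>) = C0 * (t powr (- ?n / 2) * t powr - \<epsilon>) * dist u y powr \<epsilon>" by simp
        also have "t powr (- ?n / 2) * t powr - \<epsilon> = t powr - (?n / 2 + \<epsilon>)" unfolding powr_add[symmetric] by (rule arg_cong[where f="\<lambda>e. t powr e"]) simp
        finally show ?thesis .
      qed
      have nd: "norm ((u - y) /\<^sub>R (2 * s)) = dist u y / (2 * s)" for u using s by (intro norm_div_dist) auto
      have \<eta>1: "\<eta> u = 1" if "dist u y \<le> 2 * s" for u unfolding \<eta>_def using that s by (intro chi1) (simp only: nd, simp)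
      have \<eta>0: "\<eta> u = 0" if "dist u y > 2 * s * \<rho>" for u unfolding \<eta>_def using that s by (intro \<rho>) (simp only: nd, simp add: pos_less_divide_eq mult.commute)
      have \<eta>B: "cmod (\<eta> u) \<le> B" for u unfolding \<eta>_def by (rule B)
      have loc: "l2norm fa * l2norm g \<le> (Ca + Cb + 1) * Q"
      proof -
        define r where "r = 2 * s * \<rho>"
        have r: "r > 0" unfolding r_def using s \<rho> by simp
        have "l2norm fa \<le> (C0 * t powr - (?n / 2 + \<epsilon>) * r powr \<epsilon> * B) * sqrt (v * r ^ DIM('a))"
          unfolding v_def
        proof (rule l2norm_le_cball[where y=y])
          show "fa \<in> borel_measurable borel" by (rule test_fun_measurable[OF tfa])
          show "0 \<le> C0 * t powr - (?n / 2 + \<epsilon>) * r powr \<epsilon> * B" using C0 B by auto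
          show "cmod (fa u) \<le> C0 * t powr - (?n / 2 + \<epsilon>) * r powr \<epsilon> * B" if "dist u y \<le> r" for u
          proof -
            have "cmod (fa u) \<le> (C0 * t powr - (?n / 2 + \<epsilon>) * dist u y powr \<epsilon>) * B" unfolding fa_def norm_mult using h3[of u] \<eta>B[of u] C0 by (intro mult_mono) auto
            also have "\<dots> \<le> (C0 * t powr - (?n / 2 + \<epsilon>) * r powr \<epsilon>) * B" using that C0 B \<epsilon> by (intro mult_right_mono mult_left_mono powr_mono2) auto
            finally show ?thesis .
          qed
          show "fa u = 0" if "dist u y > r" for u using \<eta>0[of u] that by (simp add: fa_def r_def)
        qed (use r in auto)
        also have "sqrt (v * r ^ DIM('a)) = sqrt v * r powr (?n / 2)" using r by (simp add: real_sqrt_mult powr_realpow[symmetric] powr_half_sqrt[symmetric] powr_powr)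
        also have "(C0 * t powr - (?n / 2 + \<epsilon>) * r powr \<epsilon> * B) * (sqrt v * r powr (?n / 2)) = B * C0 * sqrt v * t powr - (?n / 2 + \<epsilon>) * (r powr (?n / 2) * r powr \<epsilon>)" by simp
        also have "r powr (?n / 2) * r powr \<epsilon> = (2 * \<rho>) powr (?n / 2 + \<epsilon>) * s powr (?n / 2 + \<epsilon>)"
          unfolding powr_add[symmetric] r_def using s \<rho> by (simp add: powr_mult mult_ac)
        finally have "l2norm fa * l2norm g \<le> (B * C0 * sqrt v * t powr - (?n / 2 + \<epsilon>) * ((2 * \<rho>) powr (?n / 2 + \<epsilon>) * s powr (?n / 2 + \<epsilon>))) * A2"
          using wav_integral(3)[OF w, of "(y, s)"] s nn by (simp add: g_def A2_def mult_right_mono)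
        also have "\<dots> = Ca * Q" by (simp add: Ca_def Q_def mult_ac)
        also have "\<dots> \<le> (Ca + Cb + 1) * Q" using Q nn' by (intro mult_right_mono) auto
        finally show ?thesis .
      qed
      have far: "kgood \<delta> ((Ca + Cb + 1) * Q) fb g"
      proof -
        \<comment> \<open>At distance at least 2s from y one has |u - y| >= (s + |u - y|)/2, which
          replaces the singular weight by one integrable on the whole space.\<close>
        define D where "D = (\<lambda>u. ((1 + B) * C0 * t powr - (?n / 2 + \<epsilon>) * 2 powr (?n + \<epsilon>)) * (s + dist u y) powr - (?n + \<epsilon>))"
        have Ds: "(\<integral>\<^sup>+u. ennreal ((s + dist u y) powr - (?n + \<epsilon>)) \<partial>lborel) \<le> ennreal (Cd * s powr - \<epsilon>)" by (rule Cd(2)[OF s(1)])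
        have Di: "integrable lborel (\<lambda>u. (s + dist u y) powr - (?n + \<epsilon>))"
          using order_le_less_trans[OF Ds ennreal_less_top] by (intro integrableI_nonneg) auto
        have Dint: "(\<integral>u. (s + dist u y) powr - (?n + \<epsilon>) \<partial>lborel) \<le> Cd * s powr - \<epsilon>"
          using Ds Cd by (subst (asm) nn_integral_eq_integral[OF Di]) (auto simp: ennreal_le_iff)
        have fb0: "2 * s \<le> dist u y" if "fb u \<noteq> 0" for u 
        proof (rule ccontr)
          assume "\<not> 2 * s \<le> dist u y"
          then have "\<eta> u = 1" by (intro \<eta>1) simp
          then show False using that by (simp add: fb_def fa_def)
        qed
        have "kgood \<delta> (s powr \<delta> * (\<integral>v. cmod (g v) \<partial>lborel) * integral\<^sup>L lborel D) fb g"
        proof (rule kgoodI[where c=y])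
          show "integral\<^sup>L lborel g = 0" unfolding g_def using wav_integral(1)[OF w, of "(y, s)"] s by simp
          show "dist v y \<le> s" if "g v \<noteq> 0" for v using wav_supp[OF w s(1)] that by (force simp: g_def)
          show "tsupp fb \<inter> tsupp g = {}"
          proof -
            have "tsupp fb \<subseteq> {u. 2 * s \<le> dist u y}"
              using fb0 by (intro tsupp_subset closed_Collect_le continuous_intros) auto
            then show ?thesis using wav_tsupp[OF w s(1), of y] s unfolding g_def by (fastforce simp: dist_commute)
          qed
          show "integrable lborel D" unfolding D_def using Di by (rule integrable_mult_right)
          show "D u \<ge> 0" for u unfolding D_def using C0 B by auto
          show "cmod (fb u) / dist u y powr (?n + \<delta>) \<le> D u" if u: "2 * s \<le> dist u y" for u
          proof -
            let ?d = "dist u y"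
            have d: "?d > 0" using u s by linarith
            have "fb u = h u * (1 - \<eta> u)" by (simp add: fb_def fa_def algebra_simps)
            then have "cmod (fb u) = cmod (h u) * cmod (1 - \<eta> u)" by (simp add: norm_mult)
            also have "\<dots> \<le> (C0 * t powr - (?n / 2 + \<epsilon>) * ?d powr \<epsilon>) * (1 + B)"
              using h3[of u] norm_triangle_ineq4[of 1 "\<eta> u"] \<eta>B[of u] C0 by (intro mult_mono) auto
            finally have "cmod (fb u) / ?d powr (?n + \<delta>) \<le> ((C0 * t powr - (?n / 2 + \<epsilon>) * ?d powr \<epsilon>) * (1 + B)) / ?d powr (?n + \<delta>)" by (intro divide_right_mono) auto
            also have "\<dots> = ((1 + B) * C0 * t powr - (?n / 2 + \<epsilon>)) * (?d powr \<epsilon> * ?d powr - (?n + \<delta>))" by (simp only: powr_minus divide_inverse mult_ac)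
            also have "?d powr \<epsilon> * ?d powr - (?n + \<delta>) = ?d powr - (?n + \<epsilon>)" unfolding powr_add[symmetric] by (rule arg_cong[where f="\<lambda>e. ?d powr e"]) (simp add: \<epsilon>(3))
            also have "((1 + B) * C0 * t powr - (?n / 2 + \<epsilon>)) * ?d powr - (?n + \<epsilon>) \<le> ((1 + B) * C0 * t powr - (?n / 2 + \<epsilon>)) * ((s + ?d) / 2) powr - (?n + \<epsilon>)"
              using B C0 u s \<epsilon> by (intro mult_left_mono powr_mono2') auto
            also have "((s + ?d) / 2) powr - (?n + \<epsilon>) = 2 powr (?n + \<epsilon>) * (s + ?d) powr - (?n + \<epsilon>)"
            proof -
              have "((s + ?d) / 2) powr - (?n + \<epsilon>) = (s + ?d) powr - (?n + \<epsilon>) / 2 powr - (?n + \<epsilon>)" using s d by (simp add: powr_divide)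
              then show ?thesis by (simp only: powr_minus divide_inverse inverse_inverse_eq mult.commute)
            qed
            finally show ?thesis by (simp add: D_def mult_ac)
          qed
        qed (use tfb tg \<delta> s fb0 in auto)
        moreover have "s powr \<delta> * (\<integral>v. cmod (g v) \<partial>lborel) * integral\<^sup>L lborel D \<le> (Ca + Cb + 1) * Q"
        proof -
          have i1: "(\<integral>v. cmod (g v) \<partial>lborel) = s powr (?n / 2) * A1" using wav_integral(2)[OF w, of "(y, s)"] s by (simp add: A1_def g_def)
          have "integral\<^sup>L lborel D = ((1 + B) * C0 * t powr - (?n / 2 + \<epsilon>) * 2 powr (?n + \<epsilon>)) * (\<integral>u. (s + dist u y) powr - (?n + \<epsilon>) \<partial>lborel)" by (simp add: D_def)
          also have "\<dots> \<le> ((1 + B) * C0 * t powr - (?n / 2 + \<epsilon>) * 2 powr (?n + \<epsilon>)) * (Cd * s powr - \<epsilon>)" using B C0 by (intro mult_left_mono Dint) auto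
          finally have "s powr \<delta> * (\<integral>v. cmod (g v) \<partial>lborel) * integral\<^sup>L lborel D \<le> s powr \<delta> * (s powr (?n / 2) * A1) * (((1 + B) * C0 * t powr - (?n / 2 + \<epsilon>) * 2 powr (?n + \<epsilon>)) * (Cd * s powr - \<epsilon>))"
            unfolding i1 using nn by (intro mult_left_mono) auto
          also have "\<dots> = Cb * t powr - (?n / 2 + \<epsilon>) * (s powr \<delta> * s powr (?n / 2) * s powr - \<epsilon>)" by (simp add: Cb_def mult_ac)
          also have "s powr \<delta> * s powr (?n / 2) * s powr - \<epsilon> = s powr (?n / 2 + \<epsilon>)" unfolding powr_add[symmetric] by (rule arg_cong[where f="\<lambda>e. s powr e"]) (simp add: \<epsilon>(3))
          also have "Cb * t powr - (?n / 2 + \<epsilon>) * s powr (?n / 2 + \<epsilon>) = Cb * Q" by (simp add: Q_def mult_ac)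
          also have "\<dots> \<le> (Ca + Cb + 1) * Q" using Q nn' by (intro mult_right_mono) auto
          finally show ?thesis .
        qed
        ultimately show ?thesis unfolding kgood_def using cz_kernel_nonneg by (meson mult_right_mono order_trans)
      qed
      have "S h g = S fa g + S fb g" if "bilinear_on_test S" for S
      proof -
        have "h = (\<lambda>u. 1 * fa u + 1 * fb u)" by (simp add: fb_def)
        moreover have "S (\<lambda>u. 1 * fa u + 1 * fb u) g = 1 * S fa g + 1 * S fb g" using that tfa tfb tg unfolding bilinear_on_test_def by blast
        ultimately show ?thesis by simp
      qed
      then have "good \<delta> ((Ca + Cb + 1) * Q) h g" unfolding good_def using tfa tg tfb loc far by blast
      then show ?thesis unfolding h_def g_def al_def .
    qed
    then show ?thesis using good_mono[OF _ Q(1)] by blast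
  qed
  then show thesis using that[OF C] unfolding \<epsilon>_def by blast
qed

text \<open>If a correction is made, it falls on the wider wavelet, so at most one coefficient is
  nonzero. The condition al * be = 0 matters, since full cancellation says nothing about the
  function 1 in both slots of the same variable.\<close>

lemma wavelet_pair_good:
  fixes \<psi> :: "'a::euclidean_space \<Rightarrow> real"
  assumes w: "wavelet \<psi>" and chi: "cutoff chi" and \<delta>: "0 < \<delta>" "\<delta> \<le> 1"
  obtains C where "C > 0" "\<And>z w. snd z > 0 \<Longrightarrow> snd w > 0 \<Longrightarrow> \<exists>al be k0. al * be = 0 \<and> (\<forall>k\<ge>k0.
     good \<delta> (C * hker (\<delta> / 2) z w) (\<lambda>u. wav \<psi> z u - al * dil chi k u) (\<lambda>u. wav \<psi> w u - be * dil chi k u))"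
proof -
  obtain C1 where C1: "C1 > 0" "\<And>x y t s. 0 < s \<Longrightarrow> s \<le> t \<Longrightarrow> dist x y < 3 * t \<Longrightarrow>
     \<exists>k0. \<forall>k\<ge>k0. good \<delta> (C1 * hker (\<delta> / 2) (x, t) (y, s)) (\<lambda>u. wav \<psi> (x, t) u - wav \<psi> (x, t) y * dil chi k u) (wav \<psi> (y, s))"
    using wavelet_pair_near[OF w chi \<delta>] by blast
  define C2 where "C2 = (\<integral>v. \<bar>\<psi> v\<bar> \<partial>lborel)\<^sup>2 * 2 powr (real DIM('a) + \<delta>)"
  have C2: "C2 \<ge> 0" by (simp add: C2_def)
  have le: "\<exists>al k0. \<forall>k\<ge>k0. good \<delta> ((C1 + C2) * hker (\<delta> / 2) (x, t) (y, s)) (\<lambda>u. wav \<psi> (x, t) u - al * dil chi k u) (wav \<psi> (y, s))"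
    if s: "0 < s" "s \<le> t" for x y :: 'a and t s
  proof (cases "dist x y < 3 * t")
    case True
    have "C1 * hker (\<delta> / 2) (x, t) (y, s) \<le> (C1 + C2) * hker (\<delta> / 2) (x, t) (y, s)" using C2 by (intro mult_right_mono hker_nonneg) auto
    then show ?thesis using C1(2)[OF s True] good_mono by blast
  next
    case False
    have "C2 * hker (\<delta> / 2) (x, t) (y, s) \<le> (C1 + C2) * hker (\<delta> / 2) (x, t) (y, s)" using C1 by (intro mult_right_mono hker_nonneg) auto
    moreover have "good \<delta> (C2 * hker (\<delta> / 2) (x, t) (y, s)) (wav \<psi> (x, t)) (wav \<psi> (y, s))"
      unfolding C2_def using False by (intro wavelet_pair_far w \<delta>(1) s) auto
    ultimately have "good \<delta> ((C1 + C2) * hker (\<delta> / 2) (x, t) (y, s)) (wav \<psi> (x, t)) (wav \<psi> (y, s))"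
      using good_mono by blast
    then show ?thesis by (intro exI[of _ 0]) simp
  qed
  have "\<exists>al be k0. al * be = 0 \<and> (\<forall>k\<ge>k0. good \<delta> ((C1 + C2) * hker (\<delta> / 2) z w) (\<lambda>u. wav \<psi> z u - al * dil chi k u) (\<lambda>u. wav \<psi> w u - be * dil chi k u))"
    if pos: "snd z > 0" "snd w > 0" for z w :: "'a \<times> real"
  proof (cases "snd w \<le> snd z")
    case True
    then obtain al k0 where "\<forall>k\<ge>k0. good \<delta> ((C1 + C2) * hker (\<delta> / 2) z w) (\<lambda>u. wav \<psi> z u - al * dil chi k u) (wav \<psi> w)"
      using le[of "snd w" "snd z" "fst z" "fst w"] pos unfolding prod.collapse by blast
    then show ?thesis by (intro exI[of _ al] exI[of _ 0] exI[of _ k0]) simp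
  next
    case False
    then obtain al k0 where "\<forall>k\<ge>k0. good \<delta> ((C1 + C2) * hker (\<delta> / 2) w z) (\<lambda>u. wav \<psi> w u - al * dil chi k u) (wav \<psi> z)"
      using le[of "snd z" "snd w" "fst w" "fst z"] pos unfolding prod.collapse by (meson nle_le)
    then have "\<forall>k\<ge>k0. good \<delta> ((C1 + C2) * hker (\<delta> / 2) z w) (wav \<psi> z) (\<lambda>u. wav \<psi> w u - al * dil chi k u)"
      unfolding hker_sym[of _ z w] using good_sym[OF _ \<delta>(1)] by blast
    then show ?thesis by (intro exI[of _ 0] exI[of _ al] exI[of _ k0]) simp
  qed
  then show thesis using that[of "C1 + C2"] C1 C2 by auto
qed

section \<open>Completeness and the Riesz representation\<close>

lemma cnj_measurable [measurable]: "cnj \<in> borel_measurable borel"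
  by (intro borel_measurable_continuous_onI continuous_intros)

lemma sq_int_cnj: assumes "sq_int f" shows "sq_int (\<lambda>x. cnj (f x))"
proof -
  have [measurable]: "f \<in> borel_measurable borel" using assms by (simp add: sq_int_def)
  show ?thesis using assms by (simp add: sq_int_def)
qed

lemma cmod_add_sq: "(cmod (a + c * b))\<^sup>2 = (cmod a)\<^sup>2 + 2 * Re (c * (b * cnj a)) + (cmod c)\<^sup>2 * (cmod b)\<^sup>2"
proof -
  have "complex_of_real ((cmod (a + c * b))\<^sup>2) = (a + c * b) * cnj (a + c * b)" by (simp only: complex_norm_square)
  also have "\<dots> = a * cnj a + (c * (b * cnj a) + cnj (c * (b * cnj a))) + (c * cnj c) * (b * cnj b)"
    by (simp add: algebra_simps)
  also have "\<dots> = complex_of_real ((cmod a)\<^sup>2 + 2 * Re (c * (b * cnj a)) + (cmod c)\<^sup>2 * (cmod b)\<^sup>2)"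
    by (simp only: complex_norm_square[symmetric] complex_add_cnj of_real_add of_real_mult)
  finally show ?thesis using of_real_eq_iff by blast
qed

text \<open>\<open>pair\<close> is bilinear, without conjugation, so the Hermitian product of g with
  f has to be written with an explicit \<open>cnj\<close>. The complex parameter c is what makes the
  identity fit for polarisation.\<close>

lemma l2norm_add_sq:
  assumes f: "sq_int f" and g: "sq_int g"
  shows "(l2norm (\<lambda>x. f x + c * g x))\<^sup>2 = (l2norm f)\<^sup>2 + 2 * Re (c * pair g (\<lambda>x. cnj (f x))) + (cmod c)\<^sup>2 * (l2norm g)\<^sup>2"
proof -
  have cf: "sq_int (\<lambda>x. cnj (f x))" by (rule sq_int_cnj[OF f])
  have i: "integrable lborel (\<lambda>x. (cmod (f x))\<^sup>2)" "integrable lborel (\<lambda>x. (cmod (g x))\<^sup>2)" using f g by (auto simp: sq_int_def)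
  have i2: "integrable lborel (\<lambda>x. c * (g x * cnj (f x)))" using sq_int_mult_integrable[OF g cf] by simp
  have "(l2norm (\<lambda>x. f x + c * g x))\<^sup>2 = (\<integral>x. ((cmod (f x))\<^sup>2 + 2 * Re (c * (g x * cnj (f x)))) + (cmod c)\<^sup>2 * (cmod (g x))\<^sup>2 \<partial>lborel)"
    unfolding l2norm_sq cmod_add_sq by simp
  also have "\<dots> = (\<integral>x. (cmod (f x))\<^sup>2 \<partial>lborel) + 2 * (\<integral>x. Re (c * (g x * cnj (f x))) \<partial>lborel) + (cmod c)\<^sup>2 * (\<integral>x. (cmod (g x))\<^sup>2 \<partial>lborel)"

  proof -
    define p where "p = (\<lambda>x. Re (c * (g x * cnj (f x))))"
    have "integrable lborel p" unfolding p_def by (rule integrable_Re[OF i2])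
    moreover have pd: "Re (c * (g x * cnj (f x))) = p x" for x by (simp add: p_def)
    ultimately show ?thesis unfolding pd using i by simp
  qed
  also have "(\<integral>x. Re (c * (g x * cnj (f x))) \<partial>lborel) = Re (c * pair g (\<lambda>x. cnj (f x)))"
    using integral_Re[OF i2] by (simp add: pair_def)
  finally show ?thesis by (simp only: l2norm_sq)
qed

lemma l2norm_cnj: "l2norm (\<lambda>x. cnj (f x)) = l2norm f" by (simp add: l2norm_def)

text \<open>Along a subsequence with successive differences d_k of norm below 2^(-k), the sum of 2^k
  |d_k|^2 has finite integral. It is thus finite almost everywhere, which forces |d_k| <= const *
  2^(-k/2) and pointwise convergence. Fatou's lemma then carries the Cauchy estimate to the
  limit.\<close>

lemma L2_complete:
  fixes f :: "nat \<Rightarrow> 'a::euclidean_space \<Rightarrow> complex"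
  assumes f: "\<And>k. sq_int (f k)" and C: "\<And>e. e > 0 \<Longrightarrow> \<exists>N. \<forall>m\<ge>N. \<forall>n\<ge>N. l2norm (\<lambda>x. f m x - f n x) < e"
  obtains g where "sq_int g" "(\<lambda>k. l2norm (\<lambda>x. f k x - g x)) \<longlonglongrightarrow> 0"
proof -
  have fm[measurable]: "f k \<in> borel_measurable borel" for k using f by (auto simp: sq_int_def)
  have "\<forall>k. \<exists>N. \<forall>m\<ge>N. \<forall>n\<ge>N. l2norm (\<lambda>x. f m x - f n x) < (1/2)^k" using C by simp
  then obtain N where N: "\<And>k m n. m \<ge> N k \<Longrightarrow> n \<ge> N k \<Longrightarrow> l2norm (\<lambda>x. f m x - f n x) < (1/2)^k" by metis
  \<comment> \<open>Partial sums dominate every \<open>N i\<close> with i <= k; the summand k makes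
    r strictly increasing even where N is 0.\<close>
  define r where "r = (\<lambda>k. (\<Sum>i\<le>k. N i) + k)"
  have rN: "r k \<ge> N k" for k unfolding r_def using member_le_sum[of k "{..k}" N] by simp
  have rmono: "strict_mono r" unfolding r_def strict_mono_Suc_iff by simp
  define d where "d = (\<lambda>k x. f (r (Suc k)) x - f (r k) x)"
  have dm[measurable]: "d k \<in> borel_measurable borel" for k unfolding d_def by measurable
  have ds: "sq_int (d k)" for k unfolding d_def by (intro sq_int_diff f)
  have dn: "l2norm (d k) < (1/2)^k" for k unfolding d_def
    using N[of k "r (Suc k)" "r k"] rN[of k] strict_monoD[OF rmono, of k "Suc k"] by simp
  have "(\<integral>\<^sup>+x. (\<Sum>k. ennreal (2^k * (cmod (d k x))\<^sup>2)) \<partial>lborel) = (\<Sum>k. \<integral>\<^sup>+x. ennreal (2^k * (cmod (d k x))\<^sup>2) \<partial>lborel)"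
    by (rule nn_integral_suminf) auto
  also have "\<dots> \<le> (\<Sum>k. ennreal ((1/2)^k))"
  proof (rule suminf_le)
    fix k
    have "(\<integral>\<^sup>+x. ennreal (2^k * (cmod (d k x))\<^sup>2) \<partial>lborel) = ennreal (2^k) * ennreal ((l2norm (d k))\<^sup>2)"
      by (subst nn_integral_l2norm[OF ds, symmetric], subst nn_integral_cmult[symmetric]) (auto simp: ennreal_mult)
    also have "\<dots> = ennreal (2^k * (l2norm (d k))\<^sup>2)" by (simp add: ennreal_mult)
    also have "\<dots> \<le> ennreal (2^k * ((1/2)^k)\<^sup>2)" using dn[of k] l2norm_nonneg[of "d k"] by (intro ennreal_leI mult_left_mono power_mono) auto
    also have "(2::real)^k * ((1/2)^k)\<^sup>2 = (1/2)^k" by (simp add: power2_eq_square power_mult_distrib[symmetric] field_simps)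
    finally show "(\<integral>\<^sup>+x. ennreal (2^k * (cmod (d k x))\<^sup>2) \<partial>lborel) \<le> ennreal ((1/2)^k)" .
  qed auto
  also have "\<dots> = ennreal (\<Sum>k. (1/2::real)^k)" by (rule suminf_ennreal2) (auto intro!: summable_geometric)
  finally have "(\<integral>\<^sup>+x. (\<Sum>k. ennreal (2^k * (cmod (d k x))\<^sup>2)) \<partial>lborel) \<noteq> \<infinity>" by (auto simp: top_unique)
  then have "AE x in lborel. (\<Sum>k. ennreal (2^k * (cmod (d k x))\<^sup>2)) \<noteq> \<infinity>"
    by (intro nn_integral_PInf_AE) auto
  then have conv: "AE x in lborel. convergent (\<lambda>k. f (r k) x)"
  proof eventually_elim
    case (elim x)
    define S where "S = (\<Sum>k. ennreal (2^k * (cmod (d k x))\<^sup>2))"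
    have "S \<noteq> top" using elim unfolding S_def infinity_ennreal_def .
    then obtain c where c: "c \<ge> 0" "S = ennreal c" by (cases S rule: ennreal_cases) auto
    have b: "cmod (d k x) \<le> sqrt c * (sqrt (1/2))^k" for k
    proof -
      have "(\<Sum>k\<in>{k}. ennreal (2^k * (cmod (d k x))\<^sup>2)) \<le> ennreal c"
        unfolding c(2)[symmetric] S_def by (rule sum_le_suminf) auto
      then have "ennreal (2^k * (cmod (d k x))\<^sup>2) \<le> ennreal c" by (simp del: ennreal_le_iff)
      then have "2^k * (cmod (d k x))\<^sup>2 \<le> c" using c(1) by (simp add: ennreal_le_iff)
      then have "(cmod (d k x))\<^sup>2 \<le> c * (1/2)^k" by (simp add: field_simps power_divide)
      then have "cmod (d k x) \<le> sqrt (c * (1/2)^k)" by (rule real_le_rsqrt)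
      then show ?thesis by (simp only: real_sqrt_mult real_sqrt_power)
    qed
    have "sqrt (1/2) < sqrt 1" by (subst real_sqrt_less_iff) simp
    then have "summable (\<lambda>k. sqrt c * (sqrt (1/2))^k)" by (intro summable_mult summable_geometric) auto
    then have "summable (\<lambda>k. d k x)" using b by (rule summable_comparison_test'[where N=0])
    then have "(\<lambda>n. \<Sum>k<n. d k x) \<longlonglongrightarrow> suminf (\<lambda>k. d k x)" by (rule summable_LIMSEQ)
    moreover have "(\<Sum>k<n. d k x) = f (r n) x - f (r 0) x" for n unfolding d_def by (rule sum_lessThan_telescope)
    ultimately have "(\<lambda>n. (f (r n) x - f (r 0) x) + f (r 0) x) \<longlonglongrightarrow> suminf (\<lambda>k. d k x) + f (r 0) x" by (intro tendsto_add) auto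
    then show ?case unfolding convergent_def by auto
  qed
  define g where "g = (\<lambda>x. lim (\<lambda>k. f (r k) x))"
  have gm[measurable]: "g \<in> borel_measurable borel" unfolding g_def by measurable
  have bound: "(\<integral>\<^sup>+x. ennreal ((cmod (f m x - g x))\<^sup>2) \<partial>lborel) \<le> ennreal (e\<^sup>2)" if e: "e > 0" and m: "m \<ge> M" and M: "\<forall>m\<ge>M. \<forall>n\<ge>M. l2norm (\<lambda>x. f m x - f n x) < e" for e m M
  proof -
    have "(\<integral>\<^sup>+x. ennreal ((cmod (f m x - g x))\<^sup>2) \<partial>lborel) = (\<integral>\<^sup>+x. liminf (\<lambda>k. ennreal ((cmod (f m x - f (r k) x))\<^sup>2)) \<partial>lborel)"
    proof (rule nn_integral_cong_AE, use conv in eventually_elim)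
      case (elim x)
      then have "(\<lambda>k. f (r k) x) \<longlonglongrightarrow> g x" unfolding g_def by (rule convergent_LIMSEQ_iff[THEN iffD1])
      then have "(\<lambda>k. ennreal ((cmod (f m x - f (r k) x))\<^sup>2)) \<longlonglongrightarrow> ennreal ((cmod (f m x - g x))\<^sup>2)" by (intro tendsto_intros)
      then show ?case using lim_imp_Liminf[OF sequentially_bot] by metis
    qed
    also have "\<dots> \<le> liminf (\<lambda>k. \<integral>\<^sup>+x. ennreal ((cmod (f m x - f (r k) x))\<^sup>2) \<partial>lborel)" by (rule nn_integral_liminf) auto
    also have "\<dots> \<le> ennreal (e\<^sup>2)"
    proof (rule Liminf_le)
      have "\<forall>\<^sub>F k in sequentially. r k \<ge> M" using filterlim_subseq[OF rmono] by (simp add: filterlim_at_top)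
      then show "\<forall>\<^sub>F k in sequentially. (\<integral>\<^sup>+x. ennreal ((cmod (f m x - f (r k) x))\<^sup>2) \<partial>lborel) \<le> ennreal (e\<^sup>2)"
      proof eventually_elim
        case (elim k)
        then have "l2norm (\<lambda>x. f m x - f (r k) x) < e" using M m by blast
        then have "(l2norm (\<lambda>x. f m x - f (r k) x))\<^sup>2 \<le> e\<^sup>2" using l2norm_nonneg by (intro power_mono) auto
        then show ?case using nn_integral_l2norm[OF sq_int_diff[OF f f]] by (simp add: ennreal_leI)
      qed
    qed simp
    finally show ?thesis .
  qed
  have sfg: "sq_int (\<lambda>x. f m x - g x)" if "m \<ge> M" "\<forall>m\<ge>M. \<forall>n\<ge>M. l2norm (\<lambda>x. f m x - f n x) < 1" for m M
  proof (rule sq_int_nnI)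
    have "(\<integral>\<^sup>+x. ennreal ((cmod (f m x - g x))\<^sup>2) \<partial>lborel) \<le> ennreal (1\<^sup>2)" by (rule bound[OF _ that]) simp
    also have "\<dots> < \<infinity>" by simp
    finally show "(\<integral>\<^sup>+x. ennreal ((cmod (f m x - g x))\<^sup>2) \<partial>lborel) < \<infinity>" .
  qed measurable
  obtain M1 where M1: "\<forall>m\<ge>M1. \<forall>n\<ge>M1. l2norm (\<lambda>x. f m x - f n x) < 1" using C[of 1] by auto
  have "sq_int (\<lambda>x. f M1 x - (f M1 x - g x))" by (intro sq_int_diff f sfg[OF _ M1]) simp
  then have g: "sq_int g" by simp
  have "(\<lambda>k. l2norm (\<lambda>x. f k x - g x)) \<longlonglongrightarrow> 0"
  proof (rule LIMSEQ_I)
    fix e :: real assume "e > 0"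
    then obtain M where M: "\<forall>m\<ge>M. \<forall>n\<ge>M. l2norm (\<lambda>x. f m x - f n x) < e / 2" using C[of "e / 2"] by auto
    have "l2norm (\<lambda>x. f m x - g x) \<le> e / 2" if "m \<ge> M" for m
    proof -
      have "ennreal ((l2norm (\<lambda>x. f m x - g x))\<^sup>2) \<le> ennreal ((e / 2)\<^sup>2)"
        using bound[OF _ that M] \<open>e > 0\<close> nn_integral_l2norm[OF sq_int_diff[OF f g]] by simp
      then have "(l2norm (\<lambda>x. f m x - g x))\<^sup>2 \<le> (e / 2)\<^sup>2" by simp
      then show ?thesis using \<open>e > 0\<close> power2_le_imp_le by fastforce
    qed
    then have "norm (l2norm (\<lambda>x. f n x - g x) - 0) < e" if "n \<ge> M" for n
      using that \<open>e > 0\<close> l2norm_nonneg[of "\<lambda>x. f n x - g x"] by fastforce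
    then show "\<exists>no. \<forall>n\<ge>no. norm (l2norm (\<lambda>x. f n x - g x) - 0) < e" by blast
  qed
  then show thesis using that g by blast
qed

text \<open>The representing function minimises $\|f\|^2 - 2\,\mathrm{Re}\, F f$; the parallelogram law makes every minimising
  sequence Cauchy.\<close>

lemma L2_Riesz:
  fixes F :: "('a::euclidean_space \<Rightarrow> complex) \<Rightarrow> complex"
  assumes lin: "\<And>f g a b. sq_int f \<Longrightarrow> sq_int g \<Longrightarrow> F (\<lambda>x. a * f x + b * g x) = a * F f + b * F g"
    and bd: "\<And>f. sq_int f \<Longrightarrow> cmod (F f) \<le> M * l2norm f"
  obtains h where "sq_int h" "\<And>f. sq_int f \<Longrightarrow> F f = pair f h"
proof -
  define J where "J = (\<lambda>f. (l2norm f)\<^sup>2 - 2 * Re (F f))"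
  have Jlow: "J f \<ge> - M\<^sup>2" if "sq_int f" for f
  proof -
    have "Re (F f) \<le> M * l2norm f" using bd[OF that] complex_Re_le_cmod[of "F f"] by linarith
    moreover have "(l2norm f - M)\<^sup>2 \<ge> 0" by simp
    ultimately show ?thesis unfolding J_def by (simp add: power2_eq_square algebra_simps)
  qed
  define m where "m = Inf (J ` {f. sq_int f})"
  have bb: "bdd_below (J ` {f. sq_int f})" using Jlow by (auto intro!: bdd_belowI)
  have m: "m \<le> J f" if "sq_int f" for f unfolding m_def using bb that by (intro cInf_lower) auto
  have z: "sq_int (\<lambda>x::'a. 0::complex)" by (simp add: sq_int_def)
  have "\<exists>f. sq_int f \<and> J f < m + 1 / (real k + 1)" for k
  proof -
    have "\<exists>y\<in>J ` {f. sq_int f}. y < m + 1 / (real k + 1)"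
      unfolding m_def using z by (intro cInf_lessD) (auto simp: m_def[symmetric])
    then show ?thesis by auto
  qed
  then obtain f where f: "\<And>k. sq_int (f k)" "\<And>k. J (f k) < m + 1 / (real k + 1)" by metis
  have para: "(l2norm (\<lambda>x. u x - v x))\<^sup>2 \<le> 2 * (J u - m) + 2 * (J v - m)" if u: "sq_int u" and v: "sq_int v" for u v
  proof -
    have 1: "(l2norm (\<lambda>x. u x + (-1) * v x))\<^sup>2 = (l2norm u)\<^sup>2 + 2 * Re ((-1) * pair v (\<lambda>x. cnj (u x))) + (cmod (-1))\<^sup>2 * (l2norm v)\<^sup>2" by (rule l2norm_add_sq[OF u v])
    have 2: "(l2norm (\<lambda>x. u x + 1 * v x))\<^sup>2 = (l2norm u)\<^sup>2 + 2 * Re (1 * pair v (\<lambda>x. cnj (u x))) + (cmod 1)\<^sup>2 * (l2norm v)\<^sup>2" by (rule l2norm_add_sq[OF u v])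
    have 3: "J (\<lambda>x. (1/2) * u x + (1/2) * v x) = (l2norm (\<lambda>x. (1/2) * (u x + 1 * v x)))\<^sup>2 - Re (F u) - Re (F v)"
      unfolding J_def using lin[OF u v, of "1/2" "1/2"] by (simp add: algebra_simps add_divide_distrib)
    have 4: "m \<le> J (\<lambda>x. (1/2) * u x + (1/2) * v x)" by (intro m sq_int_lincomb u v)
    have 5: "(l2norm (\<lambda>x. (1/2) * (u x + 1 * v x)))\<^sup>2 = (1/4) * (l2norm (\<lambda>x. u x + 1 * v x))\<^sup>2" unfolding l2norm_cmult by (simp add: power2_eq_square)
    have "(l2norm (\<lambda>x. u x - v x))\<^sup>2 = (l2norm (\<lambda>x. u x + (-1) * v x))\<^sup>2" by simp
    then show ?thesis using 1 2 3 4 5 unfolding J_def by simp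
  qed
  have Cau: "\<exists>N. \<forall>j\<ge>N. \<forall>k\<ge>N. l2norm (\<lambda>x. f j x - f k x) < e" if e: "e > 0" for e
  proof -
    obtain N where N: "real N > 4 / e\<^sup>2" using reals_Archimedean2 by blast
    have "l2norm (\<lambda>x. f j x - f k x) < e" if "j \<ge> N" "k \<ge> N" for j k
    proof -
      have *: "J (f i) - m < e\<^sup>2 / 4" if "i \<ge> N" for i
      proof -
        have "4 / e\<^sup>2 < real i + 1" using N that by linarith
        then have "1 / (real i + 1) < e\<^sup>2 / 4" using e by (simp add: field_simps)
        then show ?thesis using f(2)[of i] by linarith
      qed
      have "(l2norm (\<lambda>x. f j x - f k x))\<^sup>2 < e\<^sup>2" 
      proof (rule order_le_less_trans[OF para[OF f(1) f(1), of j k]])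
        have "2 * (J (f j) - m) < e\<^sup>2 / 2" "2 * (J (f k) - m) < e\<^sup>2 / 2" using *[OF that(1)] *[OF that(2)] by simp_all
        then have "2 * (J (f j) - m) + 2 * (J (f k) - m) < e\<^sup>2 / 2 + e\<^sup>2 / 2" by (rule add_strict_mono)
        then show "2 * (J (f j) - m) + 2 * (J (f k) - m) < e\<^sup>2" by simp
      qed
      then show ?thesis using e by (meson less_imp_le power2_less_imp_less)
    qed
    then show ?thesis by blast
  qed
  obtain h where h: "sq_int h" "(\<lambda>k. l2norm (\<lambda>x. f k x - h x)) \<longlonglongrightarrow> 0" by (rule L2_complete[of f, OF f(1) Cau])
  \<comment> \<open>The minimiser h represents F in the Hermitian product; in terms of
    \<open>pair\<close> the representing function is its conjugate.\<close>
  have "F g = pair g (\<lambda>x. cnj (h x))" if g: "sq_int g" for g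
  proof -
    define D where "D = pair g (\<lambda>x. cnj (h x)) - F g"
    have lim: "(\<lambda>k. pair g (\<lambda>x. cnj (f k x))) \<longlonglongrightarrow> pair g (\<lambda>x. cnj (h x))"
    proof (rule Lim_null_comparison[THEN LIM_zero_cancel])
      show "\<forall>\<^sub>F k in sequentially. cmod (pair g (\<lambda>x. cnj (f k x)) - pair g (\<lambda>x. cnj (h x))) \<le> l2norm g * l2norm (\<lambda>x. f k x - h x)"
      proof (intro always_eventually allI)
        fix k
        have "pair g (\<lambda>x. 1 * cnj (f k x) + (-1) * cnj (h x)) = 1 * pair g (\<lambda>x. cnj (f k x)) + (-1) * pair g (\<lambda>x. cnj (h x))"
          by (intro pair_lincomb_right sq_int_cnj f h g)
        then have "pair g (\<lambda>x. cnj (f k x)) - pair g (\<lambda>x. cnj (h x)) = pair g (\<lambda>x. cnj (f k x - h x))" by simp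
        moreover have "cmod (pair g (\<lambda>x. cnj (f k x - h x))) \<le> l2norm g * l2norm (\<lambda>x. cnj (f k x - h x))" by (intro cmod_pair_le g sq_int_cnj sq_int_diff f h)
        ultimately show "cmod (pair g (\<lambda>x. cnj (f k x)) - pair g (\<lambda>x. cnj (h x))) \<le> l2norm g * l2norm (\<lambda>x. f k x - h x)" by (simp only: l2norm_cnj)
      qed
      show "(\<lambda>k. l2norm g * l2norm (\<lambda>x. f k x - h x)) \<longlonglongrightarrow> 0" using tendsto_mult_right_zero[OF h(2)] .
    qed
    \<comment> \<open>First-order condition: J is at least m at f_k + c g for every complex c, and J
      f_k tends to m.\<close>
    have ineq: "0 \<le> 2 * Re (c * D) + (cmod c)\<^sup>2 * (l2norm g)\<^sup>2" for c
    proof -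
      have a1: "- (1 / (real k + 1)) \<le> 2 * Re (c * (pair g (\<lambda>x. cnj (f k x)) - F g)) + (cmod c)\<^sup>2 * (l2norm g)\<^sup>2" for k
      proof -
        have "F (\<lambda>x. 1 * f k x + c * g x) = 1 * F (f k) + c * F g" by (rule lin[OF f(1) g])
        then have "J (\<lambda>x. f k x + c * g x) = (l2norm (f k))\<^sup>2 + 2 * Re (c * pair g (\<lambda>x. cnj (f k x))) + (cmod c)\<^sup>2 * (l2norm g)\<^sup>2 - 2 * Re (F (f k) + c * F g)"
          unfolding J_def l2norm_add_sq[OF f(1) g] by simp
        moreover have "m \<le> J (\<lambda>x. f k x + c * g x)" using m[OF sq_int_lincomb[OF f(1) g], of 1 k c] by simp
        ultimately show ?thesis using f(2)[of k] unfolding J_def by (simp add: algebra_simps)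
      qed
      have a2: "(\<lambda>k. 2 * Re (c * (pair g (\<lambda>x. cnj (f k x)) - F g)) + (cmod c)\<^sup>2 * (l2norm g)\<^sup>2) \<longlonglongrightarrow> 2 * Re (c * D) + (cmod c)\<^sup>2 * (l2norm g)\<^sup>2"
        unfolding D_def by (intro tendsto_intros lim)
      have a3: "(\<lambda>k. - (1 / (real k + 1))) \<longlonglongrightarrow> - 0" using LIMSEQ_inverse_real_of_nat by (intro tendsto_minus) (simp add: inverse_eq_divide add.commute)
      have "- 0 \<le> 2 * Re (c * D) + (cmod c)\<^sup>2 * (l2norm g)\<^sup>2" by (rule LIMSEQ_le[OF a3 a2]) (use a1 in blast)
      then show ?thesis by simp
    qed
    define G where "G = (l2norm g)\<^sup>2"
    \<comment> \<open>Taking c = -\<tau> cnj D in \<open>ineq\<close> gives 2 \<tau> |D|^2 <=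
      \<tau>^2 G |D|^2. As \<tau> G <= 1, this forces D = 0; the summand 1 in the denominator covers
      G = 0.\<close>
    define \<tau> where "\<tau> = 1 / (G + 1)"
    have G: "G \<ge> 0" by (simp add: G_def)
    have \<tau>: "\<tau> > 0" "\<tau> * G \<le> 1" unfolding \<tau>_def using G by (auto simp: field_simps)
    have "0 \<le> 2 * Re ((- complex_of_real \<tau> * cnj D) * D) + (cmod (- complex_of_real \<tau> * cnj D))\<^sup>2 * G" using ineq[of "- complex_of_real \<tau> * cnj D"] unfolding G_def .
    moreover have "Re ((- complex_of_real \<tau> * cnj D) * D) = - \<tau> * (cmod D)\<^sup>2"
    proof -
      have "(- complex_of_real \<tau> * cnj D) * D = complex_of_real (- \<tau> * (cmod D)\<^sup>2)" using complex_norm_square[of D] by (simp add: mult_ac)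
      then show ?thesis by (metis Re_complex_of_real)
    qed
    moreover have "(cmod (- complex_of_real \<tau> * cnj D))\<^sup>2 = \<tau> * \<tau> * (cmod D)\<^sup>2" by (simp add: norm_mult power_mult_distrib power2_eq_square)
    ultimately have "2 * \<tau> * (cmod D)\<^sup>2 \<le> \<tau> * ((\<tau> * G) * (cmod D)\<^sup>2)" by (simp add: mult_ac)
    also have "\<dots> \<le> \<tau> * (1 * (cmod D)\<^sup>2)" using \<tau> by (intro mult_left_mono mult_right_mono) auto
    finally have "\<tau> * (cmod D)\<^sup>2 \<le> 0" by simp
    then have "(cmod D)\<^sup>2 \<le> 0" using \<tau> by (simp add: mult_le_0_iff)
    then have "D = 0" by simp
    then show ?thesis by (simp add: D_def)
  qed
  then show thesis using that[OF sq_int_cnj[OF h(1)]] by blast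
qed

section \<open>The Plancherel identity\<close>

lemma (in pair_sigma_finite) integrable_prod_mult:
  fixes f :: "'a \<Rightarrow> complex" and g :: "'b \<Rightarrow> complex"
  assumes f: "integrable M1 f" and g: "integrable M2 g"
  shows "integrable (M1 \<Otimes>\<^sub>M M2) (\<lambda>p. f (fst p) * g (snd p))"
    and "(\<integral>p. f (fst p) * g (snd p) \<partial>(M1 \<Otimes>\<^sub>M M2)) = integral\<^sup>L M1 f * integral\<^sup>L M2 g"
proof -
  have [measurable]: "f \<in> borel_measurable M1" "g \<in> borel_measurable M2" using f g by auto
  show i: "integrable (M1 \<Otimes>\<^sub>M M2) (\<lambda>p. f (fst p) * g (snd p))"
    by (rule Fubini_integrable) (use f g in \<open>auto simp: norm_mult\<close>)
  show "(\<integral>p. f (fst p) * g (snd p) \<partial>(M1 \<Otimes>\<^sub>M M2)) = integral\<^sup>L M1 f * integral\<^sup>L M2 g"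
    using integral_fst'[OF i] by simp
qed

section \<open>The Gaussian as its own Fourier transform\<close>

lemma sum_Basis_inner: "c \<in> Basis \<Longrightarrow> (\<Sum>b\<in>Basis. f b *\<^sub>R b) \<bullet> (c::'a::euclidean_space) = f c"
  by (simp add: inner_sum_left inner_Basis if_distrib sum.delta cong: if_cong)

text \<open>The substitution x = sqrt(2 pi) y reduces this to the characteristic function of the
  standard normal distribution.\<close>

lemma gauss_integral_1d:
  fixes v :: real
  shows "integrable lborel (\<lambda>y. complex_of_real (exp (- pi * y\<^sup>2)) * cis (- 2 * pi * (y * v)))" (is ?i)
    and "(\<integral>y. complex_of_real (exp (- pi * y\<^sup>2)) * cis (- 2 * pi * (y * v)) \<partial>lborel) = complex_of_real (exp (- pi * v\<^sup>2))" (is ?e)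
proof -
  define c where "c = sqrt (2 * pi)"
  have c: "c > 0" "c * c = 2 * pi" unfolding c_def by auto
  have e: "std_normal_density (c * y) = exp (- pi * y\<^sup>2) / c" for y
  proof -
    have "(c * y)\<^sup>2 = 2 * (pi * y\<^sup>2)" using c(2) by (simp add: power2_eq_square algebra_simps)
    then show ?thesis by (simp add: std_normal_density_def c_def)
  qed
  define F where "F = (\<lambda>x. complex_of_real (std_normal_density x) * iexp ((- c * v) * x))"
  have Fm: "F \<in> borel_measurable borel" unfolding F_def by measurable
  have Fi: "integrable lborel F"
    by (rule Bochner_Integration.integrable_bound[of _ std_normal_density])
       (auto simp: F_def norm_mult integrable_normal_density Fm[unfolded F_def])
  have "char std_normal_distribution (- c * v) = integral\<^sup>L lborel F"
    unfolding char_def F_def by (subst integral_density) (auto simp: scaleR_conv_of_real)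
  then have I: "integral\<^sup>L lborel F = complex_of_real (exp (- (- c * v)\<^sup>2 / 2))" by (simp add: char_std_normal_distribution)
  have "(- c * v)\<^sup>2 / 2 = pi * v\<^sup>2" using c(2) by (simp add: power2_eq_square algebra_simps)
  then have I: "integral\<^sup>L lborel F = complex_of_real (exp (- pi * v\<^sup>2))" using I by simp
  have G: "complex_of_real c * F (0 + c *\<^sub>R y) = complex_of_real (exp (- pi * y\<^sup>2)) * cis (- 2 * pi * (y * v))" for y
  proof -
    have r: "(- c * v) * (c * y) = - 2 * pi * (y * v)" using c(2) by (simp add: algebra_simps) 
    have "iexp r = cis r" for r by (simp add: cis_conv_exp)
    then have "iexp ((- c * v) * (c * y)) = cis (- 2 * pi * (y * v))" by (simp only: r)
    then have "F (c * y) = complex_of_real (exp (- pi * y\<^sup>2) / c) * cis (- 2 * pi * (y * v))" unfolding F_def e by simp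
    then show ?thesis using c(1) by simp
  qed
  have "integrable lborel (\<lambda>y. complex_of_real c * F (0 + c *\<^sub>R y))"
    using c Fi by (intro integrable_mult_right lborel_integrable_affine) auto
  then show ?i unfolding G .
  have "integral\<^sup>L lborel F = \<bar>c\<bar> ^ DIM(real) *\<^sub>R (\<integral>y. F (0 + c *\<^sub>R y) \<partial>lborel)"
    using c by (intro lborel_integral_affine Fm) auto
  also have "\<dots> = (\<integral>y. complex_of_real c * F (0 + c *\<^sub>R y) \<partial>lborel)" using c(1) by (simp add: scaleR_conv_of_real)
  finally show ?e unfolding G I by simp
qed

text \<open>Gaussian and character both factor over the coordinates, and \<open>lborel\<close> is
  the image of a product of one-dimensional Lebesgue measures.\<close>

lemma gauss_integral:
  fixes v :: "'a::euclidean_space"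
  shows "integrable lborel (\<lambda>x::'a. complex_of_real (exp (- pi * (norm x)\<^sup>2)) * cis (- 2 * pi * (x \<bullet> v)))" (is ?i)
    and "(\<integral>x. complex_of_real (exp (- pi * (norm x)\<^sup>2)) * cis (- 2 * pi * (x \<bullet> v)) \<partial>lborel) = complex_of_real (exp (- pi * (norm v)\<^sup>2))" (is ?e)
proof -
  interpret P: product_sigma_finite "\<lambda>_::'a. lborel :: real measure" by standard
  define f where "f = (\<lambda>(b::'a) y. complex_of_real (exp (- pi * y\<^sup>2)) * cis (- 2 * pi * (y * (v \<bullet> b))))"
  have e: "complex_of_real (exp (- pi * (norm (\<Sum>b\<in>Basis. w b *\<^sub>R b))\<^sup>2)) * cis (- 2 * pi * ((\<Sum>b\<in>Basis. w b *\<^sub>R b) \<bullet> v)) = (\<Prod>b\<in>Basis. f b (w b))" for w :: "'a \<Rightarrow> real"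
  proof -
    have 1: "(norm (\<Sum>b\<in>Basis. w b *\<^sub>R b :: 'a))\<^sup>2 = (\<Sum>b\<in>Basis. (w b)\<^sup>2)"
      unfolding power2_norm_eq_inner by (subst euclidean_inner) (simp add: sum_Basis_inner power2_eq_square)
    have 2: "(\<Sum>b\<in>Basis. w b *\<^sub>R b) \<bullet> v = (\<Sum>b\<in>Basis. w b * (v \<bullet> b))"
      unfolding inner_sum_left by (simp add: inner_commute)
    have fb: "f b y = exp (complex_of_real (- pi * y\<^sup>2) + \<i> * complex_of_real (- 2 * pi * (y * (v \<bullet> b))))" for b y
      unfolding f_def cis_conv_exp exp_add exp_of_real ..
    have "(\<Prod>b\<in>Basis. f b (w b)) = exp (\<Sum>b\<in>Basis. complex_of_real (- pi * (w b)\<^sup>2) + \<i> * complex_of_real (- 2 * pi * (w b * (v \<bullet> b))))"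
      unfolding fb by (rule exp_sum[symmetric]) (rule finite_Basis)
    also have "(\<Sum>b\<in>Basis. complex_of_real (- pi * (w b)\<^sup>2) + \<i> * complex_of_real (- 2 * pi * (w b * (v \<bullet> b)))) =
       complex_of_real (- pi * (\<Sum>b\<in>Basis. (w b)\<^sup>2)) + \<i> * complex_of_real (- 2 * pi * (\<Sum>b\<in>Basis. w b * (v \<bullet> b)))"
      unfolding sum.distrib sum_distrib_left of_real_sum ..
    finally have P: "(\<Prod>b\<in>Basis. f b (w b)) = exp (complex_of_real (- pi * (\<Sum>b\<in>Basis. (w b)\<^sup>2)) + \<i> * complex_of_real (- 2 * pi * (\<Sum>b\<in>Basis. w b * (v \<bullet> b))))" .
    show ?thesis unfolding 1 2 P exp_add exp_of_real cis_conv_exp ..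
  qed
  have fi: "integrable lborel (f b)" and fe: "integral\<^sup>L lborel (f b) = complex_of_real (exp (- pi * (v \<bullet> b)\<^sup>2))" for b
    unfolding f_def using gauss_integral_1d[of "v \<bullet> b"] by auto
  have m: "(\<lambda>x::'a. complex_of_real (exp (- pi * (norm x)\<^sup>2)) * cis (- 2 * pi * (x \<bullet> v))) \<in> borel_measurable borel"
    by (intro borel_measurable_continuous_onI continuous_intros)
  have md: "(\<lambda>w. \<Sum>b\<in>Basis. w b *\<^sub>R b) \<in> (\<Pi>\<^sub>M b\<in>Basis. lborel) \<rightarrow>\<^sub>M (borel :: 'a measure)" by measurable
  show ?i 
    by (subst lborel_eq[where 'a='a], subst integrable_distr_eq[OF md m]) (unfold e, rule P.product_integrable_prod, auto simp: fi)
  have "(\<integral>x. complex_of_real (exp (- pi * (norm x)\<^sup>2)) * cis (- 2 * pi * (x \<bullet> v)) \<partial>lborel) = (\<integral>w. (\<Prod>b\<in>Basis. f b (w b)) \<partial>(\<Pi>\<^sub>M b\<in>Basis. lborel))"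
    by (subst lborel_eq[where 'a='a], subst integral_distr[OF md m]) (simp only: e)
  also have "\<dots> = (\<Prod>b\<in>Basis. complex_of_real (exp (- pi * (v \<bullet> b)\<^sup>2)))" 
    by (subst P.product_integral_prod) (auto simp: fi fe)
  also have "\<dots> = exp (\<Sum>b\<in>Basis. complex_of_real (- pi * (v \<bullet> b)\<^sup>2))" unfolding exp_of_real[symmetric] by (rule exp_sum[symmetric]) (rule finite_Basis)
  also have "(\<Sum>b\<in>Basis. complex_of_real (- pi * (v \<bullet> b)\<^sup>2)) = complex_of_real (- pi * (norm v)\<^sup>2)"
    unfolding power2_norm_eq_inner by (subst euclidean_inner) (simp add: sum_distrib_left power2_eq_square)
  finally show ?e by (simp only: exp_of_real)
qed

lemma gauss_integrable: "integrable lborel (\<lambda>x::'a::euclidean_space. complex_of_real (exp (- pi * (norm x)\<^sup>2)))"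
  and gauss_integral_one: "integral\<^sup>L lborel (\<lambda>x::'a. complex_of_real (exp (- pi * (norm x)\<^sup>2))) = 1"
  using gauss_integral[of "0::'a"] by simp_all

section \<open>The Fourier transform and its Gaussian regularisation\<close>

definition FT :: "('a::euclidean_space \<Rightarrow> complex) \<Rightarrow> 'a \<Rightarrow> complex" where
  "FT u \<xi> = (\<integral>x. u x * cis (- 2 * pi * (x \<bullet> \<xi>)) \<partial>lborel)"

lemma cis_measurable [measurable]: "cis \<in> borel_measurable borel"
  by (intro borel_measurable_continuous_onI continuous_intros)

lemma FT_measurable [measurable]:
  assumes [measurable]: "u \<in> borel_measurable borel" shows "FT u \<in> borel_measurable borel"
  unfolding FT_def by measurable

lemma FT_integrable:
  assumes u: "integrable lborel u" shows "integrable lborel (\<lambda>x. u x * cis (- 2 * pi * (x \<bullet> \<xi>)))"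
proof -
  have [measurable]: "u \<in> borel_measurable borel" using u by auto
  show ?thesis by (rule Bochner_Integration.integrable_bound[OF u]) (auto simp: norm_mult)
qed

lemma cis_split: "cis (- 2 * pi * ((x - y) \<bullet> \<xi>)) = cis (- 2 * pi * (x \<bullet> \<xi>)) * cnj (cis (- 2 * pi * (y \<bullet> \<xi>)))"
  by (simp add: cis_cnj cis_mult inner_diff_left algebra_simps)

text \<open>The modulus squared of the transform is a double integral in x and y. The Gaussian makes
  the triple integral absolutely convergent, so \<xi> can be integrated first; this leaves e^(-n)
  g((x-y)/e), and x = y + e v absorbs the power of e.\<close>

lemma FT_gauss_pairing:
  fixes u :: "'a::euclidean_space \<Rightarrow> complex"
  assumes c: "continuous_on UNIV u" and b: "\<And>x. cmod (u x) \<le> B" and u: "integrable lborel u" and e: "e > 0"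
  shows "(\<integral>\<xi>. complex_of_real (exp (- pi * (norm (e *\<^sub>R \<xi>))\<^sup>2)) * (FT u \<xi> * cnj (FT u \<xi>)) \<partial>lborel)
     = (\<integral>p. u (fst p + e *\<^sub>R snd p) * cnj (u (fst p)) * complex_of_real (exp (- pi * (norm (snd p))\<^sup>2)) \<partial>(lborel \<Otimes>\<^sub>M lborel))"
    and "integrable lborel (\<lambda>\<xi>. complex_of_real (exp (- pi * (norm (e *\<^sub>R \<xi>))\<^sup>2)) * (FT u \<xi> * cnj (FT u \<xi>)))"
proof -
  have um[measurable]: "u \<in> borel_measurable borel" using c by (rule borel_measurable_continuous_onI)
  define g where "g = (\<lambda>x::'a. complex_of_real (exp (- pi * (norm x)\<^sup>2)))"
  have g[measurable]: "g \<in> borel_measurable borel" and gi: "integrable lborel g" unfolding g_def by (measurable, rule gauss_integrable)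
  have gei: "integrable lborel (\<lambda>\<xi>. g (e *\<^sub>R \<xi>))" using lborel_integrable_affine[OF gi, of e 0] e by simp
  have cu: "integrable lborel (\<lambda>x. cnj (u x))" using u by simp
  define M2 where "M2 = (lborel \<Otimes>\<^sub>M lborel :: ('a \<times> 'a) measure)"
  have M2: "M2 = lborel" by (simp add: M2_def lborel_prod)
  define G where "G = (\<lambda>\<xi> p. g (e *\<^sub>R \<xi>) * (u (fst p) * cnj (u (snd p))) * cis (- 2 * pi * ((fst p - snd p) \<bullet> \<xi>)))"
  have FF: "g (e *\<^sub>R \<xi>) * (FT u \<xi> * cnj (FT u \<xi>)) = (\<integral>p. G \<xi> p \<partial>M2)" for \<xi>
  proof -
    have Cn: "cnj (FT u \<xi>) = (\<integral>x. cnj (u x * cis (- 2 * pi * (x \<bullet> \<xi>))) \<partial>lborel)" unfolding FT_def by (rule Bochner_Integration.integral_cnj[symmetric])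
    have Ai: "integrable lborel (\<lambda>x. cnj (u x * cis (- 2 * pi * (x \<bullet> \<xi>))))" by (rule integrable_cnj[OF FT_integrable[OF u]])
    have "FT u \<xi> * cnj (FT u \<xi>) = (\<integral>p. (u (fst p) * cis (- 2 * pi * (fst p \<bullet> \<xi>))) * cnj (u (snd p) * cis (- 2 * pi * (snd p \<bullet> \<xi>))) \<partial>M2)"
      unfolding M2_def Cn unfolding FT_def by (rule lborel_pair.integrable_prod_mult(2)[OF FT_integrable[OF u] Ai, symmetric])
    then have "g (e *\<^sub>R \<xi>) * (FT u \<xi> * cnj (FT u \<xi>)) = (\<integral>p. g (e *\<^sub>R \<xi>) * ((u (fst p) * cis (- 2 * pi * (fst p \<bullet> \<xi>))) * cnj (u (snd p) * cis (- 2 * pi * (snd p \<bullet> \<xi>)))) \<partial>M2)"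
      by simp
    also have "\<dots> = (\<integral>p. G \<xi> p \<partial>M2)" unfolding G_def cis_split by (intro Bochner_Integration.integral_cong) (simp_all add: mult_ac)
    finally show ?thesis .
  qed
  have sf2: "sigma_finite_measure M2" unfolding M2 by (rule lborel.sigma_finite_measure_axioms)
  interpret Q: pair_sigma_finite "lborel :: 'a measure" M2 using sf2 by (simp add: pair_sigma_finite_def lborel.sigma_finite_measure_axioms)
  have ui: "integrable M2 (\<lambda>p. u (fst p) * cnj (u (snd p)))" unfolding M2_def by (rule lborel_pair.integrable_prod_mult(1)[OF u cu])
  have Gi: "integrable (lborel \<Otimes>\<^sub>M M2) (\<lambda>(\<xi>, p). G \<xi> p)"
  proof (rule Bochner_Integration.integrable_bound[OF Q.integrable_prod_mult(1)[OF gei ui]])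
    show "(\<lambda>(\<xi>, p). G \<xi> p) \<in> borel_measurable (lborel \<Otimes>\<^sub>M M2)" unfolding G_def M2_def by measurable
  qed (auto simp: G_def norm_mult)
  show "integrable lborel (\<lambda>\<xi>. complex_of_real (exp (- pi * (norm (e *\<^sub>R \<xi>))\<^sup>2)) * (FT u \<xi> * cnj (FT u \<xi>)))"
    using Q.integrable_fst[OF Gi] unfolding FF[symmetric] g_def .
  have "(\<integral>\<xi>. g (e *\<^sub>R \<xi>) * (FT u \<xi> * cnj (FT u \<xi>)) \<partial>lborel) = (\<integral>\<xi>. (\<integral>p. G \<xi> p \<partial>M2) \<partial>lborel)" by (simp only: FF)
  also have "\<dots> = (\<integral>p. (\<integral>\<xi>. G \<xi> p \<partial>lborel) \<partial>M2)" using Q.Fubini_integral[OF Gi] by simp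
  also have "\<dots> = (\<integral>p. u (fst p) * cnj (u (snd p)) * (complex_of_real (1 / e ^ DIM('a)) * g ((fst p - snd p) /\<^sub>R e)) \<partial>M2)"
  proof (rule Bochner_Integration.integral_cong)
    fix p :: "'a \<times> 'a"
    let ?d = "fst p - snd p"
    have "(\<integral>\<xi>. g (e *\<^sub>R \<xi>) * cis (- 2 * pi * (?d \<bullet> \<xi>)) \<partial>lborel) = \<bar>1 / e\<bar> ^ DIM('a) *\<^sub>R (\<integral>\<xi>. g (e *\<^sub>R (0 + (1 / e) *\<^sub>R \<xi>)) * cis (- 2 * pi * (?d \<bullet> (0 + (1 / e) *\<^sub>R \<xi>))) \<partial>lborel)"
      using e by (intro lborel_integral_affine) auto
    also have "(\<integral>\<xi>. g (e *\<^sub>R (0 + (1 / e) *\<^sub>R \<xi>)) * cis (- 2 * pi * (?d \<bullet> (0 + (1 / e) *\<^sub>R \<xi>))) \<partial>lborel) = (\<integral>\<xi>. complex_of_real (exp (- pi * (norm \<xi>)\<^sup>2)) * cis (- 2 * pi * (\<xi> \<bullet> (?d /\<^sub>R e))) \<partial>lborel)"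
      using e by (intro Bochner_Integration.integral_cong) (simp_all add: g_def inner_commute divide_inverse mult_ac)
    also have "\<dots> = g (?d /\<^sub>R e)" unfolding g_def by (rule gauss_integral(2))
    finally have "(\<integral>\<xi>. g (e *\<^sub>R \<xi>) * cis (- 2 * pi * (?d \<bullet> \<xi>)) \<partial>lborel) = complex_of_real (1 / e ^ DIM('a)) * g (?d /\<^sub>R e)"
      using e by (simp add: scaleR_conv_of_real power_one_over)
    moreover have "(\<integral>\<xi>. G \<xi> p \<partial>lborel) = (\<integral>\<xi>. (u (fst p) * cnj (u (snd p))) * (g (e *\<^sub>R \<xi>) * cis (- 2 * pi * (?d \<bullet> \<xi>))) \<partial>lborel)"
      by (intro Bochner_Integration.integral_cong) (simp_all add: G_def mult_ac)
    ultimately show "(\<integral>\<xi>. G \<xi> p \<partial>lborel) = u (fst p) * cnj (u (snd p)) * (complex_of_real (1 / e ^ DIM('a)) * g (?d /\<^sub>R e))"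
      by simp
  qed simp
  also have "\<dots> = (\<integral>y. \<integral>x. u x * cnj (u y) * (complex_of_real (1 / e ^ DIM('a)) * g ((x - y) /\<^sub>R e)) \<partial>lborel \<partial>lborel)"
  proof -
    have "integrable M2 (\<lambda>p. u (fst p) * cnj (u (snd p)) * (complex_of_real (1 / e ^ DIM('a)) * g ((fst p - snd p) /\<^sub>R e)))"
    proof (rule Bochner_Integration.integrable_bound[OF integrable_mult_right[OF ui, of "complex_of_real (1 / e ^ DIM('a))"]])
      show "(\<lambda>p. u (fst p) * cnj (u (snd p)) * (complex_of_real (1 / e ^ DIM('a)) * g ((fst p - snd p) /\<^sub>R e))) \<in> borel_measurable M2" unfolding M2_def by measurable
      have g1: "cmod (g x) \<le> 1" for x by (simp add: g_def)
      show "AE p in M2. cmod (u (fst p) * cnj (u (snd p)) * (complex_of_real (1 / e ^ DIM('a)) * g ((fst p - snd p) /\<^sub>R e))) \<le> cmod (complex_of_real (1 / e ^ DIM('a)) * (u (fst p) * cnj (u (snd p))))"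
      proof (intro AE_I2)
        fix p :: "'a \<times> 'a"
        have "cmod (u (fst p)) * cmod (u (snd p)) * (1 / e ^ DIM('a)) * cmod (g ((fst p - snd p) /\<^sub>R e)) \<le> cmod (u (fst p)) * cmod (u (snd p)) * (1 / e ^ DIM('a)) * 1"
          using e by (intro mult_left_mono g1) auto
        then show "cmod (u (fst p) * cnj (u (snd p)) * (complex_of_real (1 / e ^ DIM('a)) * g ((fst p - snd p) /\<^sub>R e))) \<le> cmod (complex_of_real (1 / e ^ DIM('a)) * (u (fst p) * cnj (u (snd p))))"
          using e by (simp add: norm_mult norm_divide norm_power mult_ac)
      qed
    qed
    then show ?thesis unfolding M2_def
      using lborel_pair.integral_snd[of "\<lambda>x y. u x * cnj (u y) * (complex_of_real (1 / e ^ DIM('a)) * g ((x - y) /\<^sub>R e))"] by (auto simp: split_beta')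
  qed
  also have "\<dots> = (\<integral>y. \<integral>v. u (y + e *\<^sub>R v) * cnj (u y) * g v \<partial>lborel \<partial>lborel)"
  proof (rule Bochner_Integration.integral_cong)
    fix y
    have "(\<integral>x. u x * cnj (u y) * (complex_of_real (1 / e ^ DIM('a)) * g ((x - y) /\<^sub>R e)) \<partial>lborel) = \<bar>e\<bar> ^ DIM('a) *\<^sub>R (\<integral>v. u (y + e *\<^sub>R v) * cnj (u y) * (complex_of_real (1 / e ^ DIM('a)) * g ((y + e *\<^sub>R v - y) /\<^sub>R e)) \<partial>lborel)"
      using e by (intro lborel_integral_affine) auto
    also have "\<dots> = (\<integral>v. complex_of_real (e ^ DIM('a)) * (u (y + e *\<^sub>R v) * cnj (u y) * (complex_of_real (1 / e ^ DIM('a)) * g ((y + e *\<^sub>R v - y) /\<^sub>R e))) \<partial>lborel)"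
      using e by (simp only: scaleR_conv_of_real abs_of_pos of_real_power integral_mult_right_zero)
    also have "\<dots> = (\<integral>v. u (y + e *\<^sub>R v) * cnj (u y) * g v \<partial>lborel)"
      using e by (intro Bochner_Integration.integral_cong) (auto simp: mult_ac)
    finally show "(\<integral>x. u x * cnj (u y) * (complex_of_real (1 / e ^ DIM('a)) * g ((x - y) /\<^sub>R e)) \<partial>lborel) = (\<integral>v. u (y + e *\<^sub>R v) * cnj (u y) * g v \<partial>lborel)" .
  qed simp
  also have "\<dots> = (\<integral>p. u (fst p + e *\<^sub>R snd p) * cnj (u (fst p)) * g (snd p) \<partial>(lborel \<Otimes>\<^sub>M lborel))"
  proof -
    have "integrable (lborel \<Otimes>\<^sub>M lborel) (\<lambda>(y, v). u (y + e *\<^sub>R v) * cnj (u y) * g v)"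
    proof (rule Bochner_Integration.integrable_bound[OF integrable_mult_right[OF lborel_pair.integrable_prod_mult(1)[OF cu gi], of "complex_of_real B"]])
      show "(\<lambda>(y, v). u (y + e *\<^sub>R v) * cnj (u y) * g v) \<in> borel_measurable (lborel \<Otimes>\<^sub>M lborel)" by measurable
      have B: "B \<ge> 0" using b[of 0] norm_ge_zero[of "u 0"] by linarith
      show "AE p in lborel \<Otimes>\<^sub>M lborel. norm (case p of (y, v) \<Rightarrow> u (y + e *\<^sub>R v) * cnj (u y) * g v) \<le> norm (complex_of_real B * (cnj (u (fst p)) * g (snd p)))"
        using B b by (intro AE_I2) (auto simp: norm_mult mult.assoc intro!: mult_right_mono)
    qed
    then show ?thesis using lborel_pair.integral_fst[of "\<lambda>y v. u (y + e *\<^sub>R v) * cnj (u y) * g v"] by (simp add: split_beta')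
  qed
  finally show "(\<integral>\<xi>. complex_of_real (exp (- pi * (norm (e *\<^sub>R \<xi>))\<^sup>2)) * (FT u \<xi> * cnj (FT u \<xi>)) \<partial>lborel)
     = (\<integral>p. u (fst p + e *\<^sub>R snd p) * cnj (u (fst p)) * complex_of_real (exp (- pi * (norm (snd p))\<^sup>2)) \<partial>(lborel \<Otimes>\<^sub>M lborel))"
    unfolding g_def .
qed

text \<open>Gaussian regularisation: let the width tend to infinity, with monotone convergence on the Fourier side and
  dominated convergence on the other side.\<close>

lemma Plancherel:
  fixes u :: "'a::euclidean_space \<Rightarrow> complex"
  assumes c: "continuous_on UNIV u" and b: "\<And>x. cmod (u x) \<le> B" and u: "integrable lborel u"
  shows "(\<integral>\<^sup>+\<xi>. ennreal ((cmod (FT u \<xi>))\<^sup>2) \<partial>lborel) = (\<integral>\<^sup>+x. ennreal ((cmod (u x))\<^sup>2) \<partial>lborel)"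
proof -
  have um[measurable]: "u \<in> borel_measurable borel" using c by (rule borel_measurable_continuous_onI)
  define e where "e = (\<lambda>k::nat. 1 / (real k + 1))"
  have e: "e k > 0" for k by (simp add: e_def)
  have e0: "e \<longlonglongrightarrow> 0" unfolding e_def using LIMSEQ_inverse_real_of_nat by (simp add: inverse_eq_divide add.commute)
  have B: "B \<ge> 0" using b[of 0] norm_ge_zero[of "u 0"] by linarith
  have cu: "integrable lborel (\<lambda>x. cnj (u x))" using u by simp
  have u2: "integrable lborel (\<lambda>x. (cmod (u x))\<^sup>2)"
  proof (rule Bochner_Integration.integrable_bound[OF integrable_mult_right[OF integrable_norm[OF u], of B]])
    show "AE x in lborel. norm ((cmod (u x))\<^sup>2) \<le> norm (B * cmod (u x))"
      using b B by (intro AE_I2) (auto simp: power2_eq_square intro!: mult_right_mono)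
  qed auto
  have lim1: "(\<lambda>k. \<integral>p. u (fst p + e k *\<^sub>R snd p) * cnj (u (fst p)) * complex_of_real (exp (- pi * (norm (snd p))\<^sup>2)) \<partial>(lborel \<Otimes>\<^sub>M lborel))
     \<longlonglongrightarrow> (\<integral>p. u (fst p) * cnj (u (fst p)) * complex_of_real (exp (- pi * (norm (snd p))\<^sup>2)) \<partial>(lborel \<Otimes>\<^sub>M (lborel :: 'a measure)))"
  proof (rule integral_dominated_convergence[where w="\<lambda>p. norm (complex_of_real B * (cnj (u (fst p)) * complex_of_real (exp (- pi * (norm (snd p))\<^sup>2))))"])
    show "integrable (lborel \<Otimes>\<^sub>M lborel) (\<lambda>p. norm (complex_of_real B * (cnj (u (fst p)) * complex_of_real (exp (- pi * (norm (snd p :: 'a))\<^sup>2)))))"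
      by (intro integrable_norm integrable_mult_right lborel_pair.integrable_prod_mult(1)[OF cu gauss_integrable])
    show "AE p in lborel \<Otimes>\<^sub>M lborel. (\<lambda>k. u (fst p + e k *\<^sub>R snd p) * cnj (u (fst p)) * complex_of_real (exp (- pi * (norm (snd p))\<^sup>2)))
        \<longlonglongrightarrow> u (fst p) * cnj (u (fst p)) * complex_of_real (exp (- pi * (norm (snd p :: 'a))\<^sup>2))"
    proof (intro AE_I2 tendsto_intros)
      fix p :: "'a \<times> 'a"
      have "(\<lambda>k. fst p + e k *\<^sub>R snd p) \<longlonglongrightarrow> fst p + 0 *\<^sub>R snd p" by (intro tendsto_intros e0)
      then show "(\<lambda>k. u (fst p + e k *\<^sub>R snd p)) \<longlonglongrightarrow> u (fst p)"
        using continuous_on_tendsto_compose[OF c] by simp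
    qed
    show "AE p in lborel \<Otimes>\<^sub>M lborel. norm (u (fst p + e k *\<^sub>R snd p) * cnj (u (fst p)) * complex_of_real (exp (- pi * (norm (snd p :: 'a))\<^sup>2))) \<le>
       norm (complex_of_real B * (cnj (u (fst p)) * complex_of_real (exp (- pi * (norm (snd p))\<^sup>2))))" for k
      using B b by (intro AE_I2) (auto simp: norm_mult mult.assoc intro!: mult_right_mono)
  qed measurable
  have uu: "integrable lborel (\<lambda>x. u x * cnj (u x))" unfolding complex_norm_square[symmetric] by (rule integrable_of_real[OF u2])
  have "(\<integral>p. u (fst p) * cnj (u (fst p)) * complex_of_real (exp (- pi * (norm (snd p))\<^sup>2)) \<partial>(lborel \<Otimes>\<^sub>M (lborel :: 'a measure))) = (\<integral>x. u x * cnj (u x) \<partial>lborel) * 1"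
    using lborel_pair.integrable_prod_mult(2)[OF uu gauss_integrable[where 'a='a]] gauss_integral_one[where 'a='a] by simp
  also have "\<dots> = complex_of_real (\<integral>x. (cmod (u x))\<^sup>2 \<partial>lborel)" unfolding complex_norm_square[symmetric] mult_1_right by (rule integral_complex_of_real)
  finally have lim2: "(\<lambda>k. \<integral>\<xi>. complex_of_real (exp (- pi * (norm (e k *\<^sub>R \<xi>))\<^sup>2)) * (FT u \<xi> * cnj (FT u \<xi>)) \<partial>lborel) \<longlonglongrightarrow> complex_of_real (\<integral>x. (cmod (u x))\<^sup>2 \<partial>lborel)"
    using lim1 unfolding FT_gauss_pairing(1)[OF c b u e] by simp
  define H where "H = (\<lambda>k \<xi>. exp (- pi * (norm (e k *\<^sub>R \<xi>))\<^sup>2) * (cmod (FT u \<xi>))\<^sup>2)"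
  have He: "complex_of_real (exp (- pi * (norm (e k *\<^sub>R \<xi>))\<^sup>2)) * (FT u \<xi> * cnj (FT u \<xi>)) = complex_of_real (H k \<xi>)" for k \<xi>
    unfolding H_def complex_norm_square[symmetric] by simp
  have Hi: "integrable lborel (H k)" for k
    using integrable_Re[OF FT_gauss_pairing(2)[OF c b u e, of k]] unfolding He by simp
  have "(\<lambda>k. complex_of_real (integral\<^sup>L lborel (H k))) \<longlonglongrightarrow> complex_of_real (\<integral>x. (cmod (u x))\<^sup>2 \<partial>lborel)"
    using lim2 unfolding He by simp
  then have "(\<lambda>k. integral\<^sup>L lborel (H k)) \<longlonglongrightarrow> (\<integral>x. (cmod (u x))\<^sup>2 \<partial>lborel)" by (simp only: tendsto_of_real_iff)
  then have "(\<lambda>k. ennreal (integral\<^sup>L lborel (H k))) \<longlonglongrightarrow> ennreal (\<integral>x. (cmod (u x))\<^sup>2 \<partial>lborel)" by (rule tendsto_ennrealI)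
  moreover have "ennreal (integral\<^sup>L lborel (H k)) = (\<integral>\<^sup>+\<xi>. ennreal (H k \<xi>) \<partial>lborel)" for k
    by (rule nn_integral_eq_integral[OF Hi, symmetric]) (simp add: H_def)
  ultimately have L1: "(\<lambda>k. \<integral>\<^sup>+\<xi>. ennreal (H k \<xi>) \<partial>lborel) \<longlonglongrightarrow> ennreal (\<integral>x. (cmod (u x))\<^sup>2 \<partial>lborel)" by simp
  have L2: "(\<lambda>k. \<integral>\<^sup>+\<xi>. ennreal (H k \<xi>) \<partial>lborel) \<longlonglongrightarrow> (\<integral>\<^sup>+\<xi>. ennreal ((cmod (FT u \<xi>))\<^sup>2) \<partial>lborel)"
  proof (rule nn_integral_LIMSEQ)
    show "incseq (\<lambda>k \<xi>. ennreal (H k \<xi>))"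
    proof (intro incseq_SucI le_funI ennreal_leI)
      fix k and \<xi> :: 'a
      have "e (Suc k) \<le> e k" unfolding e_def by (simp add: field_simps)
      then have "(norm (e (Suc k) *\<^sub>R \<xi>))\<^sup>2 \<le> (norm (e k *\<^sub>R \<xi>))\<^sup>2" using e[of k] e[of "Suc k"] by (intro power_mono) (auto intro!: mult_right_mono)
      then show "H k \<xi> \<le> H (Suc k) \<xi>" unfolding H_def by (intro mult_right_mono) auto
    qed
    show "(\<lambda>\<xi>. ennreal (H k \<xi>)) \<in> borel_measurable lborel" for k unfolding H_def by measurable
    show "(\<lambda>k. ennreal (H k \<xi>)) \<longlonglongrightarrow> ennreal ((cmod (FT u \<xi>))\<^sup>2)" for \<xi>
    proof (rule tendsto_ennrealI)
      have "(\<lambda>k. H k \<xi>) \<longlonglongrightarrow> exp (- pi * (norm (0 *\<^sub>R \<xi>))\<^sup>2) * (cmod (FT u \<xi>))\<^sup>2" unfolding H_def by (intro tendsto_intros e0)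
      then show "(\<lambda>k. H k \<xi>) \<longlonglongrightarrow> (cmod (FT u \<xi>))\<^sup>2" by simp
    qed
  qed
  have "(\<integral>\<^sup>+\<xi>. ennreal ((cmod (FT u \<xi>))\<^sup>2) \<partial>lborel) = ennreal (\<integral>x. (cmod (u x))\<^sup>2 \<partial>lborel)" using LIMSEQ_unique[OF L2 L1] .
  then show ?thesis using nn_integral_eq_integral[OF u2] by simp
qed

section \<open>Calderon's reproducing formula\<close>

lemma nn_integral_hmeas:
  fixes F :: "'a::euclidean_space \<times> real \<Rightarrow> ennreal"
  assumes [measurable]: "F \<in> borel_measurable borel"
  shows "(\<integral>\<^sup>+z. F z \<partial>hmeas) = (\<integral>\<^sup>+t. ennreal (indicator {0<..} t * t powr - (real DIM('a) + 1)) * (\<integral>\<^sup>+x. F (x, t) \<partial>lborel) \<partial>lborel)"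
proof -
  have Fm[measurable]: "F \<in> borel_measurable (borel \<Otimes>\<^sub>M borel)" unfolding borel_prod by measurable
  have "(\<integral>\<^sup>+z. F z \<partial>hmeas) = (\<integral>\<^sup>+z. ennreal (indicator {0<..} (snd z) * snd z powr - (real DIM('a) + 1)) * F z \<partial>(lborel \<Otimes>\<^sub>M lborel))"
    unfolding hmeas_def lborel_prod by (rule nn_integral_density) auto
  also have "\<dots> = (\<integral>\<^sup>+t. \<integral>\<^sup>+x. ennreal (indicator {0<..} t * t powr - (real DIM('a) + 1)) * F (x, t) \<partial>lborel \<partial>lborel)"
    by (subst lborel_pair.nn_integral_snd[symmetric]) auto
  also have "\<dots> = (\<integral>\<^sup>+t. ennreal (indicator {0<..} t * t powr - (real DIM('a) + 1)) * (\<integral>\<^sup>+x. F (x, t) \<partial>lborel) \<partial>lborel)"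
    by (intro nn_integral_cong nn_integral_cmult) auto
  finally show ?thesis .
qed

lemma pair_wav_measurable:
  assumes w: "wavelet \<psi>" and [measurable]: "f \<in> borel_measurable borel"
  shows "(\<lambda>z. pair f (wav \<psi> z)) \<in> borel_measurable borel"
proof -
  have [measurable]: "\<psi> \<in> borel_measurable borel" by (rule wavelet_measurable[OF w])
  show ?thesis unfolding pair_def wav_def by measurable
qed

text \<open>In this form translation and dilation act on f while \<psi> stays fixed, so the Fourier
  transform in x and limits in (x, t) can be taken under one integral.\<close>

lemma pair_wav_convolution:
  fixes f :: "'a::euclidean_space \<Rightarrow> complex"
  assumes w: "wavelet \<psi>" and [measurable]: "f \<in> borel_measurable borel" and t: "t > 0"
  shows "pair f (wav \<psi> (x, t)) = complex_of_real (t powr (real DIM('a) / 2)) * (\<integral>u. f (x + t *\<^sub>R u) * complex_of_real (\<psi> u) \<partial>lborel)"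
proof -
  have [measurable]: "\<psi> \<in> borel_measurable borel" by (rule wavelet_measurable[OF w])
  have tn: "t ^ DIM('a) * t powr (- real DIM('a) / 2) = t powr (real DIM('a) / 2)"
    using t by (simp add: powr_realpow[symmetric] powr_add[symmetric])
  have "pair f (wav \<psi> (x, t)) = \<bar>t\<bar> ^ DIM('a) *\<^sub>R (\<integral>u. f (x + t *\<^sub>R u) * wav \<psi> (x, t) (x + t *\<^sub>R u) \<partial>lborel)"
    unfolding pair_def wav_def using t by (intro lborel_integral_affine) auto
  also have "\<dots> = \<bar>t\<bar> ^ DIM('a) *\<^sub>R (\<integral>u. complex_of_real (t powr (- real DIM('a) / 2)) * (f (x + t *\<^sub>R u) * complex_of_real (\<psi> u)) \<partial>lborel)"
    using t by (intro arg_cong2[where f=scaleR] refl Bochner_Integration.integral_cong) (auto simp: wav_def mult_ac)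
  also have "\<dots> = complex_of_real (t ^ DIM('a) * t powr (- real DIM('a) / 2)) * (\<integral>u. f (x + t *\<^sub>R u) * complex_of_real (\<psi> u) \<partial>lborel)"
    using t by (simp add: scaleR_conv_of_real)
  finally show ?thesis unfolding tn .
qed

lemma fourier_eq_FT: "fourier \<psi> = FT (\<lambda>x. complex_of_real (\<psi> x))"
  by (auto simp: fourier_def FT_def fun_eq_iff)

text \<open>For fixed t the coefficients are, up to a power of t, a correlation G of f with \<psi>.
  Its transform at \<xi> is that of f times the conjugate of the transform of \<psi> at t\<xi>. G is
  continuous, bounded and integrable, so Plancherel applies to it.\<close>

lemma wavelet_slice:
  fixes f :: "'a::euclidean_space \<Rightarrow> complex"
  assumes w: "wavelet \<psi>" and c: "continuous_on UNIV f" and b: "\<And>x. cmod (f x) \<le> B" and fi: "integrable lborel f" and t: "t > 0"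
  shows "(\<integral>\<^sup>+x. ennreal ((cmod (pair f (wav \<psi> (x, t))))\<^sup>2) \<partial>lborel) = ennreal (t ^ DIM('a)) * (\<integral>\<^sup>+\<xi>. ennreal ((cmod (FT f \<xi>))\<^sup>2 * (cmod (fourier \<psi> (t *\<^sub>R \<xi>)))\<^sup>2) \<partial>lborel)"
proof -
  have fm[measurable]: "f \<in> borel_measurable borel" using fi by auto
  have pm[measurable]: "\<psi> \<in> borel_measurable borel" by (rule wavelet_measurable[OF w])
  define p where "p = (\<lambda>x. complex_of_real (\<psi> x))"
  have pi_: "integrable lborel p" unfolding p_def by (rule test_fun_integrable[OF wavelet_test_fun[OF w]])
  have pm'[measurable]: "p \<in> borel_measurable borel" using pi_ by auto
  have B: "B \<ge> 0" using b[of 0] norm_ge_zero[of "f 0"] by linarith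
  define G where "G = (\<lambda>x. \<integral>u. f (x + t *\<^sub>R u) * p u \<partial>lborel)"
  have Gm[measurable]: "G \<in> borel_measurable borel" unfolding G_def by measurable
  have pG: "pair f (wav \<psi> (x, t)) = complex_of_real (t powr (real DIM('a) / 2)) * G x" for x
    unfolding G_def p_def by (rule pair_wav_convolution[OF w fm t])
  have fp: "cmod (f y * p u) \<le> B * cmod (p u)" for y u unfolding norm_mult by (intro mult_right_mono b) auto
  have Bp: "integrable lborel (\<lambda>u. B * cmod (p u))" using pi_ by auto
  have Gc: "continuous_on UNIV G"
  proof (intro continuous_at_imp_continuous_on ballI continuous_at_sequentiallyI)
    fix x and X :: "nat \<Rightarrow> 'a" assume X: "X \<longlonglongrightarrow> x"
    show "(\<lambda>n. G (X n)) \<longlonglongrightarrow> G x" unfolding G_def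
    proof (rule integral_dominated_convergence[where w="\<lambda>u. B * cmod (p u)"])
      show "AE u in lborel. (\<lambda>n. f (X n + t *\<^sub>R u) * p u) \<longlonglongrightarrow> f (x + t *\<^sub>R u) * p u"
      proof (intro AE_I2 tendsto_intros)
        fix u
        have "(\<lambda>n. X n + t *\<^sub>R u) \<longlonglongrightarrow> x + t *\<^sub>R u" by (intro tendsto_intros X)
        then show "(\<lambda>n. f (X n + t *\<^sub>R u)) \<longlonglongrightarrow> f (x + t *\<^sub>R u)" using continuous_on_tendsto_compose[OF c] by simp
      qed
    qed (use Bp fp in auto)
  qed
  have Gb: "cmod (G x) \<le> (\<integral>u. B * cmod (p u) \<partial>lborel)" for x
    unfolding G_def
  proof (rule Bochner_Integration.integral_norm_bound_integral)
    show "integrable lborel (\<lambda>u. f (x + t *\<^sub>R u) * p u)"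
      by (rule Bochner_Integration.integrable_bound[OF Bp]) (use fp B in auto)
  qed (use Bp fp in auto)
  \<comment> \<open>Joint integrability is checked in the other order, where the inner integral is
    |p u| times the L1 norm of f.\<close>
  have Hi: "integrable (lborel \<Otimes>\<^sub>M lborel) (\<lambda>(x, u). f (x + t *\<^sub>R u) * p u)"
  proof -
    have "integrable (lborel \<Otimes>\<^sub>M lborel) (\<lambda>(u, x). f (x + t *\<^sub>R u) * p u)"
    proof (rule lborel_pair.Fubini_integrable)
      have "(\<integral>x. cmod (f (x + t *\<^sub>R u) * p u) \<partial>lborel) = cmod (p u) * (\<integral>x. cmod (f x) \<partial>lborel)" for u
        using lborel_integral_affine[of "\<lambda>x. cmod (f x)" 1 "t *\<^sub>R u"] by (simp add: norm_mult add.commute)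
      then show "integrable lborel (\<lambda>u. \<integral>x. norm (case (u, x) of (u, x) \<Rightarrow> f (x + t *\<^sub>R u) * p u) \<partial>lborel)" using pi_ by simp
      show "AE u in lborel. integrable lborel (\<lambda>x. case (u, x) of (u, x) \<Rightarrow> f (x + t *\<^sub>R u) * p u)"

      proof (intro AE_I2)
        fix u
        have "integrable lborel (\<lambda>x. f (t *\<^sub>R u + 1 *\<^sub>R x))" by (rule lborel_integrable_affine[OF fi]) simp
        then show "integrable lborel (\<lambda>x. case (u, x) of (u, x) \<Rightarrow> f (x + t *\<^sub>R u) * p u)" by (simp add: add.commute)
      qed
    qed measurable
    then show ?thesis using lborel_pair.integrable_product_swap by fastforce
  qed
  have Gi: "integrable lborel G" using lborel_pair.integrable_fst[OF Hi] unfolding G_def .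
  have "FT G \<xi> = FT f \<xi> * cnj (fourier \<psi> (t *\<^sub>R \<xi>))" for \<xi>
  proof -
    have Ki: "integrable (lborel \<Otimes>\<^sub>M lborel) (\<lambda>(x, u). f (x + t *\<^sub>R u) * p u * cis (- 2 * pi * (x \<bullet> \<xi>)))"
      by (rule Bochner_Integration.integrable_bound[OF Hi]) (auto simp: norm_mult)
    have "FT G \<xi> = (\<integral>x. (\<integral>u. f (x + t *\<^sub>R u) * p u * cis (- 2 * pi * (x \<bullet> \<xi>)) \<partial>lborel) \<partial>lborel)"
      unfolding FT_def G_def by simp
    also have "\<dots> = (\<integral>u. (\<integral>x. f (x + t *\<^sub>R u) * p u * cis (- 2 * pi * (x \<bullet> \<xi>)) \<partial>lborel) \<partial>lborel)"
      by (rule lborel_pair.Fubini_integral[OF Ki, symmetric])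
    also have "\<dots> = (\<integral>u. FT f \<xi> * cnj (p u * cis (- 2 * pi * (u \<bullet> (t *\<^sub>R \<xi>)))) \<partial>lborel)"
    proof (rule Bochner_Integration.integral_cong)
      fix u
      have "(\<integral>x. f x * cis (- 2 * pi * ((x - t *\<^sub>R u) \<bullet> \<xi>)) \<partial>lborel) = (\<integral>x. f (x + t *\<^sub>R u) * cis (- 2 * pi * (x \<bullet> \<xi>)) \<partial>lborel)"
        using lborel_integral_affine[of "\<lambda>x. f x * cis (- 2 * pi * ((x - t *\<^sub>R u) \<bullet> \<xi>))" 1 "t *\<^sub>R u"] by (simp add: add.commute)
      moreover have "(\<integral>x. f x * cis (- 2 * pi * ((x - t *\<^sub>R u) \<bullet> \<xi>)) \<partial>lborel) = (\<integral>x. cnj (cis (- 2 * pi * ((t *\<^sub>R u) \<bullet> \<xi>))) * (f x * cis (- 2 * pi * (x \<bullet> \<xi>))) \<partial>lborel)"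
        unfolding cis_split by (simp add: mult_ac)
      ultimately have "(\<integral>x. f (x + t *\<^sub>R u) * cis (- 2 * pi * (x \<bullet> \<xi>)) \<partial>lborel) = cnj (cis (- 2 * pi * ((t *\<^sub>R u) \<bullet> \<xi>))) * FT f \<xi>"
        unfolding FT_def by simp
      moreover have "(\<integral>x. f (x + t *\<^sub>R u) * p u * cis (- 2 * pi * (x \<bullet> \<xi>)) \<partial>lborel) = p u * (\<integral>x. f (x + t *\<^sub>R u) * cis (- 2 * pi * (x \<bullet> \<xi>)) \<partial>lborel)"
        by (subst integral_mult_right_zero[symmetric]) (simp add: mult_ac)
      \<comment> \<open>The wavelet is real, so the phase left over by the translation assembles to
        the conjugate of its transform.\<close>
      moreover have "cnj (p u) = p u" by (simp add: p_def)
      ultimately show "(\<integral>x. f (x + t *\<^sub>R u) * p u * cis (- 2 * pi * (x \<bullet> \<xi>)) \<partial>lborel) = FT f \<xi> * cnj (p u * cis (- 2 * pi * (u \<bullet> (t *\<^sub>R \<xi>))))"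
        by (simp add: mult_ac)
    qed simp
    also have "\<dots> = FT f \<xi> * cnj (FT p (t *\<^sub>R \<xi>))"
      unfolding FT_def[of p] Bochner_Integration.integral_cnj[symmetric] by (rule integral_mult_right_zero)
    finally show ?thesis by (simp add: fourier_eq_FT p_def)
  qed
  then have FG: "(cmod (FT G \<xi>))\<^sup>2 = (cmod (FT f \<xi>))\<^sup>2 * (cmod (fourier \<psi> (t *\<^sub>R \<xi>)))\<^sup>2" for \<xi>
    by (simp add: norm_mult power_mult_distrib)
  have tp: "(t powr (real DIM('a) / 2))\<^sup>2 = t ^ DIM('a)" using t by (simp add: power2_eq_square powr_add[symmetric] powr_realpow)
  have "(\<integral>\<^sup>+x. ennreal ((cmod (pair f (wav \<psi> (x, t))))\<^sup>2) \<partial>lborel) = (\<integral>\<^sup>+x. ennreal (t ^ DIM('a)) * ennreal ((cmod (G x))\<^sup>2) \<partial>lborel)"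
    unfolding pG using t by (simp add: norm_mult power_mult_distrib tp ennreal_mult)
  also have "\<dots> = ennreal (t ^ DIM('a)) * (\<integral>\<^sup>+x. ennreal ((cmod (G x))\<^sup>2) \<partial>lborel)" by (rule nn_integral_cmult) auto
  also have "(\<integral>\<^sup>+x. ennreal ((cmod (G x))\<^sup>2) \<partial>lborel) = (\<integral>\<^sup>+\<xi>. ennreal ((cmod (FT G \<xi>))\<^sup>2) \<partial>lborel)"
    by (rule Plancherel[OF Gc Gb Gi, symmetric])
  finally show ?thesis unfolding FG .
qed

text \<open>The factor t^n of the slice turns dt/t^(n+1) into dt/t. Tonelli then moves the scale
  integral inside, where it equals 1 for every \<xi> except 0.\<close>

lemma calderon_continuous:
  fixes f :: "'a::euclidean_space \<Rightarrow> complex"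
  assumes w: "wavelet \<psi>" and c: "continuous_on UNIV f" and b: "\<And>x. cmod (f x) \<le> B" and fi: "integrable lborel f"
  shows "(\<integral>\<^sup>+z. ennreal ((cmod (pair f (wav \<psi> z)))\<^sup>2) \<partial>hmeas) = (\<integral>\<^sup>+x. ennreal ((cmod (f x))\<^sup>2) \<partial>lborel)"
proof -
  have fm[measurable]: "f \<in> borel_measurable borel" using fi by auto
  have pm[measurable]: "\<psi> \<in> borel_measurable borel" by (rule wavelet_measurable[OF w])
  have Fm[measurable]: "fourier \<psi> \<in> borel_measurable borel" unfolding fourier_eq_FT by measurable
  have "(\<integral>\<^sup>+z. ennreal ((cmod (pair f (wav \<psi> z)))\<^sup>2) \<partial>hmeas) =
      (\<integral>\<^sup>+t. ennreal (indicator {0<..} t * t powr - (real DIM('a) + 1)) * (\<integral>\<^sup>+x. ennreal ((cmod (pair f (wav \<psi> (x, t))))\<^sup>2) \<partial>lborel) \<partial>lborel)"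

  proof (rule nn_integral_hmeas)
    have [measurable]: "(\<lambda>z. pair f (wav \<psi> z)) \<in> borel_measurable borel" by (rule pair_wav_measurable[OF w fm])
    show "(\<lambda>z. ennreal ((cmod (pair f (wav \<psi> z)))\<^sup>2)) \<in> borel_measurable borel" by measurable
  qed
  also have "\<dots> = (\<integral>\<^sup>+t. \<integral>\<^sup>+\<xi>. ennreal ((cmod (FT f \<xi>))\<^sup>2) * (ennreal ((cmod (fourier \<psi> (t *\<^sub>R \<xi>)))\<^sup>2 / t) * indicator {0<..} t) \<partial>lborel \<partial>lborel)"
  proof (rule nn_integral_cong)
    fix t :: real
    show "ennreal (indicator {0<..} t * t powr - (real DIM('a) + 1)) * (\<integral>\<^sup>+x. ennreal ((cmod (pair f (wav \<psi> (x, t))))\<^sup>2) \<partial>lborel) =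
       (\<integral>\<^sup>+\<xi>. ennreal ((cmod (FT f \<xi>))\<^sup>2) * (ennreal ((cmod (fourier \<psi> (t *\<^sub>R \<xi>)))\<^sup>2 / t) * indicator {0<..} t) \<partial>lborel)"
    proof (cases "t > 0")
      case t: True
      have e: "t powr - (real DIM('a) + 1) * t ^ DIM('a) = 1 / t" using t by (simp add: powr_realpow[symmetric] powr_add[symmetric] powr_minus_divide)
      have "ennreal (indicator {0<..} t * t powr - (real DIM('a) + 1)) * (\<integral>\<^sup>+x. ennreal ((cmod (pair f (wav \<psi> (x, t))))\<^sup>2) \<partial>lborel)
         = ennreal (t powr - (real DIM('a) + 1) * t ^ DIM('a)) * (\<integral>\<^sup>+\<xi>. ennreal ((cmod (FT f \<xi>))\<^sup>2 * (cmod (fourier \<psi> (t *\<^sub>R \<xi>)))\<^sup>2) \<partial>lborel)"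
        unfolding wavelet_slice[OF w c b fi t] using t by (simp add: ennreal_mult mult.assoc)
      also have "\<dots> = (\<integral>\<^sup>+\<xi>. ennreal (1 / t) * ennreal ((cmod (FT f \<xi>))\<^sup>2 * (cmod (fourier \<psi> (t *\<^sub>R \<xi>)))\<^sup>2) \<partial>lborel)"
        unfolding e by (rule nn_integral_cmult[symmetric]) auto
      also have "\<dots> = (\<integral>\<^sup>+\<xi>. ennreal ((cmod (FT f \<xi>))\<^sup>2) * (ennreal ((cmod (fourier \<psi> (t *\<^sub>R \<xi>)))\<^sup>2 / t) * indicator {0<..} t) \<partial>lborel)"
        using t by (intro nn_integral_cong) (simp add: ennreal_mult[symmetric] mult_ac)
      finally show ?thesis .
    qed simp
  qed
  also have "\<dots> = (\<integral>\<^sup>+\<xi>. \<integral>\<^sup>+t. ennreal ((cmod (FT f \<xi>))\<^sup>2) * (ennreal ((cmod (fourier \<psi> (t *\<^sub>R \<xi>)))\<^sup>2 / t) * indicator {0<..} t) \<partial>lborel \<partial>lborel)"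
    by (rule lborel_pair.Fubini') measurable
  also have "\<dots> = (\<integral>\<^sup>+\<xi>. ennreal ((cmod (FT f \<xi>))\<^sup>2) \<partial>lborel)"
  proof (rule nn_integral_cong_AE)
    have "AE \<xi> in lborel. \<xi> \<noteq> (0::'a)" by (rule AE_lborel_singleton)
    then show "AE \<xi> in lborel. (\<integral>\<^sup>+t. ennreal ((cmod (FT f \<xi>))\<^sup>2) * (ennreal ((cmod (fourier \<psi> (t *\<^sub>R \<xi>)))\<^sup>2 / t) * indicator {0<..} t) \<partial>lborel) = ennreal ((cmod (FT f \<xi>))\<^sup>2)"
    proof eventually_elim
      case (elim \<xi>)
      have "(\<integral>\<^sup>+t. ennreal ((cmod (fourier \<psi> (t *\<^sub>R \<xi>)))\<^sup>2 / t) * indicator {0<..} t \<partial>lborel) = ennreal 1"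
        using w elim unfolding wavelet_def by (intro nn_integral_has_integral_on) auto
      then show ?case by (subst nn_integral_cmult) auto
    qed
  qed
  also have "\<dots> = (\<integral>\<^sup>+x. ennreal ((cmod (f x))\<^sup>2) \<partial>lborel)" by (rule Plancherel[OF c b fi])
  finally show ?thesis .
qed

section \<open>Density of continuous functions and Calderon's formula on L2\<close>

lemma l2norm_triangle:
  assumes f: "sq_int f" and g: "sq_int g" shows "l2norm (\<lambda>x. f x + g x) \<le> l2norm f + l2norm g"
proof (rule power2_le_imp_le)
  have "(l2norm (\<lambda>x. f x + g x))\<^sup>2 = (l2norm f)\<^sup>2 + 2 * Re (pair g (\<lambda>x. cnj (f x))) + (l2norm g)\<^sup>2"
    using l2norm_add_sq[OF f g, of 1] by simp
  also have "Re (pair g (\<lambda>x. cnj (f x))) \<le> l2norm g * l2norm f"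
    using cmod_pair_le[OF g sq_int_cnj[OF f]] complex_Re_le_cmod[of "pair g (\<lambda>x. cnj (f x))"] by (simp add: l2norm_cnj)
  finally show "(l2norm (\<lambda>x. f x + g x))\<^sup>2 \<le> (l2norm f + l2norm g)\<^sup>2" by (simp add: power2_sum algebra_simps)
qed (simp add: l2norm_nonneg)

lemma l2norm_swap: "l2norm (\<lambda>x. f x - g x) = l2norm (\<lambda>x. g x - f x)"
  by (simp add: l2norm_def norm_minus_commute)

lemma l2norm_triangle_diff:
  assumes "sq_int f" "sq_int g" shows "l2norm f \<le> l2norm g + l2norm (\<lambda>x. f x - g x)"
  using l2norm_triangle[OF assms(2) sq_int_diff[OF assms]] by simp

lemma l2norm_tendsto_dominated:
  fixes F :: "nat \<Rightarrow> 'a::euclidean_space \<Rightarrow> complex"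
  assumes [measurable]: "\<And>n. F n \<in> borel_measurable borel" "f \<in> borel_measurable borel" and w: "integrable lborel w"
    and lim: "AE x in lborel. (\<lambda>n. F n x) \<longlonglongrightarrow> f x" and bd: "\<And>n x. (cmod (F n x - f x))\<^sup>2 \<le> w x"
  shows "(\<lambda>n. l2norm (\<lambda>x. F n x - f x)) \<longlonglongrightarrow> 0"
proof -
  have "(\<lambda>n. \<integral>x. (cmod (F n x - f x))\<^sup>2 \<partial>lborel) \<longlonglongrightarrow> (\<integral>x. 0 \<partial>(lborel :: 'a measure))"
  proof (rule integral_dominated_convergence[where w=w])
    show "AE x in lborel. (\<lambda>n. (cmod (F n x - f x))\<^sup>2) \<longlonglongrightarrow> 0" using lim
    proof eventually_elim
      case (elim x)
      have "(\<lambda>n. (cmod (F n x - f x))\<^sup>2) \<longlonglongrightarrow> (cmod (f x - f x))\<^sup>2" by (intro tendsto_intros elim)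
      then show ?case by simp
    qed
  qed (use w bd in auto)
  then have "(\<lambda>n. sqrt (\<integral>x. (cmod (F n x - f x))\<^sup>2 \<partial>lborel)) \<longlonglongrightarrow> sqrt 0" by (intro tendsto_real_sqrt) simp
  then show ?thesis by (simp add: l2norm_def)
qed

text \<open>Lebesgue measurability supplies continuous functions that converge to f almost
  everywhere. The radial clipping \<open>cl\<close> and the spatial \<open>bump\<close> are
  continuous and leave f unchanged; they give the approximants a common bound and a common bounded
  support, as dominated convergence requires.\<close>

lemma continuous_dense_bounded:
  fixes f :: "'a::euclidean_space \<Rightarrow> complex"
  assumes f[measurable]: "f \<in> borel_measurable borel" and b: "\<And>x. cmod (f x) \<le> N" and s: "\<And>x. norm x > N \<Longrightarrow> f x = 0" and N: "N > 0" and e: "e > 0"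
  obtains h B where "continuous_on UNIV h" "\<And>x. cmod (h x) \<le> B" "integrable lborel h" "sq_int h" "l2norm (\<lambda>x. f x - h x) < e"
proof -
  have "f \<in> borel_measurable lebesgue" using f by (simp add: borel_measurable_if_D measurable_completion)
  then have "f measurable_on UNIV" by (rule lebesgue_measurable_imp_measurable_on) simp
  then obtain S g where S: "negligible S" and g: "\<And>n. continuous_on UNIV (g n)" "\<And>x. x \<notin> S \<Longrightarrow> (\<lambda>n. g n x) \<longlonglongrightarrow> (if x \<in> UNIV then f x else 0)"
    unfolding measurable_on_def by metis
  define cl where "cl = (\<lambda>z::complex. (N / max N (cmod z)) *\<^sub>R z)"
  define bump where "bump = (\<lambda>x::'a. max 0 (min 1 (N + 1 - norm x)))"
  define h where "h = (\<lambda>n x. bump x *\<^sub>R cl (g n x))"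
  have clc: "continuous_on UNIV cl" unfolding cl_def using N by (intro continuous_intros) auto
  have clb: "cmod (cl z) \<le> N" for z
  proof -
    have "cmod (cl z) = N * (cmod z / max N (cmod z))" using N by (simp add: cl_def)
    also have "\<dots> \<le> N * 1" using N by (intro mult_left_mono) (auto simp: divide_le_eq)
    finally show ?thesis by simp
  qed
  have clf: "cl (f x) = f x" for x using b[of x] N by (simp add: cl_def max_absorb1)
  have bump: "0 \<le> bump x" "bump x \<le> 1" "norm x \<ge> N + 1 \<Longrightarrow> bump x = 0" "norm x \<le> N \<Longrightarrow> bump x = 1" for x unfolding bump_def by auto
  have bf: "bump x *\<^sub>R f x = f x" for x using s[of x] bump(4)[of x] by (cases "norm x \<le> N") auto
  have hc: "continuous_on UNIV (h n)" for n unfolding h_def bump_def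
    by (intro continuous_intros continuous_on_compose2[OF clc g(1)]) auto
  have hm[measurable]: "h n \<in> borel_measurable borel" for n using hc by (rule borel_measurable_continuous_onI)
  have hb: "cmod (h n x) \<le> N * indicator (cball 0 (N + 1)) x" for n x
  proof (cases "norm x \<le> N + 1")
    case True
    have "bump x * cmod (cl (g n x)) \<le> 1 * N" using bump clb N by (intro mult_mono) auto
    then show ?thesis using True bump(1) by (simp add: h_def)
  next
    case False then show ?thesis using bump(3)[of x] by (simp add: h_def)
  qed
  have fb: "cmod (f x) \<le> N * indicator (cball 0 (N + 1)) x" for x
    using b[of x] s[of x] by (cases "norm x \<le> N + 1") auto
  have ind: "integrable lborel (\<lambda>x. c * indicat_real (cball (0::'a) (N + 1)) x)" for c
    using N by (intro integrable_mult_right integrable_real_indicator) (auto simp: emeasure_cball)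
  have lim: "(\<lambda>n. l2norm (\<lambda>x. h n x - f x)) \<longlonglongrightarrow> 0"
  proof (rule l2norm_tendsto_dominated[OF hm f ind[of "(2 * N)\<^sup>2"]])
    have "S \<in> null_sets lebesgue" using S by (simp add: negligible_iff_null_sets)
    then have "AE x in lebesgue. x \<notin> S" by (rule AE_not_in)
    then have "AE x in lborel. x \<notin> S" by (simp add: AE_completion_iff)
    then show "AE x in lborel. (\<lambda>n. h n x) \<longlonglongrightarrow> f x"
    proof eventually_elim
      case (elim x)
      then have "(\<lambda>n. g n x) \<longlonglongrightarrow> f x" using g(2) by simp
      then have "(\<lambda>n. cl (g n x)) \<longlonglongrightarrow> cl (f x)" using continuous_on_tendsto_compose[OF clc] by simp
      then have "(\<lambda>n. bump x *\<^sub>R cl (g n x)) \<longlonglongrightarrow> bump x *\<^sub>R cl (f x)" by (intro tendsto_intros)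
      then show ?case by (simp add: h_def clf bf)
    qed
    fix n x
    have "cmod (h n x - f x) \<le> 2 * N * indicator (cball 0 (N + 1)) x" using hb[of n x] fb[of x] norm_triangle_ineq4[of "h n x" "f x"] by linarith
    then have "(cmod (h n x - f x))\<^sup>2 \<le> (2 * N * indicator (cball 0 (N + 1)) x)\<^sup>2" by (intro power_mono) auto
    then show "(cmod (h n x - f x))\<^sup>2 \<le> (2 * N)\<^sup>2 * indicator (cball 0 (N + 1)) x" by (cases "norm x \<le> N + 1") auto
  qed
  from eventually_happens'[OF sequentially_bot order_tendstoD(2)[OF lim e]]
  obtain n where n: "l2norm (\<lambda>x. h n x - f x) < e" by blast
  show thesis
  proof (rule that[of "h n" N])
    show "cmod (h n x) \<le> N" for x using hb[of n x] N by (cases "norm x \<le> N + 1") auto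
    show "integrable lborel (h n)" by (rule Bochner_Integration.integrable_bound[OF ind[of N]]) (use hb N in auto)
    have "integrable lborel (\<lambda>x. (cmod (h n x))\<^sup>2)"
    proof (rule Bochner_Integration.integrable_bound[OF ind[of "N\<^sup>2"]])
      have "(cmod (h n x))\<^sup>2 \<le> N\<^sup>2 * indicator (cball 0 (N + 1)) x" for x
        using power_mono[OF hb[of n x], of 2] by (cases "norm x \<le> N + 1") auto
      then show "AE x in lborel. norm ((cmod (h n x))\<^sup>2) \<le> norm (N\<^sup>2 * indicat_real (cball 0 (N + 1)) x)" by auto
    qed auto
    then show "sq_int (h n)" by (simp add: sq_int_def)
    show "l2norm (\<lambda>x. f x - h n x) < e" using n by (subst l2norm_swap)
  qed (rule hc)
qed

text \<open>Truncation in height and in space reduces to the bounded case; e/2 is spent on either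
  approximation.\<close>

lemma continuous_dense:
  fixes f :: "'a::euclidean_space \<Rightarrow> complex"
  assumes f: "sq_int f" and e: "e > 0"
  obtains h B where "continuous_on UNIV h" "\<And>x. cmod (h x) \<le> B" "integrable lborel h" "sq_int h" "l2norm (\<lambda>x. f x - h x) < e"
proof -
  have fm[measurable]: "f \<in> borel_measurable borel" and fi: "integrable lborel (\<lambda>x. (cmod (f x))\<^sup>2)" using f by (auto simp: sq_int_def)
  define F where "F = (\<lambda>n x. if norm x \<le> real n + 1 \<and> cmod (f x) \<le> real n + 1 then f x else 0)"
  have Fm[measurable]: "F n \<in> borel_measurable borel" for n unfolding F_def by measurable
  have lim: "(\<lambda>n. l2norm (\<lambda>x. F n x - f x)) \<longlonglongrightarrow> 0"
  proof (rule l2norm_tendsto_dominated[OF Fm fm fi])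
    show "AE x in lborel. (\<lambda>n. F n x) \<longlonglongrightarrow> f x"
    proof (intro AE_I2 tendsto_eventually)
      fix x
      obtain m where "real m \<ge> max (norm x) (cmod (f x))" using real_arch_simple by blast
      then have "F n x = f x" if "n \<ge> m" for n unfolding F_def using that by auto
      then show "\<forall>\<^sub>F n in sequentially. F n x = f x" using eventually_sequentially by blast
    qed
    show "(cmod (F n x - f x))\<^sup>2 \<le> (cmod (f x))\<^sup>2" for n x by (simp add: F_def)
  qed
  from eventually_happens'[OF sequentially_bot order_tendstoD(2)[OF lim half_gt_zero[OF e]]]
  obtain n where n: "l2norm (\<lambda>x. F n x - f x) < e / 2" by blast
  have Fs: "sq_int (F n)"
    unfolding sq_int_def
  proof
    show "integrable lborel (\<lambda>x. (cmod (F n x))\<^sup>2)"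
      by (rule Bochner_Integration.integrable_bound[OF fi]) (auto simp: F_def)
  qed measurable
  obtain h B where h: "continuous_on UNIV h" "\<And>x. cmod (h x) \<le> B" "integrable lborel h" "sq_int h" "l2norm (\<lambda>x. F n x - h x) < e / 2"
  proof (rule continuous_dense_bounded[OF Fm, of n "real n + 1" "e / 2"])
    show "cmod (F n x) \<le> real n + 1" for x by (simp add: F_def)
    show "F n x = 0" if "norm x > real n + 1" for x using that by (simp add: F_def)
  qed (use e in auto)
  have "l2norm (\<lambda>x. (f x - F n x) + (F n x - h x)) \<le> l2norm (\<lambda>x. f x - F n x) + l2norm (\<lambda>x. F n x - h x)"
    by (intro l2norm_triangle sq_int_diff f Fs h)
  then have "l2norm (\<lambda>x. f x - h x) < e" using n h(5) l2norm_swap[of f "F n"] by simp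
  then show thesis using that h by blast
qed

lemma sq_int_wav: "wavelet \<psi> \<Longrightarrow> snd z > 0 \<Longrightarrow> sq_int (wav \<psi> z)"
  by (intro test_fun_sq_int test_fun_wav)

text \<open>A single coefficient is continuous in f, so Fatou yields the inequality <=. For the
  converse, |a+b|^2 <= (1+c)|a|^2 + (1+1/c)|b|^2 is integrated with b the coefficient of h_k - f, to
  which the inequality <= applies; then k tends to infinity and c to 0.\<close>

lemma calderon:
  fixes f :: "'a::euclidean_space \<Rightarrow> complex"
  assumes w: "wavelet \<psi>" and f: "sq_int f"
  shows "(\<integral>\<^sup>+z. ennreal ((cmod (pair f (wav \<psi> z)))\<^sup>2) \<partial>hmeas) = ennreal ((l2norm f)\<^sup>2)"
proof -
  define I where "I = (\<lambda>f. \<integral>\<^sup>+z. ennreal ((cmod (pair f (wav \<psi> z)))\<^sup>2) \<partial>hmeas)"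
  have meas[measurable]: "(\<lambda>z. pair f (wav \<psi> z)) \<in> borel_measurable hmeas" if "sq_int f" for f
    using pair_wav_measurable[OF w, of f] that by (simp add: sq_int_def measurable_cong_sets[OF sets_hmeas refl])
  have approx: "\<exists>h. (\<forall>k. sq_int (h k) \<and> I (h k) = ennreal ((l2norm (h k))\<^sup>2)) \<and> (\<lambda>k. l2norm (\<lambda>x. f x - h k x)) \<longlonglongrightarrow> 0" if f: "sq_int f" for f
  proof -
    have "\<exists>h. sq_int h \<and> I h = ennreal ((l2norm h)\<^sup>2) \<and> l2norm (\<lambda>x. f x - h x) < 1 / (real k + 1)" for k
    proof -
      obtain h B where h: "continuous_on UNIV h" "\<And>x. cmod (h x) \<le> B" "integrable lborel h" "sq_int h" "l2norm (\<lambda>x. f x - h x) < 1 / (real k + 1)"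
        by (rule continuous_dense[OF f, of "1 / (real k + 1)"]) auto
      have "I h = ennreal ((l2norm h)\<^sup>2)" unfolding I_def calderon_continuous[OF w h(1-3)] by (rule nn_integral_l2norm[OF h(4)])
      then show ?thesis using h by blast
    qed
    then obtain h where h: "\<And>k. sq_int (h k)" "\<And>k. I (h k) = ennreal ((l2norm (h k))\<^sup>2)" "\<And>k. l2norm (\<lambda>x. f x - h k x) < 1 / (real k + 1)" by metis
    have "(\<lambda>k. l2norm (\<lambda>x. f x - h k x)) \<longlonglongrightarrow> 0"
    proof (rule tendsto_sandwich[OF _ _ tendsto_const])
      show "\<forall>\<^sub>F k in sequentially. l2norm (\<lambda>x. f x - h k x) \<le> 1 / (real k + 1)" using h(3) less_imp_le by (intro always_eventually) blast
      show "(\<lambda>k. 1 / (real k + 1)) \<longlonglongrightarrow> 0" using LIMSEQ_inverse_real_of_nat by (simp add: inverse_eq_divide add.commute)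
    qed (simp add: l2norm_nonneg)
    then show ?thesis using h by blast
  qed
  have norm_lim: "(\<lambda>k. l2norm (h k)) \<longlonglongrightarrow> l2norm f" if "sq_int f" "\<And>k. sq_int (h k)" "(\<lambda>k. l2norm (\<lambda>x. f x - h k x)) \<longlonglongrightarrow> 0" for f h
  proof (rule Lim_null_comparison[THEN LIM_zero_cancel, OF _ that(3)])
    show "\<forall>\<^sub>F k in sequentially. norm (l2norm (h k) - l2norm f) \<le> l2norm (\<lambda>x. f x - h k x)"
    proof (intro always_eventually allI)
      fix k
      have "l2norm f \<le> l2norm (h k) + l2norm (\<lambda>x. f x - h k x)" by (rule l2norm_triangle_diff[OF that(1,2)])
      moreover have "l2norm (h k) \<le> l2norm f + l2norm (\<lambda>x. h k x - f x)" by (rule l2norm_triangle_diff[OF that(2,1)])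
      ultimately show "norm (l2norm (h k) - l2norm f) \<le> l2norm (\<lambda>x. f x - h k x)" using l2norm_swap[of f "h k"] by auto
    qed
  qed
  have upper: "I f \<le> ennreal ((l2norm f)\<^sup>2)" if f: "sq_int f" for f
  proof -
    obtain h where h: "\<And>k. sq_int (h k)" "\<And>k. I (h k) = ennreal ((l2norm (h k))\<^sup>2)" "(\<lambda>k. l2norm (\<lambda>x. f x - h k x)) \<longlonglongrightarrow> 0" using approx[OF f] by blast
    have "I f = (\<integral>\<^sup>+z. liminf (\<lambda>k. ennreal ((cmod (pair (h k) (wav \<psi> z)))\<^sup>2)) \<partial>hmeas)"
      unfolding I_def
    proof (rule nn_integral_cong_AE, use AE_hmeas in eventually_elim)
      case (elim z)
      note sw = sq_int_wav[OF w elim]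
      have "(\<lambda>k. pair (h k) (wav \<psi> z)) \<longlonglongrightarrow> pair f (wav \<psi> z)"
      proof (rule Lim_null_comparison[THEN LIM_zero_cancel])
        show "\<forall>\<^sub>F k in sequentially. norm (pair (h k) (wav \<psi> z) - pair f (wav \<psi> z)) \<le> l2norm (\<lambda>x. f x - h k x) * l2norm (wav \<psi> z)"
        proof (intro always_eventually allI)
          fix k
          have "pair (\<lambda>x. 1 * h k x + (-1) * f x) (wav \<psi> z) = 1 * pair (h k) (wav \<psi> z) + (-1) * pair f (wav \<psi> z)" by (rule pair_lincomb_left[OF h(1) f sw])
          then have "pair (h k) (wav \<psi> z) - pair f (wav \<psi> z) = pair (\<lambda>x. h k x - f x) (wav \<psi> z)" by simp
          then show "norm (pair (h k) (wav \<psi> z) - pair f (wav \<psi> z)) \<le> l2norm (\<lambda>x. f x - h k x) * l2norm (wav \<psi> z)"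
            using cmod_pair_le[OF sq_int_diff[OF h(1)[of k] f] sw] l2norm_swap[of f "h k"] by simp
        qed
        show "(\<lambda>k. l2norm (\<lambda>x. f x - h k x) * l2norm (wav \<psi> z)) \<longlonglongrightarrow> 0" by (rule tendsto_mult_left_zero[OF h(3)])
      qed
      then have "(\<lambda>k. ennreal ((cmod (pair (h k) (wav \<psi> z)))\<^sup>2)) \<longlonglongrightarrow> ennreal ((cmod (pair f (wav \<psi> z)))\<^sup>2)" by (intro tendsto_intros)
      then show ?case using lim_imp_Liminf[OF sequentially_bot] by metis
    qed
    also have "\<dots> \<le> liminf (\<lambda>k. I (h k))" unfolding I_def using h by (intro nn_integral_liminf) measurable
    also have "\<dots> = ennreal ((l2norm f)\<^sup>2)"
      unfolding h(2) by (intro lim_imp_Liminf sequentially_bot tendsto_ennrealI tendsto_intros norm_lim f h)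
    finally show ?thesis .
  qed
  obtain h where h: "\<And>k. sq_int (h k)" "\<And>k. I (h k) = ennreal ((l2norm (h k))\<^sup>2)" "(\<lambda>k. l2norm (\<lambda>x. f x - h k x)) \<longlonglongrightarrow> 0" using approx[OF f] by blast
  define i where "i = enn2real (I f)"
  have i: "I f = ennreal i" "i \<ge> 0" unfolding i_def using upper[OF f] by (auto simp: le_less_trans[OF _ ennreal_less_top])
  have lower: "(l2norm f)\<^sup>2 \<le> (1 + c) * i" if c: "c > 0" for c
  proof -
    have "(l2norm (h k))\<^sup>2 \<le> (1 + c) * i + (1 + 1 / c) * (l2norm (\<lambda>x. f x - h k x))\<^sup>2" for k
    proof -
      have d: "sq_int (\<lambda>x. h k x - f x)" by (intro sq_int_diff h f)
      have pt: "(cmod (pair (h k) (wav \<psi> z)))\<^sup>2 \<le> (1 + c) * (cmod (pair f (wav \<psi> z)))\<^sup>2 + (1 + 1 / c) * (cmod (pair (\<lambda>x. h k x - f x) (wav \<psi> z)))\<^sup>2" if z: "snd z > 0" for z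
      proof -
        define a b where "a = cmod (pair f (wav \<psi> z))" and "b = cmod (pair (\<lambda>x. h k x - f x) (wav \<psi> z))"
        have "pair (\<lambda>x. 1 * f x + 1 * (h k x - f x)) (wav \<psi> z) = 1 * pair f (wav \<psi> z) + 1 * pair (\<lambda>x. h k x - f x) (wav \<psi> z)"
          by (rule pair_lincomb_left[OF f d sq_int_wav[OF w z]])
        then have "cmod (pair (h k) (wav \<psi> z)) \<le> a + b" unfolding a_def b_def using norm_triangle_ineq by simp
        then have "(cmod (pair (h k) (wav \<psi> z)))\<^sup>2 \<le> (a + b)\<^sup>2" by (intro power_mono) auto
        also have "\<dots> \<le> (1 + c) * a\<^sup>2 + (1 + 1 / c) * b\<^sup>2"
        proof -
          have "0 \<le> (c * a - b)\<^sup>2 / c" using c by simp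
          also have "\<dots> = c * a\<^sup>2 + (1 / c) * b\<^sup>2 - 2 * a * b" using c by (simp add: power2_eq_square field_simps)
          finally show ?thesis by (simp add: power2_sum algebra_simps)
        qed
        finally show ?thesis unfolding a_def b_def .
      qed
      have "ennreal ((l2norm (h k))\<^sup>2) \<le> (\<integral>\<^sup>+z. ennreal (1 + c) * ennreal ((cmod (pair f (wav \<psi> z)))\<^sup>2) + ennreal (1 + 1 / c) * ennreal ((cmod (pair (\<lambda>x. h k x - f x) (wav \<psi> z)))\<^sup>2) \<partial>hmeas)"
        unfolding h(2)[symmetric] I_def
      proof (rule nn_integral_mono_AE, use AE_hmeas in eventually_elim)
        case (elim z)
        then show ?case using pt[OF elim] c by (simp add: ennreal_mult[symmetric] ennreal_plus[symmetric] ennreal_leI del: ennreal_plus)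
      qed
      also have "\<dots> = ennreal (1 + c) * I f + ennreal (1 + 1 / c) * I (\<lambda>x. h k x - f x)"
        unfolding I_def using f d by (subst nn_integral_add) (auto simp: nn_integral_cmult)
      also have "\<dots> \<le> ennreal (1 + c) * ennreal i + ennreal (1 + 1 / c) * ennreal ((l2norm (\<lambda>x. h k x - f x))\<^sup>2)"
        unfolding i(1) by (intro add_left_mono mult_left_mono upper d) auto
      also have "\<dots> = ennreal ((1 + c) * i + (1 + 1 / c) * (l2norm (\<lambda>x. f x - h k x))\<^sup>2)"
        using c i(2) by (simp add: ennreal_mult[symmetric] ennreal_plus[symmetric] l2norm_swap[of f] del: ennreal_plus)
      finally show ?thesis using c i(2) by (subst (asm) ennreal_le_iff) auto
    qed
    moreover have "(\<lambda>k. (l2norm (h k))\<^sup>2) \<longlonglongrightarrow> (l2norm f)\<^sup>2" by (intro tendsto_intros norm_lim f h)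
    moreover have "(\<lambda>k. (1 + c) * i + (1 + 1 / c) * (l2norm (\<lambda>x. f x - h k x))\<^sup>2) \<longlonglongrightarrow> (1 + c) * i + (1 + 1 / c) * 0\<^sup>2" by (intro tendsto_intros h(3))
    ultimately have "(l2norm f)\<^sup>2 \<le> (1 + c) * i + (1 + 1 / c) * 0\<^sup>2" by (intro LIMSEQ_le[of "\<lambda>k. (l2norm (h k))\<^sup>2" _ "\<lambda>k. (1 + c) * i + (1 + 1 / c) * (l2norm (\<lambda>x. f x - h k x))\<^sup>2"]) auto
    then show ?thesis by simp
  qed
  have "(l2norm f)\<^sup>2 \<le> i"
  proof (rule field_le_epsilon)
    fix e :: real assume e: "e > 0"
    \<comment> \<open>The choice c = e/(i+1) keeps c * i at most e, also when i = 0.\<close>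
    have "(l2norm f)\<^sup>2 \<le> (1 + e / (i + 1)) * i" using e i by (intro lower) auto
    also have "\<dots> \<le> i + e" using e i(2) by (simp add: field_simps)
    finally show "(l2norm f)\<^sup>2 \<le> i + e" .
  qed
  then have "I f = ennreal ((l2norm f)\<^sup>2)" using upper[OF f] i by (intro antisym) auto
  then show ?thesis by (simp add: I_def)
qed

section \<open>The bi-parameter wavelet matrix\<close>

definition quad :: "(('a \<times> 'b \<Rightarrow> complex) \<Rightarrow> 'a::euclidean_space \<times> 'b::euclidean_space \<Rightarrow> complex) \<Rightarrow> ('a \<Rightarrow> complex) \<Rightarrow> ('b \<Rightarrow> complex) \<Rightarrow> ('a \<Rightarrow> complex) \<Rightarrow> ('b \<Rightarrow> complex) \<Rightarrow> complex" where
  "quad T f1 f2 g1 g2 = pair (T (tensor f1 f2)) (tensor g1 g2)"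

lemma quad_sub:
  assumes T: "bounded_L2_op T" and t: "test_fun f1" "test_fun f2" "test_fun g1" "test_fun g2" "test_fun u" "test_fun v"
  shows "quad T (\<lambda>x. f1 x - c * u x) f2 g1 g2 = quad T f1 f2 g1 g2 - c * quad T u f2 g1 g2"
    and "quad T f1 (\<lambda>x. f2 x - c * v x) g1 g2 = quad T f1 f2 g1 g2 - c * quad T f1 v g1 g2"
    and "quad T f1 f2 (\<lambda>x. g1 x - c * u x) g2 = quad T f1 f2 g1 g2 - c * quad T f1 f2 u g2"
    and "quad T f1 f2 g1 (\<lambda>x. g2 x - c * v x) = quad T f1 f2 g1 g2 - c * quad T f1 f2 g1 v"
proof -
  have sq: "sq_int f1" "sq_int f2" "sq_int g1" "sq_int g2" "sq_int u" "sq_int v" using t test_fun_sq_int by auto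
  note s = tensor_l2(1)[OF sq(1,2)] tensor_l2(1)[OF sq(5,2)] tensor_l2(1)[OF sq(1,6)] tensor_l2(1)[OF sq(3,4)] tensor_l2(1)[OF sq(5,4)] tensor_l2(1)[OF sq(3,6)]
  note st = s(1-3)[THEN bounded_L2_op_sq_int[OF T]]
  have "quad T (\<lambda>x. 1 * f1 x + (- c) * u x) f2 g1 g2 = 1 * quad T f1 f2 g1 g2 + (- c) * quad T u f2 g1 g2"
    unfolding quad_def tensor_lincomb_left bounded_L2_op_lincomb[OF T s(1,2)] by (rule pair_lincomb_left[OF st(1,2) s(4)])
  then show "quad T (\<lambda>x. f1 x - c * u x) f2 g1 g2 = quad T f1 f2 g1 g2 - c * quad T u f2 g1 g2" by simp
  have "quad T f1 (\<lambda>x. 1 * f2 x + (- c) * v x) g1 g2 = 1 * quad T f1 f2 g1 g2 + (- c) * quad T f1 v g1 g2"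
    unfolding quad_def tensor_lincomb_right bounded_L2_op_lincomb[OF T s(1,3)] by (rule pair_lincomb_left[OF st(1,3) s(4)])
  then show "quad T f1 (\<lambda>x. f2 x - c * v x) g1 g2 = quad T f1 f2 g1 g2 - c * quad T f1 v g1 g2" by simp
  have "quad T f1 f2 (\<lambda>x. 1 * g1 x + (- c) * u x) g2 = 1 * quad T f1 f2 g1 g2 + (- c) * quad T f1 f2 u g2"
    unfolding quad_def tensor_lincomb_left by (rule pair_lincomb_right[OF s(4,5) st(1)])
  then show "quad T f1 f2 (\<lambda>x. g1 x - c * u x) g2 = quad T f1 f2 g1 g2 - c * quad T f1 f2 u g2" by simp
  have "quad T f1 f2 g1 (\<lambda>x. 1 * g2 x + (- c) * v x) = 1 * quad T f1 f2 g1 g2 + (- c) * quad T f1 f2 g1 v"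
    unfolding quad_def tensor_lincomb_right by (rule pair_lincomb_right[OF s(4,6) st(1)])
  then show "quad T f1 f2 g1 (\<lambda>x. g2 x - c * v x) = quad T f1 f2 g1 g2 - c * quad T f1 f2 g1 v" by simp
qed

text \<open>Each variable is corrected on at most one side, which leaves four cases. Expansion
  produces two terms with a single cut-off and one with two; each combination of slots is among
  those listed in \<open>fully_cancellative\<close>.\<close>

lemma quad_cancel_limit:
  fixes T :: "('a::euclidean_space \<times> 'b::euclidean_space \<Rightarrow> complex) \<Rightarrow> 'a \<times> 'b \<Rightarrow> complex"
  assumes T: "bounded_L2_op T" and fc: "fully_cancellative T" and chi: "cutoff chi1" "cutoff chi2"
    and m: "mean_zero_test f1" "mean_zero_test f2" "mean_zero_test g1" "mean_zero_test g2"
    and ab: "a1 * b1 = 0" "a2 * b2 = 0"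
  shows "(\<lambda>k. quad T (\<lambda>x. f1 x - a1 * dil chi1 k x) (\<lambda>x. f2 x - a2 * dil chi2 k x) (\<lambda>x. g1 x - b1 * dil chi1 k x) (\<lambda>x. g2 x - b2 * dil chi2 k x))
     \<longlonglongrightarrow> quad T f1 f2 g1 g2"
proof -
  have t: "test_fun f1" "test_fun f2" "test_fun g1" "test_fun g2" using m by (auto simp: mean_zero_test_def)
  \<comment> \<open>For k = 0 the dilation divides by 0 and gives a constant function, so k >= 1 is
    imposed.\<close>
  have d: "test_fun (dil chi1 k)" "test_fun (dil chi2 k)" if "k \<ge> 1" for k using chi that by (auto simp: cutoff_def intro!: test_fun_dil)
  note L = fc[unfolded fully_cancellative_def quad_def[symmetric], rule_format, OF chi m]
  note q = quad_sub[OF T]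
  note sub = test_fun_diff_cmult
  consider (1) "b1 = 0" "b2 = 0" | (2) "b1 = 0" "a2 = 0" | (3) "a1 = 0" "b2 = 0" | (4) "a1 = 0" "a2 = 0" using ab by auto
  then show ?thesis
  proof cases
    case 1
    have "\<forall>\<^sub>F k in sequentially. quad T f1 f2 g1 g2 - a1 * quad T (dil chi1 k) f2 g1 g2 - a2 * (quad T f1 (dil chi2 k) g1 g2 - a1 * quad T (dil chi1 k) (dil chi2 k) g1 g2)
       = quad T (\<lambda>x. f1 x - a1 * dil chi1 k x) (\<lambda>x. f2 x - a2 * dil chi2 k x) (\<lambda>x. g1 x - b1 * dil chi1 k x) (\<lambda>x. g2 x - b2 * dil chi2 k x)"
      using eventually_ge_at_top[of 1]
    proof eventually_elim
      case (elim k)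
      show ?case using 1 t d[OF elim] by (simp add: q sub algebra_simps)
    qed
    moreover have "(\<lambda>k. quad T f1 f2 g1 g2 - a1 * quad T (dil chi1 k) f2 g1 g2 - a2 * (quad T f1 (dil chi2 k) g1 g2 - a1 * quad T (dil chi1 k) (dil chi2 k) g1 g2))
       \<longlonglongrightarrow> quad T f1 f2 g1 g2 - a1 * 0 - a2 * (0 - a1 * 0)" using L by (intro tendsto_intros) auto
    ultimately show ?thesis by (simp add: tendsto_cong)
  next
    case 2
    have "\<forall>\<^sub>F k in sequentially. quad T f1 f2 g1 g2 - a1 * quad T (dil chi1 k) f2 g1 g2 - b2 * (quad T f1 f2 g1 (dil chi2 k) - a1 * quad T (dil chi1 k) f2 g1 (dil chi2 k))
       = quad T (\<lambda>x. f1 x - a1 * dil chi1 k x) (\<lambda>x. f2 x - a2 * dil chi2 k x) (\<lambda>x. g1 x - b1 * dil chi1 k x) (\<lambda>x. g2 x - b2 * dil chi2 k x)"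
      using eventually_ge_at_top[of 1]
    proof eventually_elim
      case (elim k)
      show ?case using 2 t d[OF elim] by (simp add: q sub algebra_simps)
    qed
    moreover have "(\<lambda>k. quad T f1 f2 g1 g2 - a1 * quad T (dil chi1 k) f2 g1 g2 - b2 * (quad T f1 f2 g1 (dil chi2 k) - a1 * quad T (dil chi1 k) f2 g1 (dil chi2 k)))
       \<longlonglongrightarrow> quad T f1 f2 g1 g2 - a1 * 0 - b2 * (0 - a1 * 0)" using L by (intro tendsto_intros) auto
    ultimately show ?thesis by (simp add: tendsto_cong)
  next
    case 3
    have "\<forall>\<^sub>F k in sequentially. quad T f1 f2 g1 g2 - a2 * quad T f1 (dil chi2 k) g1 g2 - b1 * (quad T f1 f2 (dil chi1 k) g2 - a2 * quad T f1 (dil chi2 k) (dil chi1 k) g2)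
       = quad T (\<lambda>x. f1 x - a1 * dil chi1 k x) (\<lambda>x. f2 x - a2 * dil chi2 k x) (\<lambda>x. g1 x - b1 * dil chi1 k x) (\<lambda>x. g2 x - b2 * dil chi2 k x)"
      using eventually_ge_at_top[of 1]
    proof eventually_elim
      case (elim k)
      show ?case using 3 t d[OF elim] by (simp add: q sub algebra_simps)
    qed
    moreover have "(\<lambda>k. quad T f1 f2 g1 g2 - a2 * quad T f1 (dil chi2 k) g1 g2 - b1 * (quad T f1 f2 (dil chi1 k) g2 - a2 * quad T f1 (dil chi2 k) (dil chi1 k) g2))
       \<longlonglongrightarrow> quad T f1 f2 g1 g2 - a2 * 0 - b1 * (0 - a2 * 0)" using L by (intro tendsto_intros) auto
    ultimately show ?thesis by (simp add: tendsto_cong)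
  next
    case 4
    have "\<forall>\<^sub>F k in sequentially. quad T f1 f2 g1 g2 - b1 * quad T f1 f2 (dil chi1 k) g2 - b2 * (quad T f1 f2 g1 (dil chi2 k) - b1 * quad T f1 f2 (dil chi1 k) (dil chi2 k))
       = quad T (\<lambda>x. f1 x - a1 * dil chi1 k x) (\<lambda>x. f2 x - a2 * dil chi2 k x) (\<lambda>x. g1 x - b1 * dil chi1 k x) (\<lambda>x. g2 x - b2 * dil chi2 k x)"
      using eventually_ge_at_top[of 1]
    proof eventually_elim
      case (elim k)
      show ?case using 4 t d[OF elim] by (simp add: q sub algebra_simps)
    qed
    moreover have "(\<lambda>k. quad T f1 f2 g1 g2 - b1 * quad T f1 f2 (dil chi1 k) g2 - b2 * (quad T f1 f2 g1 (dil chi2 k) - b1 * quad T f1 f2 (dil chi1 k) (dil chi2 k)))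
       \<longlonglongrightarrow> quad T f1 f2 g1 g2 - b1 * 0 - b2 * (0 - b1 * 0)" using L by (intro tendsto_intros) auto
    ultimately show ?thesis by (simp add: tendsto_cong)
  qed
qed

text \<open>How large k must be depends on the four points, but the bound for the corrected wavelets
  does not depend on k. It therefore survives the limit, in which full cancellation removes the
  corrections.\<close>

lemma wavelet_matrix_bound:
  fixes T :: "('a::euclidean_space \<times> 'b::euclidean_space \<Rightarrow> complex) \<Rightarrow> 'a \<times> 'b \<Rightarrow> complex"
  assumes w: "wavelet \<psi>1" "wavelet \<psi>2" and T: "biparam_czo T" and fc: "fully_cancellative T"
  obtains C \<epsilon> where "C > 0" "\<epsilon> > 0" "\<And>z1 z2 w1 w2. snd z1 > 0 \<Longrightarrow> snd z2 > 0 \<Longrightarrow> snd w1 > 0 \<Longrightarrow> snd w2 > 0 \<Longrightarrow>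
     cmod (quad T (wav \<psi>1 z1) (wav \<psi>2 z2) (wav \<psi>1 w1) (wav \<psi>2 w2)) \<le> C * (hker \<epsilon> z1 w1 * hker \<epsilon> z2 w2)"
proof -
  have Tb: "bounded_L2_op T" using T by (simp add: biparam_czo_def)
  obtain \<delta> C1 C2 K1 K2 where \<delta>: "0 < \<delta>" "\<delta> \<le> 1" and K: "czo_valued_kernel \<delta> C1 (K1 :: 'a \<Rightarrow> 'a \<Rightarrow> (('b \<Rightarrow> complex) \<Rightarrow> ('b \<Rightarrow> complex) \<Rightarrow> complex))"
        "czo_valued_kernel \<delta> C2 (K2 :: 'b \<Rightarrow> 'b \<Rightarrow> (('a \<Rightarrow> complex) \<Rightarrow> ('a \<Rightarrow> complex) \<Rightarrow> complex))"
    and r1: "\<forall>f1 f2 g1 g2. test_fun f1 \<longrightarrow> test_fun f2 \<longrightarrow> test_fun g1 \<longrightarrow> test_fun g2 \<longrightarrow> tsupp f1 \<inter> tsupp g1 = {} \<longrightarrow>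
           pair (T (tensor f1 f2)) (tensor g1 g2) = integral\<^sup>L lborel (\<lambda>(x, y). f1 y * g1 x * K1 x y f2 g2)"
    and r2: "\<forall>f1 f2 g1 g2. test_fun f1 \<longrightarrow> test_fun f2 \<longrightarrow> test_fun g1 \<longrightarrow> test_fun g2 \<longrightarrow> tsupp f2 \<inter> tsupp g2 = {} \<longrightarrow>
           pair (T (tensor f1 f2)) (tensor g1 g2) = integral\<^sup>L lborel (\<lambda>(x, y). f2 y * g2 x * K2 x y f1 g1)"
    using T unfolding biparam_czo_def by (elim conjE exE) blast
  obtain C0 where C0: "C0 > 0" "\<And>f. sq_int f \<Longrightarrow> l2norm (T f) \<le> C0 * l2norm f" using bounded_L2_op_bound[OF Tb] by blast
  obtain chi1 :: "'a \<Rightarrow> complex" where chi1: "cutoff chi1" using ex_cutoff[OF w(1)] by blast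
  obtain chi2 :: "'b \<Rightarrow> complex" where chi2: "cutoff chi2" using ex_cutoff[OF w(2)] by blast
  obtain A1 where A1: "A1 > 0" "\<And>z w. snd z > 0 \<Longrightarrow> snd w > 0 \<Longrightarrow> \<exists>al be k0. al * be = 0 \<and> (\<forall>k\<ge>k0.
     good \<delta> (A1 * hker (\<delta> / 2) z w) (\<lambda>u. wav \<psi>1 z u - al * dil chi1 k u) (\<lambda>u. wav \<psi>1 w u - be * dil chi1 k u))"
    using wavelet_pair_good[OF w(1) chi1 \<delta>] by blast
  obtain A2 where A2: "A2 > 0" "\<And>z w. snd z > 0 \<Longrightarrow> snd w > 0 \<Longrightarrow> \<exists>al be k0. al * be = 0 \<and> (\<forall>k\<ge>k0.
     good \<delta> (A2 * hker (\<delta> / 2) z w) (\<lambda>u. wav \<psi>2 z u - al * dil chi2 k u) (\<lambda>u. wav \<psi>2 w u - be * dil chi2 k u))"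
    using wavelet_pair_good[OF w(2) chi2 \<delta>] by blast
  define D where "D = \<bar>C0 + C1 + C2\<bar> + 1"
  have D: "D > 0" "C0 + C1 + C2 \<le> D" by (auto simp: D_def)
  have "cmod (quad T (wav \<psi>1 z1) (wav \<psi>2 z2) (wav \<psi>1 w1) (wav \<psi>2 w2)) \<le> (A1 * A2 * D) * (hker (\<delta> / 2) z1 w1 * hker (\<delta> / 2) z2 w2)"
    if p: "snd z1 > 0" "snd z2 > 0" "snd w1 > 0" "snd w2 > 0" for z1 z2 w1 w2
  proof -
    define l1 where "l1 = A1 * hker (\<delta> / 2) z1 w1"
    define l2 where "l2 = A2 * hker (\<delta> / 2) z2 w2"
    have l: "l1 \<ge> 0" "l2 \<ge> 0" unfolding l1_def l2_def 
      by (intro mult_nonneg_nonneg hker_nonneg less_imp_le[OF A1(1)] less_imp_le[OF A2(1)])+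
    obtain a1 b1 k1 where 1: "a1 * b1 = 0" "\<forall>k\<ge>k1. good \<delta> l1 (\<lambda>u. wav \<psi>1 z1 u - a1 * dil chi1 k u) (\<lambda>u. wav \<psi>1 w1 u - b1 * dil chi1 k u)"
      using A1(2)[OF p(1,3)] unfolding l1_def by blast
    obtain a2 b2 k2 where 2: "a2 * b2 = 0" "\<forall>k\<ge>k2. good \<delta> l2 (\<lambda>u. wav \<psi>2 z2 u - a2 * dil chi2 k u) (\<lambda>u. wav \<psi>2 w2 u - b2 * dil chi2 k u)"
      using A2(2)[OF p(2,4)] unfolding l2_def by blast
    have tw: "test_fun (wav \<psi>1 z1)" "test_fun (wav \<psi>2 z2)" "test_fun (wav \<psi>1 w1)" "test_fun (wav \<psi>2 w2)" using test_fun_wav w p by blast+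
    have mz: "mean_zero_test (wav \<psi>1 z1)" "mean_zero_test (wav \<psi>2 z2)" "mean_zero_test (wav \<psi>1 w1)" "mean_zero_test (wav \<psi>2 w2)"
      unfolding mean_zero_test_def using tw wav_integral(1) w p by blast+
    note lim = quad_cancel_limit[OF Tb fc chi1 chi2 mz 1(1) 2(1)]
    have "cmod (quad T (\<lambda>x. wav \<psi>1 z1 x - a1 * dil chi1 k x) (\<lambda>x. wav \<psi>2 z2 x - a2 * dil chi2 k x) (\<lambda>x. wav \<psi>1 w1 x - b1 * dil chi1 k x) (\<lambda>x. wav \<psi>2 w2 x - b2 * dil chi2 k x))
        \<le> l1 * l2 * D" if k: "k \<ge> max 1 (max k1 k2)" for k
    proof -
      have d: "test_fun (dil chi1 k)" "test_fun (dil chi2 k)" using chi1 chi2 k by (auto simp: cutoff_def intro!: test_fun_dil)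
      have "cmod (quad T (\<lambda>x. wav \<psi>1 z1 x - a1 * dil chi1 k x) (\<lambda>x. wav \<psi>2 z2 x - a2 * dil chi2 k x) (\<lambda>x. wav \<psi>1 w1 x - b1 * dil chi1 k x) (\<lambda>x. wav \<psi>2 w2 x - b2 * dil chi2 k x))
         \<le> l1 * l2 * (C0 + C1 + C2)"
        unfolding quad_def
      proof (rule biparam_good_bound[OF Tb C0(2) _ \<delta>(1) K])
        show "good \<delta> l1 (\<lambda>u. wav \<psi>1 z1 u - a1 * dil chi1 k u) (\<lambda>u. wav \<psi>1 w1 u - b1 * dil chi1 k u)" using 1 k by simp
        show "good \<delta> l2 (\<lambda>u. wav \<psi>2 z2 u - a2 * dil chi2 k u) (\<lambda>u. wav \<psi>2 w2 u - b2 * dil chi2 k u)" using 2 k by simp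
      qed (use r1 r2 C0 in \<open>auto intro!: test_fun_diff_cmult tw d\<close>)
      also have "\<dots> \<le> l1 * l2 * D" using l D by (intro mult_left_mono) auto
      finally show ?thesis .
    qed
    then have "cmod (quad T (wav \<psi>1 z1) (wav \<psi>2 z2) (wav \<psi>1 w1) (wav \<psi>2 w2)) \<le> l1 * l2 * D"
      by (intro LIMSEQ_le_const2[OF tendsto_norm[OF lim]]) blast
    then show ?thesis by (simp add: l1_def l2_def mult_ac)
  qed
  then show thesis using that[of "A1 * A2 * D" "\<delta> / 2"] A1 A2 D \<delta> by auto
qed

section \<open>Hyperbolic balls and the almost-diagonal kernel\<close>

lemma hdist_quotient:
  fixes z w :: "'a::euclidean_space \<times> real"
  assumes p: "snd z > 0" "snd w > 0"
  shows "1 + ((dist (fst z) (fst w))\<^sup>2 + (snd z - snd w)\<^sup>2) / (2 * snd z * snd w) = ((dist (fst z) (fst w))\<^sup>2 + (snd z)\<^sup>2 + (snd w)\<^sup>2) / (2 * snd z * snd w)"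
  using p by (simp add: field_simps power2_eq_square)

text \<open>The hyperbolic cosine is increasing on the nonnegative reals, so membership becomes a
  condition on a rational function of the coordinates.\<close>

lemma mem_hball_iff:
  fixes z w :: "'a::euclidean_space \<times> real"
  assumes p: "snd z > 0" "snd w > 0" and R: "R > 0"
  shows "w \<in> hball z R \<longleftrightarrow> ((dist (fst z) (fst w))\<^sup>2 + (snd z)\<^sup>2 + (snd w)\<^sup>2) / (2 * snd z * snd w) < cosh R"
proof -
  define X where "X = 1 + ((dist (fst z) (fst w))\<^sup>2 + (snd z - snd w)\<^sup>2) / (2 * snd z * snd w)"
  have X: "X \<ge> 1" unfolding X_def using p by simp
  have a: "arcosh X \<ge> 0" using X by (rule arcosh_nonneg_real)
  have "cosh (arcosh X) = X" using X by (rule cosh_arcosh_real)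
  then have "arcosh X < R \<longleftrightarrow> X < cosh R" using cosh_real_nonneg_less_iff[OF a, of R] R by simp
  moreover have "w \<in> hball z R \<longleftrightarrow> hdist z w < R" using p by (simp add: hball_def)
  moreover have "hdist z w = arcosh X" by (simp add: hdist_def X_def)
  ultimately show ?thesis unfolding hdist_quotient[OF p, symmetric] X_def[symmetric] by simp
qed

text \<open>Half of the decay is split off as a power of min/(max + dist), a number between 0 and 1
  that is small when the points are hyperbolically far apart.\<close>

lemma hker_ratio:
  fixes z w :: "'a::euclidean_space \<times> real"
  assumes p: "snd z > 0" "snd w > 0"
  shows "hker \<epsilon> z w = hker (\<epsilon> / 2) z w * (min (snd z) (snd w) / (max (snd z) (snd w) + dist (fst z) (fst w))) powr (\<epsilon> / 2)"
proof -
  define m where "m = min (snd z) (snd w)"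
  define q where "q = max (snd z) (snd w) + dist (fst z) (fst w)"
  let ?n = "real DIM('a)"
  have m: "m > 0" "q > 0" using p by (auto simp: m_def q_def intro!: add_pos_nonneg)
  have 1: "m powr (?n / 2 + \<epsilon>) = m powr (?n / 2 + \<epsilon> / 2) * m powr (\<epsilon> / 2)" unfolding powr_add[symmetric] by (rule arg_cong[where f="\<lambda>e. m powr e"]) simp
  have 2: "q powr - (?n + \<epsilon>) = q powr - (?n + \<epsilon> / 2) * q powr - (\<epsilon> / 2)" unfolding powr_add[symmetric] by (rule arg_cong[where f="\<lambda>e. q powr e"]) simp
  have 3: "(m / q) powr (\<epsilon> / 2) = m powr (\<epsilon> / 2) * q powr - (\<epsilon> / 2)" using m by (simp add: powr_divide powr_minus_divide)
  show ?thesis unfolding hker_def m_def[symmetric] q_def[symmetric] 1 2 3 by (simp only: mult_ac)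
qed

lemma hker_ratio_le_1:
  fixes z w :: "'a::euclidean_space \<times> real"
  assumes p: "snd z > 0" "snd w > 0"
  shows "0 < min (snd z) (snd w) / (max (snd z) (snd w) + dist (fst z) (fst w))" "min (snd z) (snd w) / (max (snd z) (snd w) + dist (fst z) (fst w)) \<le> 1"
proof -
  have "min (snd z) (snd w) \<le> max (snd z) (snd w) + dist (fst z) (fst w)" using zero_le_dist[of "fst z" "fst w"] by linarith
  moreover have "max (snd z) (snd w) + dist (fst z) (fst w) > 0" using p by (intro add_pos_nonneg) auto
  ultimately show "0 < min (snd z) (snd w) / (max (snd z) (snd w) + dist (fst z) (fst w))" "min (snd z) (snd w) / (max (snd z) (snd w) + dist (fst z) (fst w)) \<le> 1"
    using p by (auto intro!: divide_pos_pos)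
qed

lemma hker_half:
  fixes z w :: "'a::euclidean_space \<times> real"
  assumes p: "snd z > 0" "snd w > 0" and \<epsilon>: "\<epsilon> > 0"
  shows "hker \<epsilon> z w \<le> hker (\<epsilon> / 2) z w"
proof -
  have "(min (snd z) (snd w) / (max (snd z) (snd w) + dist (fst z) (fst w))) powr (\<epsilon> / 2) \<le> 1"

  proof -
    have "(min (snd z) (snd w) / (max (snd z) (snd w) + dist (fst z) (fst w))) powr (\<epsilon> / 2) \<le> 1 powr (\<epsilon> / 2)"
      by (intro powr_mono2 less_imp_le[OF hker_ratio_le_1(1)[OF p]] hker_ratio_le_1(2)[OF p]) (use \<epsilon> in simp)
    then show ?thesis by simp
  qed
  then have "hker (\<epsilon> / 2) z w * (min (snd z) (snd w) / (max (snd z) (snd w) + dist (fst z) (fst w))) powr (\<epsilon> / 2) \<le> hker (\<epsilon> / 2) z w * 1"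
    by (intro mult_left_mono hker_nonneg)
  then show ?thesis unfolding hker_ratio[OF p, of \<epsilon>] by simp
qed

text \<open>With scales m <= M, the cosine of the hyperbolic distance is (d^2+m^2+M^2)/(2mM) <=
  ((M+d)/m)^2. Outside the ball the ratio m/(M+d) is thus at most cosh(R)^(-1/2).\<close>

lemma hker_far:
  fixes z w :: "'a::euclidean_space \<times> real"
  assumes p: "snd z > 0" "snd w > 0" and \<epsilon>: "\<epsilon> > 0" and R: "R > 0" and far: "w \<notin> hball z R"
  shows "hker \<epsilon> z w \<le> cosh R powr - (\<epsilon> / 4) * hker (\<epsilon> / 2) z w"
proof -
  define m where "m = min (snd z) (snd w)"
  define M where "M = max (snd z) (snd w)"
  define d where "d = dist (fst z) (fst w)"
  have pm: "m > 0" "M > 0" "m \<le> M" "d \<ge> 0" using p by (auto simp: m_def M_def d_def)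
  have mM: "snd z * snd w = m * M" unfolding m_def M_def by (simp add: min_def max_def)
  have sq: "(snd z)\<^sup>2 + (snd w)\<^sup>2 = m\<^sup>2 + M\<^sup>2" unfolding m_def M_def by (simp add: min_def max_def)
  have "cosh R \<le> (d\<^sup>2 + (snd z)\<^sup>2 + (snd w)\<^sup>2) / (2 * snd z * snd w)"
    using far mem_hball_iff[OF p R] unfolding d_def by simp
  also have "\<dots> = (d\<^sup>2 + (m\<^sup>2 + M\<^sup>2)) / (2 * (m * M))" unfolding mM[symmetric] sq[symmetric] by (simp add: add.assoc mult.assoc)
  also have "\<dots> \<le> (2 * (M + d)\<^sup>2) / (2 * (m * M))"
  proof (intro divide_right_mono)
    have "m\<^sup>2 \<le> M\<^sup>2" using pm by (intro power_mono) auto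
    moreover have "0 \<le> M * d" using pm by simp
    moreover have "(M + d)\<^sup>2 = M\<^sup>2 + 2 * (M * d) + d\<^sup>2" by (simp add: power2_sum)
    moreover have "0 \<le> d\<^sup>2" by simp
    ultimately show "d\<^sup>2 + (m\<^sup>2 + M\<^sup>2) \<le> 2 * (M + d)\<^sup>2" by linarith
  qed (use pm in auto)
  also have "\<dots> = (M + d)\<^sup>2 / (m * M)" by simp
  also have "\<dots> \<le> (M + d)\<^sup>2 / (m * m)" using pm by (intro divide_left_mono mult_left_mono) auto
  also have "\<dots> = ((M + d) / m)\<^sup>2" by (simp add: power2_eq_square)
  finally have c: "cosh R \<le> ((M + d) / m)\<^sup>2" .
  have cp: "cosh R > 0" by (rule cosh_real_pos)
  have r: "(m / (M + d)) powr (\<epsilon> / 2) = (((M + d) / m)\<^sup>2) powr - (\<epsilon> / 4)"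
  proof -
    have pos: "(M + d) / m > 0" using pm by (intro divide_pos_pos) auto
    have "(((M + d) / m)\<^sup>2) powr - (\<epsilon> / 4) = ((M + d) / m) powr (2 * - (\<epsilon> / 4))" 
    proof -
      have "((M + d) / m)\<^sup>2 = ((M + d) / m) powr 2" using pos by (simp only: powr_numeral less_imp_le)
      then show ?thesis by (simp only: powr_powr)
    qed
    also have "\<dots> = inverse ((M + d) / m) powr (\<epsilon> / 2)" 
    proof -
      have e: "2 * - (\<epsilon> / 4) = - (\<epsilon> / 2)" by simp
      show ?thesis unfolding e powr_minus by (rule inverse_powr[symmetric])
    qed
    finally show ?thesis by simp
  qed
  have "(m / (M + d)) powr (\<epsilon> / 2) \<le> cosh R powr - (\<epsilon> / 4)"
    unfolding r using c cp \<epsilon> by (intro powr_mono2') auto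
  then have "hker (\<epsilon> / 2) z w * (m / (M + d)) powr (\<epsilon> / 2) \<le> hker (\<epsilon> / 2) z w * cosh R powr - (\<epsilon> / 4)" by (intro mult_left_mono hker_nonneg)
  then show ?thesis unfolding hker_ratio[OF p, of \<epsilon>] m_def M_def d_def by (simp add: mult.commute)
qed

text \<open>Inside the ball (M+d)^2 <= 2(d^2+m^2+M^2) < 4 cosh(R) m M, whence M+d <= 4 cosh(R) m.
  All scales are then comparable to m, and the powers of m cancel by homogeneity.\<close>

lemma hker_near_lower:
  fixes z w :: "'a::euclidean_space \<times> real"
  assumes p: "snd z > 0" "snd w > 0" and \<epsilon>: "\<epsilon> > 0" and R: "R > 0" and near: "w \<in> hball z R"
  shows "(4 * cosh R) powr - (real DIM('a) + \<epsilon>) \<le> hker \<epsilon> z w"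
proof -
  let ?n = "real DIM('a)"
  define m where "m = min (snd z) (snd w)"
  define M where "M = max (snd z) (snd w)"
  define d where "d = dist (fst z) (fst w)"
  have pm: "m > 0" "M > 0" "m \<le> M" "d \<ge> 0" using p by (auto simp: m_def M_def d_def)
  have mM: "snd z * snd w = m * M" unfolding m_def M_def by (simp add: min_def max_def)
  have sq: "(snd z)\<^sup>2 + (snd w)\<^sup>2 = m\<^sup>2 + M\<^sup>2" unfolding m_def M_def by (simp add: min_def max_def)
  have cp: "cosh R > 0" by (rule cosh_real_pos)
  have "(d\<^sup>2 + (snd z)\<^sup>2 + (snd w)\<^sup>2) / (2 * snd z * snd w) < cosh R"
    using near mem_hball_iff[OF p R] unfolding d_def by simp
  then have "(d\<^sup>2 + (m\<^sup>2 + M\<^sup>2)) / (2 * (m * M)) < cosh R" unfolding mM[symmetric] sq[symmetric] by (simp add: add.assoc mult.assoc)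
  then have 1: "d\<^sup>2 + (m\<^sup>2 + M\<^sup>2) < cosh R * (2 * (m * M))" using pm by (simp add: pos_divide_less_eq)
  have "2 * (M * d) \<le> M * M + d * d" using sum_squares_bound[of M d] by (simp add: power2_eq_square)
  moreover have "0 \<le> m * m" by simp
  ultimately have "M * M + 2 * (M * d) + d * d \<le> 2 * (d * d + (m * m + M * M))" by argo
  moreover have "(M + d) * (M + d) = M * M + 2 * (M * d) + d * d" by (simp add: algebra_simps)
  ultimately have "(M + d) * (M + d) \<le> 2 * (d\<^sup>2 + (m\<^sup>2 + M\<^sup>2))" by (simp only: power2_eq_square)
  also have "\<dots> \<le> 4 * cosh R * m * M" using 1 by simp
  also have "\<dots> \<le> 4 * cosh R * m * (M + d)" using pm cp by (intro mult_left_mono) auto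
  finally have Md: "M + d \<le> 4 * cosh R * m" using pm by (simp add: mult_le_cancel_right)
  have "(4 * cosh R) powr - (?n + \<epsilon>) = (4 * cosh R * m) powr - (?n + \<epsilon>) * m powr (?n + \<epsilon>)"
  proof -
    have "(4 * cosh R * m) powr - (?n + \<epsilon>) = (4 * cosh R) powr - (?n + \<epsilon>) * m powr - (?n + \<epsilon>)" using pm cp by (simp add: powr_mult)
    moreover have "m powr - (?n + \<epsilon>) * m powr (?n + \<epsilon>) = 1" using pm by (simp add: powr_add[symmetric])
    ultimately show ?thesis by (simp only: mult.assoc mult_1_right)
  qed
  also have "\<dots> \<le> (M + d) powr - (?n + \<epsilon>) * m powr (?n + \<epsilon>)"
    using Md pm \<epsilon> by (intro mult_right_mono powr_mono2') auto
  also have "m powr (?n + \<epsilon>) = m powr (?n / 2 + \<epsilon>) * m powr (?n / 2)" unfolding powr_add[symmetric] by (rule arg_cong[where f="\<lambda>e. m powr e"]) simp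
  also have "(M + d) powr - (?n + \<epsilon>) * (m powr (?n / 2 + \<epsilon>) * m powr (?n / 2)) \<le> (M + d) powr - (?n + \<epsilon>) * (m powr (?n / 2 + \<epsilon>) * M powr (?n / 2))"
    using pm by (intro mult_left_mono powr_mono2) auto
  also have "\<dots> = hker \<epsilon> z w" unfolding hker_def m_def M_def d_def by (simp only: mult_ac)
  finally show ?thesis .
qed

text \<open>R is fixed first so that C cosh(R)^(-\<epsilon>/4) <= \<eta>; then weak compactness is
  invoked at tolerance \<eta> c1 c2, where c1 and c2 bound the two kernels from below on balls of
  radius R. If one of the points w1, w2 is far, its factor alone provides the smallness.\<close>

lemma wavelet_matrix_small:
  fixes T :: "('a::euclidean_space \<times> 'b::euclidean_space \<Rightarrow> complex) \<Rightarrow> 'a \<times> 'b \<Rightarrow> complex"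
  assumes pwc: "product_weak_compact \<psi>1 \<psi>2 T" and C: "C > 0" and \<epsilon>: "\<epsilon> > 0" 
    and mb: "\<And>z1 z2 w1 w2. snd z1 > 0 \<Longrightarrow> snd z2 > 0 \<Longrightarrow> snd w1 > 0 \<Longrightarrow> snd w2 > 0 \<Longrightarrow>
     cmod (quad T (wav \<psi>1 z1) (wav \<psi>2 z2) (wav \<psi>1 w1) (wav \<psi>2 w2)) \<le> C * (hker \<epsilon> z1 w1 * hker \<epsilon> z2 w2)"
    and \<eta>: "\<eta> > 0"
  obtains R0 where "\<And>z1 z2 w1 w2. snd z1 > 0 \<Longrightarrow> snd z2 > 0 \<Longrightarrow> snd w1 > 0 \<Longrightarrow> snd w2 > 0 \<Longrightarrow> z1 \<notin> hball (0, 1) R0 \<or> z2 \<notin> hball (0, 1) R0 \<Longrightarrow>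
     cmod (quad T (wav \<psi>1 z1) (wav \<psi>2 z2) (wav \<psi>1 w1) (wav \<psi>2 w2)) \<le> \<eta> * (hker (\<epsilon> / 2) z1 w1 * hker (\<epsilon> / 2) z2 w2)"
proof -
  have "((\<lambda>R::real. cosh R powr - (\<epsilon> / 4)) \<longlongrightarrow> 0) at_top"
    using \<epsilon> by (intro tendsto_neg_powr cosh_real_at_top) auto
  then have "\<forall>\<^sub>F R in at_top. cosh (R::real) powr - (\<epsilon> / 4) < \<eta> / C" using C \<eta> by (intro order_tendstoD(2)) auto
  moreover have "\<forall>\<^sub>F R in at_top. (R::real) > 0" by (rule eventually_gt_at_top)
  ultimately have "\<forall>\<^sub>F R in at_top. cosh (R::real) powr - (\<epsilon> / 4) < \<eta> / C \<and> R > 0" by eventually_elim simp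
  then obtain R :: real where R: "cosh R powr - (\<epsilon> / 4) < \<eta> / C" "R > 0" using eventually_happens'[OF trivial_limit_at_top_linorder] by blast
  have CR: "C * cosh R powr - (\<epsilon> / 4) \<le> \<eta>" using R(1) C by (simp add: field_simps)
  define c1 where "c1 = (4 * cosh R) powr - (real DIM('a) + \<epsilon> / 2)"
  define c2 where "c2 = (4 * cosh R) powr - (real DIM('b) + \<epsilon> / 2)"
  have c: "c1 > 0" "c2 > 0" unfolding c1_def c2_def using cosh_real_pos[of R] by auto
  then have "\<eta> * (c1 * c2) > 0" using \<eta> by simp
  then obtain R0 where R0: "\<forall>z1 z2. snd z1 > 0 \<longrightarrow> snd z2 > 0 \<longrightarrow> (z1 \<notin> hball (0, 1) R0 \<or> z2 \<notin> hball (0, 1) R0) \<longrightarrow>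
        (\<forall>w1\<in>hball z1 R. \<forall>w2\<in>hball z2 R. cmod (quad T (wav \<psi>1 z1) (wav \<psi>2 z2) (wav \<psi>1 w1) (wav \<psi>2 w2)) \<le> \<eta> * (c1 * c2))"
    using pwc R(2) unfolding product_weak_compact_def quad_def by blast
  show thesis
  proof (rule that)
    fix z1 w1 :: "'a \<times> real" and z2 w2 :: "'b \<times> real" assume p: "snd z1 > 0" "snd z2 > 0" "snd w1 > 0" "snd w2 > 0" and z: "z1 \<notin> hball (0, 1) R0 \<or> z2 \<notin> hball (0, 1) R0"
    let ?Q = "cmod (quad T (wav \<psi>1 z1) (wav \<psi>2 z2) (wav \<psi>1 w1) (wav \<psi>2 w2))"
    let ?h1 = "hker (\<epsilon> / 2) z1 w1" and ?h2 = "hker (\<epsilon> / 2) z2 w2"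
    have e2: "\<epsilon> / 2 > 0" using \<epsilon> by simp
    consider "w1 \<in> hball z1 R" "w2 \<in> hball z2 R" | "w1 \<notin> hball z1 R" | "w2 \<notin> hball z2 R" by blast
    then show "?Q \<le> \<eta> * (?h1 * ?h2)"
    proof cases
      case 1
      then have "?Q \<le> \<eta> * (c1 * c2)" using R0 p z by blast
      also have "\<dots> \<le> \<eta> * (?h1 * ?h2)" unfolding c1_def c2_def
        using hker_near_lower[OF p(1,3) e2 R(2) 1(1)] hker_near_lower[OF p(2,4) e2 R(2) 1(2)] \<eta> by (intro mult_left_mono mult_mono hker_nonneg) auto
      finally show ?thesis .
    next
      case 2
      have "?Q \<le> C * (hker \<epsilon> z1 w1 * hker \<epsilon> z2 w2)" by (rule mb[OF p])
      also have "\<dots> \<le> C * ((cosh R powr - (\<epsilon> / 4) * ?h1) * ?h2)"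
        using hker_far[OF p(1,3) \<epsilon> R(2) 2] hker_half[OF p(2,4) \<epsilon>] C by (intro mult_left_mono mult_mono hker_nonneg mult_nonneg_nonneg) auto
      also have "\<dots> = (C * cosh R powr - (\<epsilon> / 4)) * (?h1 * ?h2)" by simp
      also have "\<dots> \<le> \<eta> * (?h1 * ?h2)" by (intro mult_right_mono CR mult_nonneg_nonneg hker_nonneg)
      finally show ?thesis .
    next
      case 3
      have "?Q \<le> C * (hker \<epsilon> z1 w1 * hker \<epsilon> z2 w2)" by (rule mb[OF p])
      also have "\<dots> \<le> C * (?h1 * (cosh R powr - (\<epsilon> / 4) * ?h2))"
        using hker_far[OF p(2,4) \<epsilon> R(2) 3] hker_half[OF p(1,3) \<epsilon>] C by (intro mult_left_mono mult_mono hker_nonneg mult_nonneg_nonneg) auto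
      also have "\<dots> = (C * cosh R powr - (\<epsilon> / 4)) * (?h1 * ?h2)" by simp
      also have "\<dots> \<le> \<eta> * (?h1 * ?h2)" by (intro mult_right_mono CR mult_nonneg_nonneg hker_nonneg)
      finally show ?thesis .
    qed
  qed
qed

section \<open>The product wavelet transform\<close>

abbreviation pwav :: "('a::euclidean_space \<Rightarrow> real) \<Rightarrow> ('b::euclidean_space \<Rightarrow> real) \<Rightarrow> ('a \<times> real) \<times> ('b \<times> real) \<Rightarrow> 'a \<times> 'b \<Rightarrow> complex" where
  "pwav \<psi>1 \<psi>2 z \<equiv> tensor (wav \<psi>1 (fst z)) (wav \<psi>2 (snd z))"

abbreviation hmeas2 :: "(('a::euclidean_space \<times> real) \<times> ('b::euclidean_space \<times> real)) measure" where
  "hmeas2 \<equiv> hmeas \<Otimes>\<^sub>M hmeas"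

lemma pair_sigma_finite_hmeas: "pair_sigma_finite (hmeas :: ('a::euclidean_space \<times> real) measure) (hmeas :: ('b::euclidean_space \<times> real) measure)"
  by (simp add: pair_sigma_finite_def sigma_finite_hmeas)

lemma sets_hmeas2: "sets (hmeas2 :: (('a::euclidean_space \<times> real) \<times> ('b::euclidean_space \<times> real)) measure) = sets borel"
proof -
  have "sets (hmeas2 :: (('a \<times> real) \<times> ('b \<times> real)) measure) = sets (borel \<Otimes>\<^sub>M borel)"
    by (intro sets_pair_measure_cong sets_hmeas)
  then show ?thesis by (simp only: borel_prod)
qed

lemma AE_hmeas2: "AE z in (hmeas2 :: (('a::euclidean_space \<times> real) \<times> ('b::euclidean_space \<times> real)) measure). snd (fst z) > 0 \<and> snd (snd z) > 0"
proof -
  interpret pair_sigma_finite "hmeas :: ('a \<times> real) measure" "hmeas :: ('b \<times> real) measure" by (rule pair_sigma_finite_hmeas)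
  have m: "{z \<in> space (hmeas2 :: (('a \<times> real) \<times> ('b \<times> real)) measure). snd (fst z) > 0 \<and> snd (snd z) > 0} \<in> sets hmeas2" by measurable
  have "AE x in (hmeas :: ('a \<times> real) measure). AE y in (hmeas :: ('b \<times> real) measure). snd x > 0 \<and> snd y > 0"
  proof (use AE_hmeas[where 'a='a] in eventually_elim)
    case (elim x)
    show ?case using AE_hmeas[where 'a='b] by eventually_elim (use elim in simp)
  qed
  then have "AE x in (hmeas :: ('a \<times> real) measure). AE y in (hmeas :: ('b \<times> real) measure). snd (fst (x, y)) > 0 \<and> snd (snd (x, y)) > 0" by simp
  then show ?thesis by (subst AE_pair_iff[symmetric, OF m]) (simp only: fst_conv snd_conv)
qed

lemma sq_int_pwav:
  assumes "wavelet \<psi>1" "wavelet \<psi>2" "snd (fst z) > 0" "snd (snd z) > 0"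
  shows "sq_int (pwav \<psi>1 \<psi>2 z)"
  by (intro tensor_l2 sq_int_wav assms)

lemma pair_pwav_measurable:
  fixes f :: "'a::euclidean_space \<times> 'b::euclidean_space \<Rightarrow> complex"
  assumes w: "wavelet \<psi>1" "wavelet \<psi>2" and f: "f \<in> borel_measurable borel"
  shows "(\<lambda>z. pair f (pwav \<psi>1 \<psi>2 z)) \<in> borel_measurable borel"
proof -
  have [measurable]: "\<psi>1 \<in> borel_measurable borel" "\<psi>2 \<in> borel_measurable borel" using w wavelet_measurable by auto
  have [measurable]: "f \<in> borel_measurable borel" by (rule f)
  show ?thesis unfolding pair_def tensor_def wav_def split_beta by measurable
qed

text \<open>\<open>calderon\<close> is applied to the sections of f in the first variable and then
  to the partial transform \<open>F z1\<close> in the second. Both are square integrable only almost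
  everywhere, which Tonelli ensures, so each application takes place outside a null set.\<close>

lemma calderon_product:
  fixes f :: "'a::euclidean_space \<times> 'b::euclidean_space \<Rightarrow> complex"
  assumes w: "wavelet \<psi>1" "wavelet \<psi>2" and f: "sq_int f"
  shows "(\<integral>\<^sup>+z. ennreal ((cmod (pair f (pwav \<psi>1 \<psi>2 z)))\<^sup>2) \<partial>hmeas2) = ennreal ((l2norm f)\<^sup>2)"
proof -
  have [measurable]: "\<psi>1 \<in> borel_measurable borel" "\<psi>2 \<in> borel_measurable borel" using w wavelet_measurable by auto
  have f0: "f \<in> borel_measurable borel" using f by (simp add: sq_int_def)
  have fm[measurable]: "f \<in> borel_measurable (borel \<Otimes>\<^sub>M borel)" unfolding borel_prod by (rule f0)
  interpret H: pair_sigma_finite "hmeas :: ('a \<times> real) measure" "hmeas :: ('b \<times> real) measure" by (rule pair_sigma_finite_hmeas)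
  interpret HL: pair_sigma_finite "hmeas :: ('a \<times> real) measure" "lborel :: 'b measure"
    by (simp add: pair_sigma_finite_def sigma_finite_hmeas lborel.sigma_finite_measure_axioms)
  define F where "F = (\<lambda>z1 y. pair (\<lambda>x. f (x, y)) (wav \<psi>1 z1))"
  have Fm[measurable]: "(\<lambda>(z1, y). F z1 y) \<in> borel_measurable (borel \<Otimes>\<^sub>M borel)"
    unfolding F_def pair_def wav_def by measurable
  have sec: "AE y in lborel. sq_int (\<lambda>x. f (x, y))"
  proof -
    have fin: "(\<integral>\<^sup>+y. \<integral>\<^sup>+x. ennreal ((cmod (f (x, y)))\<^sup>2) \<partial>lborel \<partial>lborel) < \<infinity>"
    proof -
      have "(\<integral>\<^sup>+p. ennreal ((cmod (f p))\<^sup>2) \<partial>(lborel \<Otimes>\<^sub>M lborel)) < \<infinity>" using nn_integral_l2norm[OF f] by (simp add: lborel_prod)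
      then show ?thesis by (subst lborel_pair.nn_integral_snd) auto
    qed
    have "AE y in lborel. (\<integral>\<^sup>+x. ennreal ((cmod (f (x, y)))\<^sup>2) \<partial>lborel) \<noteq> \<infinity>"
      using fin by (intro nn_integral_PInf_AE) auto
    then show ?thesis by eventually_elim (intro sq_int_nnI, auto simp: less_top)
  qed
  have s1: "(\<integral>\<^sup>+z1. \<integral>\<^sup>+y. ennreal ((cmod (F z1 y))\<^sup>2) \<partial>lborel \<partial>hmeas) = ennreal ((l2norm f)\<^sup>2)"
  proof -
    have "(\<integral>\<^sup>+z1. \<integral>\<^sup>+y. ennreal ((cmod (F z1 y))\<^sup>2) \<partial>lborel \<partial>hmeas) = (\<integral>\<^sup>+y. \<integral>\<^sup>+z1. ennreal ((cmod (F z1 y))\<^sup>2) \<partial>hmeas \<partial>lborel)"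
      by (rule HL.Fubini'[symmetric]) measurable
    also have "\<dots> = (\<integral>\<^sup>+y. \<integral>\<^sup>+x. ennreal ((cmod (f (x, y)))\<^sup>2) \<partial>lborel \<partial>lborel)"
    proof (rule nn_integral_cong_AE, use sec in eventually_elim)
      case (elim y)
      show ?case unfolding F_def using calderon[OF w(1) elim] nn_integral_l2norm[OF elim] by simp
    qed
    also have "\<dots> = (\<integral>\<^sup>+p. ennreal ((cmod (f p))\<^sup>2) \<partial>(lborel \<Otimes>\<^sub>M lborel))" by (subst lborel_pair.nn_integral_snd) auto
    also have "\<dots> = ennreal ((l2norm f)\<^sup>2)" using nn_integral_l2norm[OF f] by (simp add: lborel_prod)
    finally show ?thesis .
  qed
  have "AE z1 in hmeas. (\<integral>\<^sup>+y. ennreal ((cmod (F z1 y))\<^sup>2) \<partial>lborel) \<noteq> \<infinity>"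
    using s1 by (intro nn_integral_PInf_AE) auto
  then have s2: "AE z1 in hmeas. (\<integral>\<^sup>+z2. ennreal ((cmod (pair f (pwav \<psi>1 \<psi>2 (z1, z2))))\<^sup>2) \<partial>hmeas) = (\<integral>\<^sup>+y. ennreal ((cmod (F z1 y))\<^sup>2) \<partial>lborel)"
    using AE_hmeas
  proof eventually_elim
    case (elim z1)
    have Fz[measurable]: "F z1 \<in> borel_measurable borel" using measurable_compose_Pair1[OF _ Fm, of z1] by simp
    have Fs: "sq_int (F z1)" using elim by (intro sq_int_nnI Fz) (auto simp: less_top)
    have "(\<integral>\<^sup>+z2. ennreal ((cmod (pair f (pwav \<psi>1 \<psi>2 (z1, z2))))\<^sup>2) \<partial>hmeas) = (\<integral>\<^sup>+z2. ennreal ((cmod (pair (F z1) (wav \<psi>2 z2)))\<^sup>2) \<partial>hmeas)"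
    proof (rule nn_integral_cong_AE, use AE_hmeas in eventually_elim)
      case (elim z2)
      have "integrable (lborel \<Otimes>\<^sub>M lborel) (\<lambda>p. f p * tensor (wav \<psi>1 z1) (wav \<psi>2 z2) p)"
        unfolding lborel_prod using \<open>0 < snd z1\<close> elim by (intro sq_int_mult_integrable f tensor_l2 sq_int_wav w)
      then have i: "integrable (lborel \<Otimes>\<^sub>M lborel) (\<lambda>(x, y). f (x, y) * (wav \<psi>1 z1 x * wav \<psi>2 z2 y))"
        by (simp add: tensor_def split_beta')
      have "pair f (pwav \<psi>1 \<psi>2 (z1, z2)) = (\<integral>p. (\<lambda>(x, y). f (x, y) * (wav \<psi>1 z1 x * wav \<psi>2 z2 y)) p \<partial>(lborel \<Otimes>\<^sub>M lborel))"
        unfolding pair_def lborel_prod by (simp add: tensor_def split_beta')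
      also have "\<dots> = (\<integral>y. (\<integral>x. f (x, y) * (wav \<psi>1 z1 x * wav \<psi>2 z2 y) \<partial>lborel) \<partial>lborel)"
        using lborel_pair.integral_snd[OF i] by simp
      also have "\<dots> = pair (F z1) (wav \<psi>2 z2)"
        unfolding F_def pair_def by (simp add: mult.assoc[symmetric])
      finally show ?case by simp
    qed
    also have "\<dots> = ennreal ((l2norm (F z1))\<^sup>2)" by (rule calderon[OF w(2) Fs])
    also have "\<dots> = (\<integral>\<^sup>+y. ennreal ((cmod (F z1 y))\<^sup>2) \<partial>lborel)" by (rule nn_integral_l2norm[OF Fs, symmetric])
    finally show ?case .
  qed
  have m: "(\<lambda>z. pair f (pwav \<psi>1 \<psi>2 z)) \<in> borel_measurable hmeas2"
    using pair_pwav_measurable[OF w f0] by (simp add: measurable_cong_sets[OF sets_hmeas2 refl])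
  have "(\<integral>\<^sup>+z. ennreal ((cmod (pair f (pwav \<psi>1 \<psi>2 z)))\<^sup>2) \<partial>hmeas2) = (\<integral>\<^sup>+z1. \<integral>\<^sup>+z2. ennreal ((cmod (pair f (pwav \<psi>1 \<psi>2 (z1, z2))))\<^sup>2) \<partial>hmeas \<partial>hmeas)"
    using m by (subst H.M2.nn_integral_fst[symmetric]) auto
  also have "\<dots> = (\<integral>\<^sup>+z1. \<integral>\<^sup>+y. ennreal ((cmod (F z1 y))\<^sup>2) \<partial>lborel \<partial>hmeas)" by (rule nn_integral_cong_AE[OF s2])
  also have "\<dots> = ennreal ((l2norm f)\<^sup>2)" by (rule s1)
  finally show ?thesis .
qed

text \<open>Comparison of the norm of h + c f with that of its coefficients isolates Re(c *
  product); c = 1 and c = \<i> give the real and the imaginary part.\<close>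

lemma calderon_polarized:
  fixes f h :: "'a::euclidean_space \<times> 'b::euclidean_space \<Rightarrow> complex"
  assumes w: "wavelet \<psi>1" "wavelet \<psi>2" and f: "sq_int f" and h: "sq_int h"
  shows "pair f (\<lambda>x. cnj (h x)) = (\<integral>z. pair f (pwav \<psi>1 \<psi>2 z) * cnj (pair h (pwav \<psi>1 \<psi>2 z)) \<partial>hmeas2)"
proof -
  define W where "W = (\<lambda>f z. pair f (pwav \<psi>1 \<psi>2 z))"
  have Wm[measurable]: "W f \<in> borel_measurable hmeas2" if "sq_int f" for f :: "'a \<times> 'b \<Rightarrow> complex"
    unfolding W_def using pair_pwav_measurable[OF w, of f] that by (simp add: sq_int_def measurable_cong_sets[OF sets_hmeas2 refl])
  have Wi: "integrable hmeas2 (\<lambda>z. (cmod (W f z))\<^sup>2)" and We: "(\<integral>z. (cmod (W f z))\<^sup>2 \<partial>hmeas2) = (l2norm f)\<^sup>2" if "sq_int f" for f :: "'a \<times> 'b \<Rightarrow> complex"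
  proof -
    have *: "(\<integral>\<^sup>+z. ennreal ((cmod (W f z))\<^sup>2) \<partial>hmeas2) = ennreal ((l2norm f)\<^sup>2)" unfolding W_def by (rule calderon_product[OF w that])
    show "integrable hmeas2 (\<lambda>z. (cmod (W f z))\<^sup>2)" using Wm[OF that] * by (intro integrableI_nonneg) auto
    show "(\<integral>z. (cmod (W f z))\<^sup>2 \<partial>hmeas2) = (l2norm f)\<^sup>2" using * by (intro integral_eq_nn_integral[THEN trans]) (use Wm[OF that] in auto)
  qed
  define A where "A = (\<integral>z. W f z * cnj (W h z) \<partial>hmeas2)"
  have ci: "integrable hmeas2 (\<lambda>z. W f z * cnj (W h z))"
    using f h by (intro integrable_mult_L2) (auto simp: Wi)
  have re: "Re (c * pair f (\<lambda>x. cnj (h x))) = Re (c * A)" for c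
  proof -
    have s: "sq_int (\<lambda>x. 1 * h x + c * f x)" by (intro sq_int_lincomb f h)
    have cc: "integrable hmeas2 (\<lambda>z. c * (W f z * cnj (W h z)))" using ci by simp
    have "(l2norm h)\<^sup>2 + 2 * Re (c * pair f (\<lambda>x. cnj (h x))) + (cmod c)\<^sup>2 * (l2norm f)\<^sup>2 = (l2norm (\<lambda>x. 1 * h x + c * f x))\<^sup>2"
      using l2norm_add_sq[OF h f, of c] by simp
    also have "\<dots> = (\<integral>z. (cmod (W (\<lambda>x. 1 * h x + c * f x) z))\<^sup>2 \<partial>hmeas2)" by (rule We[OF s, symmetric])
    also have "\<dots> = (\<integral>z. (cmod (W h z))\<^sup>2 + 2 * Re (c * (W f z * cnj (W h z))) + (cmod c)\<^sup>2 * (cmod (W f z))\<^sup>2 \<partial>hmeas2)"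
    proof (rule integral_cong_AE)
      show "AE z in hmeas2. (cmod (W (\<lambda>x. 1 * h x + c * f x) z))\<^sup>2 = (cmod (W h z))\<^sup>2 + 2 * Re (c * (W f z * cnj (W h z))) + (cmod c)\<^sup>2 * (cmod (W f z))\<^sup>2"
        using AE_hmeas2
      proof eventually_elim
        case (elim z)
        have "W (\<lambda>x. 1 * h x + c * f x) z = 1 * W h z + c * W f z" unfolding W_def
          using elim by (intro pair_lincomb_left h f sq_int_pwav w) auto
        then show ?case using cmod_add_sq[of "W h z" c "W f z"] by simp
      qed
      show "(\<lambda>z. (cmod (W (\<lambda>x. 1 * h x + c * f x) z))\<^sup>2) \<in> borel_measurable hmeas2" using Wm[OF s] by measurable
      show "(\<lambda>z. (cmod (W h z))\<^sup>2 + 2 * Re (c * (W f z * cnj (W h z))) + (cmod c)\<^sup>2 * (cmod (W f z))\<^sup>2) \<in> borel_measurable hmeas2"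
        using Wm[OF f] Wm[OF h] by measurable
    qed
    also have "\<dots> = (l2norm h)\<^sup>2 + 2 * Re (c * A) + (cmod c)\<^sup>2 * (l2norm f)\<^sup>2"
    proof -
      define p where "p = (\<lambda>z. Re (c * (W f z * cnj (W h z))))"
      have pi_: "integrable hmeas2 p" unfolding p_def by (rule integrable_Re[OF cc])
      have pe: "integral\<^sup>L hmeas2 p = Re (c * A)" unfolding p_def A_def using integral_Re[OF cc] by simp
      have pd: "Re (c * (W f z * cnj (W h z))) = p z" for z by (simp add: p_def)
      show ?thesis unfolding pd using pi_ Wi[OF f] Wi[OF h] by (simp add: We f h pe)
    qed
    finally show ?thesis by simp
  qed
  have "pair f (\<lambda>x. cnj (h x)) = A"
  proof (rule complex_eqI)
    show "Re (pair f (\<lambda>x. cnj (h x))) = Re A" using re[of 1] by simp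
    show "Im (pair f (\<lambda>x. cnj (h x))) = Im A" using re[of "\<i>"] by simp
  qed
  then show ?thesis by (simp add: A_def W_def)
qed

lemma cnj_pair_pwav: "cnj (pair (\<lambda>x. cnj (h x)) (pwav \<psi>1 \<psi>2 z)) = pair h (pwav \<psi>1 \<psi>2 z)"
  unfolding pair_def Bochner_Integration.integral_cnj[symmetric] by (simp add: tensor_def wav_def split_beta)

text \<open>If h represents F, the polarised formula expands F g into products of the coefficients
  of g and h. As the wavelets are real and \<open>pair\<close> is symmetric, the coefficient of h at
  z is the value of F at the wavelet. For F f = <T f, \<psi>_v> this brings in the wavelet matrix
  without an adjoint of T.\<close>

lemma functional_wavelet_expansion:
  fixes F :: "('a::euclidean_space \<times> 'b::euclidean_space \<Rightarrow> complex) \<Rightarrow> complex"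
  assumes w: "wavelet \<psi>1" "wavelet \<psi>2"
    and lin: "\<And>f g a b. sq_int f \<Longrightarrow> sq_int g \<Longrightarrow> F (\<lambda>x. a * f x + b * g x) = a * F f + b * F g"
    and bd: "\<And>f. sq_int f \<Longrightarrow> cmod (F f) \<le> M * l2norm f" and g: "sq_int g"
  shows "ennreal (cmod (F g)) \<le> (\<integral>\<^sup>+z. ennreal (cmod (pair g (pwav \<psi>1 \<psi>2 z))) * ennreal (cmod (F (pwav \<psi>1 \<psi>2 z))) \<partial>hmeas2)"
proof -
  have "\<exists>h. sq_int h \<and> (\<forall>f. sq_int f \<longrightarrow> F f = pair f h)"
  proof (rule L2_Riesz[of F M])
    fix h assume "sq_int h" "\<And>f. sq_int f \<Longrightarrow> F f = pair f h"
    then show ?thesis by blast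
  qed (use lin bd in auto)
  then obtain h where h: "sq_int h" "\<And>f. sq_int f \<Longrightarrow> F f = pair f h" by blast
  have "F g = pair g (\<lambda>x. cnj (cnj (h x)))" using h g by simp
  also have "\<dots> = (\<integral>z. pair g (pwav \<psi>1 \<psi>2 z) * cnj (pair (\<lambda>x. cnj (h x)) (pwav \<psi>1 \<psi>2 z)) \<partial>hmeas2)"
    by (rule calderon_polarized[OF w g sq_int_cnj[OF h(1)]])
  also have "\<dots> = (\<integral>z. pair g (pwav \<psi>1 \<psi>2 z) * pair h (pwav \<psi>1 \<psi>2 z) \<partial>hmeas2)" unfolding cnj_pair_pwav ..
  finally have "F g = (\<integral>z. pair g (pwav \<psi>1 \<psi>2 z) * pair h (pwav \<psi>1 \<psi>2 z) \<partial>hmeas2)" .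
  \<comment> \<open>An integrand that is not integrable would have integral 0 by convention, so both
    cases give the bound.\<close>
  then have "ennreal (cmod (F g)) \<le> (\<integral>\<^sup>+z. ennreal (cmod (pair g (pwav \<psi>1 \<psi>2 z) * pair h (pwav \<psi>1 \<psi>2 z))) \<partial>hmeas2)"
    using integral_norm_bound_ennreal not_integrable_integral_eq
    by (cases "integrable hmeas2 (\<lambda>z. pair g (pwav \<psi>1 \<psi>2 z) * pair h (pwav \<psi>1 \<psi>2 z))") force+
  also have "\<dots> = (\<integral>\<^sup>+z. ennreal (cmod (pair g (pwav \<psi>1 \<psi>2 z))) * ennreal (cmod (F (pwav \<psi>1 \<psi>2 z))) \<partial>hmeas2)"
  proof (rule nn_integral_cong_AE, use AE_hmeas2 in eventually_elim)
    case (elim z)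
    have "F (pwav \<psi>1 \<psi>2 z) = pair h (pwav \<psi>1 \<psi>2 z)" using h(2)[OF sq_int_pwav[OF w]] elim pair_commute by metis
    then show ?case by (simp add: norm_mult ennreal_mult)
  qed
  finally show ?thesis .
qed

section \<open>Compactness\<close>

lemma hker_product_schur:
  assumes \<epsilon>: "\<epsilon> > 0"
  obtains S where "S > 0" "\<And>z::('a::euclidean_space \<times> real) \<times> ('b::euclidean_space \<times> real). snd (fst z) > 0 \<Longrightarrow> snd (snd z) > 0 \<Longrightarrow>
    (\<integral>\<^sup>+w. ennreal (hker \<epsilon> (fst z) (fst w) * hker \<epsilon> (snd z) (snd w) * (snd (fst w) powr (real DIM('a) / 2) * snd (snd w) powr (real DIM('b) / 2))) \<partial>hmeas2)
      \<le> ennreal (S * (snd (fst z) powr (real DIM('a) / 2) * snd (snd z) powr (real DIM('b) / 2)))"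
proof -
  interpret H: pair_sigma_finite "hmeas :: ('a \<times> real) measure" "hmeas :: ('b \<times> real) measure" by (rule pair_sigma_finite_hmeas)
  obtain S1 where S1: "S1 > 0" "\<And>z::'a \<times> real. snd z > 0 \<Longrightarrow> (\<integral>\<^sup>+w. ennreal (hker \<epsilon> z w * snd w powr (real DIM('a) / 2)) \<partial>hmeas) \<le> ennreal (S1 * snd z powr (real DIM('a) / 2))"
    by (rule hker_schur[OF \<epsilon>]) blast
  obtain S2 where S2: "S2 > 0" "\<And>z::'b \<times> real. snd z > 0 \<Longrightarrow> (\<integral>\<^sup>+w. ennreal (hker \<epsilon> z w * snd w powr (real DIM('b) / 2)) \<partial>hmeas) \<le> ennreal (S2 * snd z powr (real DIM('b) / 2))"
    by (rule hker_schur[OF \<epsilon>]) blast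
  have main: "(\<integral>\<^sup>+w. ennreal (hker \<epsilon> (fst z) (fst w) * hker \<epsilon> (snd z) (snd w) * (snd (fst w) powr (real DIM('a) / 2) * snd (snd w) powr (real DIM('b) / 2))) \<partial>hmeas2)
      \<le> ennreal ((S1 * S2) * (snd (fst z) powr (real DIM('a) / 2) * snd (snd z) powr (real DIM('b) / 2)))"
    if p: "snd (fst z) > 0" "snd (snd z) > 0" for z :: "('a \<times> real) \<times> ('b \<times> real)"
  proof -
    define a where "a = (\<lambda>w::'a \<times> real. hker \<epsilon> (fst z) w * snd w powr (real DIM('a) / 2))"
    define b where "b = (\<lambda>w::'b \<times> real. hker \<epsilon> (snd z) w * snd w powr (real DIM('b) / 2))"
    have [measurable]: "a \<in> borel_measurable borel" unfolding a_def hker_def by measurable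
    have [measurable]: "b \<in> borel_measurable borel" unfolding b_def hker_def by measurable
    have ab: "a w \<ge> 0" "b v \<ge> 0" for w v unfolding a_def b_def by (auto intro!: mult_nonneg_nonneg hker_nonneg)
    have "(\<integral>\<^sup>+w. ennreal (hker \<epsilon> (fst z) (fst w) * hker \<epsilon> (snd z) (snd w) * (snd (fst w) powr (real DIM('a) / 2) * snd (snd w) powr (real DIM('b) / 2))) \<partial>hmeas2)
        = (\<integral>\<^sup>+w. ennreal (a (fst w)) * ennreal (b (snd w)) \<partial>hmeas2)"
      by (intro nn_integral_cong) (simp add: a_def b_def ennreal_mult[symmetric] hker_nonneg mult_ac)
    also have "\<dots> = (\<integral>\<^sup>+x. \<integral>\<^sup>+y. ennreal (a x) * ennreal (b y) \<partial>hmeas \<partial>hmeas)"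
      by (subst H.M2.nn_integral_fst[symmetric]) auto
    also have "\<dots> = (\<integral>\<^sup>+x. ennreal (a x) * (\<integral>\<^sup>+y. ennreal (b y) \<partial>hmeas) \<partial>hmeas)"
      by (intro nn_integral_cong nn_integral_cmult) auto
    also have "\<dots> = (\<integral>\<^sup>+x. ennreal (a x) \<partial>hmeas) * (\<integral>\<^sup>+y. ennreal (b y) \<partial>hmeas)"
      by (rule nn_integral_multc) auto
    also have "\<dots> \<le> ennreal (S1 * snd (fst z) powr (real DIM('a) / 2)) * ennreal (S2 * snd (snd z) powr (real DIM('b) / 2))"
      unfolding a_def b_def by (intro mult_mono S1 S2 p) auto
    also have "\<dots> = ennreal ((S1 * S2) * (snd (fst z) powr (real DIM('a) / 2) * snd (snd z) powr (real DIM('b) / 2)))"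
      using S1(1) S2(1) by (subst ennreal_mult[symmetric]) (auto simp: mult_ac)
    finally show ?thesis .
  qed
  show thesis by (rule that[of "S1 * S2"]) (use main S1 S2 in auto)
qed

text \<open>Boxes stand in for closed hyperbolic balls: they are plainly measurable and bounded, and
  their scales stay away from 0.\<close>

definition hbox :: "real \<Rightarrow> ('a::euclidean_space \<times> real) set" where
  "hbox A = {z. norm (fst z) \<le> A \<and> 1 / A \<le> snd z \<and> snd z \<le> A}"

lemma hbox_measurable [measurable]: "hbox A \<in> sets borel"
proof -
  have "closed (hbox A :: ('a \<times> real) set)" unfolding hbox_def
    by (intro closed_Collect_conj closed_Collect_le continuous_intros)
  then show ?thesis by (rule borel_closed)
qed

text \<open>With c = cosh R, membership reads |x|^2 + 1 + t^2 < 2ct. Each of the three summands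
  alone is below 2ct, which gives the three bounds of the box.\<close>

lemma hball_subset_hbox:
  assumes R: "R > 0" shows "hball (0, 1) R \<subseteq> (hbox (2 * cosh R) :: ('a::euclidean_space \<times> real) set)"
proof
  fix w :: "'a \<times> real" assume w: "w \<in> hball (0, 1) R"
  define c where "c = cosh R"
  have c: "c \<ge> 1" unfolding c_def by (rule cosh_real_ge_1)
  have s: "snd w > 0" using w by (simp add: hball_def)
  have "((norm (fst w))\<^sup>2 + 1 + (snd w)\<^sup>2) / (2 * snd w) < c"
    using w mem_hball_iff[of "(0, 1)" w R] s R by (simp add: c_def)
  then have *: "(norm (fst w))\<^sup>2 + 1 + (snd w)\<^sup>2 < c * (2 * snd w)" using s by (simp add: pos_divide_less_eq)
  have n2: "(norm (fst w))\<^sup>2 \<ge> 0" by simp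
  have "(snd w)\<^sup>2 \<le> c * (2 * snd w)" using * n2 by linarith
  then have "snd w * snd w \<le> snd w * (2 * c)" by (simp add: power2_eq_square mult_ac)
  then have 1: "snd w \<le> 2 * c" using s by simp
  have "1 < c * (2 * snd w)" using * n2 zero_le_power2[of "snd w"] by linarith
  then have "1 \<le> snd w * (2 * c)" by (simp only: mult_ac less_imp_le)
  then have 2: "1 / (2 * c) \<le> snd w" using c by (simp add: pos_divide_le_eq)
  have "(norm (fst w))\<^sup>2 \<le> c * (2 * snd w)" using * zero_le_power2[of "snd w"] by linarith
  also have "\<dots> \<le> c * (2 * (2 * c))" using 1 c by (intro mult_left_mono) auto
  also have "\<dots> = (2 * c)\<^sup>2" by (simp add: power2_eq_square)
  finally have "(norm (fst w))\<^sup>2 \<le> (2 * c)\<^sup>2" .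
  then have 3: "norm (fst w) \<le> 2 * c" by (rule power2_le_imp_le) (use c in simp)
  show "w \<in> hbox (2 * cosh R)" using 1 2 3 by (simp add: hbox_def c_def)
qed

lemma emeasure_hbox_finite:
  assumes A: "A > 0" shows "emeasure hmeas (hbox A :: ('a::euclidean_space \<times> real) set) < \<infinity>"
proof -
  have "emeasure hmeas (hbox A :: ('a \<times> real) set) = (\<integral>\<^sup>+z. ennreal (indicator {0<..} (snd z) * snd z powr - (real DIM('a) + 1)) * indicator (hbox A) z \<partial>(lborel :: ('a \<times> real) measure))"
    unfolding hmeas_def by (rule emeasure_density) auto
  also have "\<dots> \<le> (\<integral>\<^sup>+z. ennreal ((1 / A) powr - (real DIM('a) + 1)) * indicator (hbox A) z \<partial>(lborel :: ('a \<times> real) measure))"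
  proof (rule nn_integral_mono)
    fix z :: "'a \<times> real"
    show "ennreal (indicator {0<..} (snd z) * snd z powr - (real DIM('a) + 1)) * indicator (hbox A) z \<le> ennreal ((1 / A) powr - (real DIM('a) + 1)) * indicator (hbox A) z"
    proof (cases "z \<in> hbox A")
      case True
      then have "snd z powr - (real DIM('a) + 1) \<le> (1 / A) powr - (real DIM('a) + 1)" using A by (intro powr_mono2') (auto simp: hbox_def)
      then have "indicator {0<..} (snd z) * snd z powr - (real DIM('a) + 1) \<le> (1 / A) powr - (real DIM('a) + 1)" by (simp add: indicator_def)
      then show ?thesis using True by (simp add: ennreal_leI)
    qed simp
  qed
  also have "\<dots> = ennreal ((1 / A) powr - (real DIM('a) + 1)) * emeasure lborel (hbox A :: ('a \<times> real) set)" by (rule nn_integral_cmult_indicator) simp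
  also have "\<dots> < \<infinity>"
  proof -
    have "bounded (cball 0 A \<times> {0..A} :: ('a \<times> real) set)" by (intro bounded_Times bounded_cball bounded_closed_interval)
    moreover have "hbox A \<subseteq> (cball 0 A \<times> {0..A} :: ('a \<times> real) set)"
    proof
      fix z :: "'a \<times> real" assume zA: "z \<in> hbox A"
      have "0 \<le> 1 / A" using A by simp
      also have "1 / A \<le> snd z" using zA by (simp add: hbox_def)
      finally have "0 \<le> snd z" .
      then show "z \<in> cball 0 A \<times> {0..A}" using zA unfolding hbox_def by (cases z) auto
    qed
    ultimately have "emeasure lborel (hbox A :: ('a \<times> real) set) < \<infinity>" by (intro emeasure_bounded_finite) (rule bounded_subset)
    then show ?thesis by (simp add: ennreal_mult_less_top)
  qed
  finally show ?thesis .
qed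

text \<open>The constants C and S are fixed before e, and e enters the Schur bound off the box only
  through S^2 e^2. Shrinking e enlarges the box but leaves S unchanged.\<close>

lemma essential_norm_estimate:
  fixes T :: "('a::euclidean_space \<times> 'b::euclidean_space \<Rightarrow> complex) \<Rightarrow> 'a \<times> 'b \<Rightarrow> complex"
  assumes w: "wavelet \<psi>1" "wavelet \<psi>2" and T: "biparam_czo T" and fc: "fully_cancellative T" and pwc: "product_weak_compact \<psi>1 \<psi>2 T"
    and \<eta>: "\<eta> > 0"
  obtains A C where "A > 0" "C \<ge> 0" "\<And>g. sq_int g \<Longrightarrow> ennreal ((l2norm (T g))\<^sup>2) \<le>
      ennreal C * (\<integral>\<^sup>+z. ennreal ((cmod (pair g (pwav \<psi>1 \<psi>2 z)))\<^sup>2) * indicator (hbox A \<times> hbox A) z \<partial>hmeas2) + ennreal (\<eta> * (l2norm g)\<^sup>2)"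
proof -
  interpret H: pair_sigma_finite "hmeas :: ('a \<times> real) measure" "hmeas :: ('b \<times> real) measure" by (rule pair_sigma_finite_hmeas)
  have Tb: "bounded_L2_op T" using T by (simp add: biparam_czo_def)
  obtain CT where CT: "CT > 0" "\<And>f. sq_int f \<Longrightarrow> l2norm (T f) \<le> CT * l2norm f" using bounded_L2_op_bound[OF Tb] by blast
  obtain C \<epsilon> where C: "C > 0" "\<epsilon> > 0" and mb: "\<And>z1 z2 w1 w2. snd z1 > 0 \<Longrightarrow> snd z2 > 0 \<Longrightarrow> snd w1 > 0 \<Longrightarrow> snd w2 > 0 \<Longrightarrow>
     cmod (quad T (wav \<psi>1 z1) (wav \<psi>2 z2) (wav \<psi>1 w1) (wav \<psi>2 w2)) \<le> C * (hker \<epsilon> z1 w1 * hker \<epsilon> z2 w2)"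
    by (rule wavelet_matrix_bound[OF w T fc]) blast
  have e2: "\<epsilon> / 2 > 0" using C by simp
  obtain S where S: "S > 0" "\<And>z::('a \<times> real) \<times> ('b \<times> real). snd (fst z) > 0 \<Longrightarrow> snd (snd z) > 0 \<Longrightarrow>
    (\<integral>\<^sup>+w. ennreal (hker (\<epsilon> / 2) (fst z) (fst w) * hker (\<epsilon> / 2) (snd z) (snd w) * (snd (fst w) powr (real DIM('a) / 2) * snd (snd w) powr (real DIM('b) / 2))) \<partial>hmeas2)
      \<le> ennreal (S * (snd (fst z) powr (real DIM('a) / 2) * snd (snd z) powr (real DIM('b) / 2)))"
    by (rule hker_product_schur[OF e2]) blast
  \<comment> \<open>Chosen so that 2 S^2 e^2 = \<eta>.\<close>
  define e where "e = sqrt (\<eta> / 2) / S"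
  have e: "e > 0" "2 * S\<^sup>2 * e\<^sup>2 = \<eta>" unfolding e_def using \<eta> S by (auto simp: power_divide)
  obtain R0 where R0: "\<And>z1 z2 w1 w2. snd z1 > 0 \<Longrightarrow> snd z2 > 0 \<Longrightarrow> snd w1 > 0 \<Longrightarrow> snd w2 > 0 \<Longrightarrow> z1 \<notin> hball (0, 1) R0 \<or> z2 \<notin> hball (0, 1) R0 \<Longrightarrow>
     cmod (quad T (wav \<psi>1 z1) (wav \<psi>2 z2) (wav \<psi>1 w1) (wav \<psi>2 w2)) \<le> e * (hker (\<epsilon> / 2) z1 w1 * hker (\<epsilon> / 2) z2 w2)"
    by (rule wavelet_matrix_small[OF pwc C mb e(1)]) blast+
  \<comment> \<open>\<open>R0\<close> comes without a sign, whereas \<open>hball_subset_hbox\<close>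
    asks for a positive radius.\<close>
  define A where "A = 2 * cosh (max R0 1)"
  have A: "A > 0" unfolding A_def using cosh_real_pos by simp
  have box1: "z \<notin> hbox A \<Longrightarrow> z \<notin> hball (0, 1) R0" for z :: "'a \<times> real"
  proof (erule contrapos_nn)
    assume "z \<in> hball (0, 1) R0"
    then have "z \<in> hball (0, 1) (max R0 1)" by (auto simp: hball_def)
    then show "z \<in> hbox A" unfolding A_def by (rule subsetD[OF hball_subset_hbox, rotated]) simp
  qed
  have box2: "z \<notin> hbox A \<Longrightarrow> z \<notin> hball (0, 1) R0" for z :: "'b \<times> real"
  proof (erule contrapos_nn)
    assume "z \<in> hball (0, 1) R0"
    then have "z \<in> hball (0, 1) (max R0 1)" by (auto simp: hball_def)
    then show "z \<in> hbox A" unfolding A_def by (rule subsetD[OF hball_subset_hbox, rotated]) simp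
  qed
  define E where "E = (hbox A \<times> hbox A :: (('a \<times> real) \<times> ('b \<times> real)) set)"
  have Em[measurable]: "E \<in> sets hmeas2" unfolding E_def by (intro pair_measureI) (simp_all add: sets_hmeas)
  define k where "k = (\<lambda>(z :: ('a \<times> real) \<times> ('b \<times> real)) (v :: ('a \<times> real) \<times> ('b \<times> real)). hker (\<epsilon> / 2) (fst z) (fst v) * hker (\<epsilon> / 2) (snd z) (snd v))"
  define h where "h = (\<lambda>z :: ('a \<times> real) \<times> ('b \<times> real). snd (fst z) powr (real DIM('a) / 2) * snd (snd z) powr (real DIM('b) / 2))"
  have kn: "k z v \<ge> 0" for z v unfolding k_def by (intro mult_nonneg_nonneg hker_nonneg)
  have ks: "k z v = k v z" for z v unfolding k_def by (simp add: hker_sym)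
  have km: "(\<lambda>(z, v). k z v) \<in> borel_measurable (hmeas2 \<Otimes>\<^sub>M hmeas2)"
  proof -
    have m1: "(\<lambda>p. hker (\<epsilon> / 2) (fst p) (snd p)) \<in> borel_measurable ((hmeas :: ('a \<times> real) measure) \<Otimes>\<^sub>M hmeas)"
      using hker_measurable by (simp add: measurable_cong_sets[OF sets_pair_measure_cong[OF sets_hmeas sets_hmeas] refl])
    have m2: "(\<lambda>p. hker (\<epsilon> / 2) (fst p) (snd p)) \<in> borel_measurable ((hmeas :: ('b \<times> real) measure) \<Otimes>\<^sub>M hmeas)"
      using hker_measurable by (simp add: measurable_cong_sets[OF sets_pair_measure_cong[OF sets_hmeas sets_hmeas] refl])
    have "(\<lambda>p. (\<lambda>p. hker (\<epsilon> / 2) (fst p) (snd p)) (fst (fst p), fst (snd p)) * (\<lambda>p. hker (\<epsilon> / 2) (fst p) (snd p)) (snd (fst p), snd (snd p)))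
       \<in> borel_measurable ((hmeas2 :: (('a \<times> real) \<times> ('b \<times> real)) measure) \<Otimes>\<^sub>M hmeas2)"
      by (intro borel_measurable_times measurable_compose[OF _ m1] measurable_compose[OF _ m2]) measurable
    then show ?thesis by (simp add: k_def split_beta')
  qed
  have hm: "h \<in> borel_measurable hmeas2" unfolding h_def by measurable
  have main: "ennreal ((l2norm (T g))\<^sup>2) \<le>
      ennreal (2 * S\<^sup>2 * C\<^sup>2 + 4 * S\<^sup>2 * C * e) * (\<integral>\<^sup>+z. ennreal ((cmod (pair g (pwav \<psi>1 \<psi>2 z)))\<^sup>2) * indicator E z \<partial>hmeas2) + ennreal (\<eta> * (l2norm g)\<^sup>2)"
    if g: "sq_int g" for g
  proof -
    define W where "W = (\<lambda>z. cmod (pair g (pwav \<psi>1 \<psi>2 z)))"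
    have gm: "g \<in> borel_measurable borel" using g by (simp add: sq_int_def)
    have Wm[measurable]: "W \<in> borel_measurable hmeas2"
      unfolding W_def using pair_pwav_measurable[OF w gm] by (simp add: measurable_cong_sets[OF sets_hmeas2 refl])
    define F where "F = (\<lambda>z. ennreal ((C * indicator E z + e) * W z))"
    have Fm: "F \<in> borel_measurable hmeas2" unfolding F_def by measurable
    have W0: "W z \<ge> 0" for z by (simp add: W_def)
    have point: "ennreal (cmod (pair (T g) (pwav \<psi>1 \<psi>2 v))) \<le> (\<integral>\<^sup>+z. ennreal (k z v) * F z \<partial>hmeas2)" if v: "snd (fst v) > 0" "snd (snd v) > 0" for v
    proof -
      have sv: "sq_int (pwav \<psi>1 \<psi>2 v)" using v by (intro sq_int_pwav w)
      have "ennreal (cmod (pair (T g) (pwav \<psi>1 \<psi>2 v))) \<le> (\<integral>\<^sup>+z. ennreal (cmod (pair g (pwav \<psi>1 \<psi>2 z))) * ennreal (cmod (pair (T (pwav \<psi>1 \<psi>2 z)) (pwav \<psi>1 \<psi>2 v))) \<partial>hmeas2)"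
      proof (rule functional_wavelet_expansion[OF w _ _ g, where F = "\<lambda>f. pair (T f) (pwav \<psi>1 \<psi>2 v)" and M = "CT * l2norm (pwav \<psi>1 \<psi>2 v)"])
        fix f1 f2 :: "'a \<times> 'b \<Rightarrow> complex" and a b assume f: "sq_int f1" "sq_int f2"
        show "pair (T (\<lambda>x. a * f1 x + b * f2 x)) (pwav \<psi>1 \<psi>2 v) = a * pair (T f1) (pwav \<psi>1 \<psi>2 v) + b * pair (T f2) (pwav \<psi>1 \<psi>2 v)"
          unfolding bounded_L2_op_lincomb[OF Tb f] by (intro pair_lincomb_left bounded_L2_op_sq_int[OF Tb] f sv)
      next
        fix f :: "'a \<times> 'b \<Rightarrow> complex" assume f: "sq_int f"
        have "cmod (pair (T f) (pwav \<psi>1 \<psi>2 v)) \<le> l2norm (T f) * l2norm (pwav \<psi>1 \<psi>2 v)" by (intro cmod_pair_le bounded_L2_op_sq_int[OF Tb] f sv)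
        also have "\<dots> \<le> (CT * l2norm f) * l2norm (pwav \<psi>1 \<psi>2 v)" by (intro mult_right_mono CT f l2norm_nonneg)
        finally show "cmod (pair (T f) (pwav \<psi>1 \<psi>2 v)) \<le> (CT * l2norm (pwav \<psi>1 \<psi>2 v)) * l2norm f" by (simp add: mult_ac)
      qed
      also have "\<dots> \<le> (\<integral>\<^sup>+z. ennreal (k z v) * F z \<partial>hmeas2)"
      proof (rule nn_integral_mono_AE, use AE_hmeas2 in eventually_elim)
        case (elim z)
        \<comment> \<open>On E the full matrix bound is used, with its exponent weakened to
          \<epsilon>/2 so that the same kernel k serves on and off E.\<close>
        have q: "cmod (pair (T (pwav \<psi>1 \<psi>2 z)) (pwav \<psi>1 \<psi>2 v)) \<le> (C * indicator E z + e) * k z v"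
        proof (cases "z \<in> E")
          case True
          have "cmod (pair (T (pwav \<psi>1 \<psi>2 z)) (pwav \<psi>1 \<psi>2 v)) \<le> C * (hker \<epsilon> (fst z) (fst v) * hker \<epsilon> (snd z) (snd v))"
            using mb[of "fst z" "snd z" "fst v" "snd v"] elim v unfolding quad_def by simp
          also have "\<dots> \<le> C * k z v" unfolding k_def
            using C elim v by (intro mult_left_mono mult_mono hker_half hker_nonneg) auto
          also have "\<dots> \<le> (C + e) * k z v" using e by (intro mult_right_mono kn) auto
          finally show ?thesis using True by simp
        next
          case False
          then have "fst z \<notin> hball (0, 1) R0 \<or> snd z \<notin> hball (0, 1) R0" unfolding E_def using box1[of "fst z"] box2[of "snd z"] by (auto simp: mem_Times_iff)
          then show ?thesis using R0[of "fst z" "snd z" "fst v" "snd v"] elim v False unfolding quad_def k_def by simp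
        qed
        have "cmod (pair g (pwav \<psi>1 \<psi>2 z)) * cmod (pair (T (pwav \<psi>1 \<psi>2 z)) (pwav \<psi>1 \<psi>2 v)) \<le> W z * ((C * indicator E z + e) * k z v)"
          unfolding W_def by (intro mult_left_mono q) auto
        also have "\<dots> = k z v * ((C * indicator E z + e) * W z)" by simp
        finally have "ennreal (cmod (pair g (pwav \<psi>1 \<psi>2 z)) * cmod (pair (T (pwav \<psi>1 \<psi>2 z)) (pwav \<psi>1 \<psi>2 v))) \<le> ennreal (k z v * ((C * indicator E z + e) * W z))" by (rule ennreal_leI)
        then show ?case unfolding F_def using kn C e W0 by (simp add: ennreal_mult)
      qed
      finally show ?thesis .
    qed
    have "ennreal ((l2norm (T g))\<^sup>2) = (\<integral>\<^sup>+v. ennreal ((cmod (pair (T g) (pwav \<psi>1 \<psi>2 v)))\<^sup>2) \<partial>hmeas2)"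
      by (rule calderon_product[OF w bounded_L2_op_sq_int[OF Tb g], symmetric])
    also have "\<dots> \<le> (\<integral>\<^sup>+v. (\<integral>\<^sup>+z. ennreal (k z v) * F z \<partial>hmeas2)\<^sup>2 \<partial>hmeas2)"
    proof (rule nn_integral_mono_AE, use AE_hmeas2 in eventually_elim)
      case (elim v)
      have "(ennreal (cmod (pair (T g) (pwav \<psi>1 \<psi>2 v))))\<^sup>2 \<le> (\<integral>\<^sup>+z. ennreal (k z v) * F z \<partial>hmeas2)\<^sup>2"
        using elim by (intro power_mono point) auto
      then show ?case by (simp add: ennreal_power)
    qed
    also have "\<dots> \<le> ennreal (S\<^sup>2) * (\<integral>\<^sup>+z. (F z)\<^sup>2 \<partial>hmeas2)"
    proof (rule schur_test[OF H.sigma_finite_measure_axioms km hm Fm kn ks])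
      show "AE z in hmeas2. h z > 0" using AE_hmeas2 by eventually_elim (simp add: h_def)
      show "AE z in hmeas2. (\<integral>\<^sup>+v. ennreal (k z v * h v) \<partial>hmeas2) \<le> ennreal (S * h z)"
        using AE_hmeas2 by eventually_elim (use S in \<open>simp add: k_def h_def\<close>)
    qed (use S in simp)
    also have "(\<integral>\<^sup>+z. (F z)\<^sup>2 \<partial>hmeas2) = (\<integral>\<^sup>+z. ennreal (C\<^sup>2 + 2 * C * e) * (ennreal ((W z)\<^sup>2) * indicator E z) + ennreal (e\<^sup>2) * ennreal ((W z)\<^sup>2) \<partial>hmeas2)"
    proof (rule nn_integral_cong)
      fix z
      \<comment> \<open>The indicator is idempotent, so the cross term is supported on E as well and
        joins the box integral.\<close>
      have "(C * indicator E z + e)\<^sup>2 = (C\<^sup>2 + 2 * C * e) * indicator E z + e\<^sup>2" by (cases "z \<in> E") (auto simp: power2_sum)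
      then have "(F z)\<^sup>2 = ennreal (((C\<^sup>2 + 2 * C * e) * indicator E z + e\<^sup>2) * (W z)\<^sup>2)"
        unfolding F_def using C e W0[of z] by (simp add: ennreal_power power_mult_distrib)
      also have "\<dots> = ennreal (C\<^sup>2 + 2 * C * e) * (ennreal ((W z)\<^sup>2) * indicator E z) + ennreal (e\<^sup>2) * ennreal ((W z)\<^sup>2)"
        using C e by (cases "z \<in> E") (auto simp: ennreal_mult[symmetric] ennreal_plus[symmetric] distrib_right simp del: ennreal_plus)
      finally show "(F z)\<^sup>2 = ennreal (C\<^sup>2 + 2 * C * e) * (ennreal ((W z)\<^sup>2) * indicator E z) + ennreal (e\<^sup>2) * ennreal ((W z)\<^sup>2)" .
    qed
    also have "\<dots> = ennreal (C\<^sup>2 + 2 * C * e) * (\<integral>\<^sup>+z. ennreal ((W z)\<^sup>2) * indicator E z \<partial>hmeas2) + ennreal (e\<^sup>2) * (\<integral>\<^sup>+z. ennreal ((W z)\<^sup>2) \<partial>hmeas2)"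
      by (simp add: nn_integral_add nn_integral_cmult)
    also have "(\<integral>\<^sup>+z. ennreal ((W z)\<^sup>2) \<partial>hmeas2) = ennreal ((l2norm g)\<^sup>2)" unfolding W_def by (rule calderon_product[OF w g])
    finally have "ennreal ((l2norm (T g))\<^sup>2) \<le> ennreal (S\<^sup>2) * (ennreal (C\<^sup>2 + 2 * C * e) * (\<integral>\<^sup>+z. ennreal ((W z)\<^sup>2) * indicator E z \<partial>hmeas2) + ennreal (e\<^sup>2) * ennreal ((l2norm g)\<^sup>2))" .
    also have "\<dots> \<le> ennreal (2 * S\<^sup>2 * C\<^sup>2 + 4 * S\<^sup>2 * C * e) * (\<integral>\<^sup>+z. ennreal ((W z)\<^sup>2) * indicator E z \<partial>hmeas2) + ennreal (\<eta> * (l2norm g)\<^sup>2)"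
      unfolding distrib_left
    proof (rule add_mono)
      have "ennreal (S\<^sup>2) * ennreal (C\<^sup>2 + 2 * C * e) \<le> ennreal (2 * S\<^sup>2 * C\<^sup>2 + 4 * S\<^sup>2 * C * e)"

      proof -
        have "0 \<le> S\<^sup>2 * C\<^sup>2 + 2 * (S\<^sup>2 * C * e)" using C e by simp
        then have r: "S\<^sup>2 * (C\<^sup>2 + 2 * C * e) \<le> 2 * S\<^sup>2 * C\<^sup>2 + 4 * S\<^sup>2 * C * e" by (simp add: algebra_simps)
        have "0 \<le> C\<^sup>2 + 2 * C * e" using C e by simp
        then have "ennreal (S\<^sup>2) * ennreal (C\<^sup>2 + 2 * C * e) = ennreal (S\<^sup>2 * (C\<^sup>2 + 2 * C * e))" by (intro ennreal_mult[symmetric]) auto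
        then show ?thesis using ennreal_leI[OF r] by simp
      qed
      then show "ennreal (S\<^sup>2) * (ennreal (C\<^sup>2 + 2 * C * e) * (\<integral>\<^sup>+z. ennreal ((W z)\<^sup>2) * indicator E z \<partial>hmeas2)) \<le> ennreal (2 * S\<^sup>2 * C\<^sup>2 + 4 * S\<^sup>2 * C * e) * (\<integral>\<^sup>+z. ennreal ((W z)\<^sup>2) * indicator E z \<partial>hmeas2)"
        unfolding mult.assoc[symmetric] by (rule mult_right_mono) simp
      have "S\<^sup>2 * (e\<^sup>2 * (l2norm g)\<^sup>2) \<le> \<eta> * (l2norm g)\<^sup>2" unfolding e(2)[symmetric] by (simp add: mult_ac)
      then show "ennreal (S\<^sup>2) * (ennreal (e\<^sup>2) * ennreal ((l2norm g)\<^sup>2)) \<le> ennreal (\<eta> * (l2norm g)\<^sup>2)"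
        by (simp add: ennreal_mult[symmetric] ennreal_leI)
    qed
    finally show ?thesis unfolding W_def .
  qed
  show thesis
  proof (rule that[OF A])
    show "0 \<le> 2 * S\<^sup>2 * C\<^sup>2 + 4 * S\<^sup>2 * C * e" using C e by simp
  qed (use main in \<open>simp add: E_def\<close>)
qed

section \<open>Continuity of the wavelets in L2\<close>

lemma cnj_wav: "cnj (wav \<psi> z u) = wav \<psi> z u" by (simp add: wav_def)

text \<open>Since $\|\psi_z\|$ does not depend on $z$, only the inner product $\langle \psi_z, \psi_{d_j}\rangle$ has to converge.\<close>

lemma wav_l2_continuous:
  fixes \<psi> :: "'a::euclidean_space \<Rightarrow> real"
  assumes w: "wavelet \<psi>" and z: "snd z > 0" and d: "\<And>j. snd (d j) > 0" "d \<longlonglongrightarrow> z"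
  shows "(\<lambda>j. l2norm (\<lambda>u. wav \<psi> (d j) u - wav \<psi> z u)) \<longlonglongrightarrow> 0"
proof -
  define \<kappa> where "\<kappa> = l2norm (\<lambda>v. complex_of_real (\<psi> v))"
  have sq: "sq_int (wav \<psi> z)" "\<And>j. sq_int (wav \<psi> (d j))" using sq_int_wav w z d by blast+
  have fm: "wav \<psi> z \<in> borel_measurable borel" using sq(1) by (simp add: sq_int_def)
  have [measurable]: "\<psi> \<in> borel_measurable borel" by (rule wavelet_measurable[OF w])
  have fm'[measurable]: "wav \<psi> z \<in> borel_measurable borel" by (rule fm)
  obtain B where B: "B > 0" "\<And>x. cmod (wav \<psi> z x) \<le> B" using test_fun_bounded[OF test_fun_wav[OF w z]] by blast
  have pi_: "integrable lborel (\<lambda>x. complex_of_real (\<psi> x))" by (rule test_fun_integrable[OF wavelet_test_fun[OF w]])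
  have conv: "pair (wav \<psi> z) (wav \<psi> v) = complex_of_real (snd v powr (real DIM('a) / 2)) * (\<integral>u. wav \<psi> z (fst v + snd v *\<^sub>R u) * complex_of_real (\<psi> u) \<partial>lborel)" if "snd v > 0" for v
    using pair_wav_convolution[OF w fm that, of "fst v"] by simp
  have lim: "(\<lambda>j. pair (wav \<psi> z) (wav \<psi> (d j))) \<longlonglongrightarrow> pair (wav \<psi> z) (wav \<psi> z)"
    unfolding conv[OF z] conv[OF d(1)]
  proof (rule tendsto_mult)
    show "(\<lambda>j. complex_of_real (snd (d j) powr (real DIM('a) / 2))) \<longlonglongrightarrow> complex_of_real (snd z powr (real DIM('a) / 2))"
      by (intro tendsto_of_real tendsto_powr tendsto_const tendsto_snd d(2)) (use z in auto)
    show "(\<lambda>j. \<integral>u. wav \<psi> z (fst (d j) + snd (d j) *\<^sub>R u) * complex_of_real (\<psi> u) \<partial>lborel) \<longlonglongrightarrow> (\<integral>u. wav \<psi> z (fst z + snd z *\<^sub>R u) * complex_of_real (\<psi> u) \<partial>lborel)"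
    proof (rule integral_dominated_convergence[where w="\<lambda>u. B * cmod (complex_of_real (\<psi> u))"])
      show "integrable lborel (\<lambda>u. B * cmod (complex_of_real (\<psi> u)))" using pi_ by (intro integrable_mult_right integrable_norm)
      show "AE u in lborel. (\<lambda>j. wav \<psi> z (fst (d j) + snd (d j) *\<^sub>R u) * complex_of_real (\<psi> u)) \<longlonglongrightarrow> wav \<psi> z (fst z + snd z *\<^sub>R u) * complex_of_real (\<psi> u)"
      proof (intro AE_I2 tendsto_mult tendsto_const)
        fix u
        have "(\<lambda>j. fst (d j) + snd (d j) *\<^sub>R u) \<longlonglongrightarrow> fst z + snd z *\<^sub>R u" by (intro tendsto_intros d)
        then show "(\<lambda>j. wav \<psi> z (fst (d j) + snd (d j) *\<^sub>R u)) \<longlonglongrightarrow> wav \<psi> z (fst z + snd z *\<^sub>R u)"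
          using continuous_on_tendsto_compose[OF test_fun_continuous[OF test_fun_wav[OF w z], of UNIV]] by simp
      qed
      show "AE u in lborel. norm (wav \<psi> z (fst (d j) + snd (d j) *\<^sub>R u) * complex_of_real (\<psi> u)) \<le> B * cmod (complex_of_real (\<psi> u))" for j
        unfolding norm_mult by (intro AE_I2 mult_right_mono B) auto
    qed measurable
  qed
  have self: "Re (pair (wav \<psi> z) (wav \<psi> z)) = \<kappa>\<^sup>2"
  proof -
    have "pair (wav \<psi> z) (wav \<psi> z) = complex_of_real ((l2norm (wav \<psi> z))\<^sup>2)"
      unfolding l2norm_sq pair_def integral_complex_of_real[symmetric] complex_norm_square cnj_wav ..
    then show ?thesis unfolding wav_integral(3)[OF w z] \<kappa>_def by (simp only: Re_complex_of_real)
  qed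
  have expand: "(l2norm (\<lambda>u. wav \<psi> (d j) u - wav \<psi> z u))\<^sup>2 = 2 * \<kappa>\<^sup>2 - 2 * Re (pair (wav \<psi> z) (wav \<psi> (d j)))" for j
    using l2norm_add_sq[OF sq(2)[of j] sq(1), of "-1"] wav_integral(3)[OF w z] wav_integral(3)[OF w d(1)[of j]] by (simp add: cnj_wav \<kappa>_def)
  have "(\<lambda>j. (l2norm (\<lambda>u. wav \<psi> (d j) u - wav \<psi> z u))\<^sup>2) \<longlonglongrightarrow> 2 * \<kappa>\<^sup>2 - 2 * Re (pair (wav \<psi> z) (wav \<psi> z))"
    unfolding expand by (intro tendsto_intros lim)
  then have "(\<lambda>j. sqrt ((l2norm (\<lambda>u. wav \<psi> (d j) u - wav \<psi> z u))\<^sup>2)) \<longlonglongrightarrow> sqrt 0" unfolding self by (intro tendsto_real_sqrt) simp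
  then show ?thesis by (simp add: l2norm_nonneg)
qed

text \<open>The difference of the tensors is split through a mixed tensor; the unchanged factors
  have norms independent of the point.\<close>

lemma pwav_l2_continuous:
  fixes \<psi>1 :: "'a::euclidean_space \<Rightarrow> real" and \<psi>2 :: "'b::euclidean_space \<Rightarrow> real"
  assumes w: "wavelet \<psi>1" "wavelet \<psi>2" and z: "snd (fst z) > 0" "snd (snd z) > 0"
    and d: "\<And>j. snd (fst (d j)) > 0" "\<And>j. snd (snd (d j)) > 0" "d \<longlonglongrightarrow> z"
  shows "(\<lambda>j. l2norm (\<lambda>p. pwav \<psi>1 \<psi>2 (d j) p - pwav \<psi>1 \<psi>2 z p)) \<longlonglongrightarrow> 0"
proof -
  define \<kappa>1 where "\<kappa>1 = l2norm (\<lambda>v. complex_of_real (\<psi>1 v))"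
  define \<kappa>2 where "\<kappa>2 = l2norm (\<lambda>v. complex_of_real (\<psi>2 v))"
  let ?a = "\<lambda>j u. wav \<psi>1 (fst (d j)) u - wav \<psi>1 (fst z) u" and ?b = "\<lambda>j u. wav \<psi>2 (snd (d j)) u - wav \<psi>2 (snd z) u"
  have sa: "sq_int (?a j)" for j by (intro sq_int_diff sq_int_wav w z d)
  have sb: "sq_int (?b j)" for j by (intro sq_int_diff sq_int_wav w z d)
  have s2: "sq_int (wav \<psi>2 (snd (d j)))" for j by (intro sq_int_wav w d)
  have s1: "sq_int (wav \<psi>1 (fst z))" by (intro sq_int_wav w z)
  have le: "l2norm (\<lambda>p. pwav \<psi>1 \<psi>2 (d j) p - pwav \<psi>1 \<psi>2 z p) \<le> l2norm (?a j) * \<kappa>2 + \<kappa>1 * l2norm (?b j)" for j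
  proof -
    have "(\<lambda>p. pwav \<psi>1 \<psi>2 (d j) p - pwav \<psi>1 \<psi>2 z p) = (\<lambda>p. tensor (?a j) (wav \<psi>2 (snd (d j))) p + tensor (wav \<psi>1 (fst z)) (?b j) p)"
      by (auto simp: tensor_def algebra_simps)
    then have "l2norm (\<lambda>p. pwav \<psi>1 \<psi>2 (d j) p - pwav \<psi>1 \<psi>2 z p) \<le> l2norm (tensor (?a j) (wav \<psi>2 (snd (d j)))) + l2norm (tensor (wav \<psi>1 (fst z)) (?b j))"
      using l2norm_triangle[OF tensor_l2(1)[OF sa s2] tensor_l2(1)[OF s1 sb]] by simp
    then show ?thesis unfolding tensor_l2(2)[OF sa s2] tensor_l2(2)[OF s1 sb] wav_integral(3)[OF w(1) z(1)] wav_integral(3)[OF w(2) d(2)] \<kappa>1_def \<kappa>2_def .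
  qed
  have "(\<lambda>j. l2norm (?a j) * \<kappa>2 + \<kappa>1 * l2norm (?b j)) \<longlonglongrightarrow> 0 * \<kappa>2 + \<kappa>1 * 0"
    by (intro tendsto_intros wav_l2_continuous w z d tendsto_fst tendsto_snd)
  then have lim: "(\<lambda>j. l2norm (?a j) * \<kappa>2 + \<kappa>1 * l2norm (?b j)) \<longlonglongrightarrow> 0" by simp
  show ?thesis
  proof (rule tendsto_sandwich[OF always_eventually always_eventually tendsto_const lim])
    show "\<forall>j. 0 \<le> l2norm (\<lambda>p. pwav \<psi>1 \<psi>2 (d j) p - pwav \<psi>1 \<psi>2 z p)" by (intro allI l2norm_nonneg)
    show "\<forall>j. l2norm (\<lambda>p. pwav \<psi>1 \<psi>2 (d j) p - pwav \<psi>1 \<psi>2 z p) \<le> l2norm (?a j) * \<kappa>2 + \<kappa>1 * l2norm (?b j)" by (intro allI le)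
  qed
qed

section \<open>A subsequence with convergent coefficients, and its images under T\<close>

theorem theorem6p6:
  fixes T :: "(('a::euclidean_space \<times> 'b::euclidean_space) \<Rightarrow> complex) \<Rightarrow> ('a \<times> 'b \<Rightarrow> complex)"
    and \<psi>1 :: "'a \<Rightarrow> real" and \<psi>2 :: "'b \<Rightarrow> real"
  assumes "wavelet \<psi>1" and "wavelet \<psi>2"
    and "biparam_czo T"
    and "fully_cancellative T"
    and "product_weak_compact \<psi>1 \<psi>2 T"
  shows "compact_L2_op T"
  unfolding compact_L2_op_def
proof (intro allI impI)
  note w = assms(1,2)
  have Tb: "bounded_L2_op T" using assms(3) by (simp add: biparam_czo_def)
  fix fs :: "nat \<Rightarrow> 'a \<times> 'b \<Rightarrow> complex"
  assume "\<forall>k. sq_int (fs k) \<and> l2norm (fs k) \<le> 1"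
  then have fs: "sq_int (fs k)" "l2norm (fs k) \<le> 1" for k by auto
  define P :: "(('a \<times> real) \<times> ('b \<times> real)) set" where "P = {z. snd (fst z) > 0 \<and> snd (snd z) > 0}"
  have P: "open P" unfolding P_def by (intro open_Collect_conj open_Collect_less continuous_intros)
  define W where "W = (\<lambda>f z. pair f (pwav \<psi>1 \<psi>2 z))"
  define \<kappa> where "\<kappa> = l2norm (\<lambda>v. complex_of_real (\<psi>1 v)) * l2norm (\<lambda>v. complex_of_real (\<psi>2 v))"
  have \<kappa>0: "\<kappa> \<ge> 0" unfolding \<kappa>_def by (intro mult_nonneg_nonneg l2norm_nonneg)
  have sP: "sq_int (pwav \<psi>1 \<psi>2 z)" and nP: "l2norm (pwav \<psi>1 \<psi>2 z) = \<kappa>" if "z \<in> P" for z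
    using that tensor_l2[OF sq_int_wav[OF w(1)] sq_int_wav[OF w(2)], of "fst z" "snd z"] wav_integral(3)[OF w(1)] wav_integral(3)[OF w(2)]
    by (auto simp: P_def \<kappa>_def)
  have Wb: "cmod (W (fs n) z) \<le> \<kappa>" if "z \<in> P" for n z
  proof -
    have "cmod (W (fs n) z) \<le> l2norm (fs n) * \<kappa>" using cmod_pair_le[OF fs(1)[of n] sP[OF that]] nP[OF that] by (simp add: W_def)
    also have "\<dots> \<le> 1 * \<kappa>" by (intro mult_right_mono fs \<kappa>0)
    finally show ?thesis by simp
  qed
  \<comment> \<open>D is dense in the ambient space; since P is open, D \<inter> P is dense in
    P.\<close>
  obtain D :: "(('a \<times> real) \<times> ('b \<times> real)) set" where D: "countable D" "\<And>X. open X \<Longrightarrow> X \<noteq> {} \<Longrightarrow> \<exists>d\<in>D. d \<in> X"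
    using countable_dense_exists by blast
  obtain r where r: "strict_mono (r :: nat \<Rightarrow> nat)" "\<And>z. z \<in> D \<inter> P \<Longrightarrow> \<exists>l. (\<lambda>n. W (fs (r n)) z) \<longlonglongrightarrow> l"
  proof (rule function_convergent_subsequence[of "D \<inter> P" "\<lambda>n. W (fs n)" \<kappa>])
    show "countable (D \<inter> P)" using D(1) by (rule countable_Int1)
  qed (use Wb in auto)
  define g where "g = (\<lambda>n. fs (r n))"
  have g: "sq_int (g n)" "l2norm (g n) \<le> 1" for n unfolding g_def using fs by auto
  \<comment> \<open>The coefficients of functions of norm at most 1 are equicontinuous in z, by
    continuity of the wavelets in L2. Convergence on a dense set therefore spreads to all of
    P.\<close>
  have conv: "convergent (\<lambda>n. W (g n) z)" if z: "z \<in> P" for z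
  proof (rule Cauchy_convergent, rule CauchyI)
    fix e :: real assume e: "e > 0"
    have "\<exists>d. d \<in> D \<inter> P \<and> dist d z < 1 / (real j + 1)" for j
      using D(2)[of "ball z (1 / (real j + 1)) \<inter> P"] z P by (force simp: dist_commute)
    then obtain d where d: "\<And>j. d j \<in> D \<inter> P" "\<And>j. dist (d j) z < 1 / (real j + 1)" by metis
    have "d \<longlonglongrightarrow> z"
    proof (rule metric_tendsto_imp_tendsto[where f="\<lambda>j. 1 / (real j + 1)" and a="0::real"])
      show "(\<lambda>j. 1 / (real j + 1)) \<longlonglongrightarrow> 0" using LIMSEQ_inverse_real_of_nat by (simp add: inverse_eq_divide add.commute)
      show "\<forall>\<^sub>F j in sequentially. dist (d j) z \<le> dist (1 / (real j + 1)) 0" using d(2) less_imp_le by (intro always_eventually) fastforce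
    qed
    then have "(\<lambda>j. l2norm (\<lambda>p. pwav \<psi>1 \<psi>2 (d j) p - pwav \<psi>1 \<psi>2 z p)) \<longlonglongrightarrow> 0"
      using d(1) z by (intro pwav_l2_continuous w) (auto simp: P_def)
    from eventually_happens'[OF sequentially_bot order_tendstoD(2)[OF this, of "e / 3"]] e
    obtain j where j: "l2norm (\<lambda>p. pwav \<psi>1 \<psi>2 (d j) p - pwav \<psi>1 \<psi>2 z p) < e / 3" by auto
    have dP: "d j \<in> P" using d(1) by blast
    have close: "cmod (W (g n) (d j) - W (g n) z) < e / 3" for n
    proof -
      have "pair (g n) (\<lambda>p. 1 * pwav \<psi>1 \<psi>2 (d j) p + (-1) * pwav \<psi>1 \<psi>2 z p) = 1 * W (g n) (d j) + (-1) * W (g n) z"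
        unfolding W_def by (rule pair_lincomb_right[OF sP[OF dP] sP[OF z] g(1)])
      then have "cmod (W (g n) (d j) - W (g n) z) \<le> l2norm (g n) * l2norm (\<lambda>p. pwav \<psi>1 \<psi>2 (d j) p - pwav \<psi>1 \<psi>2 z p)"
        using cmod_pair_le[OF g(1)[of n] sq_int_diff[OF sP[OF dP] sP[OF z]]] by simp
      also have "\<dots> \<le> 1 * l2norm (\<lambda>p. pwav \<psi>1 \<psi>2 (d j) p - pwav \<psi>1 \<psi>2 z p)" by (intro mult_right_mono g l2norm_nonneg)
      finally show ?thesis using j by simp
    qed
    have "Cauchy (\<lambda>n. W (g n) (d j))" using r(2)[OF d(1)] unfolding g_def by (metis LIMSEQ_imp_Cauchy)
    then obtain N where N: "\<And>m n. m \<ge> N \<Longrightarrow> n \<ge> N \<Longrightarrow> cmod (W (g m) (d j) - W (g n) (d j)) < e / 3"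
      using e unfolding Cauchy_iff by (metis divide_pos_pos zero_less_numeral)
    have "cmod (W (g m) z - W (g n) z) < e" if "m \<ge> N" "n \<ge> N" for m n
    proof -
      have "W (g m) z - W (g n) z = - (W (g m) (d j) - W (g m) z) + (W (g m) (d j) - W (g n) (d j)) + (W (g n) (d j) - W (g n) z)" by simp
      also have "cmod \<dots> \<le> cmod (W (g m) (d j) - W (g m) z) + cmod (W (g m) (d j) - W (g n) (d j)) + cmod (W (g n) (d j) - W (g n) z)"
        by (metis (no_types, opaque_lifting) add_mono_thms_linordered_semiring(3) norm_minus_cancel norm_triangle_ineq order_trans)
      finally show ?thesis using close[of m] close[of n] N[OF that] by linarith
    qed
    then show "\<exists>M. \<forall>m\<ge>M. \<forall>n\<ge>M. norm (W (g m) z - W (g n) z) < e" by blast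
  qed
  define L where "L = (\<lambda>z. lim (\<lambda>n. W (g n) z))"
  have Wm[measurable]: "W (g n) \<in> borel_measurable hmeas2" for n
    unfolding W_def using pair_pwav_measurable[OF w, of "g n"] g(1)[of n] by (simp add: sq_int_def measurable_cong_sets[OF sets_hmeas2 refl])
  have Lm[measurable]: "L \<in> borel_measurable hmeas2" unfolding L_def by measurable
  have Llim: "(\<lambda>n. W (g n) z) \<longlonglongrightarrow> L z" if "z \<in> P" for z using conv[OF that] unfolding L_def by (rule convergent_LIMSEQ_iff[THEN iffD1])
  have Lb: "cmod (L z) \<le> \<kappa>" if "z \<in> P" for z
    using Wb[OF that] by (intro LIMSEQ_le_const2[OF tendsto_norm[OF Llim[OF that]]]) (auto simp: g_def)
  have "\<exists>N::nat. \<forall>m\<ge>N. \<forall>n\<ge>N. l2norm (\<lambda>x. T (g m) x - T (g n) x) < e" if e: "e > 0" for e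
  proof -
    \<comment> \<open>Differences of members of the sequence have norm at most 2, so the error term
      contributes at most 4 * e^2/16 = e^2/4.\<close>
    have "e\<^sup>2 / 16 > 0" using e by simp
    then obtain A C where A: "A > 0" "C \<ge> 0" and est: "\<And>g. sq_int g \<Longrightarrow> ennreal ((l2norm (T g))\<^sup>2) \<le>
      ennreal C * (\<integral>\<^sup>+z. ennreal ((cmod (pair g (pwav \<psi>1 \<psi>2 z)))\<^sup>2) * indicator (hbox A \<times> hbox A) z \<partial>hmeas2) + ennreal (e\<^sup>2 / 16 * (l2norm g)\<^sup>2)"
      using essential_norm_estimate[OF assms, of "e\<^sup>2 / 16"] by blast
    define E where "E = (hbox A \<times> hbox A :: (('a \<times> real) \<times> ('b \<times> real)) set)"
    have Em[measurable]: "E \<in> sets hmeas2" unfolding E_def by (intro pair_measureI) (simp_all add: sets_hmeas)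
    interpret H: pair_sigma_finite "hmeas :: ('a \<times> real) measure" "hmeas :: ('b \<times> real) measure" by (rule pair_sigma_finite_hmeas)
    have Ef: "emeasure hmeas2 E < \<infinity>" unfolding E_def
      by (subst H.M2.emeasure_pair_measure_Times)
         (use emeasure_hbox_finite[OF A(1), where 'a='a] emeasure_hbox_finite[OF A(1), where 'a='b]
           in \<open>auto simp: sets_hmeas ennreal_mult_less_top\<close>)
    \<comment> \<open>Distances to the pointwise limit, rather than between two members, leave a
      single index for dominated convergence.\<close>
    define d where "d = (\<lambda>n. \<integral>\<^sup>+z. ennreal ((cmod (W (g n) z - L z))\<^sup>2) * indicator E z \<partial>hmeas2)"
    have "d \<longlonglongrightarrow> (\<integral>\<^sup>+z. 0 \<partial>(hmeas2 :: (('a \<times> real) \<times> ('b \<times> real)) measure))"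
      unfolding d_def
    proof (rule nn_integral_dominated_convergence[where w="\<lambda>z. ennreal ((2 * \<kappa>)\<^sup>2) * indicator E z"])
      show "AE z in hmeas2. ennreal ((cmod (W (g n) z - L z))\<^sup>2) * indicator E z \<le> ennreal ((2 * \<kappa>)\<^sup>2) * indicator E z" for n
        using AE_hmeas2
      proof eventually_elim
        case (elim z)
        then have z: "z \<in> P" by (simp add: P_def)
        have "cmod (W (g n) z - L z) \<le> 2 * \<kappa>" using Wb[OF z, of "r n"] Lb[OF z] norm_triangle_ineq4[of "W (g n) z" "L z"] by (simp add: g_def)
        then show ?case by (intro mult_right_mono ennreal_leI power_mono) auto
      qed
      show "(\<integral>\<^sup>+z. ennreal ((2 * \<kappa>)\<^sup>2) * indicator E z \<partial>hmeas2) < \<infinity>" using Ef by (simp add: nn_integral_cmult_indicator ennreal_mult_less_top)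
      show "AE z in hmeas2. (\<lambda>n. ennreal ((cmod (W (g n) z - L z))\<^sup>2) * indicator E z) \<longlonglongrightarrow> 0"
        using AE_hmeas2
      proof eventually_elim
        case (elim z)
        then have z: "z \<in> P" by (simp add: P_def)
        have "(\<lambda>n. (cmod (W (g n) z - L z))\<^sup>2) \<longlonglongrightarrow> (cmod (L z - L z))\<^sup>2" by (intro tendsto_intros Llim z)
        then have "(\<lambda>n. ennreal ((cmod (W (g n) z - L z))\<^sup>2)) \<longlonglongrightarrow> ennreal 0" by (intro tendsto_ennrealI) simp
        then show ?case by (cases "z \<in> E") auto
      qed
    qed measurable
    then have "d \<longlonglongrightarrow> 0" by simp
    \<comment> \<open>The box integral of a difference is at most 2 d m + 2 d n <= 4b, contributing
      at most e^2/4 after multiplication by C; C + 1 avoids division by 0.\<close>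
    moreover define b where "b = e\<^sup>2 / (16 * (C + 1))"
    have b: "b > 0" "C * b \<le> e\<^sup>2 / 16" unfolding b_def using e A(2) by (auto simp: field_simps)
    ultimately have "\<forall>\<^sub>F n in sequentially. d n < ennreal b" by (intro order_tendstoD(2)) (use b in auto)
    then obtain N where N: "\<And>n. n \<ge> N \<Longrightarrow> d n < ennreal b" unfolding eventually_sequentially by blast
    have "l2norm (\<lambda>x. T (g m) x - T (g n) x) < e" if mn: "m \<ge> N" "n \<ge> N" for m n
    proof -
      define u where "u = (\<lambda>x. 1 * g m x + (-1) * g n x)"
      have u: "sq_int u" unfolding u_def by (intro sq_int_lincomb g)
      have Tu: "T u = (\<lambda>x. T (g m) x - T (g n) x)" unfolding u_def bounded_L2_op_lincomb[OF Tb g(1) g(1)] by simp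
      have "l2norm u \<le> l2norm (g m) + l2norm (\<lambda>x. (-1) * g n x)" unfolding u_def using l2norm_triangle[OF g(1) sq_int_cmult[OF g(1)], of m "-1" n] by simp
      also have "\<dots> \<le> 2" using g(2)[of m] g(2)[of n] unfolding l2norm_cmult by simp
      finally have u2: "(l2norm u)\<^sup>2 \<le> 2\<^sup>2" using l2norm_nonneg by (intro power_mono) auto
      have "(\<integral>\<^sup>+z. ennreal ((cmod (pair u (pwav \<psi>1 \<psi>2 z)))\<^sup>2) * indicator E z \<partial>hmeas2)
          \<le> (\<integral>\<^sup>+z. 2 * (ennreal ((cmod (W (g m) z - L z))\<^sup>2) * indicator E z) + 2 * (ennreal ((cmod (W (g n) z - L z))\<^sup>2) * indicator E z) \<partial>hmeas2)"
      proof (rule nn_integral_mono_AE, use AE_hmeas2 in eventually_elim)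
        case (elim z)
        then have z: "z \<in> P" by (simp add: P_def)
        have "pair u (pwav \<psi>1 \<psi>2 z) = 1 * W (g m) z + (-1) * W (g n) z" unfolding u_def W_def by (rule pair_lincomb_left[OF g(1) g(1) sP[OF z]])
        also have "\<dots> = 1 * (W (g m) z - L z) + (-1) * (W (g n) z - L z)" by simp
        finally have "(cmod (pair u (pwav \<psi>1 \<psi>2 z)))\<^sup>2 \<le> 2 * (cmod (W (g m) z - L z))\<^sup>2 + 2 * (cmod (W (g n) z - L z))\<^sup>2"
          using cmod_lincomb_sq[of 1 "W (g m) z - L z" "-1" "W (g n) z - L z"] by simp
        then have "ennreal ((cmod (pair u (pwav \<psi>1 \<psi>2 z)))\<^sup>2) \<le> 2 * ennreal ((cmod (W (g m) z - L z))\<^sup>2) + 2 * ennreal ((cmod (W (g n) z - L z))\<^sup>2)"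
          by (simp add: ennreal_plus[symmetric] ennreal_mult[symmetric] ennreal_numeral[symmetric] ennreal_leI del: ennreal_plus ennreal_numeral)
        then show ?case by (cases "z \<in> E") auto
      qed
      also have "\<dots> = 2 * d m + 2 * d n" unfolding d_def by (simp add: nn_integral_add nn_integral_cmult)
      also have "\<dots> \<le> 2 * ennreal b + 2 * ennreal b" using N[OF mn(1)] N[OF mn(2)] by (intro add_mono mult_left_mono) auto
      also have "\<dots> = ennreal (4 * b)" using b by (simp add: ennreal_plus[symmetric] ennreal_mult[symmetric] ennreal_numeral[symmetric] del: ennreal_plus ennreal_numeral)
      finally have I: "(\<integral>\<^sup>+z. ennreal ((cmod (pair u (pwav \<psi>1 \<psi>2 z)))\<^sup>2) * indicator E z \<partial>hmeas2) \<le> ennreal (4 * b)" .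
      have "ennreal ((l2norm (T u))\<^sup>2) \<le> ennreal C * ennreal (4 * b) + ennreal (e\<^sup>2 / 16 * (l2norm u)\<^sup>2)"
        using order_trans[OF est[OF u] add_right_mono[OF mult_left_mono[OF I[unfolded E_def]]]] by simp
      also have "\<dots> = ennreal (C * (4 * b) + e\<^sup>2 / 16 * (l2norm u)\<^sup>2)" using A b by (simp add: ennreal_plus[symmetric] ennreal_mult[symmetric] del: ennreal_plus)
      finally have "(l2norm (T u))\<^sup>2 \<le> C * (4 * b) + e\<^sup>2 / 16 * (l2norm u)\<^sup>2" using A b by (subst (asm) ennreal_le_iff) auto
      also have "\<dots> \<le> e\<^sup>2 / 4 + e\<^sup>2 / 16 * 2\<^sup>2" using b u2 by (intro add_mono mult_left_mono) auto
      also have "\<dots> < e\<^sup>2" using e by simp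
      finally have "(l2norm (T u))\<^sup>2 < e\<^sup>2" .
      then have "l2norm (T u) < e" using e by (meson less_imp_le power2_less_imp_less)
      then show ?thesis unfolding Tu .
    qed
    then show ?thesis by blast
  qed
  then show "\<exists>r. strict_mono r \<and> (\<forall>e>0. \<exists>N::nat. \<forall>m\<ge>N. \<forall>n\<ge>N. l2norm (\<lambda>x. T (fs (r m)) x - T (fs (r n)) x) < e)"
    using r(1) unfolding g_def by blast
qed

end
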